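(* Let $d\in\mathbb N$, $s>d/2$, $R\ge0$, $\sigma>0$ and $\Theta=H^s_2(\mathbb S^d,R)$. (1) There is a constant $C>0$ depending only on $d$ and $s$ such that for all $n,L\in\mathbb N$ with $L\geq 1$ and every spherical $t$-design $\mathcal X=\{x_1,\ldots,x_n\}\subset\mathbb S^d$ with $t\ge 2L$, $$\Delta(\mathcal F^d_n,\mathcal G^d_n)\le C\,\sigma^{-1}n^{1/2}L^{-s}R .$$ (2) In particular, if $\mathcal X$ is a spherical $t$-design with $t=2L$ and cardinality $n$ of the minimal possible order $n\asymp L^d$, i.e. $c_1L^d\le n\le c_2L^d$ for constants $0<c_1\le c_2$, then, with constants depending only on $d,s,c_1,c_2$, $$\Delta(\mathcal F^d_n,\mathcal G^d_n)\lesssim\sigma^{-1}L^{-s+d/2}R\asymp\sigma^{-1}n^{-s/d+1/2}R,$$ and, along any sequence of such designs (with $c_1,c_2$ fixed) for which $n\to\infty$, the experiments are asymptotically equivalent: $\Delta(\mathcal F^d_n,\mathcal G^d_n)\to0$.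
   Context: Sphere: $\mathbb S^d=\{x\in\mathbb R^{d+1}:\|x\|=1\}$ with normalized surface area measure $\mu$; $L^2(\mathbb S^d)$ is the real $L^2$ space of $\mu$. A set $\{x_1,\ldots,x_n\}\subset\mathbb S^d$ of $n$ points is a spherical $t$-design if $\frac1n\sum_{i=1}^n p(x_i)=\int_{\mathbb S^d}p\,d\mu$ for all polynomials $p$ of total degree $\le t$ in $d+1$ variables. Sobolev balls: for $\ell\in\mathbb N_0$ let $\mathscr H^d_\ell$ be the space of spherical harmonics of degree $\ell$ (eigenspace of $-\Delta_{\mathbb S^d}$, the negative Laplace--Beltrami operator, with eigenvalue $\ell(\ell+d-1)$), $N^d_\ell=\dim\mathscr H^d_\ell$, and $\{Y_{\ell,m}\}_{m=1}^{N^d_\ell}$ a real orthonormal basis of $\mathscr H_\ell^d$ in $L^2(\mathbb S^d)$. With $\theta_{\ell,m}=\int f\,Y_{\ell,m}\,d\mu$, put $\|f\|^2_{H^s_2(\mathbb S^d)}=\sum_{\ell=0}^\infty(1+\ell(\ell+d-1))^s\sum_{m=1}^{N^d_\ell}\theta_{\ell,m}^2$ and $H^s_2(\mathbb S^d,R)=\{f\in L^2(\mathbb S^d):\|f\|_{H^s_2(\mathbb S^d)}\le R\}$. For $s>d/2$ each such $f$ has a continuous representative, which is used for point evaluations. Experiments (parameter $f\in\Theta$; $\sigma$ known): $\mathcal F^d_n=\mathcal F^d_n(\Theta,\mathcal X)$: observe $Z_i=f(x_i)+\sigma\epsilon_i$, $i=1,\ldots,n$, $\epsilon_i$ i.i.d.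 standard Gaussian. $\mathcal G^d_n=\mathcal G^d_n(\Theta)$: observe $dZ(x)=f(x)\,d\mu(x)+\frac{\sigma}{\sqrt n}\,dW(x)$ with $dW$ standard Gaussian white noise on $\mathbb S^d$; i.e. observe the Gaussian process $(G_g)_{g\in L^2(\mathbb S^d)}$ with mean $\langle f,g\rangle_{L^2(\mathbb S^d)}$ and covariance $\frac{\sigma^2}{n}\langle g,h\rangle_{L^2(\mathbb S^d)}$; equivalently, for an orthonormal basis $(\varphi_j)_{j\in\mathbb N}$ of $L^2(\mathbb S^d)$, the sequence $y_j=\langle f,\varphi_j\rangle+\frac{\sigma}{\sqrt n}\eta_j$ with $\eta_j$ i.i.d. standard Gaussian. Le Cam distance: for experiments $\mathcal E,\mathcal E'$ with the same parameter space $\Theta$ and laws $P^{\mathcal E}_\theta,P^{\mathcal E'}_\theta$, $\delta(\mathcal E,\mathcal E')=\inf_K\sup_{\theta\in\Theta}V(KP^{\mathcal E}_\theta,P^{\mathcal E'}_\theta)$, the infimum over all Markov kernels $K$ from the sample space of $\mathcal E$ to that of $\mathcal E'$, $KP(A)=\int K(x,A)\,dP(x)$, $V(P,Q)=\sup_A|P(A)-Q(A)|$; $\Delta(\mathcal E,\mathcal E')=\max\{\delta(\mathcal E,\mathcal E'),\delta(\mathcal E',\mathcal E)\}$. $a\lesssim b$ means $a\le Cb$ for a constant $C$ as specified; $a\asymp b$ means $a\lesssim b$ and $b\lesssim a$. *)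

theory Defs
  imports "HOL-Probability.Probability"
begin

section \<open>The sphere, polynomials and designs\<close>

text \<open>
  The ambient space is \<open>real ^ 'n\<close> with \<open>CARD('n) = d + 1\<close>, and the \<open>d\<close>-dimensional sphere is
  \<open>sphere 0 1\<close>.  Its normalized surface measure assigns to \<open>A\<close> the proportion of the unit ball
  that is filled by the cone over \<open>A\<close>.  Functions on the sphere are represented by functions on
  \<open>real ^ 'n\<close>, of which only the values on the sphere are ever used.
\<close>

definition sphere_measure :: "(real ^ 'n) measure" where
  "sphere_measure =
     restrict_space (distr (uniform_measure lborel (cball 0 1)) borel sgn) (sphere 0 1)"

definition L2_sphere :: "(real ^ 'n \<Rightarrow> real) set" where
  "L2_sphere = {f \<in> borel_measurable sphere_measure. integrable sphere_measure (\<lambda>x. (f x)\<^sup>2)}"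

definition L2_inner :: "(real ^ 'n \<Rightarrow> real) \<Rightarrow> (real ^ 'n \<Rightarrow> real) \<Rightarrow> real" where
  "L2_inner f g = (\<integral>x. f x * g x \<partial>sphere_measure)"

definition polynomials_upto :: "nat \<Rightarrow> (real ^ 'n \<Rightarrow> real) set" where
  "polynomials_upto t =
     {p. \<exists>c. p = (\<lambda>x. \<Sum>\<alpha>\<in>{\<alpha> :: 'n \<Rightarrow> nat. (\<Sum>i\<in>UNIV. \<alpha> i) \<le> t}. c \<alpha> * (\<Prod>i\<in>UNIV. (x $ i) ^ \<alpha> i))}"

definition spherical_design :: "nat \<Rightarrow> nat \<Rightarrow> (nat \<Rightarrow> real ^ 'n) \<Rightarrow> bool" where
  "spherical_design t n x \<longleftrightarrow>
     n \<ge> 1 \<and> inj_on x {1..n} \<and> x ` {1..n} \<subseteq> sphere 0 1 \<and>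
     (\<forall>p\<in>polynomials_upto t. (1 / real n) * (\<Sum>i=1..n. p (x i)) = (\<integral>y. p y \<partial>sphere_measure))"


section \<open>Spherical harmonics and Sobolev balls\<close>

definition partial_deriv :: "'n \<Rightarrow> (real ^ 'n \<Rightarrow> real) \<Rightarrow> real ^ 'n \<Rightarrow> real" where
  "partial_deriv i g x = frechet_derivative g (at x) (axis i 1)"

definition C2_on :: "(real ^ 'n) set \<Rightarrow> (real ^ 'n \<Rightarrow> real) \<Rightarrow> bool" where
  "C2_on U g \<longleftrightarrow> g differentiable_on U \<and>
     (\<forall>i. partial_deriv i g differentiable_on U \<and>
          (\<forall>j. continuous_on U (partial_deriv j (partial_deriv i g))))"

text \<open>
  The degree-zero homogeneous extension \<open>x \<mapsto> f (x / \<parallel>x\<parallel>)\<close> carries the differential structure of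
  the sphere: \<open>f\<close> is \<open>C\<^sup>2\<close> on the sphere iff its extension is \<open>C\<^sup>2\<close> off the origin, and the
  Laplace--Beltrami operator applied to \<open>f\<close> is the Euclidean Laplacian of the extension,
  evaluated on the sphere.
\<close>

definition radial_ext :: "(real ^ 'n \<Rightarrow> real) \<Rightarrow> real ^ 'n \<Rightarrow> real" where
  "radial_ext f = (\<lambda>x. f (sgn x))"

definition laplace_beltrami :: "(real ^ 'n \<Rightarrow> real) \<Rightarrow> real ^ 'n \<Rightarrow> real" where
  "laplace_beltrami f x = (\<Sum>i\<in>UNIV. partial_deriv i (partial_deriv i (radial_ext f)) x)"

definition harmonic_eigenvalue :: "nat \<Rightarrow> nat \<Rightarrow> real" where
  "harmonic_eigenvalue d l = real l * (real l + real d - 1)"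

definition spherical_harmonics :: "nat \<Rightarrow> nat \<Rightarrow> (real ^ 'n \<Rightarrow> real) set" where
  "spherical_harmonics d l =
     {f. C2_on (- {0}) (radial_ext f) \<and>
         (\<forall>x\<in>sphere 0 1. - laplace_beltrami f x = harmonic_eigenvalue d l * f x)}"

text \<open>
  For every degree \<open>l\<close>, the family \<open>Y l 1, \<dots>, Y l (N l)\<close> is a real orthonormal basis of the
  harmonics of degree \<open>l\<close>; in particular \<open>N l\<close> is the dimension of that space.
\<close>

definition harmonic_basis ::
  "nat \<Rightarrow> (nat \<Rightarrow> nat) \<Rightarrow> (nat \<Rightarrow> nat \<Rightarrow> real ^ 'n \<Rightarrow> real) \<Rightarrow> bool" where
  "harmonic_basis d N Y \<longleftrightarrow> (\<forall>l.
     (\<forall>m\<in>{1..N l}. Y l m \<in> spherical_harmonics d l) \<and>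
     (\<forall>m\<in>{1..N l}. \<forall>m'\<in>{1..N l}. L2_inner (Y l m) (Y l m') = (if m = m' then 1 else 0)) \<and>
     (\<forall>h\<in>spherical_harmonics d l. \<exists>c. \<forall>x\<in>sphere 0 1. h x = (\<Sum>m=1..N l. c m * Y l m x)))"

definition sobolev_norm_sq ::
  "nat \<Rightarrow> (nat \<Rightarrow> nat) \<Rightarrow> (nat \<Rightarrow> nat \<Rightarrow> real ^ 'n \<Rightarrow> real) \<Rightarrow> real \<Rightarrow> (real ^ 'n \<Rightarrow> real) \<Rightarrow> ennreal"
  where
  "sobolev_norm_sq d N Y s f =
     (\<Sum>l. ennreal ((1 + harmonic_eigenvalue d l) powr s * (\<Sum>m=1..N l. (L2_inner f (Y l m))\<^sup>2)))"

text \<open>The radius is meant to be nonnegative; the norm may be infinite, so it is compared squared.\<close>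

definition sobolev_ball ::
  "nat \<Rightarrow> (nat \<Rightarrow> nat) \<Rightarrow> (nat \<Rightarrow> nat \<Rightarrow> real ^ 'n \<Rightarrow> real) \<Rightarrow> real \<Rightarrow> real \<Rightarrow> (real ^ 'n \<Rightarrow> real) set"
  where
  "sobolev_ball d N Y s R = {f \<in> L2_sphere. sobolev_norm_sq d N Y s f \<le> ennreal (R\<^sup>2)}"

text \<open>On the sphere a continuous representative is unique, because every nonempty relatively open
  subset has positive measure.\<close>

definition cont_rep :: "(real ^ 'n \<Rightarrow> real) \<Rightarrow> real ^ 'n \<Rightarrow> real" where
  "cont_rep f = (SOME g. continuous_on (sphere 0 1) g \<and> (AE x in sphere_measure. f x = g x))"


section \<open>Statistical experiments and the Le Cam distance\<close>

text \<open>Of \<open>sample_space\<close> only the underlying measurable space matters.\<close>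

record ('p, 'x) stat_experiment =
  sample_space :: "'x measure"
  law :: "'p \<Rightarrow> 'x measure"

definition total_variation :: "'x measure \<Rightarrow> 'x measure \<Rightarrow> ennreal" where
  "total_variation P Q = (SUP A\<in>sets P. ennreal \<bar>measure P A - measure Q A\<bar>)"

definition deficiency ::
  "'p set \<Rightarrow> ('p, 'x) stat_experiment \<Rightarrow> ('p, 'y) stat_experiment \<Rightarrow> ennreal" where
  "deficiency \<Theta> E E' =
     (INF K \<in> sample_space E \<rightarrow>\<^sub>M prob_algebra (sample_space E').
        SUP \<theta>\<in>\<Theta>. total_variation (law E \<theta> \<bind> K) (law E' \<theta>))"

definition le_cam_distance ::
  "'p set \<Rightarrow> ('p, 'x) stat_experiment \<Rightarrow> ('p, 'y) stat_experiment \<Rightarrow> ennreal" where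
  "le_cam_distance \<Theta> E E' = max (deficiency \<Theta> E E') (deficiency \<Theta> E' E)"


section \<open>Regression on the sphere and Gaussian white noise\<close>

definition std_gaussian :: "real measure" where
  "std_gaussian = density lborel std_normal_density"

definition regression_experiment ::
  "nat \<Rightarrow> real \<Rightarrow> (nat \<Rightarrow> real ^ 'n) \<Rightarrow> (real ^ 'n \<Rightarrow> real, nat \<Rightarrow> real) stat_experiment" where
  "regression_experiment n \<sigma> x =
     \<lparr>sample_space = Pi\<^sub>M {1..n} (\<lambda>_. borel),
      law = (\<lambda>f. distr (Pi\<^sub>M {1..n} (\<lambda>_. std_gaussian)) (Pi\<^sub>M {1..n} (\<lambda>_. borel))
                   (\<lambda>\<epsilon>. \<lambda>i\<in>{1..n}. cont_rep f (x i) + \<sigma> * \<epsilon> i))\<rparr>"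

text \<open>
  \<open>gaussian_process I m k P\<close>: under \<open>P\<close>, a law on the product space of real functions on \<open>I\<close>, the
  coordinate process is Gaussian (all finite linear combinations are normally distributed,
  possibly with zero variance) with mean function \<open>m\<close> and covariance function \<open>k\<close>.
\<close>

definition gaussian_process ::
  "'i set \<Rightarrow> ('i \<Rightarrow> real) \<Rightarrow> ('i \<Rightarrow> 'i \<Rightarrow> real) \<Rightarrow> ('i \<Rightarrow> real) measure \<Rightarrow> bool" where
  "gaussian_process I m k P \<longleftrightarrow>
     prob_space P \<and> sets P = sets (Pi\<^sub>M I (\<lambda>_. borel)) \<and>
     (\<forall>J a. finite J \<and> J \<subseteq> I \<longrightarrow>
        (\<exists>b \<tau>. distr P borel (\<lambda>\<omega>. \<Sum>i\<in>J. a i * \<omega> i)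
                 = distr std_gaussian borel (\<lambda>z. b + \<tau> * z))) \<and>
     (\<forall>i\<in>I. (\<integral>\<omega>. \<omega> i \<partial>P) = m i) \<and>
     (\<forall>i\<in>I. \<forall>j\<in>I. (\<integral>\<omega>. (\<omega> i - m i) * (\<omega> j - m j) \<partial>P) = k i j)"

definition white_noise :: "((real ^ 'n \<Rightarrow> real) \<Rightarrow> real) measure \<Rightarrow> bool" where
  "white_noise W \<longleftrightarrow> gaussian_process L2_sphere (\<lambda>_. 0) L2_inner W"

text \<open>
  With \<open>W\<close> the law of white noise, the observation of \<open>f d\<mu> + (\<sigma> / \<surd>n) dW\<close> is the process
  \<open>g \<mapsto> \<langle>f, g\<rangle> + (\<sigma> / \<surd>n) W\<^sub>g\<close> indexed by the square-integrable functions.  Functions that agree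
  almost everywhere are separate indices, but their coordinates are almost surely equal.
\<close>

definition white_noise_experiment ::
  "((real ^ 'n \<Rightarrow> real) \<Rightarrow> real) measure \<Rightarrow> nat \<Rightarrow> real
     \<Rightarrow> (real ^ 'n \<Rightarrow> real, (real ^ 'n \<Rightarrow> real) \<Rightarrow> real) stat_experiment" where
  "white_noise_experiment W n \<sigma> =
     \<lparr>sample_space = Pi\<^sub>M L2_sphere (\<lambda>_. borel),
      law = (\<lambda>f. distr W (Pi\<^sub>M L2_sphere (\<lambda>_. borel))
                   (\<lambda>w. \<lambda>g\<in>L2_sphere. L2_inner f g + \<sigma> / sqrt (real n) * w g))\<rparr>"

end

theory Submission
  imports Defs
begin

text \<open>
  The coupling uses that a design of strength \<open>2L\<close> makes the basis functions of degree at most \<open>L\<close>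
  orthonormal both in \<open>L\<^sup>2\<close> of the sphere and, after division by \<open>\<surd>n\<close>, on the design. A kernel
  exchanges the noise components along these functions between the two experiments and adds independent
  noise in the remaining directions; both kernels reproduce the noise exactly and are off only in the
  mean. The total variation between Gaussian laws with a common noise is at most the length of the
  difference of the means in the Cameron--Martin norm. This length is \<open>\<surd>n / \<sigma>\<close> times the
  \<open>L\<^sup>2\<close> error of hyperinterpolation in one direction, and \<open>1 / \<sigma>\<close> times the Euclidean norm of the
  values at the design of \<open>f\<close> minus its degree \<open>L\<close> projection in the other.

  Both errors reduce to a bound for \<open>\<Sum>\<^sub>i p(x\<^sub>i)\<^sup>2\<close> by a multiple of \<open>n (M / L)\<^sup>d\<close> times the squared
  \<open>L\<^sup>2\<close> norm of \<open>p\<close>, for polynomials of degree \<open>M \<ge> L\<close>, applied to the dyadic blocks of \<open>f\<close>; the series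
  over the blocks converges because of \<open>s > d / 2\<close>. For the bound, \<open>p\<close> is taken harmonic, so that \<open>p(x\<^sub>i)\<^sup>2\<close> is at
  most its mean over a ball of radius \<open>1 / (2M)\<close>; these balls lie in a thin annulus around the sphere,
  and few of them overlap because a power of the Dirichlet kernel of degree at most \<open>2L\<close> bounds the
  number of design points in a cap of radius \<open>1 / L\<close>.
\<close>

section \<open>Harmonic polynomials\<close>

text \<open>Harmonics are given as \<open>C\<^sup>2\<close> eigenfunctions, while a design
  integrates only polynomials. Eigenfunctions must therefore be recognised as restrictions of
  harmonic forms; this rests on the orthogonality of eigenspaces, the density of polynomials and the
  finite dimension granted by \<open>harmonic_basis\<close>.

  The rate leaves no room for a lost power of \<open>L\<close>: bounding the blocks at the design by
  their supremum would cost a factor \<open>L^(d/2)\<close>. Comparing the sum over the design with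
  the L2 norm costs only \<open>2^(k d / 2)\<close>, up to a constant, in the \<open>k\<close>-th
  block. One such bound serves both directions, because hyperinterpolation is exact on degree
  \<open>L\<close>, so its deviation from the projection depends on the residual at the design
  points alone and is controlled by Bessel's inequality.

  White noise is indexed by the uncountable set \<open>L2_sphere\<close>, where no Lebesgue density
  is at hand. Laws are identified through characteristic functions of finite linear functionals, and
  a change of mean is reduced to the shift of a single standard Gaussian coordinate on the real
  line.\<close>

inductive hpoly :: "nat \<Rightarrow> (real ^ 'n \<Rightarrow> real) \<Rightarrow> bool" where
  hpoly_const: "hpoly 0 (\<lambda>x. c)"
| hpoly_mult_coord: "hpoly k p \<Longrightarrow> hpoly (Suc k) (\<lambda>x. x $ i * p x)"
| hpoly_add: "hpoly k p \<Longrightarrow> hpoly k q \<Longrightarrow> hpoly k (\<lambda>x. p x + q x)"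

text \<open>The zero function is a form of every degree, so the index of \<open>hpoly\<close> is not
  determined by the function; families padded with zero summands still satisfy the degree condition
  in every index.\<close>

lemma hpoly_zero: "hpoly k (\<lambda>x. 0)"
proof (induction k)
  case 0 show ?case by (rule hpoly_const)
next
  case (Suc k) from hpoly_mult_coord[OF this] show ?case by simp
qed

lemma hpoly_scale: "hpoly k p \<Longrightarrow> hpoly k (\<lambda>x. c * p x)"
proof (induction rule: hpoly.induct)
  case (hpoly_const b) show ?case using hpoly.hpoly_const[of "c * b"] by simp
next
  case (hpoly_mult_coord k p i)
  from hpoly.hpoly_mult_coord[OF this(2), of i] show ?case by (simp add: mult.left_commute)
next
  case (hpoly_add k p q)
  from hpoly.hpoly_add[OF this(3,4)] show ?case by (simp add: distrib_left)
qed

lemma hpoly_sum: "(\<And>i. i \<in> A \<Longrightarrow> hpoly k (p i)) \<Longrightarrow> hpoly k (\<lambda>x. \<Sum>i\<in>A. p i x)"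
  by (induction A rule: infinite_finite_induct) (auto simp: hpoly_zero intro: hpoly_add)

lemma hpoly_diff:
  assumes "hpoly k p" "hpoly k q" shows "hpoly k (\<lambda>x. p x - q x)"
  using hpoly_add[OF assms(1) hpoly_scale[OF assms(2), of "-1"]] by simp

lemma hpoly_mult: "hpoly k p \<Longrightarrow> hpoly m q \<Longrightarrow> hpoly (k + m) (\<lambda>x. p x * q x)"
proof (induction rule: hpoly.induct)
  case (hpoly_const c) then show ?case using hpoly_scale[of m q c] by simp
next
  case (hpoly_mult_coord k p i)
  then have "hpoly (k + m) (\<lambda>x. p x * q x)" by simp
  from hpoly.hpoly_mult_coord[OF this, of i] show ?case by (simp add: mult.assoc)
next
  case (hpoly_add k p q')
  then have "hpoly (k + m) (\<lambda>x. p x * q x)" "hpoly (k + m) (\<lambda>x. q' x * q x)" by simp_all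
  from hpoly.hpoly_add[OF this] show ?case by (simp add: distrib_right)
qed

lemma hpoly_homogeneous: "hpoly k p \<Longrightarrow> p (r *\<^sub>R x) = r ^ k * p x"
  by (induction rule: hpoly.induct) (auto simp: distrib_left)

lemma inner_self_cart: "(x::real^'n) \<bullet> x = (\<Sum>i\<in>UNIV. x $ i * x $ i)"
  by (simp add: inner_vec_def)

lemma hpoly_coord: "hpoly (Suc 0) (\<lambda>x. x $ i)"
  using hpoly_mult_coord[OF hpoly_const[of 1], of i] by simp

lemma hpoly_inner: "hpoly (Suc 0) (\<lambda>x. x \<bullet> a)"
proof -
  have "hpoly (Suc 0) (\<lambda>x. \<Sum>i\<in>UNIV. a $ i * x $ i)"
    by (intro hpoly_sum hpoly_scale hpoly_coord)
  then show ?thesis by (simp add: inner_vec_def mult.commute)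
qed

lemma hpoly_inner_self: "hpoly 2 (\<lambda>x. x \<bullet> x)"
  unfolding inner_self_cart using hpoly_sum[OF hpoly_mult_coord[OF hpoly_coord]]
  by (simp add: numeral_2_eq_2)

section \<open>Partial derivatives of homogeneous polynomials\<close>

lemma has_derivative_coord: "((\<lambda>x::real^'n. x $ i) has_derivative (\<lambda>h. h $ i)) (at x within A)"
  by (simp add: bounded_linear_imp_has_derivative bounded_linear_vec_nth)

lemma partial_deriv_eqI: "(g has_derivative D) (at x) \<Longrightarrow> partial_deriv i g x = D (axis i 1)"
  unfolding partial_deriv_def using frechet_derivative_at by metis

lemma differentiable_imp_has_derivative:
  fixes g :: "real ^ 'n \<Rightarrow> real"
  assumes "g differentiable (at x)"
  shows "(g has_derivative (\<lambda>h. \<Sum>i\<in>UNIV. partial_deriv i g x * h $ i)) (at x)"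
proof -
  let ?D = "frechet_derivative g (at x)"
  have D: "(g has_derivative ?D) (at x)" using assms frechet_derivative_works by blast
  then have lin: "linear ?D" by (rule has_derivative_linear)
  have "?D h = (\<Sum>i\<in>UNIV. partial_deriv i g x * h $ i)" for h
  proof -
    have "?D h = ?D (\<Sum>i\<in>UNIV. h $ i *\<^sub>R axis i 1)"
      by (metis basis_expansion scalar_mult_eq_scaleR)
    also have "\<dots> = (\<Sum>i\<in>UNIV. h $ i *\<^sub>R ?D (axis i 1))"
      using lin by (simp add: linear_sum linear_cmul)
    finally show ?thesis by (simp add: partial_deriv_def mult.commute)
  qed
  then have "?D = (\<lambda>h. \<Sum>i\<in>UNIV. partial_deriv i g x * h $ i)" by blast
  with D show ?thesis by simp
qed

lemma partial_deriv_add: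
  "f differentiable at x \<Longrightarrow> g differentiable at x \<Longrightarrow>
    partial_deriv i (\<lambda>x. f x + g x) x = partial_deriv i f x + partial_deriv i g x"
  by (rule trans[OF partial_deriv_eqI[OF has_derivative_add]])
     (auto simp: partial_deriv_def frechet_derivative_works)

lemma partial_deriv_diff:
  "f differentiable at x \<Longrightarrow> g differentiable at x \<Longrightarrow>
    partial_deriv i (\<lambda>x. f x - g x) x = partial_deriv i f x - partial_deriv i g x"
  by (rule trans[OF partial_deriv_eqI[OF has_derivative_diff]])
     (auto simp: partial_deriv_def frechet_derivative_works)

lemma partial_deriv_mult:
  "f differentiable at x \<Longrightarrow> g differentiable at x \<Longrightarrow>
    partial_deriv i (\<lambda>x. f x * g x) x = f x * partial_deriv i g x + partial_deriv i f x * g x"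
  by (rule trans[OF partial_deriv_eqI[OF has_derivative_mult]])
     (auto simp: partial_deriv_def frechet_derivative_works)

lemma partial_deriv_const [simp]: "partial_deriv i (\<lambda>x. c) x = 0"
  by (rule trans[OF partial_deriv_eqI[OF has_derivative_const]]) simp

lemma partial_deriv_coord [simp]: "partial_deriv i (\<lambda>x. x $ j) x = (if i = j then 1 else 0)"
  by (rule trans[OF partial_deriv_eqI[OF has_derivative_coord]]) (simp add: axis_def)

lemma differentiable_coord [simp]: "(\<lambda>x::real^'n. x $ i) differentiable (at x within A)"
  using has_derivative_coord differentiable_def by blast

lemma partial_deriv_cmult:
  "f differentiable at x \<Longrightarrow> partial_deriv i (\<lambda>x. c * f x) x = c * partial_deriv i f x"
  by (subst partial_deriv_mult) auto

lemma partial_deriv_sum: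
  "(\<And>j. j \<in> A \<Longrightarrow> f j differentiable at x) \<Longrightarrow>
    partial_deriv i (\<lambda>x. \<Sum>j\<in>A. f j x) x = (\<Sum>j\<in>A. partial_deriv i (f j) x)"
  by (induction A rule: infinite_finite_induct) (auto simp: partial_deriv_add)

lemma hpoly_differentiable: "hpoly k p \<Longrightarrow> p differentiable (at x)"
  by (induction rule: hpoly.induct) auto

lemma hpoly_continuous_on: "hpoly k p \<Longrightarrow> continuous_on A p"
  by (meson continuous_at_imp_continuous_on differentiable_imp_continuous_within hpoly_differentiable)

text \<open>Degree \<open>0\<close> is split off because truncated subtraction would only yield that
  the derivative is constant again. That it vanishes is what makes the Laplacian of forms of degree
  below \<open>2\<close> zero.\<close>

lemma hpoly_partial_deriv:
  "hpoly k p \<Longrightarrow> if k = 0 then partial_deriv i p = (\<lambda>x. 0) else hpoly (k - 1) (partial_deriv i p)"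
proof (induction rule: hpoly.induct)
  case (hpoly_const c) show ?case by auto
next
  case (hpoly_mult_coord k p j)
  have eq: "partial_deriv i (\<lambda>x. x $ j * p x) = (\<lambda>x. x $ j * partial_deriv i p x + (if i = j then p x else 0))"
    using hpoly_differentiable[OF hpoly_mult_coord(1)] by (auto simp: partial_deriv_mult)
  have "hpoly k (\<lambda>x. x $ j * partial_deriv i p x)"
    using hpoly_mult_coord(2) hpoly.hpoly_mult_coord[of "k-1" "partial_deriv i p" j]
    by (cases "k = 0") (auto intro: hpoly_zero)
  moreover have "hpoly k (\<lambda>x. if i = j then p x else 0)" using hpoly_mult_coord(1) hpoly_zero by (cases "i = j") simp_all
  ultimately show ?case using hpoly_add eq by auto
next
  case (hpoly_add k p q)
  have eq: "partial_deriv i (\<lambda>x. p x + q x) = (\<lambda>x. partial_deriv i p x + partial_deriv i q x)"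
    using hpoly_add(1,2) by (auto simp: partial_deriv_add hpoly_differentiable)
  then show ?case using hpoly_add(3,4) hpoly.hpoly_add by (auto split: if_splits)
qed

lemma hpoly_partial_deriv': "hpoly k p \<Longrightarrow> hpoly (k - 1) (partial_deriv i p)"
  using hpoly_partial_deriv[of k p i] hpoly_zero[of 0] by (auto split: if_splits)

lemma partial_deriv_differentiable: "hpoly k p \<Longrightarrow> partial_deriv i p differentiable (at x)"
  using hpoly_partial_deriv' hpoly_differentiable by blast

section \<open>The Laplacian on homogeneous polynomials\<close>

definition laplacian :: "(real ^ 'n \<Rightarrow> real) \<Rightarrow> real ^ 'n \<Rightarrow> real" where
  "laplacian p x = (\<Sum>i\<in>UNIV. partial_deriv i (partial_deriv i p) x)"

lemma euler_identity: "hpoly k p \<Longrightarrow> (\<Sum>i\<in>UNIV. x $ i * partial_deriv i p x) = real k * p x"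
proof (induction rule: hpoly.induct)
  case (hpoly_const c) show ?case by simp
next
  case (hpoly_mult_coord k p j)
  have "(\<Sum>i\<in>UNIV. x $ i * partial_deriv i (\<lambda>x. x $ j * p x) x)
     = (\<Sum>i\<in>UNIV. x $ j * (x $ i * partial_deriv i p x) + (if i = j then x $ j * p x else 0))"
    using hpoly_differentiable[OF hpoly_mult_coord(1)]
    by (intro sum.cong) (auto simp: partial_deriv_mult algebra_simps)
  also have "\<dots> = x $ j * (\<Sum>i\<in>UNIV. x $ i * partial_deriv i p x) + x $ j * p x"
    by (simp add: sum.distrib sum_distrib_left)
  also have "\<dots> = real (Suc k) * (x $ j * p x)"
    using hpoly_mult_coord(2) by (simp add: algebra_simps)
  finally show ?case .
next
  case (hpoly_add k p q)
  then show ?case by (simp add: partial_deriv_add hpoly_differentiable distrib_left sum.distrib)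
qed

lemma hpoly_laplacian:
  assumes "hpoly k p" shows "if k < 2 then laplacian p = (\<lambda>x. 0) else hpoly (k - 2) (laplacian p)"
proof (cases "k < 2")
  case True
  have "partial_deriv i (partial_deriv i p) x = 0" for i x
    using hpoly_partial_deriv[OF assms, of i] True hpoly_partial_deriv[of 0 "partial_deriv i p" i]
    by (auto split: if_splits simp: less_Suc_eq numeral_2_eq_2)
  with True show ?thesis by (auto simp: laplacian_def)
next
  case False
  have "hpoly (k - 2) (partial_deriv i (partial_deriv i p))" for i
    using hpoly_partial_deriv'[OF hpoly_partial_deriv'[OF assms]] by (simp add: numeral_2_eq_2)
  from hpoly_sum[of UNIV, OF this] have "hpoly (k - 2) (laplacian p)" unfolding laplacian_def .
  with False show ?thesis by simp
qed

lemma laplacian_add: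
  assumes "hpoly k p" "hpoly m q"
  shows "laplacian (\<lambda>x. p x + q x) x = laplacian p x + laplacian q x"
proof -
  have "partial_deriv i (\<lambda>x. p x + q x) = (\<lambda>x. partial_deriv i p x + partial_deriv i q x)" for i
    using assms by (auto simp: partial_deriv_add hpoly_differentiable)
  then show ?thesis
    using assms by (simp add: laplacian_def partial_deriv_add partial_deriv_differentiable sum.distrib)
qed

lemma laplacian_cmult:
  assumes "hpoly k p" shows "laplacian (\<lambda>x. c * p x) x = c * laplacian p x"
proof -
  have "partial_deriv i (\<lambda>x. c * p x) = (\<lambda>x. c * partial_deriv i p x)" for i
    using assms by (auto simp: partial_deriv_cmult hpoly_differentiable)
  then show ?thesis
    using assms by (simp add: laplacian_def partial_deriv_cmult partial_deriv_differentiable sum_distrib_left)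
qed

lemma laplacian_diff:
  assumes "hpoly k p" "hpoly m q"
  shows "laplacian (\<lambda>x. p x - q x) x = laplacian p x - laplacian q x"
  using laplacian_add[OF assms(1) hpoly_scale[OF assms(2), of "-1"]] laplacian_cmult[OF assms(2), of "-1"]
  by simp

lemma partial_deriv_inner_self: "partial_deriv i (\<lambda>x. x \<bullet> x) = (\<lambda>x. 2 * x $ i)"
proof
  fix x
  have "((\<lambda>x::real^'a. x \<bullet> x) has_derivative (\<lambda>h. x \<bullet> h + h \<bullet> x)) (at x)"
    by (auto intro!: derivative_eq_intros)
  from partial_deriv_eqI[OF this] show "partial_deriv i (\<lambda>x::real^'a. x \<bullet> x) x = 2 * x $ i"
    by (simp add: inner_axis inner_axis')
qed

text \<open>In the product rule the mixed term is \<open>4\<close> times the radial derivative of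
  \<open>q\<close>, which Euler's identity turns into \<open>4 * m * q\<close>.\<close>

lemma laplacian_inner_self_mult:
  fixes q :: "real ^ 'n \<Rightarrow> real"
  assumes "hpoly m q"
  shows "laplacian (\<lambda>x. (x \<bullet> x) * q x) x = (2 * real CARD('n) + 4 * real m) * q x + (x \<bullet> x) * laplacian q x"
proof -
  note d = hpoly_differentiable[OF assms] partial_deriv_differentiable[OF assms]
    hpoly_differentiable[OF hpoly_inner_self]
  have d1: "partial_deriv i (\<lambda>x. (x \<bullet> x) * q x) = (\<lambda>x. (x \<bullet> x) * partial_deriv i q x + (2 * x $ i) * q x)" for i
    using d by (simp add: fun_eq_iff partial_deriv_mult partial_deriv_inner_self)
  have "partial_deriv i (partial_deriv i (\<lambda>x. (x \<bullet> x) * q x)) x =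
     (x \<bullet> x) * partial_deriv i (partial_deriv i q) x + 4 * (x $ i * partial_deriv i q x) + 2 * q x" for i
    unfolding d1 using d
    by (simp add: partial_deriv_add partial_deriv_mult partial_deriv_inner_self partial_deriv_cmult)
  then have "laplacian (\<lambda>x. (x \<bullet> x) * q x) x = (x \<bullet> x) * laplacian q x
     + 4 * (\<Sum>i\<in>UNIV. x $ i * partial_deriv i q x) + 2 * real CARD('n) * q x"
    by (simp add: laplacian_def sum.distrib sum_distrib_left)
  then show ?thesis by (simp add: euler_identity[OF assms] algebra_simps)
qed

section \<open>Harmonic forms and the decomposition of forms on the sphere\<close>

definition harmonic_poly :: "nat \<Rightarrow> (real ^ 'n \<Rightarrow> real) \<Rightarrow> bool" where
  "harmonic_poly l h \<longleftrightarrow> hpoly l h \<and> (\<forall>x. laplacian h x = 0)"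

lemma partial_deriv_zero [simp]: "partial_deriv i (\<lambda>x. 0) = (\<lambda>x. 0)"
  by auto

lemma harmonic_poly_zero: "harmonic_poly l (\<lambda>x. 0)"
  by (auto simp: harmonic_poly_def hpoly_zero laplacian_def)

lemma harmonic_poly_add: "harmonic_poly l g \<Longrightarrow> harmonic_poly l h \<Longrightarrow> harmonic_poly l (\<lambda>x. g x + h x)"
  by (auto simp: harmonic_poly_def laplacian_add intro: hpoly_add)

lemma harmonic_poly_cmult: "harmonic_poly l h \<Longrightarrow> harmonic_poly l (\<lambda>x. c * h x)"
  by (auto simp: harmonic_poly_def laplacian_cmult intro: hpoly_scale)

lemma harmonic_poly_sum:
  "(\<And>i. i \<in> A \<Longrightarrow> harmonic_poly l (h i)) \<Longrightarrow> harmonic_poly l (\<lambda>x. \<Sum>i\<in>A. h i x)"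
  by (induction A rule: infinite_finite_induct) (auto simp: harmonic_poly_zero intro: harmonic_poly_add)

lemma hpoly_inner_self_power: "hpoly (2 * k) (\<lambda>x. (x \<bullet> x) ^ k)"
proof (induction k)
  case (Suc k) from hpoly_mult[OF hpoly_inner_self this] show ?case by simp
qed (simp add: hpoly_const)

text \<open>Each further factor \<open>x \<bullet> x\<close> adds a positive multiple to the
  constant. Only positivity matters: it permits division by \<open>c\<close> when the Laplacian is
  inverted.\<close>

lemma laplacian_power_inner_self_mult:
  fixes h :: "real ^ 'n \<Rightarrow> real"
  assumes "harmonic_poly m h"
  shows "\<exists>c>0. \<forall>x. laplacian (\<lambda>x. (x \<bullet> x) ^ Suc j * h x) x = c * ((x \<bullet> x) ^ j * h x)"
proof (induction j)
  case 0
  then show ?case using assms laplacian_inner_self_mult[of m h]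
    by (intro exI[of _ "2 * real CARD('n) + 4 * real m"]) (auto simp: harmonic_poly_def add_pos_nonneg)
next
  case (Suc j)
  then obtain c where c: "c > 0"
    "\<And>x. laplacian (\<lambda>x. (x \<bullet> x) ^ Suc j * h x) x = c * ((x \<bullet> x) ^ j * h x)" by blast
  have "hpoly (2 * Suc j + m) (\<lambda>x. (x \<bullet> x) ^ Suc j * h x)"
    using hpoly_mult[OF hpoly_inner_self_power] assms unfolding harmonic_poly_def by blast
  from laplacian_inner_self_mult[OF this]
  show ?case using c
    by (intro exI[of _ "c + (2 * real CARD('n) + 4 * real (2 * Suc j + m))"])
      (auto simp: algebra_simps intro!: add_pos_nonneg)
qed

text \<open>The Fischer decomposition: finite sums of harmonic forms multiplied by powers of the
  squared norm, all summands having the same total degree.\<close>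

inductive harmonic_decomp :: "nat \<Rightarrow> (real ^ 'n \<Rightarrow> real) \<Rightarrow> bool" where
  harmonic_decomp_zero: "harmonic_decomp k (\<lambda>x. 0)"
| harmonic_decomp_add: "harmonic_poly m h \<Longrightarrow> harmonic_decomp (m + 2 * j) p \<Longrightarrow> harmonic_decomp (m + 2 * j) (\<lambda>x. (x \<bullet> x) ^ j * h x + p x)"

lemma harmonic_decomp_imp_hpoly: "harmonic_decomp k p \<Longrightarrow> hpoly k p"
proof (induction rule: harmonic_decomp.induct)
  case (harmonic_decomp_add m h j p)
  have "hpoly (m + 2 * j) (\<lambda>x. (x \<bullet> x) ^ j * h x)"
    using hpoly_mult[OF hpoly_inner_self_power, of m h j] harmonic_decomp_add(1)
    by (simp add: harmonic_poly_def add.commute)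
  from hpoly_add[OF this harmonic_decomp_add(3)] show ?case .
qed (rule hpoly_zero)

text \<open>Summand by summand, raising the power of \<open>x \<bullet> x\<close> by one and
  dividing by the constant of \<open>laplacian_power_inner_self_mult\<close> gives a
  preimage.\<close>

lemma harmonic_decomp_inverse_laplacian:
  "harmonic_decomp k p \<Longrightarrow> \<exists>q. harmonic_decomp (k + 2) q \<and> (\<forall>x. laplacian q x = p x)"
proof (induction rule: harmonic_decomp.induct)
  case (harmonic_decomp_zero k)
  show ?case using harmonic_decomp.harmonic_decomp_zero[of "k+2"] by (intro exI[of _ "\<lambda>x. 0"]) (auto simp: laplacian_def)
next
  case (harmonic_decomp_add m h j p)
  then obtain q where q: "harmonic_decomp (m + 2 * j + 2) q" "\<And>x. laplacian q x = p x" by blast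
  obtain c where c: "c > 0" "\<And>x. laplacian (\<lambda>x. (x \<bullet> x) ^ Suc j * h x) x = c * ((x \<bullet> x) ^ j * h x)"
    using laplacian_power_inner_self_mult[OF harmonic_decomp_add(1)] by blast
  let ?h = "\<lambda>x. inverse c * h x"
  have h: "harmonic_poly m ?h" by (rule harmonic_poly_cmult[OF harmonic_decomp_add(1)])
  have q': "harmonic_decomp (m + 2 * Suc j) q" using q by simp
  have hp: "hpoly (2 * Suc j + m) (\<lambda>x. (x \<bullet> x) ^ Suc j * h x)"
    using hpoly_mult[OF hpoly_inner_self_power] harmonic_decomp_add(1) unfolding harmonic_poly_def by blast
  have "laplacian (\<lambda>x. (x \<bullet> x) ^ Suc j * ?h x + q x) x = (x \<bullet> x) ^ j * h x + p x" for x
  proof -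
    have "laplacian (\<lambda>x. inverse c * ((x \<bullet> x) ^ Suc j * h x) + q x) x = (x \<bullet> x) ^ j * h x + p x"
      using c by (subst laplacian_add[OF hpoly_scale[OF hp] harmonic_decomp_imp_hpoly[OF q']])
        (simp add: laplacian_cmult[OF hp] q(2) del: power_Suc)
    then show ?thesis by (simp add: mult.left_commute)
  qed
  with harmonic_decomp.harmonic_decomp_add[OF h q'] show ?case by (intro exI[of _ "\<lambda>x. (x \<bullet> x) ^ Suc j * ?h x + q x"]) auto
qed

text \<open>The Laplacian of \<open>p\<close> has lower degree and is decomposable by induction. A
  decomposable \<open>q\<close> with the same Laplacian then exists in degree \<open>k\<close>, and
  \<open>p - q\<close> is harmonic.\<close>

lemma hpoly_imp_harmonic_decomp: "hpoly k p \<Longrightarrow> harmonic_decomp k p"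
proof (induction k arbitrary: p rule: less_induct)
  case (less k)
  obtain q where q: "harmonic_decomp k q" "\<And>x. laplacian q x = laplacian p x"
  proof (cases "k < 2")
    case True
    then show ?thesis using hpoly_laplacian[OF less(2)] that[of "\<lambda>x. 0"] by (auto simp: harmonic_decomp_zero laplacian_def)
  next
    case False
    then have "harmonic_decomp (k - 2) (laplacian p)" using less hpoly_laplacian[OF less(2)] by auto
    from harmonic_decomp_inverse_laplacian[OF this] obtain q where "harmonic_decomp (k - 2 + 2) q" "\<And>x. laplacian q x = laplacian p x"
      by blast
    moreover have "k - 2 + 2 = k" using False by simp
    ultimately show ?thesis using that by metis
  qed
  have "harmonic_poly k (\<lambda>x. p x - q x)"
    using q laplacian_diff[OF less(2) harmonic_decomp_imp_hpoly[OF q(1)]] hpoly_diff[OF less(2) harmonic_decomp_imp_hpoly[OF q(1)]]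
    by (simp add: harmonic_poly_def)
  from harmonic_decomp_add[OF this, of 0 q] q show ?case by simp
qed

text \<open>On the sphere the powers of \<open>x \<bullet> x\<close> are \<open>1\<close>, so only
  the harmonic factors remain; summands of equal degree are collected in one component.\<close>

lemma harmonic_decomp_on_sphere:
  "harmonic_decomp k p \<Longrightarrow> \<exists>h. (\<forall>l. harmonic_poly l (h l)) \<and> (\<forall>x\<in>sphere 0 1. p x = (\<Sum>l\<le>k. h l x))"
proof (induction rule: harmonic_decomp.induct)
  case (harmonic_decomp_zero k)
  show ?case by (intro exI[of _ "\<lambda>l x. 0"]) (auto simp: harmonic_poly_zero)
next
  case (harmonic_decomp_add m g j p)
  then obtain h where h: "\<And>l. harmonic_poly l (h l)"
    "\<And>x. x\<in>sphere 0 1 \<Longrightarrow> p x = (\<Sum>l\<le>m + 2 * j. h l x)" by blast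
  let ?h = "\<lambda>l x. h l x + (if l = m then g x else 0)"
  have 1: "harmonic_poly l (?h l)" for l
    using h(1)[of l] harmonic_decomp_add(1) by (cases "l = m") (auto intro: harmonic_poly_add)
  have "(x \<bullet> x) ^ j * g x + p x = (\<Sum>l\<le>m + 2 * j. ?h l x)" if "x \<in> sphere 0 1" for x
    using that h(2)[OF that] by (simp add: sum.distrib norm_eq_1)
  with 1 show ?case by (intro exI[of _ ?h]) blast
qed

section \<open>Polynomials of bounded total degree\<close>

inductive polyfun :: "nat \<Rightarrow> (real ^ 'n \<Rightarrow> real) \<Rightarrow> bool" for t where
  polyfun_zero: "polyfun t (\<lambda>x. 0)"
| polyfun_add: "hpoly k p \<Longrightarrow> k \<le> t \<Longrightarrow> polyfun t q \<Longrightarrow> polyfun t (\<lambda>x. p x + q x)"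

lemma polyfun_hpoly: "hpoly k p \<Longrightarrow> k \<le> t \<Longrightarrow> polyfun t p"
  using polyfun_add[OF _ _ polyfun_zero, of k p] by simp

lemma polyfun_plus: "polyfun t p \<Longrightarrow> polyfun t q \<Longrightarrow> polyfun t (\<lambda>x. p x + q x)"
  by (induction rule: polyfun.induct) (auto simp: add.assoc intro: polyfun_add)

lemma polyfun_sum: "(\<And>i. i \<in> A \<Longrightarrow> polyfun t (p i)) \<Longrightarrow> polyfun t (\<lambda>x. \<Sum>i\<in>A. p i x)"
  by (induction A rule: infinite_finite_induct) (auto intro: polyfun_zero polyfun_plus)

lemma polyfun_cmult: "polyfun t p \<Longrightarrow> polyfun t (\<lambda>x. c * p x)"
  by (induction rule: polyfun.induct) (auto simp: distrib_left intro: polyfun_zero polyfun_add hpoly_scale)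

lemma polyfun_const: "polyfun t (\<lambda>x. c)"
  by (rule polyfun_hpoly[OF hpoly_const]) simp

lemma polyfun_mono: "polyfun t p \<Longrightarrow> t \<le> u \<Longrightarrow> polyfun u p"
  by (induction rule: polyfun.induct) (auto intro: polyfun_zero polyfun_add)

lemma polyfun_mult_hpoly: "polyfun t p \<Longrightarrow> hpoly k q \<Longrightarrow> k \<le> u \<Longrightarrow> polyfun (t + u) (\<lambda>x. q x * p x)"
proof (induction rule: polyfun.induct)
  case (polyfun_add k' p r)
  then show ?case using hpoly_mult[of k q k' p] polyfun.polyfun_add[of "k + k'" "\<lambda>x. q x * p x" "t + u"]
    by (auto simp: distrib_left)
qed (simp add: polyfun_zero)

lemma polyfun_mult: "polyfun t p \<Longrightarrow> polyfun u q \<Longrightarrow> polyfun (t + u) (\<lambda>x. p x * q x)"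
proof (induction rule: polyfun.induct)
  case (polyfun_add k p r)
  then show ?case using polyfun_mult_hpoly[of u q k p t]
    by (auto simp: distrib_right add.commute intro: polyfun_plus)
qed (simp add: polyfun_zero)

lemma polyfun_power: "polyfun t p \<Longrightarrow> polyfun (k * t) (\<lambda>x. p x ^ k)"
  by (induction k) (auto simp: polyfun_const intro: polyfun_mult)

lemma polyfun_continuous_on: "polyfun t p \<Longrightarrow> continuous_on A p"
  by (induction rule: polyfun.induct) (auto intro: continuous_on_add hpoly_continuous_on)

text \<open>Reduces orthogonality to all polynomials to orthogonality to all harmonic forms.\<close>

lemma polyfun_on_sphere:
  "polyfun t p \<Longrightarrow> \<exists>h. (\<forall>l. harmonic_poly l (h l)) \<and> (\<forall>x\<in>sphere 0 1. p x = (\<Sum>l\<le>t. h l x))"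
proof (induction rule: polyfun.induct)
  case polyfun_zero
  show ?case by (intro exI[of _ "\<lambda>l x. 0"]) (auto simp: harmonic_poly_zero)
next
  case (polyfun_add k p q)
  obtain h where h: "\<And>l. harmonic_poly l (h l)"
    "\<And>x. x\<in>sphere 0 1 \<Longrightarrow> p x = (\<Sum>l\<le>k. h l x)"
    using harmonic_decomp_on_sphere[OF hpoly_imp_harmonic_decomp[OF polyfun_add(1)]] by blast
  obtain g where g: "\<And>l. harmonic_poly l (g l)"
    "\<And>x. x\<in>sphere 0 1 \<Longrightarrow> q x = (\<Sum>l\<le>t. g l x)" using polyfun_add by blast
  let ?h = "\<lambda>l x. g l x + (if l \<le> k then h l x else 0)"
  have 1: "harmonic_poly l (?h l)" for l
    using h(1)[of l] g(1)[of l] by (cases "l \<le> k") (auto intro: harmonic_poly_add)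
  have "(\<Sum>l\<le>t. if l \<le> k then h l x else 0) = (\<Sum>l\<le>k. h l x)" for x
    using polyfun_add(2) by (intro sum.mono_neutral_cong_right) auto
  then have "p x + q x = (\<Sum>l\<le>t. ?h l x)" if "x \<in> sphere 0 1" for x
    using that h(2)[OF that] g(2)[OF that] by (simp add: sum.distrib)
  with 1 show ?case by (intro exI[of _ ?h]) blast
qed


section \<open>Agreement with the monomial description of polynomials\<close>

lemma finite_multi_indices: "finite {\<alpha> :: 'n::finite \<Rightarrow> nat. (\<Sum>i\<in>UNIV. \<alpha> i) \<le> t}"
proof (rule finite_subset)
  show "{\<alpha> :: 'n \<Rightarrow> nat. (\<Sum>i\<in>UNIV. \<alpha> i) \<le> t} \<subseteq> PiE UNIV (\<lambda>_. {..t})"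
  proof
    fix \<alpha> :: "'n \<Rightarrow> nat" assume "\<alpha> \<in> {\<alpha>. (\<Sum>i\<in>UNIV. \<alpha> i) \<le> t}"
    then have "\<alpha> i \<le> t" for i using member_le_sum[of i UNIV \<alpha>] by simp
    then show "\<alpha> \<in> PiE UNIV (\<lambda>_. {..t})" by auto
  qed
qed (auto intro: finite_PiE)

lemma polynomials_upto_zero: "(\<lambda>x. 0) \<in> polynomials_upto t"
  unfolding polynomials_upto_def by (intro CollectI exI[of _ "\<lambda>_. 0"]) auto

lemma polynomials_upto_const: "(\<lambda>x :: real ^ 'a. c) \<in> polynomials_upto 0"
proof -
  have "{\<alpha> :: 'a \<Rightarrow> nat. (\<Sum>i\<in>UNIV. \<alpha> i) \<le> 0} = {\<lambda>_. 0}" by auto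
  then have "(\<lambda>x. c) = (\<lambda>x :: real ^ 'a. \<Sum>\<alpha>\<in>{\<alpha> :: 'a \<Rightarrow> nat. (\<Sum>i\<in>UNIV. \<alpha> i) \<le> 0}. c * (\<Prod>i\<in>UNIV. (x $ i) ^ \<alpha> i))"
    by (simp only:) simp
  then show ?thesis unfolding polynomials_upto_def by (intro CollectI exI)
qed

lemma polynomials_upto_add:
  assumes "p \<in> polynomials_upto t" "q \<in> polynomials_upto t"
  shows "(\<lambda>x. p x + q x) \<in> polynomials_upto t"
proof -
  obtain a b where
    p: "p = (\<lambda>x. \<Sum>\<alpha>\<in>{\<alpha> :: 'a \<Rightarrow> nat. (\<Sum>i\<in>UNIV. \<alpha> i) \<le> t}. a \<alpha> * (\<Prod>i\<in>UNIV. (x $ i) ^ \<alpha> i))" and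
    q: "q = (\<lambda>x. \<Sum>\<alpha>\<in>{\<alpha> :: 'a \<Rightarrow> nat. (\<Sum>i\<in>UNIV. \<alpha> i) \<le> t}. b \<alpha> * (\<Prod>i\<in>UNIV. (x $ i) ^ \<alpha> i))"
    using assms unfolding polynomials_upto_def by blast
  show ?thesis unfolding polynomials_upto_def p q
    by (intro CollectI exI[of _ "\<lambda>\<alpha>. a \<alpha> + b \<alpha>"]) (simp add: distrib_right sum.distrib)
qed

lemma polynomials_upto_mono:
  assumes "p \<in> polynomials_upto t" "t \<le> u"
  shows "p \<in> polynomials_upto u"
proof -
  obtain a where
    p: "p = (\<lambda>x. \<Sum>\<alpha>\<in>{\<alpha> :: 'a \<Rightarrow> nat. (\<Sum>i\<in>UNIV. \<alpha> i) \<le> t}. a \<alpha> * (\<Prod>i\<in>UNIV. (x $ i) ^ \<alpha> i))"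
    using assms unfolding polynomials_upto_def by blast
  have "p = (\<lambda>x. \<Sum>\<alpha>\<in>{\<alpha> :: 'a \<Rightarrow> nat. (\<Sum>i\<in>UNIV. \<alpha> i) \<le> u}.
      (if (\<Sum>i\<in>UNIV. \<alpha> i) \<le> t then a \<alpha> else 0) * (\<Prod>i\<in>UNIV. (x $ i) ^ \<alpha> i))"
    unfolding p using assms(2)
    by (intro ext sum.mono_neutral_cong_left finite_multi_indices) auto
  then show ?thesis unfolding polynomials_upto_def by (intro CollectI exI)
qed

lemma polynomials_upto_coord:
  assumes "p \<in> polynomials_upto t"
  shows "(\<lambda>x. x $ i * p x) \<in> polynomials_upto (Suc t)"
proof -
  let ?A = "\<lambda>t. {\<alpha> :: 'a \<Rightarrow> nat. (\<Sum>i\<in>UNIV. \<alpha> i) \<le> t}"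
  let ?m = "\<lambda>\<alpha> x. \<Prod>j\<in>UNIV. ((x :: real ^ 'a) $ j) ^ \<alpha> j"
  obtain a where p: "p = (\<lambda>x. \<Sum>\<alpha>\<in>?A t. a \<alpha> * ?m \<alpha> x)"
    using assms unfolding polynomials_upto_def by blast
  let ?s = "\<lambda>\<alpha>. \<alpha>(i := Suc (\<alpha> i))"
  have inj: "inj_on ?s (?A t)"
  proof (rule inj_onI)
    fix \<alpha> \<beta> assume "?s \<alpha> = ?s \<beta>"
    then have "\<alpha> j = \<beta> j" for j by (cases "j = i") (metis fun_upd_same nat.inject, metis fun_upd_other)
    then show "\<alpha> = \<beta>" by blast
  qed
  have sub: "?s ` ?A t \<subseteq> ?A (Suc t)"
  proof safe
    fix \<alpha> :: "'a \<Rightarrow> nat" assume "(\<Sum>i\<in>UNIV. \<alpha> i) \<le> t"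
    then show "(\<Sum>j\<in>UNIV. ?s \<alpha> j) \<le> Suc t"
      by (simp add: sum.remove[of UNIV i] sum.remove[of UNIV i \<alpha>])
  qed
  \<comment> \<open>Multi-indices outside the image of the shift get coefficient \<open>0\<close>;
    on the image the shift is undone by lowering entry \<open>i\<close>.\<close>
  let ?c = "\<lambda>\<beta>. if \<beta> \<in> ?s ` ?A t then a (\<beta>(i := \<beta> i - 1)) else 0"
  have "x $ i * p x = (\<Sum>\<beta>\<in>?A (Suc t). ?c \<beta> * ?m \<beta> x)" for x
  proof -
    have "x $ i * p x = (\<Sum>\<alpha>\<in>?A t. a \<alpha> * ?m (?s \<alpha>) x)"
      unfolding p sum_distrib_left
      by (intro sum.cong refl) (simp add: prod.remove[of UNIV i])
    also have "\<dots> = (\<Sum>\<beta>\<in>?s ` ?A t. ?c \<beta> * ?m \<beta> x)"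
      by (subst sum.reindex[OF inj]) (intro sum.cong refl, simp)
    also have "\<dots> = (\<Sum>\<beta>\<in>?A (Suc t). ?c \<beta> * ?m \<beta> x)"
      using sub by (intro sum.mono_neutral_left finite_multi_indices) auto
    finally show ?thesis .
  qed
  then have "(\<lambda>x. x $ i * p x) = (\<lambda>x. \<Sum>\<beta>\<in>?A (Suc t). ?c \<beta> * ?m \<beta> x)" by blast
  then show ?thesis unfolding polynomials_upto_def by (intro CollectI exI)
qed

lemma hpoly_imp_polynomials_upto: "hpoly k p \<Longrightarrow> p \<in> polynomials_upto k"
  by (induction rule: hpoly.induct)
    (auto intro: polynomials_upto_const polynomials_upto_coord polynomials_upto_add)

lemma polyfun_imp_polynomials_upto: "polyfun t p \<Longrightarrow> p \<in> polynomials_upto t"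
proof (induction rule: polyfun.induct)
  case (polyfun_add k p q)
  then show ?case
    by (auto intro!: polynomials_upto_add intro: polynomials_upto_mono hpoly_imp_polynomials_upto)
qed (rule polynomials_upto_zero)

text \<open>Connects with the Stone--Weierstrass theorem. No control of the degree is kept, since
  only density is drawn from it.\<close>

lemma real_polynomial_function_imp_polyfun:
  fixes p :: "real ^ 'n \<Rightarrow> real"
  shows "real_polynomial_function p \<Longrightarrow> \<exists>t. polyfun t p"
proof (induction rule: real_polynomial_function.induct)
  case (linear f)
  then have "f x = (\<Sum>i\<in>UNIV. f (axis i 1) * x $ i)" for x
  proof -
    have "f x = f (\<Sum>i\<in>UNIV. x $ i *\<^sub>R axis i 1)"
      by (metis basis_expansion scalar_mult_eq_scaleR)
    also have "\<dots> = (\<Sum>i\<in>UNIV. x $ i *\<^sub>R f (axis i 1))"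
      using linear by (simp add: bounded_linear.linear linear_sum linear_cmul)
    finally show ?thesis by (simp add: mult.commute)
  qed
  then have "f = (\<lambda>x. \<Sum>i\<in>UNIV. f (axis i 1) * x $ i)" by blast
  moreover have "polyfun 1 (\<lambda>x. \<Sum>i\<in>UNIV. f (axis i 1) * x $ i)"
    by (intro polyfun_sum polyfun_cmult polyfun_hpoly[OF hpoly_coord]) simp
  ultimately show ?case by metis
next
  case (const c) then show ?case using polyfun_const by blast
next
  case (add f g)
  then obtain t u where "polyfun t f" "polyfun u g" by blast
  then have "polyfun (max t u) (\<lambda>x. f x + g x)" by (intro polyfun_plus) (auto intro: polyfun_mono)
  then show ?case by blast
next
  case (mult f g)
  then show ?case using polyfun_mult by blast
qed

section \<open>Polar coordinates\<close>

lemma borel_measurable_sgn_vec [measurable]: "(sgn :: real ^ 'n \<Rightarrow> _) \<in> borel_measurable borel"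
  unfolding sgn_div_norm by measurable

lemma space_sphere_measure: "space (sphere_measure :: (real ^ 'n) measure) = sphere 0 1"
  by (simp add: sphere_measure_def space_restrict_space)

lemma sphere_borel [measurable]: "sphere (a :: real ^ 'n) r \<in> sets borel"
  by (intro borel_closed) (rule closed_sphere)

lemma sets_sphere_measure_iff:
  "A \<in> sets (sphere_measure :: (real ^ 'n) measure) \<longleftrightarrow> A \<in> sets borel \<and> A \<subseteq> sphere 0 1"
  unfolding sphere_measure_def by (subst sets_restrict_space_iff) auto

lemma measurable_sphere_measure_eq:
  "measurable (sphere_measure :: (real ^ 'n) measure) N = measurable (restrict_space borel (sphere 0 1)) N"
  by (intro measurable_cong_sets) (simp_all add: sphere_measure_def sets_restrict_space)

lemma continuous_on_sphere_measurable:
  fixes f :: "real ^ 'n \<Rightarrow> 'b :: topological_space"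
  assumes "continuous_on (sphere 0 1) f"
  shows "f \<in> borel_measurable sphere_measure"
  unfolding measurable_sphere_measure_eq by (rule borel_measurable_continuous_on_restrict[OF assms])

lemma emeasure_sphere_measure:
  fixes A :: "(real ^ 'n) set"
  assumes "A \<in> sets sphere_measure"
  shows "emeasure sphere_measure A =
     emeasure lborel {y. norm y \<le> 1 \<and> sgn y \<in> A} / ennreal (unit_ball_vol (real CARD('n)))"
proof -
  let ?U = "uniform_measure lborel (cball 0 1) :: (real ^ 'n) measure"
  have A: "A \<in> sets borel" "A \<subseteq> sphere 0 1" using assms by (auto simp: sets_sphere_measure_iff)
  have "emeasure sphere_measure A = emeasure (distr ?U borel sgn) A"
    unfolding sphere_measure_def using A by (intro emeasure_restrict_space) auto
  also have "\<dots> = emeasure ?U (sgn -` A \<inter> space ?U)"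
    using A by (intro emeasure_distr) auto
  also have "\<dots> = emeasure lborel (cball 0 1 \<inter> (sgn -` A \<inter> space ?U)) / emeasure lborel (cball 0 1 :: (real ^ 'n) set)"
  proof (rule emeasure_uniform_measure)
    have "sgn -` A \<inter> space (borel :: (real ^ 'n) measure) \<in> sets borel" using A by measurable
    then show "sgn -` A \<inter> space ?U \<in> sets lborel" by simp
  qed simp
  also have "cball 0 1 \<inter> (sgn -` A \<inter> space ?U) = {y. norm y \<le> 1 \<and> sgn y \<in> A}" by auto
  also have "emeasure lborel (cball 0 1 :: (real ^ 'n) set) = ennreal (unit_ball_vol (real CARD('n)))"
    using emeasure_cball[of 1 "0 :: real ^ 'n"] by simp
  finally show ?thesis .
qed

lemma prob_space_sphere_measure: "prob_space (sphere_measure :: (real ^ 'n) measure)"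
proof
  have "{y :: real ^ 'n. norm y \<le> 1 \<and> sgn y \<in> sphere 0 1} = cball 0 1 - {0}"
    by (auto simp: norm_sgn)
  moreover have "emeasure lborel (cball 0 1 - {0 :: real ^ 'n}) = ennreal (unit_ball_vol (real CARD('n)))"
    using emeasure_cball[of 1 "0 :: real ^ 'n"] by (subst emeasure_Diff_null_set) auto
  moreover have "sphere 0 1 \<in> sets (sphere_measure :: (real ^ 'n) measure)"
    by (simp add: sets_sphere_measure_iff)
  ultimately show "emeasure (sphere_measure :: (real ^ 'n) measure) (space sphere_measure) = 1"
    by (simp add: space_sphere_measure emeasure_sphere_measure ennreal_divide_self ennreal_eq_0_iff
        unit_ball_vol_pos[THEN less_imp_le] not_le)
qed

interpretation sphere: prob_space "sphere_measure :: (real ^ 'n) measure"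
  by (rule prob_space_sphere_measure)

lemma prob_sphere: "measure (sphere_measure :: (real ^ 'n) measure) (sphere 0 1) = 1"
  using sphere.prob_space by (simp add: space_sphere_measure)

lemma sgn_in_sphere: "y \<noteq> 0 \<Longrightarrow> sgn (y :: real ^ 'n) \<in> sphere 0 1"
  by (simp add: norm_sgn)

text \<open>Dilation by \<open>r\<close> carries the unit cone over \<open>A\<close> to the cone of
  radius \<open>r\<close>, which scales volumes by \<open>r ^ CARD('n)\<close>; the normalisation by
  the volume of the ball is undone by the factor \<open>unit_ball_vol\<close>.\<close>

lemma emeasure_cone:
  fixes A :: "(real ^ 'n) set"
  assumes A: "A \<in> sets sphere_measure" and r: "r \<ge> 0"
  shows "emeasure lborel {y. norm y \<le> r \<and> sgn y \<in> A} =
    ennreal (r ^ CARD('n) * (unit_ball_vol (real CARD('n)) * measure sphere_measure A))"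
proof -
  let ?C = "\<lambda>r. {y. norm y \<le> r \<and> sgn y \<in> A}"
  have A': "A \<in> sets borel" "A \<subseteq> sphere 0 1" using A by (auto simp: sets_sphere_measure_iff)
  have 0: "0 \<notin> A" using A' by auto
  have meas: "?C r \<in> sets borel" for r
    using A' by measurable
  have om: "unit_ball_vol (real CARD('n)) > 0" by simp
  have one: "emeasure lborel (?C 1) = ennreal (unit_ball_vol (real CARD('n)) * measure sphere_measure A)"
  proof -
    have "emeasure lborel (?C 1) = ennreal (unit_ball_vol (real CARD('n))) * emeasure sphere_measure A"
      unfolding emeasure_sphere_measure[OF A] using less_imp_neq[OF om]
      by (subst ennreal_times_divide, subst mult.commute, subst ennreal_mult_divide_eq) auto
    also have "\<dots> = ennreal (unit_ball_vol (real CARD('n)) * measure sphere_measure A)"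
      by (simp add: sphere.emeasure_eq_measure ennreal_mult')
    finally show ?thesis .
  qed
  show ?thesis
  proof (cases "r = 0")
    case True
    then have "?C r = {}" using 0 by auto
    then have "emeasure lborel (?C r) = 0" by (simp only: emeasure_empty)
    then show ?thesis using True by simp
  next
    case False
    with r have r: "r > 0" by simp
    have "?C r = (\<lambda>x. r *\<^sub>R x + 0) ` ?C 1"
    proof safe
      fix y assume y: "norm y \<le> r" "sgn y \<in> A"
      show "y \<in> (\<lambda>x. r *\<^sub>R x + 0) ` ?C 1"
        using r y by (intro image_eqI[of _ _ "inverse r *\<^sub>R y"]) (auto simp: sgn_scaleR field_simps)
    qed (use r in \<open>auto simp: sgn_scaleR\<close>)
    then have "emeasure lebesgue (?C r) = \<bar>r\<bar> ^ DIM(real^'n) * emeasure lebesgue (?C 1)"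
      using emeasure_lebesgue_affine[of r 0 "?C 1"] by simp
    then have "emeasure lborel (?C r) = ennreal (r ^ CARD('n)) * emeasure lborel (?C 1)"
      using meas r by (simp add: ennreal_power)
    then show ?thesis using r by (simp add: one ennreal_mult'[symmetric])
  qed
qed

text \<open>Removing the origin makes \<open>sgn\<close> map into the sphere, and the bound on the
  radius makes the measure finite. Radius \<open>2\<close> leaves room for every radial weight that
  occurs: the cutoff, balls around the origin and annuli around the unit sphere.\<close>

definition ball2 :: "(real ^ 'n) measure" where
  "ball2 = restrict_space lborel (cball 0 2 - {0})"

lemma sets_ball2 [measurable_cong]: "sets ball2 = sets (restrict_space borel (cball 0 2 - {0}))"
  by (simp add: ball2_def sets_restrict_space)

lemma sgn_measurable_ball2 [measurable]: "sgn \<in> measurable (ball2 :: (real ^ 'n) measure) sphere_measure"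
proof -
  have "sgn \<in> measurable (ball2 :: (real ^ 'n) measure) (restrict_space borel (sphere 0 1))"
    unfolding ball2_def by (intro measurable_restrict_space2 measurable_restrict_space1)
      (auto simp: norm_sgn space_restrict_space)
  also have "\<dots> = measurable ball2 sphere_measure"
    by (intro measurable_cong_sets) (simp_all add: sphere_measure_def sets_restrict_space)
  finally show ?thesis .
qed

lemma norm_measurable_ball2 [measurable]: "norm \<in> borel_measurable (ball2 :: (real ^ 'n) measure)"
  unfolding ball2_def by (intro measurable_restrict_space1) simp

lemma space_ball2: "space (ball2 :: (real ^ 'n) measure) = cball 0 2 - {0}"
  by (simp add: ball2_def space_restrict_space)

lemma emeasure_ball2:
  "A \<in> sets borel \<Longrightarrow> A \<subseteq> cball 0 2 - {0 :: real ^ 'n} \<Longrightarrow> emeasure ball2 A = emeasure lborel A"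
  unfolding ball2_def by (subst emeasure_restrict_space) auto

lemma finite_measure_ball2: "finite_measure (ball2 :: (real ^ 'n) measure)"
proof
  have "emeasure (lborel :: (real ^ 'n) measure) (cball 0 2 - {0}) \<le> emeasure lborel (cball 0 2 :: (real ^ 'n) set)"
    by (intro emeasure_mono) auto
  also have "\<dots> < \<infinity>" by (simp add: emeasure_cball)
  finally have "emeasure (lborel :: (real ^ 'n) measure) (cball 0 2 - {0}) < \<infinity>" .
  then show "emeasure (ball2 :: (real ^ 'n) measure) (space ball2) \<noteq> \<infinity>"
    unfolding space_ball2 by (subst emeasure_ball2) auto
qed

lemma emeasure_ball2_polar:
  fixes A :: "(real ^ 'n) set"
  assumes A: "A \<in> sets sphere_measure"
  shows "emeasure ball2 {y \<in> cball 0 2 - {0}. x < norm y \<and> sgn y \<in> A} =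
    ennreal ((2 ^ CARD('n) - (min 2 (max 0 x)) ^ CARD('n)) * (unit_ball_vol (real CARD('n)) * measure sphere_measure A))"
proof -
  let ?C = "\<lambda>r. {y. norm y \<le> r \<and> sgn y \<in> A}"
  \<comment> \<open>The threshold \<open>x\<close> is an arbitrary real, because the comparison of
    radial laws tests all half-lines; clamping it to the range of radii covers every case.\<close>
  let ?x = "min 2 (max 0 x)"
  have A': "A \<in> sets borel" "A \<subseteq> sphere 0 1" using A by (auto simp: sets_sphere_measure_iff)
  have 0: "0 \<notin> A" using A' by auto
  have meas: "?C r \<in> sets borel" for r
    using A' by measurable
  have eq: "{y \<in> cball 0 2 - {0}. x < norm y \<and> sgn y \<in> A} = ?C 2 - ?C ?x"
  proof (intro set_eqI)
    fix y
    have "norm y > 0" if "sgn y \<in> A" using that 0 by auto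
    then show "y \<in> {y \<in> cball 0 2 - {0}. x < norm y \<and> sgn y \<in> A} \<longleftrightarrow> y \<in> ?C 2 - ?C ?x"
      by (auto simp: max_def min_def intro: less_le_trans[OF _ norm_ge_zero])
  qed
  define m where "m = ?x"
  have m: "0 \<le> m" "m \<le> 2" by (auto simp: m_def)
  let ?c = "unit_ball_vol (real CARD('n)) * measure sphere_measure A"
  have "emeasure ball2 (?C 2 - ?C m) = emeasure lborel (?C 2 - ?C m)"
    using 0 meas m by (intro emeasure_ball2) auto
  also have "\<dots> = emeasure lborel (?C 2) - emeasure lborel (?C m)"
    using meas m by (intro emeasure_Diff) (auto simp: emeasure_cone[OF A])
  also have "\<dots> = ennreal (2 ^ CARD('n) * ?c) - ennreal (m ^ CARD('n) * ?c)"
    using m by (simp only: emeasure_cone[OF A])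
  also have "\<dots> = ennreal ((2 ^ CARD('n) - m ^ CARD('n)) * ?c)"
    using m by (subst ennreal_minus) (simp_all only: left_diff_distrib, simp)
  finally show ?thesis unfolding eq m_def .
qed

text \<open>Norm and direction are independent under \<open>ball2\<close>. The radial law is kept as
  an image measure, so no density in the radius has to be computed.\<close>

lemma polar_distr:
  "distr (ball2 :: (real ^ 'n) measure) (borel \<Otimes>\<^sub>M sphere_measure) (\<lambda>y. (norm y, sgn y)) =
   distr (ball2 :: (real ^ 'n) measure) borel norm \<Otimes>\<^sub>M sphere_measure"
proof (rule pair_measure_eqI[symmetric])
  interpret b: finite_measure "ball2 :: (real ^ 'n) measure" by (rule finite_measure_ball2)
  interpret n: finite_measure "distr (ball2 :: (real ^ 'n) measure) borel norm"
    by (rule b.finite_measure_distr) simp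
  show "sigma_finite_measure (distr (ball2 :: (real ^ 'n) measure) borel norm)"
    by unfold_locales
  show "sigma_finite_measure (sphere_measure :: (real ^ 'n) measure)"
    by unfold_locales
  show "sets (distr ball2 borel norm \<Otimes>\<^sub>M sphere_measure) =
    sets (distr (ball2 :: (real ^ 'n) measure) (borel \<Otimes>\<^sub>M sphere_measure) (\<lambda>y. (norm y, sgn y)))"
    by (simp cong: sets_pair_measure_cong)
next
  fix E and A :: "(real ^ 'n) set"
  assume E: "E \<in> sets (distr (ball2 :: (real ^ 'n) measure) borel norm)" and A: "A \<in> sets sphere_measure"
  interpret b: finite_measure "ball2 :: (real ^ 'n) measure" by (rule finite_measure_ball2)
  let ?S = "{y \<in> space ball2. sgn y \<in> A}"
  have S: "?S \<in> sets ball2" using A by measurable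
  \<comment> \<open>With the set \<open>A\<close> of directions fixed, both sides become measures in
    the radial variable. They are compared on half-lines, where the cone formula evaluates
    both.\<close>
  let ?N1 = "distr (density (ball2 :: (real ^ 'n) measure) (indicator ?S)) borel norm"
  let ?N2 = "density (distr (ball2 :: (real ^ 'n) measure) borel norm) (\<lambda>_. emeasure sphere_measure A)"
  have N1: "emeasure ?N1 F = emeasure ball2 {y \<in> cball 0 2 - {0}. norm y \<in> F \<and> sgn y \<in> A}"
    if "F \<in> sets borel" for F
  proof -
    have "emeasure ?N1 F = emeasure (density ball2 (indicator ?S)) (norm -` F \<inter> space ball2)"
      using that by (subst emeasure_distr) auto
    also have "\<dots> = emeasure ball2 (?S \<inter> (norm -` F \<inter> space ball2))"
      using that S by (intro emeasure_restricted) (auto simp: measurable_sets)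
    also have "?S \<inter> (norm -` F \<inter> space ball2) = {y \<in> cball 0 2 - {0}. norm y \<in> F \<and> sgn y \<in> A}"
      by (auto simp: space_ball2)
    finally show ?thesis .
  qed
  have N2a: "emeasure ?N2 F = emeasure sphere_measure A * emeasure (distr (ball2 :: (real ^ 'n) measure) borel norm) F"
    if "F \<in> sets borel" for F
    using that by (subst emeasure_density) (auto simp: nn_integral_cmult_indicator)
  have N2: "emeasure ?N2 F = emeasure sphere_measure A * emeasure ball2 {y \<in> cball 0 2 - {0 :: real ^ 'n}. norm y \<in> F}"
    if "F \<in> sets borel" for F
  proof -
    have "norm -` F \<inter> space (ball2 :: (real ^ 'n) measure) = {y \<in> cball 0 2 - {0 :: real ^ 'n}. norm y \<in> F}"
      by (auto simp: space_ball2)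
    then have "emeasure (distr (ball2 :: (real ^ 'n) measure) borel norm) F = emeasure ball2 {y \<in> cball 0 2 - {0 :: real ^ 'n}. norm y \<in> F}"
      using that by (subst emeasure_distr) simp_all
    then show ?thesis using N2a[OF that] by simp
  qed
  have "?N1 = ?N2"
  proof (rule measure_eqI_lessThan)
    fix x :: real
    have 1: "emeasure ?N1 {x<..} = emeasure ball2 {y \<in> cball 0 2 - {0}. x < norm y \<and> sgn y \<in> A}"
      by (subst N1) auto
    then show "emeasure ?N1 {x<..} < \<infinity>" by (simp add: b.emeasure_finite less_top[symmetric])
    have sp: "sphere 0 1 \<in> sets (sphere_measure :: (real ^ 'n) measure)" by (simp add: sets_sphere_measure_iff)
    have "{y \<in> cball 0 2 - {0}. norm y \<in> {x<..}} = {y \<in> cball 0 2 - {0 :: real ^ 'n}. x < norm y \<and> sgn y \<in> sphere 0 1}"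
      by (auto simp: norm_sgn)
    then have "emeasure ?N2 {x<..} = emeasure sphere_measure A * emeasure ball2 {y \<in> cball 0 2 - {0 :: real ^ 'n}. x < norm y \<and> sgn y \<in> sphere 0 1}"
      using N2[of "{x<..}"] by simp
    also have "\<dots> = emeasure ?N1 {x<..}" unfolding 1 emeasure_ball2_polar[OF sp] emeasure_ball2_polar[OF A]
      using prob_sphere[where 'n = 'n]
      by (simp add: sphere.emeasure_eq_measure ennreal_mult'[symmetric] mult_ac)
    finally show "emeasure ?N1 {x<..} = emeasure ?N2 {x<..}" by simp
  qed auto
  then have 1: "emeasure ?N1 E = emeasure ?N2 E" by simp
  have pre: "(\<lambda>y. (norm y, sgn y)) -` (E \<times> A) \<inter> space ball2 = {y \<in> cball 0 2 - {0}. norm y \<in> E \<and> sgn y \<in> A}"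
    by (auto simp: space_ball2)
  have E': "E \<in> sets borel" using E by simp
  have "emeasure (distr (ball2 :: (real ^ 'n) measure) (borel \<Otimes>\<^sub>M sphere_measure) (\<lambda>y. (norm y, sgn y))) (E \<times> A)
    = emeasure ball2 {y \<in> cball 0 2 - {0}. norm y \<in> E \<and> sgn y \<in> A}"
    unfolding pre[symmetric] using E' A by (intro emeasure_distr) auto
  with 1 N1[OF E'] N2a[OF E']
  show "emeasure (distr (ball2 :: (real ^ 'n) measure) borel norm) E * emeasure sphere_measure A =
    emeasure (distr ball2 (borel \<Otimes>\<^sub>M sphere_measure) (\<lambda>y. (norm y, sgn y))) (E \<times> A)" by (simp only: mult.commute)
qed


text \<open>The conditions on \<open>w\<close> confine the integrand to \<open>ball2\<close>, where
  the polar image is a product measure and Fubini separates the factors. The radial factor remains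
  an integral over the whole space, since later only its sign or an upper bound for it is
  needed.\<close>

lemma polar_integral:
  fixes h :: "real ^ 'n \<Rightarrow> real" and w :: "real \<Rightarrow> real"
  assumes w: "w \<in> borel_measurable borel" "\<And>r. \<bar>w r\<bar> \<le> B" "w 0 = 0" "\<And>r. r > 2 \<Longrightarrow> w r = 0"
    and h: "integrable sphere_measure h"
  shows "(\<integral>y. w (norm y) * h (sgn y) \<partial>lborel) =
    (\<integral>y. w (norm (y :: real ^ 'n)) \<partial>lborel) * (\<integral>x. h x \<partial>sphere_measure)" (is ?thesis1)
    and "integrable lborel (\<lambda>y. w (norm y) * h (sgn y))" (is ?thesis2)
proof -
  interpret b: finite_measure "ball2 :: (real ^ 'n) measure" by (rule finite_measure_ball2)
  interpret n: finite_measure "distr (ball2 :: (real ^ 'n) measure) borel norm"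
    by (rule b.finite_measure_distr) simp
  interpret p: pair_sigma_finite "distr (ball2 :: (real ^ 'n) measure) borel norm" "sphere_measure :: (real ^ 'n) measure"
    by unfold_locales
  let ?P = "distr (ball2 :: (real ^ 'n) measure) borel norm \<Otimes>\<^sub>M (sphere_measure :: (real ^ 'n) measure)"
  let ?F = "\<lambda>(r, x). w r * h x"
  note [measurable] = w(1) borel_measurable_integrable[OF h]
  have wi: "integrable (distr (ball2 :: (real ^ 'n) measure) borel norm) w"
    using w(2) by (intro n.integrable_const_bound[of _ B]) auto
  have F: "?F \<in> borel_measurable ?P" by measurable
  have int: "integrable ?P ?F"
  proof (rule p.Fubini_integrable[OF F])
    show "integrable (distr (ball2 :: (real ^ 'n) measure) borel norm) (\<lambda>x. LINT y|sphere_measure. norm (?F (x, y)))"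
      using wi by (simp add: abs_mult)
  qed (use h in auto)
  have meas: "(\<lambda>y. (norm y, sgn y)) \<in> measurable (ball2 :: (real ^ 'n) measure) (borel \<Otimes>\<^sub>M sphere_measure)"
    by measurable
  have F': "?F \<in> borel_measurable (borel \<Otimes>\<^sub>M sphere_measure)"
    by measurable
  have eq0: "w (norm y) = indicator (cball 0 2 - {0}) y * w (norm y)" for y :: "real ^ 'n"
    using w(3) w(4)[of "norm y"] by (cases "y = 0"; cases "norm y \<le> 2") (simp_all add: indicator_def)
  have eq1: "w (norm y) * h (sgn y) = indicator (cball 0 2 - {0}) y * (w (norm y) * h (sgn y))" for y :: "real ^ 'n"
    using w(3) w(4)[of "norm y"] by (cases "y = 0"; cases "norm y \<le> 2") (simp_all add: indicator_def)
  have "(\<integral>y. w (norm y) * h (sgn y) \<partial>lborel) = (\<integral>y. w (norm y) * h (sgn y) \<partial>ball2)"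
    unfolding ball2_def by (subst integral_restrict_space) (simp_all add: eq1[symmetric])
  also have "\<dots> = (\<integral>z. ?F z \<partial>distr (ball2 :: (real ^ 'n) measure) (borel \<Otimes>\<^sub>M sphere_measure) (\<lambda>y. (norm y, sgn y)))"
    by (subst integral_distr[OF meas F']) simp
  also have "\<dots> = integral\<^sup>L ?P ?F" unfolding polar_distr ..
  also have "\<dots> = (\<integral>r. \<integral>x. ?F (r, x) \<partial>sphere_measure \<partial>distr (ball2 :: (real ^ 'n) measure) borel norm)"
    by (rule p.integral_fst'[OF int, symmetric])
  also have "\<dots> = (\<integral>r. w r \<partial>distr (ball2 :: (real ^ 'n) measure) borel norm) * (\<integral>x. h x \<partial>sphere_measure)"
    by simp
  also have "(\<integral>r. w r \<partial>distr (ball2 :: (real ^ 'n) measure) borel norm) = (\<integral>y. w (norm y) \<partial>(ball2 :: (real ^ 'n) measure))"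
    by (subst integral_distr) auto
  also have "\<dots> = (\<integral>y. w (norm (y :: real ^ 'n)) \<partial>lborel)"
    unfolding ball2_def by (subst integral_restrict_space) (simp_all add: eq0[symmetric])
  finally show ?thesis1 .
  have "integrable (distr (ball2 :: (real ^ 'n) measure) (borel \<Otimes>\<^sub>M sphere_measure) (\<lambda>y. (norm y, sgn y))) ?F"
    unfolding polar_distr by (rule int)
  then have "integrable (ball2 :: (real ^ 'n) measure) (\<lambda>y. w (norm y) * h (sgn y))"
    using integrable_distr[OF meas, of ?F] by simp
  then show ?thesis2
    unfolding ball2_def by (subst (asm) integrable_restrict_space) (simp_all add: eq1[symmetric])
qed

text \<open>The cone over the cap is covered by balls of radius \<open>2 * r\<close> centred at the
  points \<open>k * r\<close> times \<open>a\<close> with \<open>k \<le> 1 / r\<close>. These are at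
  most \<open>2 / r\<close> balls, whence the volume bound
  \<open>(2 / r) * (2 * r) ^ (d + 1)\<close>. For \<open>r > 1\<close> the right-hand side is at
  least \<open>1\<close>.\<close>

lemma sphere_cap_bound:
  fixes a :: "real ^ 'n"
  assumes a: "norm a = 1" and r: "r > 0" and n: "CARD('n) = Suc d"
  shows "measure sphere_measure {x \<in> sphere 0 1. dist x a \<le> r} \<le> 2 ^ (d + 2) * r ^ d"
proof (cases "r \<le> 1")
  case False
  then have "1 \<le> (2::real) ^ (d + 2) * r ^ d"
    using one_le_power[of "2::real" "d+2"] one_le_power[of r d] mult_mono[of 1 "(2::real) ^ (d + 2)" 1 "r ^ d"] by simp
  then show ?thesis using sphere.prob_le_1 order_trans by blast
next
  case True
  let ?A = "{x \<in> sphere 0 1. dist x a \<le> r}"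
  let ?om = "unit_ball_vol (real CARD('n))"
  let ?K = "nat \<lfloor>1 / r\<rfloor>"
  have "?A = sphere 0 1 \<inter> cball a r" by (auto simp: dist_commute)
  then have "closed ?A" by (simp add: closed_Int)
  then have A: "?A \<in> sets sphere_measure" by (auto simp: sets_sphere_measure_iff borel_closed)
  have K: "real ?K \<le> 1 / r" using r by (simp add: of_nat_floor)
  have sub: "{y. norm y \<le> 1 \<and> sgn y \<in> ?A} \<subseteq> (\<Union>k\<in>{..?K}. cball ((real k * r) *\<^sub>R a) (2 * r))"
  proof
    fix y assume "y \<in> {y. norm y \<le> 1 \<and> sgn y \<in> ?A}"
    then have y: "norm y \<le> 1" "norm (sgn y) = 1" "dist (sgn y) a \<le> r" by auto
    define s where "s = norm y"
    have s: "0 \<le> s" "s \<le> 1" using y by (auto simp: s_def)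
    define k where "k = nat \<lfloor>s / r\<rfloor>"
    have k: "real k \<le> s / r" "s / r < real k + 1" using s r by (auto simp: k_def)
    have kK: "k \<le> ?K" unfolding k_def using s r by (intro nat_mono floor_mono divide_right_mono) auto
    have ks: "\<bar>s - real k * r\<bar> \<le> r" using k r by (auto simp: field_simps abs_le_iff)
    have ys: "y = s *\<^sub>R sgn y" by (cases "y = 0") (simp_all add: s_def sgn_div_norm)
    have "norm (y - (real k * r) *\<^sub>R a) = norm (s *\<^sub>R (sgn y - a) + (s - real k * r) *\<^sub>R a)"
      by (subst ys) (simp add: algebra_simps)
    also have "\<dots> \<le> s * norm (sgn y - a) + \<bar>s - real k * r\<bar>"
      using s a by (intro order_trans[OF norm_triangle_ineq]) auto
    also have "\<dots> \<le> 1 * r + r" using s y r ks by (intro add_mono mult_mono) (auto simp: dist_norm)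
    finally show "y \<in> (\<Union>k\<in>{..?K}. cball ((real k * r) *\<^sub>R a) (2 * r))"
      using kK by (auto simp: dist_norm norm_minus_commute)
  qed
  have "ennreal (?om * measure sphere_measure ?A) = emeasure lborel {y. norm y \<le> 1 \<and> sgn y \<in> ?A}"
    using emeasure_cone[OF A, of 1] by simp
  also have "\<dots> \<le> emeasure lborel (\<Union>k\<in>{..?K}. cball ((real k * r) *\<^sub>R a) (2 * r))"
    using sub by (intro emeasure_mono) auto
  also have "\<dots> \<le> (\<Sum>k\<in>{..?K}. emeasure lborel (cball ((real k * r) *\<^sub>R a) (2 * r)))"
    by (intro emeasure_subadditive_finite) auto
  also have "\<dots> = ennreal ((real ?K + 1) * (?om * (2 * r) ^ CARD('n)))"
    using r by (simp add: emeasure_cball ennreal_mult' ennreal_of_nat_eq_real_of_nat add.commute flip: ennreal_plus)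
  finally have "?om * measure sphere_measure ?A \<le> (real ?K + 1) * (?om * (2 * r) ^ CARD('n))"
    using r by (subst (asm) ennreal_le_iff) auto
  then have "?om * measure sphere_measure ?A \<le> ?om * ((real ?K + 1) * (2 * r) ^ CARD('n))" by (simp only: mult.left_commute)
  then have "measure sphere_measure ?A \<le> (real ?K + 1) * (2 * r) ^ CARD('n)" by (simp add: mult_le_cancel_left_pos)
  moreover
  have "1 + real ?K \<le> 1 / r + 1 / r" using K True r by (intro add_mono) (auto simp: le_divide_eq)
  then have "real ?K + 1 \<le> 2 / r" by simp
  then have "(real ?K + 1) * (2 * r) ^ CARD('n) \<le> (2 / r) * (2 * r) ^ CARD('n)"
    using r by (intro mult_right_mono) auto
  ultimately have "measure sphere_measure ?A \<le> (2 / r) * (2 * r) ^ CARD('n)" by linarith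
  also have "\<dots> = 2 ^ (d + 2) * r ^ d" using r n by (simp add: power_mult_distrib)
  finally show ?thesis .
qed

lemma continuous_open_vimage0:
  fixes f :: "'a::t1_space \<Rightarrow> 'b::topological_space"
  assumes "continuous_on (- {a}) f" "open U" shows "open (f -` U \<inter> - {a})"
proof -
  have "open (- {a})" by (simp add: open_Compl)
  with assms show ?thesis using continuous_on_open_vimage by blast
qed

text \<open>The cone over a nonempty relatively open subset of the sphere contains a nonempty open
  subset of the ball, so such a subset has positive measure.\<close>

lemma continuous_AE_eq_sphere:
  fixes f g :: "real ^ 'n \<Rightarrow> real"
  assumes f: "continuous_on (sphere 0 1) f" and g: "continuous_on (sphere 0 1) g"
    and ae: "AE x in sphere_measure. f x = g x" and x: "x \<in> sphere 0 1"
  shows "f x = g x"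
proof (rule ccontr)
  assume ne: "f x \<noteq> g x"
  have "open (- {0 :: real})" by auto
  moreover have "continuous_on (sphere 0 1) (\<lambda>x. f x - g x)" using f g by (intro continuous_intros)
  ultimately obtain U where U: "open U" "U \<inter> sphere 0 1 = (\<lambda>x. f x - g x) -` (- {0}) \<inter> sphere 0 1"
    unfolding continuous_on_open_invariant by metis
  let ?A = "U \<inter> sphere 0 1"
  have "?A \<in> sets borel" using borel_open[OF U(1)] sphere_borel by (rule sets.Int)
  then have A: "?A \<in> sets sphere_measure" by (simp add: sets_sphere_measure_iff)
  have "AE x in sphere_measure. x \<notin> ?A" using ae by eventually_elim (use U in auto)
  then have "emeasure sphere_measure ?A = 0"
    using AE_iff_measurable[OF A, of "\<lambda>x. x \<notin> ?A"] by (auto simp: space_sphere_measure Int_def conj_commute)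
  then have 0: "emeasure lborel {y. norm y \<le> 1 \<and> sgn y \<in> ?A} = 0"
    using emeasure_cone[OF A, of 1] by (simp add: sphere.emeasure_eq_measure)
  have "continuous_on (- {0}) (sgn :: real ^ 'n \<Rightarrow> _)"
    by (intro continuous_intros) auto
  from this U(1) have "open (sgn -` U \<inter> - {0})" by (rule continuous_open_vimage0)
  then have o: "open (sgn -` U \<inter> - {0} \<inter> ball 0 1)" using open_Int open_ball by blast
  \<comment> \<open>The half is taken because \<open>x\<close> itself lies on the boundary of the
    ball; the direction is unchanged.\<close>
  have "(1/2) *\<^sub>R x \<in> sgn -` U \<inter> - {0} \<inter> ball 0 1"
    using x U ne by (auto simp: sgn_scaleR sgn_div_norm)
  then have "\<not> negligible (sgn -` U \<inter> - {0} \<inter> ball 0 1)" using o open_not_negligible by blast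
  then have "emeasure lborel (sgn -` U \<inter> - {0} \<inter> ball 0 1) \<noteq> 0"
    using o by (auto simp: negligible_iff_emeasure0 borel_open)
  moreover have "emeasure lborel (sgn -` U \<inter> - {0} \<inter> ball 0 1) \<le> emeasure lborel {y. norm y \<le> 1 \<and> sgn y \<in> ?A}"
  proof (rule emeasure_mono)
    show "{y. norm y \<le> 1 \<and> sgn y \<in> ?A} \<in> sets lborel" using \<open>?A \<in> sets borel\<close> by measurable
  qed (auto simp: norm_sgn)
  ultimately show False using 0 by simp
qed

section \<open>Harmonic polynomials as eigenfunctions\<close>

lemma partial_deriv_cong_open:
  fixes f g :: "real ^ 'n \<Rightarrow> real"
  assumes "f differentiable (at x)" "open S" "x \<in> S" "\<And>y. y \<in> S \<Longrightarrow> f y = g y"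
  shows "partial_deriv i g x = partial_deriv i f x" "g differentiable (at x)"
proof -
  show "partial_deriv i g x = partial_deriv i f x"
    unfolding partial_deriv_def using frechet_derivative_transform_within_open[OF assms(1,2,3)] assms(4) by metis
  show "g differentiable (at x)"
  proof -
    obtain D where "(f has_derivative D) (at x)" using assms(1) unfolding differentiable_def by blast
    then have "(g has_derivative D) (at x)"
      by (rule has_derivative_transform_within_open[OF _ assms(2,3)]) (rule assms(4))
    then show ?thesis unfolding differentiable_def by blast
  qed
qed

text \<open>For a form of degree \<open>l\<close> the exponent \<open>b = - l / 2\<close> yields its
  degree-zero homogeneous extension. Powers of \<open>x \<bullet> x\<close> rather than of the norm
  are used because differentiation then lowers \<open>b\<close> by exactly \<open>1\<close> and
  multiplies by a coordinate.\<close>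

definition radial_mult :: "real \<Rightarrow> (real ^ 'n \<Rightarrow> real) \<Rightarrow> real ^ 'n \<Rightarrow> real" where
  "radial_mult b p x = (x \<bullet> x) powr b * p x"

lemma inner_self_powr_derivative:
  fixes x :: "real ^ 'n"
  assumes "x \<noteq> 0"
  shows "((\<lambda>x. (x \<bullet> x) powr b) has_derivative (\<lambda>h. 2 * b * (x \<bullet> x) powr (b - 1) * (x \<bullet> h))) (at x)"
proof -
  have pos: "x \<bullet> x > 0" using assms by simp
  have d1: "((\<lambda>t. t powr b) has_real_derivative b * (x \<bullet> x) powr (b - 1)) (at (x \<bullet> x))"
    by (rule has_real_derivative_powr[OF pos])
  have d2: "((\<lambda>x. x \<bullet> x) has_derivative (\<lambda>h. x \<bullet> h + h \<bullet> x)) (at x)"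
    by (auto intro!: derivative_eq_intros)
  from has_derivative_compose[OF d2 d1[unfolded has_field_derivative_def]]
  show ?thesis by (rule has_derivative_eq_rhs) (auto simp: inner_commute algebra_simps)
qed

lemma radial_mult_deriv:
  fixes p :: "real ^ 'n \<Rightarrow> real"
  assumes "x \<noteq> 0" and "p differentiable (at x)"
  shows "radial_mult b p differentiable (at x)"
    and "partial_deriv i (radial_mult b p) x =
      radial_mult b (partial_deriv i p) x + 2 * b * radial_mult (b - 1) (\<lambda>x. x $ i * p x) x"
proof -
  have d: "(\<lambda>x::real^'n. (x \<bullet> x) powr b) differentiable (at x)"
    using inner_self_powr_derivative[OF assms(1)] differentiable_def by blast
  have eq: "radial_mult b p = (\<lambda>x. (x \<bullet> x) powr b * p x)" by (simp add: radial_mult_def fun_eq_iff)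
  show "radial_mult b p differentiable (at x)" unfolding eq using d assms(2) by simp
  have "partial_deriv i (\<lambda>x::real^'n. (x \<bullet> x) powr b) x = 2 * b * (x \<bullet> x) powr (b - 1) * (x \<bullet> axis i 1)"
    by (rule partial_deriv_eqI[OF inner_self_powr_derivative[OF assms(1)]])
  then show "partial_deriv i (radial_mult b p) x =
      radial_mult b (partial_deriv i p) x + 2 * b * radial_mult (b - 1) (\<lambda>x. x $ i * p x) x"
    unfolding eq using d assms(2) by (subst partial_deriv_mult) (auto simp: radial_mult_def inner_axis)
qed

text \<open>A class that contains the extensions of forms and is closed under partial derivatives
  off the origin; differentiability of every order follows without writing out second
  derivatives.\<close>

inductive radial_poly :: "(real ^ 'n \<Rightarrow> real) \<Rightarrow> bool" where
  radial_poly_base: "hpoly k p \<Longrightarrow> radial_poly (\<lambda>x. c * radial_mult b p x)"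
| radial_poly_add: "radial_poly f \<Longrightarrow> radial_poly g \<Longrightarrow> radial_poly (\<lambda>x. f x + g x)"

lemma radial_poly_deriv:
  assumes "radial_poly f"
  shows "(\<forall>x. x \<noteq> 0 \<longrightarrow> f differentiable (at x)) \<and>
    (\<exists>g. radial_poly g \<and> (\<forall>x. x \<noteq> 0 \<longrightarrow> partial_deriv i f x = g x))"
  using assms
proof (induction rule: radial_poly.induct)
  case (radial_poly_base k p c b)
  note d = radial_mult_deriv[OF _ hpoly_differentiable[OF radial_poly_base]]
  have "radial_poly (\<lambda>x. c * radial_mult b (partial_deriv i p) x + (c * 2 * b) * radial_mult (b - 1) (\<lambda>x. x $ i * p x) x)"
    by (rule radial_poly.radial_poly_add[OF radial_poly.radial_poly_base[OF hpoly_partial_deriv'[OF radial_poly_base]]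
        radial_poly.radial_poly_base[OF hpoly_mult_coord[OF radial_poly_base]]])
  moreover have "partial_deriv i (\<lambda>x. c * radial_mult b p x) x = c * radial_mult b (partial_deriv i p) x + (c * 2 * b) * radial_mult (b - 1) (\<lambda>x. x $ i * p x) x"
    if "x \<noteq> 0" for x using d[OF that] by (simp add: partial_deriv_cmult algebra_simps)
  ultimately show ?case using d(1) by auto
next
  case (radial_poly_add f g)
  then obtain f' g' where "radial_poly f'" "radial_poly g'"
    "\<And>x. x \<noteq> 0 \<Longrightarrow> partial_deriv i f x = f' x" "\<And>x. x \<noteq> 0 \<Longrightarrow> partial_deriv i g x = g' x" by blast
  then show ?case using radial_poly_add radial_poly.radial_poly_add[of f' g']
    by (intro conjI exI[of _ "\<lambda>x. f' x + g' x"]) (auto simp: partial_deriv_add)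
qed

lemma radial_poly_C2_on:
  assumes f: "radial_poly f" and eq: "\<And>x. x \<noteq> 0 \<Longrightarrow> h x = f x"
  shows "C2_on (- {0 :: real ^ 'n}) h"
proof -
  have op: "open (- {0 :: real ^ 'n})" by auto
  have df: "f differentiable (at x)" if "x \<noteq> 0" for x using radial_poly_deriv[OF f] that by blast
  have dh: "h differentiable (at x)" "partial_deriv i h x = partial_deriv i f x" if "x \<noteq> 0" for x i
    using partial_deriv_cong_open[OF df[OF that] op, of h] eq that by auto
  have "partial_deriv i h differentiable (at x) \<and>
    continuous (at x) (partial_deriv j (partial_deriv i h))" if x: "x \<noteq> 0" for x i j
  proof -
    obtain g where g: "radial_poly g" "\<And>x. x \<noteq> 0 \<Longrightarrow> partial_deriv i f x = g x"
      using radial_poly_deriv[OF f] by blast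
    obtain g' where g': "radial_poly g'" "\<And>x. x \<noteq> 0 \<Longrightarrow> partial_deriv j g x = g' x"
      using radial_poly_deriv[OF g(1)] by blast
    have dg: "g differentiable (at x)" "g' differentiable (at x)" if "x \<noteq> 0" for x
      using radial_poly_deriv[OF g(1)] radial_poly_deriv[OF g'(1)] that by blast+
    have 1: "partial_deriv i h differentiable (at x)" "partial_deriv j (partial_deriv i h) x = g' x" if "x \<noteq> 0" for x
      using partial_deriv_cong_open[OF dg(1)[OF that] op, of "partial_deriv i h"] dh(2) g(2) g'(2) that by auto
    have "continuous (at x) g'" using dg(2)[OF x] by (rule differentiable_imp_continuous_within)
    moreover have "\<forall>\<^sub>F y in nhds x. partial_deriv j (partial_deriv i h) y = g' y"
      using op x 1(2) by (auto simp: eventually_nhds)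
    ultimately show ?thesis using 1(1)[OF x] isCont_cong by blast
  qed
  then have 2: "partial_deriv i h differentiable (at x)" "continuous (at x) (partial_deriv j (partial_deriv i h))"
    if "x \<noteq> 0" for x i j using that by blast+
  show ?thesis
    unfolding C2_on_def differentiable_on_def
  proof (intro conjI allI ballI)
    fix i j
    show "continuous_on (- {0}) (partial_deriv j (partial_deriv i h))"
      using 2(2) by (intro continuous_at_imp_continuous_on) simp
  qed (use 2(1) dh(1) in \<open>auto intro: differentiable_at_withinI\<close>)
qed

lemma radial_ext_harmonic:
  assumes "hpoly l h" "x \<noteq> 0"
  shows "radial_ext h x = radial_mult (- real l / 2) h x"
proof -
  have "(x \<bullet> x) powr (- real l / 2) = inverse (norm x) ^ l"
  proof -
    have "x \<bullet> x = norm x powr 2" using assms(2) by (simp add: power2_norm_eq_inner powr_numeral)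
    then have "(x \<bullet> x) powr (- real l / 2) = norm x powr (- real l)" by (simp only: powr_powr) simp
    also have "\<dots> = inverse (norm x) ^ l" using assms(2) by (simp add: powr_minus powr_realpow power_inverse)
    finally show ?thesis .
  qed
  then show ?thesis using hpoly_homogeneous[OF assms(1), of "inverse (norm x)" x]
    by (simp add: radial_ext_def radial_mult_def sgn_div_norm)
qed

text \<open>Two applications of the product rule to \<open>radial_mult b h\<close>, with Euler's
  identity for the mixed terms and harmonicity for the pure one, leave the factor
  \<open>4 * b * l + 2 * b * (d + 1) + 4 * b * (b - 1)\<close>, which for \<open>b = - l / 2\<close>
  equals \<open>- l * (l + d - 1)\<close>.\<close>

lemma harmonic_poly_in_spherical_harmonics:
  fixes h :: "real ^ 'n \<Rightarrow> real"
  assumes h: "harmonic_poly l h" and n: "CARD('n) = Suc d"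
  shows "h \<in> spherical_harmonics d l"
proof -
  have hp: "hpoly l h" and lap: "\<And>x. laplacian h x = 0" using h by (auto simp: harmonic_poly_def)
  define b where "b = - real l / 2"
  have eq: "radial_ext h x = 1 * radial_mult b h x" if "x \<noteq> 0" for x
    using radial_ext_harmonic[OF hp that] by (simp add: b_def)
  have C2: "C2_on (- {0}) (radial_ext h)"
    by (rule radial_poly_C2_on[OF radial_poly_base[OF hp] eq])
  have op: "open (- {0 :: real ^ 'n})" by auto
  have d1: "partial_deriv i (radial_ext h) y = radial_mult b (partial_deriv i h) y + 2 * b * radial_mult (b - 1) (\<lambda>x. x $ i * h x) y"
    if "y \<noteq> 0" for i y
    using partial_deriv_cong_open(1)[OF radial_mult_deriv(1)[OF that hpoly_differentiable[OF hp]] op, of b "radial_ext h" i]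
      radial_mult_deriv(2)[OF that hpoly_differentiable[OF hp]] eq that by simp
  have "- laplace_beltrami h x = harmonic_eigenvalue d l * h x" if "x \<in> sphere 0 1" for x
  proof -
    have x0: "x \<noteq> 0" and x1: "x \<bullet> x = 1" using that by (auto simp: norm_eq_1)
    have dd: "(\<lambda>y. y $ i * h y) differentiable at x" "partial_deriv i h differentiable at x" for i
      using hpoly_differentiable[OF hp] partial_deriv_differentiable[OF hp] by auto
    have "partial_deriv i (partial_deriv i (radial_ext h)) x =
      partial_deriv i (partial_deriv i h) x + 4 * b * (x $ i * partial_deriv i h x) + 2 * b * h x
        + 4 * b * (b - 1) * ((x $ i * x $ i) * h x)" for i
    proof -
      have "partial_deriv i (partial_deriv i (radial_ext h)) x =
        partial_deriv i (\<lambda>y. radial_mult b (partial_deriv i h) y + 2 * b * radial_mult (b - 1) (\<lambda>x. x $ i * h x) y) x"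
        using radial_mult_deriv(1)[OF x0] dd d1 x0
        by (intro partial_deriv_cong_open(1)[OF _ op]) auto
      also have "\<dots> = partial_deriv i (radial_mult b (partial_deriv i h)) x + 2 * b * partial_deriv i (radial_mult (b - 1) (\<lambda>x. x $ i * h x)) x"
        using radial_mult_deriv(1)[OF x0] dd by (simp add: partial_deriv_add partial_deriv_cmult)
      also have "\<dots> = partial_deriv i (partial_deriv i h) x + 4 * b * (x $ i * partial_deriv i h x) + 2 * b * h x
        + 4 * b * (b - 1) * ((x $ i * x $ i) * h x)"
        using radial_mult_deriv(2)[OF x0] dd hpoly_differentiable[OF hp]
        by (simp add: radial_mult_def x1 partial_deriv_mult algebra_simps)
      finally show ?thesis .
    qed
    then have "laplace_beltrami h x = laplacian h x + 4 * b * (\<Sum>i\<in>UNIV. x $ i * partial_deriv i h x)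
       + real CARD('n) * (2 * b * h x) + 4 * b * (b - 1) * ((\<Sum>i\<in>UNIV. x $ i * x $ i) * h x)"
      by (simp add: laplace_beltrami_def laplacian_def sum.distrib sum_distrib_left sum_distrib_right)
    also have "\<dots> = (4 * b * real l + 2 * b * real CARD('n) + 4 * b * (b - 1)) * h x"
      using x1 lap euler_identity[OF hp, of x] by (simp add: inner_self_cart algebra_simps)
    also have "4 * b * real l + 2 * b * real CARD('n) + 4 * b * (b - 1) = - harmonic_eigenvalue d l"
      by (simp add: b_def n harmonic_eigenvalue_def field_simps)
    finally show ?thesis by simp
  qed
  with C2 show ?thesis by (simp add: spherical_harmonics_def)
qed

section \<open>Homogeneity of the degree-zero extension\<close>

lemma radial_ext_scale: "t > 0 \<Longrightarrow> radial_ext f (t *\<^sub>R x) = radial_ext f x"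
  by (simp add: radial_ext_def sgn_scaleR)

lemma partial_deriv_scale:
  fixes v :: "real ^ 'n \<Rightarrow> real"
  assumes t: "t > 0" and x: "x \<noteq> 0" and hom: "\<And>y. y \<noteq> 0 \<Longrightarrow> v (t *\<^sub>R y) = c * v y"
    and d: "\<And>y. y \<noteq> 0 \<Longrightarrow> v differentiable (at y)"
  shows "t * partial_deriv i v (t *\<^sub>R x) = c * partial_deriv i v x"
proof -
  have tx: "t *\<^sub>R x \<noteq> 0" using t x by simp
  have d1: "(v has_derivative frechet_derivative v (at (t *\<^sub>R x))) (at (t *\<^sub>R x))"
    using d[OF tx] frechet_derivative_works by blast
  have "((\<lambda>y. t *\<^sub>R y) has_derivative (\<lambda>h. t *\<^sub>R h)) (at x)" by (auto intro!: derivative_eq_intros)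
  from has_derivative_compose[OF this d1]
  have c1: "((\<lambda>y. v (t *\<^sub>R y)) has_derivative (\<lambda>h. frechet_derivative v (at (t *\<^sub>R x)) (t *\<^sub>R h))) (at x)" .
  have "partial_deriv i (\<lambda>y. v (t *\<^sub>R y)) x = frechet_derivative v (at (t *\<^sub>R x)) (t *\<^sub>R axis i 1)"
    by (rule partial_deriv_eqI[OF c1])
  also have "\<dots> = t * partial_deriv i v (t *\<^sub>R x)"
    using has_derivative_linear[OF d1] by (simp add: partial_deriv_def linear_cmul)
  finally have 1: "partial_deriv i (\<lambda>y. v (t *\<^sub>R y)) x = t * partial_deriv i v (t *\<^sub>R x)" .
  have "(\<lambda>y. v (t *\<^sub>R y)) differentiable (at x)" using c1 differentiable_def by blast
  from partial_deriv_cong_open(1)[OF this, of "- {0}" "\<lambda>y. c * v y" i]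
  have "partial_deriv i (\<lambda>y. c * v y) x = partial_deriv i (\<lambda>y. v (t *\<^sub>R y)) x" using x hom by auto
  then show ?thesis using 1 d[OF x] by (simp add: partial_deriv_cmult)
qed

text \<open>The extension is constant along the ray through \<open>x\<close>, so the chain rule
  makes its radial derivative vanish.\<close>

lemma radial_ext_euler:
  fixes f :: "real ^ 'n \<Rightarrow> real"
  assumes x: "x \<noteq> 0" and d: "radial_ext f differentiable (at x)"
  shows "(\<Sum>i\<in>UNIV. x $ i * partial_deriv i (radial_ext f) x) = 0"
proof -
  have "((\<lambda>t. t *\<^sub>R x) has_derivative (\<lambda>t. t *\<^sub>R x)) (at (1::real))" by (auto intro!: derivative_eq_intros)
  moreover have "(radial_ext f has_derivative (\<lambda>h. \<Sum>i\<in>UNIV. partial_deriv i (radial_ext f) x * h $ i)) (at (1 *\<^sub>R x))"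
    using differentiable_imp_has_derivative[OF d] by simp
  ultimately have 1: "((\<lambda>t. radial_ext f (t *\<^sub>R x)) has_derivative (\<lambda>t. \<Sum>i\<in>UNIV. partial_deriv i (radial_ext f) x * (t *\<^sub>R x) $ i)) (at 1)"
    by (rule has_derivative_compose)
  have "((\<lambda>t. radial_ext f x) has_derivative (\<lambda>t. 0)) (at (1::real))" by simp
  then have "((\<lambda>t. radial_ext f (t *\<^sub>R x)) has_derivative (\<lambda>t. 0)) (at (1::real))"
    by (rule has_derivative_transform_within_open[of _ _ _ _ "{0<..}"]) (auto simp: radial_ext_scale)
  from has_derivative_unique[OF 1 this] have "(\<Sum>i\<in>UNIV. partial_deriv i (radial_ext f) x * (1 *\<^sub>R x) $ i) = 0" by metis
  then show ?thesis by (simp add: mult.commute)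
qed

lemma C2_on_punctured:
  fixes g :: "real ^ 'n \<Rightarrow> real"
  assumes "C2_on (- {0}) g"
  shows "y \<noteq> 0 \<Longrightarrow> g differentiable (at y)"
    and "y \<noteq> 0 \<Longrightarrow> partial_deriv i g differentiable (at y)"
    and "continuous_on (- {0}) (partial_deriv j (partial_deriv i g))"
proof -
  have w: "at y within - {0} = at y" if "y \<noteq> 0" for y :: "real ^ 'n"
    by (rule at_within_open) (use that in auto)
  have 1: "g differentiable (at y within - {0})" if "y \<noteq> 0" for y
    using assms that unfolding C2_on_def differentiable_on_def by blast
  have 2: "partial_deriv i g differentiable (at y within - {0})" if "y \<noteq> 0" for y
    using assms that unfolding C2_on_def differentiable_on_def by blast
  show "y \<noteq> 0 \<Longrightarrow> g differentiable (at y)" using 1[of y] w[of y] by metis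
  show "y \<noteq> 0 \<Longrightarrow> partial_deriv i g differentiable (at y)" using 2[of y] w[of y] by metis
  show "continuous_on (- {0}) (partial_deriv j (partial_deriv i g))"
    using assms unfolding C2_on_def by blast
qed

text \<open>First derivatives of the extension are homogeneous of degree \<open>-1\<close> and
  second derivatives of degree \<open>-2\<close>, so the Laplacian at \<open>x\<close> is its value
  at \<open>sgn x\<close> divided by the squared norm.\<close>

lemma radial_ext_laplacian:
  fixes f :: "real ^ 'n \<Rightarrow> real"
  assumes C2: "C2_on (- {0}) (radial_ext f)" and x: "x \<noteq> 0"
  shows "laplacian (radial_ext f) x = laplace_beltrami f (sgn x) / (x \<bullet> x)"
proof -
  note d = C2_on_punctured[OF C2]
  let ?t = "norm x"
  have t: "?t > 0" using x by simp
  have s: "sgn x \<noteq> 0" using x by (simp add: sgn_zero_iff)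
  have xt: "x = ?t *\<^sub>R sgn x" using x by (simp add: sgn_div_norm)
  have 1: "partial_deriv i (radial_ext f) (?t *\<^sub>R y) = inverse ?t * partial_deriv i (radial_ext f) y" if "y \<noteq> 0" for i y
    using partial_deriv_scale[OF t that, of "radial_ext f" 1 i] d t
    by (simp add: radial_ext_scale field_simps)
  have "partial_deriv i (partial_deriv i (radial_ext f)) x = partial_deriv i (partial_deriv i (radial_ext f)) (sgn x) / (x \<bullet> x)" for i
  proof -
    have "?t * partial_deriv i (partial_deriv i (radial_ext f)) (?t *\<^sub>R sgn x) = inverse ?t * partial_deriv i (partial_deriv i (radial_ext f)) (sgn x)"
      using 1 d by (intro partial_deriv_scale[OF t s]) auto
    then show ?thesis using xt[symmetric] t by (simp add: field_simps power2_norm_eq_inner[symmetric] power2_eq_square)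
  qed
  then show ?thesis by (simp add: laplacian_def laplace_beltrami_def sum_divide_distrib)
qed

section \<open>Orthogonality of the eigenspaces\<close>

lemma max_0_square_derivative: "((\<lambda>y::real. (max 0 y)\<^sup>2) has_real_derivative 2 * max 0 y) (at y)"
proof (cases y "0::real" rule: linorder_cases)
  case less
  have "((\<lambda>y::real. 0) has_real_derivative 0) (at y)" by simp
  then have "((\<lambda>y::real. (max 0 y)\<^sup>2) has_real_derivative 0) (at y)"
    by (rule has_field_derivative_transform_within_open[of _ _ _ "{..<0}"]) (use less in auto)
  then show ?thesis using less by simp
next
  case greater
  have "((\<lambda>y::real. y\<^sup>2) has_real_derivative 2 * y) (at y)" by (auto intro!: derivative_eq_intros)
  then have "((\<lambda>y::real. (max 0 y)\<^sup>2) has_real_derivative 2 * y) (at y)"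
    by (rule has_field_derivative_transform_within_open[of _ _ _ "{0<..}"]) (use greater in auto)
  then show ?thesis using greater by simp
next
  case equal
  have "((\<lambda>h::real. ((max 0 (0 + h))\<^sup>2 - (max 0 0)\<^sup>2) / h) \<longlongrightarrow> 0) (at 0)"
  proof (rule Lim_null_comparison)
    show "\<forall>\<^sub>F h::real in at 0. norm (((max 0 (0 + h))\<^sup>2 - (max 0 0)\<^sup>2) / h) \<le> \<bar>h\<bar>"
      by (intro always_eventually allI) (auto simp: max_def power2_eq_square)
    have "((\<lambda>h::real. \<bar>h\<bar>) \<longlongrightarrow> \<bar>0\<bar>) (at 0)" by (intro tendsto_intros)
    then show "((\<lambda>h::real. \<bar>h\<bar>) \<longlongrightarrow> 0) (at 0)" by simp
  qed
  then show ?thesis using equal by (simp add: DERIV_def)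
qed

text \<open>Evaluated at \<open>x \<bullet> x\<close> it lives on the annulus between the radii
  \<open>1/2\<close> and \<open>1\<close>. Squaring the positive part makes it continuously
  differentiable, which is all that integration by parts needs.\<close>

definition cutoff :: "real \<Rightarrow> real" where "cutoff t = (max 0 ((t - 1/4) * (1 - t)))\<^sup>2"
definition cutoff' :: "real \<Rightarrow> real" where "cutoff' t = 2 * max 0 ((t - 1/4) * (1 - t)) * (5/4 - 2 * t)"

lemma cutoff_derivative: "(cutoff has_real_derivative cutoff' t) (at t)"
proof -
  have 1: "((\<lambda>t::real. (t - 1/4) * (1 - t)) has_real_derivative (5/4 - 2 * t)) (at t)"
    by (auto intro!: derivative_eq_intros simp: algebra_simps)
  have "((\<lambda>t. (max 0 ((t - 1/4) * (1 - t)))\<^sup>2) has_real_derivative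
     (2 * max 0 ((t - 1/4) * (1 - t))) * (5/4 - 2 * t)) (at t)"
    by (rule DERIV_chain2[OF max_0_square_derivative 1])
  then show ?thesis by (simp add: cutoff_def[abs_def] cutoff'_def)
qed

lemma cutoff_outside:
  assumes "t \<le> 1/4 \<or> t \<ge> 1" shows "cutoff t = 0" "cutoff' t = 0"
proof -
  have "(t - 1/4) * (1 - t) \<le> 0"
    using assms by (auto intro: mult_nonpos_nonneg mult_nonneg_nonpos)
  then show "cutoff t = 0" "cutoff' t = 0" by (simp_all add: cutoff_def cutoff'_def max_absorb1)
qed

lemma cutoff_pos: "1/4 < t \<Longrightarrow> t < 1 \<Longrightarrow> cutoff t > 0"
  by (simp add: cutoff_def max_def not_le zero_less_mult_iff)

lemma cutoff_nonneg: "cutoff t \<ge> 0" by (simp add: cutoff_def)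

lemma cutoff_le_1: "cutoff t \<le> 1"
proof (cases "t \<le> 1/4 \<or> t \<ge> 1")
  case False
  then have "(t - 1/4) * (1 - t) \<le> 1 * 1" by (intro mult_mono) auto
  then show ?thesis unfolding cutoff_def by (intro power_le_one) (auto simp: max_def)
qed (simp add: cutoff_outside)

lemma continuous_on_cutoff [continuous_intros]:
  "continuous_on S f \<Longrightarrow> continuous_on S (\<lambda>x. cutoff (f x))"
  "continuous_on S f \<Longrightarrow> continuous_on S (\<lambda>x. cutoff' (f x))"
  unfolding cutoff_def cutoff'_def by (intro continuous_intros; assumption)+

text \<open>Difference quotients in direction \<open>i\<close> integrate to \<open>0\<close> by
  translation invariance. They converge pointwise to the derivative, and by the mean value theorem
  they are dominated by \<open>L\<close> on a fixed ball.\<close>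

lemma integral_partial_deriv_zero:
  fixes F :: "real ^ 'n \<Rightarrow> real"
  assumes d: "\<And>x. F differentiable (at x)" and L: "\<And>x. \<bar>partial_deriv i F x\<bar> \<le> L"
    and B: "\<And>x. norm x > B \<Longrightarrow> F x = 0"
  shows "integrable lborel (partial_deriv i F)" "(\<integral>x. partial_deriv i F x \<partial>lborel) = 0"
proof -
  let ?e = "axis i 1 :: real ^ 'n"
  have e: "norm ?e = 1" by (simp add: norm_axis_1)
  \<comment> \<open>Steps of length at most \<open>1\<close>: all difference quotients then vanish
    outside the ball of radius \<open>B + 1\<close>.\<close>
  define h where "h k = inverse (real (Suc k))" for k
  have h: "0 < h k" "h k \<le> 1" for k by (auto simp: h_def inverse_le_1_iff)
  define D where "D k x = (F (x + h k *\<^sub>R ?e) - F x) / h k" for k x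
  have contF: "continuous_on UNIV F"
    by (intro continuous_at_imp_continuous_on ballI differentiable_imp_continuous_within d)
  then have [measurable]: "F \<in> borel_measurable borel" by (rule borel_measurable_continuous_onI)
  have "integrable lborel (\<lambda>x. indicator (cball 0 B) x *\<^sub>R F x)"
    by (intro borel_integrable_compact) (auto intro: continuous_on_subset[OF contF])
  moreover have "(\<lambda>x. indicator (cball 0 B) x *\<^sub>R F x) = F"
    using B by (auto simp: indicator_def fun_eq_iff not_le)
  ultimately have intF: "integrable lborel F" by simp
  have tr: "integrable lborel (\<lambda>x. F (x + a))" "(\<integral>x. F (x + a) \<partial>lborel) = (\<integral>x. F x \<partial>lborel)" for a
  proof -
    have [measurable]: "(+) a \<in> measurable lborel borel" by simp
    have "integrable (distr lborel borel ((+) a)) F" using intF by (simp add: lborel_distr_plus)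
    then show "integrable lborel (\<lambda>x. F (x + a))" by (subst (asm) integrable_distr_eq) (auto simp: add.commute)
    have "(\<integral>x. F x \<partial>lborel) = (\<integral>x. F x \<partial>distr lborel borel ((+) a))" by (simp add: lborel_distr_plus)
    also have "\<dots> = (\<integral>x. F (x + a) \<partial>lborel)" by (subst integral_distr) (auto simp: add.commute)
    finally show "(\<integral>x. F (x + a) \<partial>lborel) = (\<integral>x. F x \<partial>lborel)" ..
  qed
  have intD: "(\<integral>x. D k x \<partial>lborel) = 0" for k
    unfolding D_def using tr[of "h k *\<^sub>R ?e"] intF by simp
  have line: "((\<lambda>t. F (x + t *\<^sub>R ?e)) has_real_derivative partial_deriv i F (x + t *\<^sub>R ?e)) (at t)" for x t
  proof -
    have "((\<lambda>t. x + t *\<^sub>R ?e) has_derivative (\<lambda>t. t *\<^sub>R ?e)) (at t)" by (auto intro!: derivative_eq_intros)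
    from has_derivative_compose[OF this differentiable_imp_has_derivative[OF d]]
    have "((\<lambda>t. F (x + t *\<^sub>R ?e)) has_derivative (\<lambda>s. \<Sum>j\<in>UNIV. partial_deriv j F (x + t *\<^sub>R ?e) * (s *\<^sub>R ?e) $ j)) (at t)" .
    moreover have "(\<Sum>j\<in>UNIV. partial_deriv j F (x + t *\<^sub>R ?e) * (s *\<^sub>R ?e) $ j) = s * partial_deriv i F (x + t *\<^sub>R ?e)" for s
    proof -
      have "(\<Sum>j\<in>UNIV. partial_deriv j F (x + t *\<^sub>R ?e) * (s *\<^sub>R ?e) $ j) =
        (\<Sum>j\<in>UNIV. if j = i then s * partial_deriv i F (x + t *\<^sub>R ?e) else 0)"
        by (intro sum.cong) (auto simp: axis_def)
      then show ?thesis by simp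
    qed
    ultimately show ?thesis by (simp add: has_field_derivative_def mult.commute[of _ "partial_deriv i F (x + t *\<^sub>R ?e)"])
  qed
  have Dbound: "\<bar>D k x\<bar> \<le> L * indicator (cball 0 (B + 1)) x" for k x
  proof (cases "norm x \<le> B + 1")
    case True
    from MVT2[of 0 "h k" "\<lambda>t. F (x + t *\<^sub>R ?e)" "\<lambda>t. partial_deriv i F (x + t *\<^sub>R ?e)", OF h(1) line]
    obtain z where "F (x + h k *\<^sub>R ?e) - F x = h k * partial_deriv i F (x + z *\<^sub>R ?e)" by auto
    then have "D k x = partial_deriv i F (x + z *\<^sub>R ?e)" using h[of k] by (simp add: D_def field_simps)
    then show ?thesis using L True by simp
  next
    case False
    have "norm x \<le> norm (x + h k *\<^sub>R ?e) + h k"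
      using norm_triangle_ineq4[of "x + h k *\<^sub>R ?e" "h k *\<^sub>R ?e"] e h[of k] by simp
    then have "norm (x + h k *\<^sub>R ?e) > B" "norm x > B" using False h[of k] by auto
    then show ?thesis using False B by (simp add: D_def)
  qed
  have Dlim: "(\<lambda>k. D k x) \<longlonglongrightarrow> partial_deriv i F x" for x
  proof -
    have "((\<lambda>s. (F (x + (0 + s) *\<^sub>R ?e) - F (x + 0 *\<^sub>R ?e)) / s) \<longlongrightarrow> partial_deriv i F (x + 0 *\<^sub>R ?e)) (at 0)"
      using line[of x 0] unfolding DERIV_def .
    moreover have "filterlim h (at 0) sequentially"
      unfolding filterlim_at using LIMSEQ_inverse_real_of_nat h by (auto simp: h_def[abs_def])
    ultimately show ?thesis using filterlim_compose by (fastforce simp: D_def)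
  qed
  have Dm: "D k \<in> borel_measurable lborel" for k unfolding D_def[abs_def] by measurable
  have pm: "partial_deriv i F \<in> borel_measurable lborel"
    by (rule borel_measurable_LIMSEQ_real[OF Dlim Dm])
  have dom: "integrable lborel (\<lambda>x. L * indicator (cball 0 (B + 1)) x :: real)"
    by (intro integrable_mult_right integrable_real_indicator) (use emeasure_bounded_finite[OF bounded_cball] in auto)
  show "integrable lborel (partial_deriv i F)"
    by (rule integrable_dominated_convergence[where s = D, OF pm Dm dom]) (use Dlim Dbound in auto)
  have "(\<lambda>k. \<integral>x. D k x \<partial>lborel) \<longlonglongrightarrow> (\<integral>x. partial_deriv i F x \<partial>lborel)"
    by (rule integral_dominated_convergence[where s = D, OF pm Dm dom]) (use Dlim Dbound in auto)
  then show "(\<integral>x. partial_deriv i F x \<partial>lborel) = 0"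
    unfolding intD using LIMSEQ_unique tendsto_const by blast
qed

lemma cutoff_radial_derivative:
  fixes x :: "real ^ 'n"
  shows "(\<lambda>x. cutoff (x \<bullet> x)) differentiable (at x)"
    and "partial_deriv i (\<lambda>x. cutoff (x \<bullet> x)) x = 2 * x $ i * cutoff' (x \<bullet> x)"
proof -
  have d2: "((\<lambda>x. x \<bullet> x) has_derivative (\<lambda>h. x \<bullet> h + h \<bullet> x)) (at x)"
    by (auto intro!: derivative_eq_intros)
  note D = has_derivative_compose[OF d2 cutoff_derivative[unfolded has_field_derivative_def]]
  show "(\<lambda>x. cutoff (x \<bullet> x)) differentiable (at x)" using D differentiable_def by blast
  show "partial_deriv i (\<lambda>x. cutoff (x \<bullet> x)) x = 2 * x $ i * cutoff' (x \<bullet> x)"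
    by (rule trans[OF partial_deriv_eqI[OF D]]) (simp add: inner_axis inner_axis')
qed

text \<open>Multiplied by the cutoff, \<open>G\<close> extends by zero across the origin and has
  bounded support. The derivative of the product is bounded because it is continuous on a compact
  annulus and zero elsewhere.\<close>

lemma cutoff_divergence:
  fixes G :: "real ^ 'n \<Rightarrow> real"
  assumes d: "\<And>x. x \<noteq> 0 \<Longrightarrow> G differentiable (at x)"
    and c: "continuous_on (- {0}) (partial_deriv i G)"
  shows "integrable lborel (\<lambda>x. cutoff (x \<bullet> x) * partial_deriv i G x + 2 * x $ i * cutoff' (x \<bullet> x) * G x)"
    and "(\<integral>x. cutoff (x \<bullet> x) * partial_deriv i G x + 2 * x $ i * cutoff' (x \<bullet> x) * G x \<partial>lborel) = 0"
proof -
  let ?E = "\<lambda>x. cutoff (x \<bullet> x) * partial_deriv i G x + 2 * x $ i * cutoff' (x \<bullet> x) * G x"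
  let ?F = "\<lambda>x. cutoff (x \<bullet> x) * G x"
  have small: "x \<bullet> x \<le> 1/4" if "norm x \<le> 1/2" for x :: "real ^ 'n"
    using power_mono[OF that, of 2] by (simp add: power2_norm_eq_inner power_divide)
  have large: "x \<bullet> x \<ge> 1" if "norm x \<ge> 1" for x :: "real ^ 'n"
    using power_mono[OF that, of 2] by (simp add: power2_norm_eq_inner)
  have F: "?F differentiable (at x) \<and> partial_deriv i ?F x = ?E x" for x
  proof (cases "x = 0")
    case False
    then show ?thesis using d[OF False] cutoff_radial_derivative(1)[where x = x] cutoff_radial_derivative(2)[where x = x and i = i]
      by (simp add: partial_deriv_mult)
  next
    case True
    have 0: "(\<lambda>x. 0::real) differentiable (at x)" by simp
    have eq: "0 = ?F y" if "y \<in> ball 0 (1/2)" for y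
      using cutoff_outside(1)[of "y \<bullet> y"] small[of y] that by simp
    have "x \<in> ball 0 (1/2)" using True by simp
    from partial_deriv_cong_open[OF 0 open_ball this, of ?F] eq
    show ?thesis using True by (simp add: cutoff_outside)
  qed
  have contG: "continuous_on (- {0}) G"
    by (intro continuous_at_imp_continuous_on ballI differentiable_imp_continuous_within d) auto
  have contE: "continuous_on (cball 0 1 - ball 0 (1/2)) ?E"
    by (intro continuous_intros continuous_on_subset[OF contG] continuous_on_subset[OF c]) auto
  have "compact (cball 0 1 - ball 0 (1/2) :: (real ^ 'n) set)" by (intro compact_diff) auto
  from compact_continuous_image[OF contE this] have "bounded (?E ` (cball 0 1 - ball 0 (1/2)))"
    by (rule compact_imp_bounded)
  then obtain L where "\<forall>y\<in>?E ` (cball 0 1 - ball 0 (1/2)). norm y \<le> L"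
    unfolding bounded_iff by blast
  then have L: "\<bar>?E x\<bar> \<le> L" if "x \<in> cball 0 1 - ball 0 (1/2)" for x using that by (simp del: Diff_iff)
  have bnd: "\<bar>partial_deriv i ?F x\<bar> \<le> max 0 L" for x
  proof (cases "x \<in> cball 0 1 - ball 0 (1/2)")
    case True then show ?thesis using F[of x] L[OF True] by auto
  next
    case False
    then have "x \<bullet> x \<le> 1/4 \<or> x \<bullet> x \<ge> 1" using small[of x] large[of x] by auto
    then show ?thesis using F[of x] cutoff_outside[of "x \<bullet> x"] by auto
  qed
  have supp: "?F x = 0" if "norm x > 1" for x
    using large[of x] that cutoff_outside(1)[of "x \<bullet> x"] by auto
  have Fd: "?F differentiable (at x)" for x using F by blast
  have FE: "partial_deriv i ?F = ?E" using F by blast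
  show "integrable lborel ?E" "integral\<^sup>L lborel ?E = 0"
    using integral_partial_deriv_zero[OF Fd bnd supp] unfolding FE by blast+
qed

lemma spherical_harmonics_continuous:
  fixes f :: "real ^ 'n \<Rightarrow> real"
  assumes "f \<in> spherical_harmonics d l" shows "continuous_on (sphere 0 1) f"
proof -
  have "C2_on (- {0}) (radial_ext f)" using assms by (simp add: spherical_harmonics_def)
  from C2_on_punctured(1)[OF this]
  have "continuous_on (- {0}) (radial_ext f)"
    by (intro continuous_at_imp_continuous_on ballI differentiable_imp_continuous_within) auto
  then have "continuous_on (sphere 0 1) (radial_ext f)" by (rule continuous_on_subset) auto
  then show ?thesis by (rule continuous_on_eq) (auto simp: radial_ext_def sgn_div_norm)
qed

lemma integrable_continuous_sphere:
  fixes f :: "real ^ 'n \<Rightarrow> real"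
  assumes "continuous_on (sphere 0 1) f" shows "integrable sphere_measure f"
proof -
  have "compact (sphere (0 :: real ^ 'n) 1)" by simp
  from compact_imp_bounded[OF compact_continuous_image[OF assms this]]
  obtain B where B: "\<And>x. x \<in> sphere 0 1 \<Longrightarrow> \<bar>f x\<bar> \<le> B" unfolding bounded_iff by fastforce
  show ?thesis
    using B by (intro sphere.integrable_const_bound[of _ B] continuous_on_sphere_measurable[OF assms])
      (auto simp: space_sphere_measure)
qed

text \<open>The eigenvalue increases strictly with the degree. This is where
  \<open>d \<ge> 1\<close> enters: for \<open>d = 0\<close> the degrees \<open>0\<close> and
  \<open>1\<close> would share the eigenvalue \<open>0\<close>.\<close>

lemma harmonic_eigenvalue_inj:
  assumes "d \<ge> 1" "harmonic_eigenvalue d l = harmonic_eigenvalue d m" shows "l = m"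
proof -
  have "harmonic_eigenvalue d l < harmonic_eigenvalue d m" if "l < m" for l m
  proof -
    have "real l * (real l + real d - 1) < real m * (real m + real d - 1)"
    proof (cases "l = 0")
      case False
      then show ?thesis using that assms(1) by (intro mult_strict_mono) auto
    qed (use that assms(1) in auto)
    then show ?thesis by (simp add: harmonic_eigenvalue_def)
  qed
  then show ?thesis using assms(2) by (cases l m rule: linorder_cases) force+
qed

text \<open>The requirements of \<open>polar_integral\<close> for the weight in Green's formula,
  whose denominator comes from the degree \<open>-2\<close> of the Laplacian of an extension. The
  bound is \<open>4\<close> because the cutoff vanishes for squared radius up to
  \<open>1/4\<close>.\<close>

lemma cutoff_weight:
  fixes r :: real
  shows "(\<lambda>r. cutoff (r\<^sup>2) / r\<^sup>2) \<in> borel_measurable borel" "\<bar>cutoff (r\<^sup>2) / r\<^sup>2\<bar> \<le> 4"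
    "cutoff (0\<^sup>2) / 0\<^sup>2 = 0" "2 < r \<Longrightarrow> cutoff (r\<^sup>2) / r\<^sup>2 = 0"
proof -
  have "cutoff \<in> borel_measurable borel"
    by (intro borel_measurable_continuous_onI continuous_on_cutoff continuous_on_id)
  then show "(\<lambda>r. cutoff (r\<^sup>2) / r\<^sup>2) \<in> borel_measurable borel" by measurable
  show "\<bar>cutoff (r\<^sup>2) / r\<^sup>2\<bar> \<le> 4"
  proof (cases "r\<^sup>2 \<le> 1/4")
    case False
    then have "cutoff (r\<^sup>2) / r\<^sup>2 \<le> 1 / (1/4)" using cutoff_le_1 cutoff_nonneg by (intro frac_le) auto
    then show ?thesis using cutoff_nonneg by simp
  qed (simp add: cutoff_outside)
  show "2 < r \<Longrightarrow> cutoff (r\<^sup>2) / r\<^sup>2 = 0" using power_mono[of 1 r 2] by (simp add: cutoff_outside)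
qed simp

text \<open>Allows the radial factor to be cancelled from the polar form of Green's formula.\<close>

lemma cutoff_mass_pos: "(\<integral>y. cutoff ((norm y)\<^sup>2) / (norm y)\<^sup>2 \<partial>(lborel :: (real ^ 'n) measure)) > 0"
proof -
  let ?w = "\<lambda>r::real. cutoff (r\<^sup>2) / r\<^sup>2"
  have sq: "1/4 < r\<^sup>2" "r\<^sup>2 < 1" if "1/2 < r" "r < 1" for r :: real
  proof -
    have "(1/2)\<^sup>2 < r\<^sup>2" using that by (intro power_strict_mono) auto
    then show "1/4 < r\<^sup>2" by (simp add: power2_eq_square)
    show "r\<^sup>2 < 1" using that by (simp add: power2_less_1_iff)
  qed
  have nn: "?w r \<ge> 0" for r using cutoff_nonneg by simp
  have int: "integrable lborel (\<lambda>y :: real ^ 'n. ?w (norm y))"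
    using polar_integral(2)[OF cutoff_weight, of "\<lambda>_. 1 :: real"] by simp
  show ?thesis
  proof (rule ccontr)
    assume "\<not> ?thesis"
    moreover have "(\<integral>y. ?w (norm y) \<partial>(lborel :: (real ^ 'n) measure)) \<ge> 0" using nn by (intro integral_nonneg_AE) auto
    ultimately have "(\<integral>y. ?w (norm y) \<partial>(lborel :: (real ^ 'n) measure)) = 0" by simp
    then have ae: "AE y in (lborel :: (real ^ 'n) measure). ?w (norm y) = 0"
      using integral_nonneg_eq_0_iff_AE[OF int] nn by simp
    let ?U = "ball 0 1 - cball 0 (1/2) :: (real ^ 'n) set"
    have "AE y in (lborel :: (real ^ 'n) measure). y \<notin> ?U"
      using ae
    proof eventually_elim
      case (elim y)
      then have "\<not> (1/2 < norm y \<and> norm y < 1)" using cutoff_pos[OF sq[of "norm y"]] by auto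
      then show ?case by auto
    qed
    then have "emeasure lborel ?U = 0"
      by (subst (asm) AE_iff_measurable[of ?U]) auto
    then have "negligible ?U" by (simp add: negligible_iff_emeasure0)
    moreover have "open ?U" by auto
    moreover have "(3/4) *\<^sub>R axis undefined 1 \<in> ?U" by (simp add: norm_axis_1)
    ultimately show False using open_not_negligible by blast
  qed
qed

text \<open>
  Green's formula for the homogeneous extensions, localised away from the origin by a radial cutoff.
  The derivative of the cutoff only meets radial derivatives, which vanish.
\<close>

lemma spherical_harmonics_orthogonal:
  fixes f g :: "real ^ 'n \<Rightarrow> real"
  assumes f: "f \<in> spherical_harmonics d l" and g: "g \<in> spherical_harmonics d m"
    and lm: "l \<noteq> m" and d: "d \<ge> 1"
  shows "L2_inner f g = 0"
proof -
  let ?u = "radial_ext f" and ?v = "radial_ext g"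
  have Cu: "C2_on (- {0}) ?u" and Cv: "C2_on (- {0}) ?v"
    and lf: "\<And>x. x \<in> sphere 0 1 \<Longrightarrow> laplace_beltrami f x = - harmonic_eigenvalue d l * f x"
    and lg: "\<And>x. x \<in> sphere 0 1 \<Longrightarrow> laplace_beltrami g x = - harmonic_eigenvalue d m * g x"
    using f g by (force simp: spherical_harmonics_def)+
  note du = C2_on_punctured[OF Cu] and dv = C2_on_punctured[OF Cv]
  \<comment> \<open>The vector field of Green's second identity: its divergence is \<open>?u\<close>
    times the Laplacian of \<open>?v\<close> minus \<open>?v\<close> times the Laplacian of
    \<open>?u\<close>.\<close>
  define G where "G i x = ?u x * partial_deriv i ?v x - ?v x * partial_deriv i ?u x" for i x
  have Gd: "G i differentiable (at x)" and
    Gp: "partial_deriv i (G i) x = ?u x * partial_deriv i (partial_deriv i ?v) x - ?v x * partial_deriv i (partial_deriv i ?u) x"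
    if "x \<noteq> 0" for i x
    unfolding G_def[abs_def] using du(1,2)[OF that] dv(1,2)[OF that]
    by (simp_all add: partial_deriv_diff partial_deriv_mult algebra_simps)
  have cu: "continuous_on (- {0}) ?u" "continuous_on (- {0}) ?v"
    using du(1) dv(1) by (auto intro!: continuous_at_imp_continuous_on differentiable_imp_continuous_within)
  have Gc: "continuous_on (- {0}) (partial_deriv i (G i))" for i
  proof -
    have "continuous_on (- {0}) (\<lambda>x. ?u x * partial_deriv i (partial_deriv i ?v) x - ?v x * partial_deriv i (partial_deriv i ?u) x)"
      by (intro continuous_intros cu du(3) dv(3))
    then show ?thesis by (rule continuous_on_eq) (use Gp in auto)
  qed
  let ?E = "\<lambda>i x. cutoff (x \<bullet> x) * partial_deriv i (G i) x + 2 * x $ i * cutoff' (x \<bullet> x) * G i x"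
  let ?w = "\<lambda>r::real. cutoff (r\<^sup>2) / r\<^sup>2"
  let ?c = "harmonic_eigenvalue d l - harmonic_eigenvalue d m"
  have E: "(\<Sum>i\<in>UNIV. ?E i x) = ?c * (?w (norm x) * (f (sgn x) * g (sgn x)))" for x
  proof (cases "x = 0")
    case True then show ?thesis by (simp add: cutoff_outside)
  next
    case False
    have s: "sgn x \<in> sphere 0 1" using sgn_in_sphere[OF False] .
    have "(\<Sum>i\<in>UNIV. ?E i x) = cutoff (x \<bullet> x) * (?u x * laplacian ?v x - ?v x * laplacian ?u x)
      + 2 * cutoff' (x \<bullet> x) * (?u x * (\<Sum>i\<in>UNIV. x $ i * partial_deriv i ?v x) - ?v x * (\<Sum>i\<in>UNIV. x $ i * partial_deriv i ?u x))"
      unfolding laplacian_def sum_distrib_left sum_subtractf[symmetric] sum.distrib[symmetric]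
      by (intro sum.cong refl) (simp add: Gp[OF False] G_def algebra_simps)
    also have "\<dots> = cutoff (x \<bullet> x) * (?u x * laplacian ?v x - ?v x * laplacian ?u x)"
      using radial_ext_euler[OF False du(1)[OF False]] radial_ext_euler[OF False dv(1)[OF False]] by simp
    also have "\<dots> = cutoff (x \<bullet> x) * ((f (sgn x) * g (sgn x)) * ?c / (x \<bullet> x))"
      unfolding radial_ext_laplacian[OF Cu False] radial_ext_laplacian[OF Cv False] lf[OF s] lg[OF s]
      by (simp add: radial_ext_def algebra_simps diff_divide_distrib)
    finally show ?thesis by (simp add: power2_norm_eq_inner)
  qed
  have "(\<integral>x. (\<Sum>i\<in>UNIV. ?E i x) \<partial>lborel) = (\<Sum>i\<in>UNIV. \<integral>x. ?E i x \<partial>lborel)"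
    by (intro Bochner_Integration.integral_sum cutoff_divergence(1) Gd Gc)
  also have "\<dots> = 0" by (intro sum.neutral ballI cutoff_divergence(2) Gd Gc)
  finally have "?c * (\<integral>x. ?w (norm x) * (f (sgn x) * g (sgn x)) \<partial>lborel) = 0"
    unfolding E by (simp only: integral_mult_right_zero)
  moreover have "?c \<noteq> 0" using harmonic_eigenvalue_inj[OF d] lm by auto
  ultimately have "(\<integral>x. ?w (norm x) * (f (sgn x) * g (sgn x)) \<partial>lborel) = 0" by simp
  moreover have "(\<integral>x. ?w (norm x) * (f (sgn x) * g (sgn x)) \<partial>lborel) =
    (\<integral>y. ?w (norm (y :: real ^ 'n)) \<partial>lborel) * (\<integral>x. f x * g x \<partial>sphere_measure)"
    by (rule polar_integral(1)[OF cutoff_weight], assumption)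
      (intro integrable_continuous_sphere continuous_on_mult spherical_harmonics_continuous[OF f] spherical_harmonics_continuous[OF g])
  ultimately show ?thesis using cutoff_mass_pos[where 'n = 'n] by (simp add: L2_inner_def)
qed

section \<open>Eigenfunctions are harmonic polynomials\<close>

lemma polyfun_harmonic_eq:
  assumes "harmonic_poly l h" "l \<le> t" shows "polyfun t h"
  using assms polyfun_hpoly unfolding harmonic_poly_def by blast

lemma harmonic_poly_continuous_on: "harmonic_poly l h \<Longrightarrow> continuous_on S h"
  unfolding harmonic_poly_def using hpoly_continuous_on by blast

section \<open>Square-integrable functions and their inner product\<close>

lemma L2_sphere_integrable:
  assumes "f \<in> L2_sphere" "g \<in> L2_sphere"
  shows "integrable sphere_measure (\<lambda>x. f x * g x)"
proof (rule Bochner_Integration.integrable_bound)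
  show "integrable sphere_measure (\<lambda>x. (f x)\<^sup>2 + (g x)\<^sup>2)"
    using assms by (simp add: L2_sphere_def)
  show "(\<lambda>x. f x * g x) \<in> borel_measurable sphere_measure"
    using assms by (auto simp: L2_sphere_def intro: borel_measurable_times)
  have "\<bar>a * b\<bar> \<le> a\<^sup>2 + b\<^sup>2" for a b :: real
  proof -
    have "2 * (\<bar>a\<bar> * \<bar>b\<bar>) \<le> \<bar>a\<bar>\<^sup>2 + \<bar>b\<bar>\<^sup>2" using sum_squares_bound[of "\<bar>a\<bar>" "\<bar>b\<bar>"] by (simp add: mult.assoc)
    moreover have "0 \<le> \<bar>a\<bar> * \<bar>b\<bar>" by simp
    ultimately have "\<bar>a\<bar> * \<bar>b\<bar> \<le> \<bar>a\<bar>\<^sup>2 + \<bar>b\<bar>\<^sup>2" by linarith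
    then show ?thesis by (simp only: abs_mult power2_abs)
  qed
  then show "AE x in sphere_measure. norm (f x * g x) \<le> norm ((f x)\<^sup>2 + (g x)\<^sup>2)" by simp
qed

lemma continuous_L2_sphere:
  fixes f :: "real ^ 'n \<Rightarrow> real"
  assumes "continuous_on (sphere 0 1) f" shows "f \<in> L2_sphere"
  unfolding L2_sphere_def
  using continuous_on_sphere_measurable[OF assms] integrable_continuous_sphere[OF continuous_on_power[OF assms]] by simp

lemma L2_sphere_integrable1: "f \<in> L2_sphere \<Longrightarrow> integrable sphere_measure f"
  using L2_sphere_integrable[of f "\<lambda>_. 1"] continuous_L2_sphere[of "\<lambda>_. 1"] by simp

lemma L2_sphere_measurable: "f \<in> L2_sphere \<Longrightarrow> f \<in> borel_measurable sphere_measure"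
  by (simp add: L2_sphere_def)

lemma L2_sphere_add: "f \<in> L2_sphere \<Longrightarrow> g \<in> L2_sphere \<Longrightarrow> (\<lambda>x. f x + g x) \<in> L2_sphere"
  using L2_sphere_integrable[of f g] by (auto simp: L2_sphere_def power2_sum mult.assoc)

lemma L2_sphere_cmult: "f \<in> L2_sphere \<Longrightarrow> (\<lambda>x. c * f x) \<in> L2_sphere"
  by (auto simp: L2_sphere_def power_mult_distrib)

lemma L2_sphere_zero: "(\<lambda>x. 0) \<in> L2_sphere"
  by (simp add: L2_sphere_def)

lemma L2_sphere_diff: "f \<in> L2_sphere \<Longrightarrow> g \<in> L2_sphere \<Longrightarrow> (\<lambda>x. f x - g x) \<in> L2_sphere"
  using L2_sphere_add[OF _ L2_sphere_cmult[of g "-1"]] by simp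

lemma L2_sphere_sum: "(\<And>i. i \<in> A \<Longrightarrow> f i \<in> L2_sphere) \<Longrightarrow> (\<lambda>x. \<Sum>i\<in>A. f i x) \<in> L2_sphere"
  by (induction A rule: infinite_finite_induct) (auto simp: L2_sphere_zero intro: L2_sphere_add)

lemma L2_inner_commute: "L2_inner f g = L2_inner g f"
  by (simp add: L2_inner_def mult.commute)

lemma L2_inner_add:
  "f \<in> L2_sphere \<Longrightarrow> g \<in> L2_sphere \<Longrightarrow> h \<in> L2_sphere \<Longrightarrow> L2_inner (\<lambda>x. f x + g x) h = L2_inner f h + L2_inner g h"
  by (simp add: L2_inner_def distrib_right L2_sphere_integrable)

lemma L2_inner_cmult: "L2_inner (\<lambda>x. c * f x) h = c * L2_inner f h"
  by (simp add: L2_inner_def mult.assoc)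

lemma L2_inner_zero [simp]: "L2_inner (\<lambda>x. 0) h = 0" "L2_inner h (\<lambda>x. 0) = 0"
  by (simp_all add: L2_inner_def)

lemma L2_inner_diff:
  "f \<in> L2_sphere \<Longrightarrow> g \<in> L2_sphere \<Longrightarrow> h \<in> L2_sphere \<Longrightarrow> L2_inner (\<lambda>x. f x - g x) h = L2_inner f h - L2_inner g h"
  by (simp add: L2_inner_def left_diff_distrib L2_sphere_integrable)

lemma L2_inner_sum:
  "(\<And>i. i \<in> A \<Longrightarrow> f i \<in> L2_sphere) \<Longrightarrow> h \<in> L2_sphere \<Longrightarrow> L2_inner (\<lambda>x. \<Sum>i\<in>A. f i x) h = (\<Sum>i\<in>A. L2_inner (f i) h)"
  by (induction A rule: infinite_finite_induct) (auto simp: L2_inner_add L2_sphere_sum)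

lemma L2_inner_right:
  "f \<in> L2_sphere \<Longrightarrow> g \<in> L2_sphere \<Longrightarrow> h \<in> L2_sphere \<Longrightarrow> L2_inner h (\<lambda>x. f x - g x) = L2_inner h f - L2_inner h g"
  "f \<in> L2_sphere \<Longrightarrow> g \<in> L2_sphere \<Longrightarrow> h \<in> L2_sphere \<Longrightarrow> L2_inner h (\<lambda>x. f x + g x) = L2_inner h f + L2_inner h g"
  "L2_inner h (\<lambda>x. c * f x) = c * L2_inner h f"
  "(\<And>i. i \<in> A \<Longrightarrow> F i \<in> L2_sphere) \<Longrightarrow> h \<in> L2_sphere \<Longrightarrow> L2_inner h (\<lambda>x. \<Sum>i\<in>A. F i x) = (\<Sum>i\<in>A. L2_inner h (F i))"
  by (simp_all only: L2_inner_commute[of h] L2_inner_diff L2_inner_add L2_inner_cmult L2_inner_sum)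

lemma L2_inner_lincomb:
  assumes "\<And>i. i \<in> A \<Longrightarrow> F i \<in> L2_sphere" "h \<in> L2_sphere"
  shows "L2_inner (\<lambda>x. \<Sum>i\<in>A. a i * F i x) h = (\<Sum>i\<in>A. a i * L2_inner (F i) h)"
    and "L2_inner h (\<lambda>x. \<Sum>i\<in>A. a i * F i x) = (\<Sum>i\<in>A. a i * L2_inner h (F i))"
proof -
  have 1: "L2_inner (\<lambda>x. \<Sum>i\<in>A. a i * F i x) h = (\<Sum>i\<in>A. L2_inner (\<lambda>x. a i * F i x) h)"
    by (rule L2_inner_sum) (auto intro: L2_sphere_cmult assms)
  then show "L2_inner (\<lambda>x. \<Sum>i\<in>A. a i * F i x) h = (\<Sum>i\<in>A. a i * L2_inner (F i) h)"
    by (simp only: L2_inner_cmult)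
  then show "L2_inner h (\<lambda>x. \<Sum>i\<in>A. a i * F i x) = (\<Sum>i\<in>A. a i * L2_inner h (F i))"
    by (simp only: L2_inner_commute[of h])
qed

lemma L2_sphere_lincomb:
  "(\<And>i. i \<in> A \<Longrightarrow> F i \<in> L2_sphere) \<Longrightarrow> (\<lambda>x. \<Sum>i\<in>A. a i * F i x) \<in> L2_sphere"
  by (intro L2_sphere_sum L2_sphere_cmult)

lemma L2_inner_cong:
  "(\<And>x. x \<in> sphere 0 1 \<Longrightarrow> f x = f' x) \<Longrightarrow> (\<And>x. x \<in> sphere 0 1 \<Longrightarrow> g x = g' x) \<Longrightarrow> L2_inner f g = L2_inner f' g'"
  unfolding L2_inner_def by (intro Bochner_Integration.integral_cong) (auto simp: space_sphere_measure)

lemma L2_inner_self_nonneg: "L2_inner f f \<ge> 0"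
  unfolding L2_inner_def by (intro integral_nonneg_AE) auto

lemma L2_inner_self_eq_0:
  assumes "f \<in> L2_sphere" "L2_inner f f = 0" shows "AE x in sphere_measure. f x = 0"
proof -
  have "AE x in sphere_measure. f x * f x = 0"
    using assms integral_nonneg_eq_0_iff_AE[OF L2_sphere_integrable[OF assms(1,1)]] by (simp add: L2_inner_def)
  then show ?thesis by simp
qed

text \<open>Stone--Weierstrass: a uniform approximation of \<open>\<phi>\<close> by a polynomial
  changes the inner product by at most the error times the L1 norm of \<open>g\<close>.\<close>

lemma integral_continuous_orthogonal_polyfun:
  fixes g :: "real ^ 'n \<Rightarrow> real"
  assumes g: "g \<in> L2_sphere" and orth: "\<And>t p. polyfun t p \<Longrightarrow> L2_inner g p = 0"
    and phi: "continuous_on (sphere 0 1) \<phi>"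
  shows "L2_inner g \<phi> = 0"
proof (rule ccontr)
  assume "L2_inner g \<phi> \<noteq> 0"
  then have pos: "\<bar>L2_inner g \<phi>\<bar> > 0" by simp
  define I where "I = (\<integral>x. \<bar>g x\<bar> \<partial>sphere_measure)"
  have I: "I \<ge> 0" unfolding I_def by (intro integral_nonneg_AE) auto
  \<comment> \<open>\<open>I + 1\<close> avoids division by zero, and the factor \<open>2\<close>
    leaves slack: the error term \<open>e * I\<close> stays strictly below the inner product it has
    to equal or exceed.\<close>
  define e where "e = \<bar>L2_inner g \<phi>\<bar> / (2 * (I + 1))"
  have e: "e > 0" using pos I by (simp add: e_def)
  obtain p where p: "real_polynomial_function p" "\<And>x. x \<in> sphere 0 1 \<Longrightarrow> \<bar>\<phi> x - p x\<bar> < e"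
    using Stone_Weierstrass_real_polynomial_function[OF compact_sphere phi e] by metis
  obtain t where t: "polyfun t p" using real_polynomial_function_imp_polyfun[OF p(1)] by blast
  have pc: "p \<in> L2_sphere" by (rule continuous_L2_sphere[OF polyfun_continuous_on[OF t]])
  have ph: "\<phi> \<in> L2_sphere" by (rule continuous_L2_sphere[OF phi])
  have "L2_inner g \<phi> = L2_inner g (\<lambda>x. \<phi> x - p x)" using orth[OF t] by (simp add: L2_inner_right(1)[OF ph pc g])
  also have "\<bar>\<dots>\<bar> \<le> (\<integral>x. \<bar>g x * (\<phi> x - p x)\<bar> \<partial>sphere_measure)"
    unfolding L2_inner_def by (rule integral_abs_bound)
  also have "\<dots> \<le> (\<integral>x. e * \<bar>g x\<bar> \<partial>sphere_measure)"
  proof (rule integral_mono_AE)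
    show "integrable sphere_measure (\<lambda>x. \<bar>g x * (\<phi> x - p x)\<bar>)"
      by (intro integrable_abs L2_sphere_integrable g L2_sphere_diff ph pc)
    show "integrable sphere_measure (\<lambda>x. e * \<bar>g x\<bar>)" using L2_sphere_integrable1[OF g] by simp
    have "\<bar>g x * (\<phi> x - p x)\<bar> \<le> e * \<bar>g x\<bar>" if "x \<in> sphere 0 1" for x
      using mult_left_mono[OF less_imp_le[OF p(2)[OF that]], of "\<bar>g x\<bar>"] by (simp add: abs_mult mult.commute)
    then show "AE x in sphere_measure. \<bar>g x * (\<phi> x - p x)\<bar> \<le> e * \<bar>g x\<bar>"
      by (intro AE_I2) (simp only: space_sphere_measure)
  qed
  also have "\<dots> = e * I" by (simp add: I_def)
  also have "\<dots> < e * (2 * (I + 1))" using e I by (intro mult_strict_left_mono) auto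
  also have "\<dots> = \<bar>L2_inner g \<phi>\<bar>" using I by (simp add: e_def)
  finally show False by simp
qed

text \<open>Integrals of \<open>g\<close> against continuous functions vanish, hence over closed
  sets by approximating indicators, hence over all Borel sets, because closed sets form an
  intersection-stable generator; a density with vanishing integrals is zero almost
  everywhere.\<close>

lemma AE_0_if_orthogonal_polyfun:
  fixes g :: "real ^ 'n \<Rightarrow> real"
  assumes g: "g \<in> L2_sphere" and orth: "\<And>t p. polyfun t p \<Longrightarrow> L2_inner g p = 0"
  shows "AE x in sphere_measure. g x = 0"
proof -
  note [measurable] = L2_sphere_measurable[OF g]
  have gi: "integrable sphere_measure g" by (rule L2_sphere_integrable1[OF g])
  have closed: "(\<integral>x. indicator F x * g x \<partial>sphere_measure) = 0" if F: "closed F" for F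
  proof (cases "F = {}")
    case False
    \<comment> \<open>Continuous functions decreasing to the indicator of the closed set
      \<open>F\<close>, bounded by \<open>1\<close>; dominated convergence applies with bound
      \<open>\<bar>g x\<bar>\<close>.\<close>
    define \<phi> where "\<phi> k x = max 0 (1 - real k * infdist x F)" for k and x :: "real ^ 'n"
    have c: "continuous_on S (\<phi> k)" for k S
      unfolding \<phi>_def by (intro continuous_intros)
    have [measurable]: "\<phi> k \<in> borel_measurable sphere_measure" for k
      by (rule continuous_on_sphere_measurable[OF c])
    have FM: "F \<inter> space sphere_measure \<in> sets sphere_measure"
      using F by (auto simp: sets_sphere_measure_iff space_sphere_measure)
    have lim: "(\<lambda>k. \<phi> k x) \<longlonglongrightarrow> indicator F x" for x
    proof (cases "x \<in> F")
      case True then show ?thesis by (simp add: \<phi>_def)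
    next
      case xF: False
      then have pos: "infdist x F > 0" using F False by (simp add: infdist_pos_not_in_closed)
      obtain K :: nat where K: "1 / infdist x F < real K" using reals_Archimedean2 by blast
      have "\<phi> k x = 0" if "k \<ge> K" for k
      proof -
        have "1 < real K * infdist x F" using K pos by (simp add: field_simps)
        also have "\<dots> \<le> real k * infdist x F" using that pos by (intro mult_right_mono) auto
        finally show ?thesis by (simp add: \<phi>_def)
      qed
      then have "\<forall>\<^sub>F k in sequentially. \<phi> k x = indicator F x" using xF by (auto simp: eventually_sequentially)
      then show ?thesis by (rule tendsto_eventually)
    qed
    have "(\<lambda>k. \<integral>x. \<phi> k x * g x \<partial>sphere_measure) \<longlonglongrightarrow> (\<integral>x. indicator F x * g x \<partial>sphere_measure)"
    proof (rule integral_dominated_convergence[where w = "\<lambda>x. \<bar>g x\<bar>"])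
      have "(\<lambda>x. indicator (F \<inter> space sphere_measure) x * g x) \<in> borel_measurable sphere_measure"
        using FM by measurable
      then show "(\<lambda>x. indicator F x * g x) \<in> borel_measurable sphere_measure"
        by (rule measurable_cong[THEN iffD1, rotated]) (auto simp: indicator_def)
      show "AE x in sphere_measure. (\<lambda>k. \<phi> k x * g x) \<longlonglongrightarrow> indicator F x * g x"
        by (intro AE_I2 tendsto_mult lim tendsto_const)
      have "0 \<le> \<phi> k x" "\<phi> k x \<le> 1" for k x by (auto simp: \<phi>_def infdist_nonneg)
      then show "AE x in sphere_measure. norm (\<phi> k x * g x) \<le> \<bar>g x\<bar>" for k
        by (intro AE_I2) (auto simp: abs_mult intro!: mult_left_le_one_le)
    qed (use gi in auto)
    moreover have "(\<integral>x. \<phi> k x * g x \<partial>sphere_measure) = 0" for k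
      using integral_continuous_orthogonal_polyfun[OF g orth c[of "sphere 0 1" k]] by (simp add: L2_inner_def mult.commute)
    ultimately have "(\<lambda>k::nat. 0) \<longlonglongrightarrow> (\<integral>x. indicator F x * g x \<partial>sphere_measure)" by (simp only:)
    then show ?thesis by (simp only: LIMSEQ_const_iff)
  qed simp
  have all: "(\<integral>x. indicator A x * g x \<partial>sphere_measure) = 0" if "A \<in> sets borel" for A
  proof -
    have A: "A \<in> sigma_sets UNIV (Collect closed)" using that by (simp add: borel_eq_closed)
    have "Int_stable (Collect closed :: (real ^ 'n) set set)" by (auto simp: Int_stable_def closed_Int)
    moreover have "Collect closed \<subseteq> Pow (UNIV :: (real ^ 'n) set)" by simp
    ultimately show ?thesis using A
    proof (induction rule: sigma_sets_induct_disjoint)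
      case (basic A) then show ?case using closed by simp
    next
      case empty show ?case by simp
    next
      case (compl A)
      have A: "A \<in> sets borel" using compl(1) by (simp add: borel_eq_closed)
      have int: "integrable sphere_measure (\<lambda>x. indicator A x * g x)"
      proof -
        have "A \<inter> space sphere_measure \<in> sets sphere_measure"
          using A by (auto simp: sets_sphere_measure_iff space_sphere_measure)
        from integrable_real_mult_indicator[OF this gi]
        have "integrable sphere_measure (\<lambda>x. indicator (A \<inter> space sphere_measure) x * g x)" by (simp add: mult.commute)
        then show ?thesis by (rule Bochner_Integration.integrable_cong[THEN iffD1, rotated -1]) (auto simp: indicator_def)
      qed
      have "(\<integral>x. g x \<partial>sphere_measure) = 0" using closed[of UNIV] by simp
      moreover have "indicator (UNIV - A) x * g x = g x - indicator A x * g x" for x by (simp add: indicator_def)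
      ultimately show ?case using compl(2) int gi by simp
    next
      case (union A)
      have A: "A i \<in> sets borel" for i using union(2) by (auto simp: borel_eq_closed)
      let ?A = "\<lambda>i. A i \<inter> space sphere_measure"
      have M: "?A i \<in> sets sphere_measure" for i
        using A by (auto simp: sets_sphere_measure_iff space_sphere_measure)
      have "(LINT x:(\<Union>i. ?A i)|sphere_measure. g x) = (\<Sum>i. LINT x:?A i|sphere_measure. g x)"
      proof (rule lebesgue_integral_countable_add)
        have "(\<Union>i. ?A i) \<in> sets sphere_measure" using M by blast
        then show "set_integrable sphere_measure (\<Union>i. ?A i) g"
          unfolding set_integrable_def using integrable_real_mult_indicator[OF _ gi] by (simp add: mult.commute)
        show "i \<noteq> j \<Longrightarrow> ?A i \<inter> ?A j = {}" for i j using union(1) by (auto simp: disjoint_family_on_def)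
      qed (rule M)
      moreover have "(LINT x:?A i|sphere_measure. g x) = 0" for i
      proof -
        have "(LINT x:?A i|sphere_measure. g x) = (\<integral>x. indicator (A i) x * g x \<partial>sphere_measure)"
          unfolding set_lebesgue_integral_def
          by (intro Bochner_Integration.integral_cong) (auto simp: indicator_def)
        then show ?thesis using union(3) by simp
      qed
      moreover have "(LINT x:(\<Union>i. ?A i)|sphere_measure. g x) = (\<integral>x. indicator (\<Union>i. A i) x * g x \<partial>sphere_measure)"
        unfolding set_lebesgue_integral_def
        by (intro Bochner_Integration.integral_cong) (auto simp: indicator_def)
      ultimately show ?case by simp
    qed
  qed
  show ?thesis
  proof (rule density_unique_real[OF gi])
    show "integrable sphere_measure (\<lambda>_::real ^ 'n. 0::real)" by simp
    fix A :: "(real ^ 'n) set" assume "A \<in> sets sphere_measure"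
    then have "A \<in> sets borel" by (simp add: sets_sphere_measure_iff)
    from all[OF this] show "(LINT x:A|sphere_measure. g x) = (LINT x:A|sphere_measure. 0)"
      by (simp add: set_lebesgue_integral_def)
  qed
qed


lemma harmonic_poly_orthogonal:
  fixes g h :: "real ^ 'n \<Rightarrow> real"
  assumes "harmonic_poly l g" "harmonic_poly m h" "l \<noteq> m" "CARD('n) = Suc d" "d \<ge> 1"
  shows "L2_inner g h = 0"
  using spherical_harmonics_orthogonal[OF harmonic_poly_in_spherical_harmonics[OF assms(1,4)]
      harmonic_poly_in_spherical_harmonics[OF assms(2,4)] assms(3,5)] .

lemma harmonic_poly_L2: "harmonic_poly l h \<Longrightarrow> h \<in> L2_sphere"
  by (intro continuous_L2_sphere harmonic_poly_continuous_on)

lemma spherical_harmonics_L2: "h \<in> spherical_harmonics d l \<Longrightarrow> h \<in> L2_sphere"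
  by (intro continuous_L2_sphere spherical_harmonics_continuous)

text \<open>Bessel's inequality against the basis of the eigenspace bounds the size of an orthonormal
  family in it.\<close>

lemma orthonormal_family_bound:
  fixes e :: "nat \<Rightarrow> real ^ 'n \<Rightarrow> real"
  assumes basis: "harmonic_basis d N (Y :: nat \<Rightarrow> nat \<Rightarrow> real ^ 'n \<Rightarrow> real)"
    and e: "\<And>j. j < r \<Longrightarrow> e j \<in> spherical_harmonics d l"
    and on: "\<And>i j. i < r \<Longrightarrow> j < r \<Longrightarrow> L2_inner (e i) (e j) = (if i = j then 1 else 0)"
  shows "r \<le> N l"
proof -
  have Y: "Y l m \<in> spherical_harmonics d l" if "m \<in> {1..N l}" for m
    using basis that by (simp add: harmonic_basis_def)
  have Yon: "L2_inner (Y l m) (Y l m') = (if m = m' then 1 else 0)" if "m \<in> {1..N l}" "m' \<in> {1..N l}" for m m'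
    using basis that by (simp add: harmonic_basis_def)
  note eL = spherical_harmonics_L2[OF e] and YL = spherical_harmonics_L2[OF Y]
  have 1: "(\<Sum>m=1..N l. (L2_inner (e j) (Y l m))\<^sup>2) = 1" if j: "j < r" for j
  proof -
    obtain c where c: "\<And>x. x \<in> sphere 0 1 \<Longrightarrow> e j x = (\<Sum>m=1..N l. c m * Y l m x)"
      using basis e[OF j] unfolding harmonic_basis_def by metis
    have ip: "L2_inner (e j) (Y l m) = c m" if m: "m \<in> {1..N l}" for m
    proof -
      have "L2_inner (e j) (Y l m) = L2_inner (\<lambda>x. \<Sum>m=1..N l. c m * Y l m x) (Y l m)"
        by (rule L2_inner_cong) (use c in auto)
      also have "\<dots> = (\<Sum>m'=1..N l. c m' * L2_inner (Y l m') (Y l m))"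
        by (rule L2_inner_lincomb(1)[OF YL YL[OF m]])
      also have "\<dots> = (\<Sum>m'=1..N l. if m' = m then c m else 0)"
        using m by (intro sum.cong) (auto simp: Yon)
      finally show ?thesis using m by simp
    qed
    have "1 = L2_inner (e j) (e j)" using on j by simp
    also have "\<dots> = L2_inner (e j) (\<lambda>x. \<Sum>m=1..N l. c m * Y l m x)"
      by (rule L2_inner_cong) (use c in auto)
    also have "\<dots> = (\<Sum>m=1..N l. c m * L2_inner (e j) (Y l m))"
      by (rule L2_inner_lincomb(2)[OF YL eL[OF j]])
    also have "\<dots> = (\<Sum>m=1..N l. (L2_inner (e j) (Y l m))\<^sup>2)"
      by (intro sum.cong) (auto simp: ip power2_eq_square)
    finally show ?thesis ..
  qed
  have 2: "(\<Sum>j<r. (L2_inner (e j) (Y l m))\<^sup>2) \<le> 1" if m: "m \<in> {1..N l}" for m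
  proof -
    let ?y = "Y l m" and ?a = "\<lambda>j. L2_inner (e j) (Y l m)"
    let ?p = "\<lambda>x. \<Sum>j<r. ?a j * e j x"
    have eL': "e j \<in> L2_sphere" if "j \<in> {..<r}" for j
      using eL that by auto
    have pL: "?p \<in> L2_sphere" by (rule L2_sphere_lincomb[OF eL'])
    have py: "L2_inner ?p ?y = (\<Sum>j<r. (?a j)\<^sup>2)"
      unfolding power2_eq_square by (rule L2_inner_lincomb(1)[OF eL' YL[OF m]])
    have ep: "L2_inner (e j) ?p = ?a j" if j: "j < r" for j
    proof -
      have "L2_inner (e j) ?p = (\<Sum>i<r. ?a i * L2_inner (e j) (e i))"
        by (rule L2_inner_lincomb(2)[OF eL' eL[OF j]])
      also have "\<dots> = (\<Sum>i<r. if i = j then ?a j else 0)"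
        using j by (intro sum.cong) (auto simp: on)
      finally show ?thesis using j by simp
    qed
    have pp: "L2_inner ?p ?p = (\<Sum>j<r. (?a j)\<^sup>2)"
    proof -
      have "L2_inner ?p ?p = (\<Sum>j<r. ?a j * L2_inner (e j) ?p)" by (rule L2_inner_lincomb(1)[OF eL' pL])
      also have "\<dots> = (\<Sum>j<r. (?a j)\<^sup>2)"
        unfolding power2_eq_square by (intro sum.cong refl) (simp only: lessThan_iff ep)
      finally show ?thesis .
    qed
    have "0 \<le> L2_inner (\<lambda>x. ?y x - ?p x) (\<lambda>x. ?y x - ?p x)" by (rule L2_inner_self_nonneg)
    also have "\<dots> = L2_inner ?y ?y - L2_inner ?p ?y - (L2_inner ?y ?p - L2_inner ?p ?p)"
      using L2_inner_diff[OF YL[OF m] pL L2_sphere_diff[OF YL[OF m] pL]]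
        L2_inner_right(1)[OF YL[OF m] pL YL[OF m]] L2_inner_right(1)[OF YL[OF m] pL pL] by linarith
    also have "\<dots> = 1 - (\<Sum>j<r. (?a j)\<^sup>2)"
      using py pp Yon[OF m m] L2_inner_commute[of ?y ?p] by simp
    finally show ?thesis by simp
  qed
  \<comment> \<open>Double counting: each \<open>e j\<close> contributes exactly \<open>1\<close> by
    its basis expansion, each basis function at most \<open>1\<close> by Bessel's
    inequality.\<close>
  have "real r = (\<Sum>j<r. \<Sum>m=1..N l. (L2_inner (e j) (Y l m))\<^sup>2)" using 1 by simp
  also have "\<dots> = (\<Sum>m=1..N l. \<Sum>j<r. (L2_inner (e j) (Y l m))\<^sup>2)" by (rule sum.swap)
  also have "\<dots> \<le> (\<Sum>m=1..N l. 1)" by (intro sum_mono 2)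
  finally show ?thesis by simp
qed

text \<open>An eigenfunction minus its projection to a maximal orthonormal family of harmonic
  polynomials of its degree is orthogonal to every polynomial.\<close>

lemma spherical_harmonics_eq_harmonic_poly:
  fixes f :: "real ^ 'n \<Rightarrow> real"
  assumes basis: "harmonic_basis d N (Y :: nat \<Rightarrow> nat \<Rightarrow> real ^ 'n \<Rightarrow> real)"
    and n: "CARD('n) = Suc d" and d: "d \<ge> 1" and f: "f \<in> spherical_harmonics d l"
  shows "\<exists>h. harmonic_poly l h \<and> (\<forall>x\<in>sphere 0 1. f x = h x)"
proof -
  \<comment> \<open>\<open>P r\<close> says that \<open>r\<close> orthonormal harmonic forms of
    degree \<open>l\<close> exist. The bound by \<open>N l\<close> provides a largest such
    \<open>r\<close>, so no dimension formula for harmonic forms is required.\<close>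
  define P where "P r \<longleftrightarrow> (\<exists>e :: nat \<Rightarrow> real ^ 'n \<Rightarrow> real. (\<forall>j<r. harmonic_poly l (e j)) \<and>
    (\<forall>i<r. \<forall>j<r. L2_inner (e i) (e j) = (if i = j then 1 else 0)))" for r :: nat
  have "P 0" by (simp add: P_def)
  moreover have bound: "r \<le> N l" if Pr: "P r" for r
  proof -
    obtain e :: "nat \<Rightarrow> real ^ 'n \<Rightarrow> real" where e: "\<forall>j<r. harmonic_poly l (e j)"
      and on: "\<forall>i<r. \<forall>j<r. L2_inner (e i) (e j) = (if i = j then 1 else 0)"
      using Pr unfolding P_def by blast
    show ?thesis
      by (rule orthonormal_family_bound[OF basis harmonic_poly_in_spherical_harmonics[OF e[rule_format] n] on[rule_format]])
  qed
  ultimately have "P (GREATEST r. P r)" and max: "\<And>r. P r \<Longrightarrow> r \<le> (GREATEST r. P r)"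
    by (auto intro: GreatestI_nat Greatest_le_nat)
  then obtain r where r: "P r" and max: "\<And>q. P q \<Longrightarrow> q \<le> r" by blast
  then obtain e :: "nat \<Rightarrow> real ^ 'n \<Rightarrow> real" where e: "\<And>j. j < r \<Longrightarrow> harmonic_poly l (e j)"
    and on: "\<And>i j. i < r \<Longrightarrow> j < r \<Longrightarrow> L2_inner (e i) (e j) = (if i = j then 1 else 0)"
    unfolding P_def by blast
  note eL = harmonic_poly_L2[OF e]
  define pr where "pr g x = (\<Sum>j<r. L2_inner g (e j) * e j x)" for g x
  have prh: "harmonic_poly l (pr g)" for g
    unfolding pr_def[abs_def] using e by (intro harmonic_poly_sum harmonic_poly_cmult) auto
  note prL = harmonic_poly_L2[OF prh]
  have eL': "e j \<in> L2_sphere" if "j \<in> {..<r}" for j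
    using eL that by auto
  have pr_e: "L2_inner (\<lambda>x. g x - pr g x) (e j) = 0" if j: "j < r" and g: "g \<in> L2_sphere" for g j
  proof -
    have "L2_inner (pr g) (e j) = (\<Sum>i<r. L2_inner g (e i) * L2_inner (e i) (e j))"
      unfolding pr_def by (rule L2_inner_lincomb(1)[OF eL' eL[OF j]])
    also have "\<dots> = (\<Sum>i<r. if i = j then L2_inner g (e j) else 0)"
      using j by (intro sum.cong) (auto simp: on)
    also have "\<dots> = L2_inner g (e j)" using j by simp
    finally show ?thesis using L2_inner_diff[OF g prL eL[OF j]] by simp
  qed
  \<comment> \<open>A harmonic form with nonzero residual could be normalised and appended to the
    family, contradicting maximality.\<close>
  have res: "L2_inner (\<lambda>x. h x - pr h x) (\<lambda>x. h x - pr h x) = 0" if h: "harmonic_poly l h" for h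
  proof (rule ccontr)
    let ?h' = "\<lambda>x. h x - pr h x"
    assume ne: "L2_inner ?h' ?h' \<noteq> 0"
    then have pos: "L2_inner ?h' ?h' > 0" using L2_inner_self_nonneg[of ?h'] by simp
    have h': "harmonic_poly l ?h'"
      using harmonic_poly_add[OF h harmonic_poly_cmult[OF prh[of h], of "-1"]] by simp
    define c where "c = 1 / sqrt (L2_inner ?h' ?h')"
    define e' where "e' j = (if j = r then (\<lambda>x. c * ?h' x) else e j)" for j
    have he: "L2_inner ?h' (e j) = 0" if "j < r" for j using pr_e[OF that harmonic_poly_L2[OF h]] .
    have "L2_inner (e' i) (e' j) = (if i = j then 1 else 0)" if "i < Suc r" "j < Suc r" for i j
    proof -
      have 1: "L2_inner (\<lambda>x. c * ?h' x) (e j) = 0" if "j < r" for j using he[OF that] by (simp only: L2_inner_cmult)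
      have 2: "L2_inner (e j) (\<lambda>x. c * ?h' x) = 0" if "j < r" for j using 1[OF that] by (simp only: L2_inner_commute)
      have "L2_inner (\<lambda>x. c * ?h' x) (\<lambda>x. c * ?h' x) = c * (c * L2_inner ?h' ?h')"
        by (simp only: L2_inner_cmult L2_inner_right(3))
      also have "\<dots> = 1" using pos by (simp add: c_def real_div_sqrt)
      finally show ?thesis using that on 1 2 by (auto simp: e'_def less_Suc_eq)
    qed
    moreover have "harmonic_poly l (e' j)" if "j < Suc r" for j
      using that e harmonic_poly_cmult[OF h'] by (auto simp: e'_def less_Suc_eq)
    ultimately have "P (Suc r)" unfolding P_def by blast
    then show False using max by fastforce
  qed
  let ?g = "\<lambda>x. f x - pr f x"
  have fL: "f \<in> L2_sphere" by (rule spherical_harmonics_L2[OF f])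
  have gL: "?g \<in> L2_sphere" by (rule L2_sphere_diff[OF fL prL])
  have gh: "L2_inner ?g h = 0" if h: "harmonic_poly m h" for m h
  proof (cases "m = l")
    case False
    have "L2_inner f h = 0"
      by (rule spherical_harmonics_orthogonal[OF f harmonic_poly_in_spherical_harmonics[OF h n] _ d]) (use False in simp)
    moreover have "L2_inner (pr f) h = 0" using harmonic_poly_orthogonal[OF prh h _ n d] False by simp
    ultimately show ?thesis using L2_inner_diff[OF fL prL harmonic_poly_L2[OF h]] by simp
  next
    case True
    let ?h' = "\<lambda>x. h x - pr h x"
    have hL: "h \<in> L2_sphere" by (rule harmonic_poly_L2[OF h])
    have h'L: "?h' \<in> L2_sphere" by (rule L2_sphere_diff[OF hL prL])
    have "AE x in sphere_measure. ?h' x = 0"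
      using res h True L2_inner_self_eq_0[OF h'L] by blast
    then have "AE x in sphere_measure. ?g x * ?h' x = 0" by eventually_elim simp
    then have 1: "L2_inner ?g ?h' = 0" unfolding L2_inner_def by (rule integral_eq_zero_AE)
    have 2: "L2_inner ?g (pr h) = 0"
    proof -
      have "L2_inner ?g (pr h) = (\<Sum>j<r. L2_inner h (e j) * L2_inner ?g (e j))"
        unfolding pr_def[of h] by (rule L2_inner_lincomb(2)[OF eL' gL])
      then show ?thesis using pr_e[OF _ fL] by simp
    qed
    show ?thesis using 1 2 L2_inner_right(1)[OF hL prL gL, of h] by simp
  qed
  have "L2_inner ?g p = 0" if "polyfun t p" for t p
  proof -
    obtain h where h: "\<And>l. harmonic_poly l (h l)" "\<And>x. x\<in>sphere 0 1 \<Longrightarrow> p x = (\<Sum>l\<le>t. h l x)"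
      using polyfun_on_sphere[OF \<open>polyfun t p\<close>] by blast
    have "L2_inner ?g p = L2_inner ?g (\<lambda>x. \<Sum>l\<le>t. h l x)" by (rule L2_inner_cong) (use h in auto)
    also have "\<dots> = (\<Sum>l\<le>t. L2_inner ?g (h l))" by (rule L2_inner_right(4)[OF harmonic_poly_L2[OF h(1)] gL])
    also have "\<dots> = 0" by (intro sum.neutral ballI gh[OF h(1)])
    finally show ?thesis .
  qed
  from AE_0_if_orthogonal_polyfun[OF gL this]
  have "AE x in sphere_measure. f x = pr f x" by simp
  from continuous_AE_eq_sphere[OF spherical_harmonics_continuous[OF f] harmonic_poly_continuous_on[OF prh] this]
  show ?thesis using prh by blast
qed

section \<open>Point evaluations of harmonic polynomials\<close>

lemma hpoly_translate: "hpoly k p \<Longrightarrow> polyfun k (\<lambda>z. p (a + z))"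
proof (induction rule: hpoly.induct)
  case (hpoly_const c) show ?case by (rule polyfun_const)
next
  case (hpoly_mult_coord k p i)
  have "polyfun (k + 1) (\<lambda>z. z $ i * p (a + z))"
    by (rule polyfun_mult_hpoly[OF hpoly_mult_coord(2) hpoly_coord]) simp
  moreover have "polyfun (k + 1) (\<lambda>z. a $ i * p (a + z))"
    by (rule polyfun_cmult[OF polyfun_mono[OF hpoly_mult_coord(2)]]) simp
  ultimately have "polyfun (k + 1) (\<lambda>z. a $ i * p (a + z) + z $ i * p (a + z))" by (rule polyfun_plus[rotated])
  then show ?case by (simp add: distrib_right)
next
  case (hpoly_add k p q)
  then show ?case by (intro polyfun_plus)
qed

lemma polyfun_translate: "polyfun t p \<Longrightarrow> polyfun t (\<lambda>z. p (a + z))"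
proof (induction rule: polyfun.induct)
  case polyfun_zero show ?case by (rule polyfun.polyfun_zero)
next
  case (polyfun_add k p q)
  then show ?case by (intro polyfun_plus) (auto intro: polyfun_mono hpoly_translate)
qed

lemma polyfun_components:
  "polyfun t p \<Longrightarrow> \<exists>c. (\<forall>k. hpoly k (c k)) \<and> (\<forall>x. p x = (\<Sum>k\<le>t. c k x))"
proof (induction rule: polyfun.induct)
  case polyfun_zero
  show ?case by (intro exI[of _ "\<lambda>l x. 0"]) (auto simp: hpoly_zero)
next
  case (polyfun_add k p q)
  then obtain c where c: "\<And>k. hpoly k (c k)" "\<And>x. q x = (\<Sum>k\<le>t. c k x)" by blast
  let ?c = "\<lambda>l x. c l x + (if l = k then p x else 0)"
  have "hpoly l (?c l)" for l
    using c(1)[of l] polyfun_add(1) by (cases "l = k") (auto intro: hpoly_add)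
  moreover have "p x + q x = (\<Sum>l\<le>t. ?c l x)" for x
    using c(2)[of x] polyfun_add(2) by (simp add: sum.distrib)
  ultimately show ?case by (intro exI[of _ ?c]) blast
qed

lemma partial_deriv_translate:
  assumes "p differentiable (at (a + z))"
  shows "partial_deriv i (\<lambda>z. p (a + z)) z = partial_deriv i p (a + z)"
proof -
  have 1: "((\<lambda>z. a + z) has_derivative (\<lambda>h. h)) (at z)" by (auto intro!: derivative_eq_intros)
  have 2: "(p has_derivative frechet_derivative p (at (a + z))) (at (a + z))"
    using assms frechet_derivative_works by blast
  from partial_deriv_eqI[OF has_derivative_compose[OF 1 2]] show ?thesis
    by (simp add: partial_deriv_def)
qed

lemma polyfun_differentiable: "polyfun t p \<Longrightarrow> p differentiable (at x)"
  by (induction rule: polyfun.induct) (auto intro: differentiable_add hpoly_differentiable)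

lemma polyfun_partial_deriv: "polyfun t p \<Longrightarrow> polyfun t (partial_deriv i p)"
proof (induction rule: polyfun.induct)
  case polyfun_zero then show ?case by (simp add: polyfun.polyfun_zero)
next
  case (polyfun_add k p q)
  have "partial_deriv i (\<lambda>x. p x + q x) = (\<lambda>x. partial_deriv i p x + partial_deriv i q x)"
    using polyfun_add(1,3) by (auto simp: partial_deriv_add hpoly_differentiable polyfun_differentiable)
  moreover have "polyfun t (partial_deriv i p)"
    using polyfun_hpoly[OF hpoly_partial_deriv'[OF polyfun_add(1)]] polyfun_add(2) by simp
  ultimately show ?case using polyfun_add(4) polyfun_plus by metis
qed

lemma laplacian_translate:
  assumes "polyfun t p" shows "laplacian (\<lambda>z. p (a + z)) z = laplacian p (a + z)"
proof -
  have "partial_deriv i (\<lambda>z. p (a + z)) = (\<lambda>z. partial_deriv i p (a + z))" for i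
    using partial_deriv_translate polyfun_differentiable[OF assms] by blast
  then show ?thesis unfolding laplacian_def
    using partial_deriv_translate[OF polyfun_differentiable[OF polyfun_partial_deriv[OF assms]]] by simp
qed

lemma laplacian_sum:
  assumes "finite A" "\<And>k. k \<in> A \<Longrightarrow> hpoly (f k) (c k)"
  shows "laplacian (\<lambda>x. \<Sum>k\<in>A. c k x) x = (\<Sum>k\<in>A. laplacian (c k) x)"
proof -
  have "partial_deriv i (\<lambda>x. \<Sum>k\<in>A. c k x) = (\<lambda>x. \<Sum>k\<in>A. partial_deriv i (c k) x)" for i
    using assms by (intro ext partial_deriv_sum hpoly_differentiable) auto
  moreover have "partial_deriv i (\<lambda>x. \<Sum>k\<in>A. partial_deriv i (c k) x) x = (\<Sum>k\<in>A. partial_deriv i (partial_deriv i (c k)) x)" for i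
    using assms by (intro partial_deriv_sum partial_deriv_differentiable) auto
  ultimately show ?thesis by (simp add: laplacian_def) (rule sum.swap)
qed

text \<open>Along a ray, the Laplacian of \<open>p\<close> is a polynomial in the scaling factor
  whose coefficients are the Laplacians of the components, up to a common power. It vanishes
  identically, so each coefficient does.\<close>

lemma harmonic_components:
  assumes p: "polyfun t p" and lap: "\<And>x. laplacian p x = 0"
  shows "\<exists>c. (\<forall>k. harmonic_poly k (c k)) \<and> (\<forall>x. p x = (\<Sum>k\<le>t. c k x))"
proof -
  obtain c where c: "\<And>k. hpoly k (c k)" "\<And>x. p x = (\<Sum>k\<le>t. c k x)"
    using polyfun_components[OF p] by blast
  have peq: "p = (\<lambda>x. \<Sum>k\<le>t. c k x)" using c(2) by blast
  \<comment> \<open>The factor \<open>r ^ 2\<close> moves the exponent \<open>k - 2\<close> to the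
    other side, so the cases \<open>k < 2\<close> need no truncated subtraction.\<close>
  have hom: "laplacian (c k) (r *\<^sub>R x) * r ^ 2 = laplacian (c k) x * r ^ k" for k r x
  proof (cases "k < 2")
    case False
    then have "hpoly (k - 2) (laplacian (c k))" using hpoly_laplacian[OF c(1)[of k]] by simp
    from hpoly_homogeneous[OF this, of r x] have "laplacian (c k) (r *\<^sub>R x) = r ^ (k - 2) * laplacian (c k) x" .
    moreover have "r ^ k = r ^ (k - 2) * r ^ 2" using False by (metis le_add_diff_inverse2 not_less power_add)
    ultimately show ?thesis by simp
  qed (use hpoly_laplacian[OF c(1)[of k]] in simp)
  have "laplacian (c k) x = 0" if "k \<le> t" for k x
  proof -
    have "(\<Sum>k\<le>t. laplacian (c k) x * r ^ k) = 0" for r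
    proof -
      have "(\<Sum>k\<le>t. laplacian (c k) x * r ^ k) = (\<Sum>k\<le>t. laplacian (c k) (r *\<^sub>R x)) * r ^ 2"
        unfolding sum_distrib_right by (intro sum.cong refl) (simp only: hom)
      also have "(\<Sum>k\<le>t. laplacian (c k) (r *\<^sub>R x)) = laplacian p (r *\<^sub>R x)"
        unfolding peq by (rule laplacian_sum[symmetric]) (use c(1) in auto)
      finally show ?thesis using lap by simp
    qed
    then show ?thesis using polyfun_eq_0[of "\<lambda>k. laplacian (c k) x" t] that by blast
  qed
  then have h: "harmonic_poly k (c k)" if "k \<le> t" for k using c(1) that by (simp add: harmonic_poly_def)
  let ?c = "\<lambda>k. if k \<le> t then c k else (\<lambda>x. 0)"
  have "harmonic_poly k (?c k)" for k using h[of k] harmonic_poly_zero[of k] by (cases "k \<le> t") simp_all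
  moreover have "p x = (\<Sum>k\<le>t. ?c k x)" for x unfolding c(2) by (intro sum.cong) auto
  ultimately show ?thesis by (intro exI[of _ ?c]) blast
qed

section \<open>Mean values of harmonic polynomials\<close>

lemma hpoly_polar:
  assumes "hpoly k h" shows "h y = norm y ^ k * h (sgn y)"
proof (cases "y = 0")
  case False
  then have "y = norm y *\<^sub>R sgn y" by (simp add: sgn_div_norm)
  then show ?thesis using hpoly_homogeneous[OF assms, of "norm y" "sgn y"] by simp
next
  case True
  then show ?thesis using hpoly_homogeneous[OF assms, of 0 0] by simp
qed

text \<open>A harmonic form of positive degree is orthogonal to the constants on the sphere, and
  integration over a centred ball factors into a radial and a spherical integral.\<close>

lemma harmonic_poly_ball_integral:
  fixes h :: "real ^ 'n \<Rightarrow> real"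
  assumes h: "harmonic_poly k h" and k: "k \<ge> 1" and n: "CARD('n) = Suc d" and d: "d \<ge> 1" and r: "r \<le> 2"
  shows "(\<integral>y. indicator (cball 0 r) y * h y \<partial>lborel) = 0"
proof -
  \<comment> \<open>The factor \<open>indicator {0..}\<close> keeps the weight bounded on the
    negative half-line, as \<open>polar_integral\<close> asks for a bound at every real; at
    \<open>0\<close> the weight vanishes since \<open>k \<ge> 1\<close>.\<close>
  let ?w = "\<lambda>s::real. indicator {..r} s * indicator {0..} s * s ^ k"
  have hp: "hpoly k h" using h by (simp add: harmonic_poly_def)
  have one: "harmonic_poly 0 (\<lambda>x :: real ^ 'n. 1)"
  proof -
    have "partial_deriv i (\<lambda>x :: real ^ 'n. 1 :: real) = (\<lambda>x. 0)" for i by auto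
    then show ?thesis by (simp add: harmonic_poly_def hpoly_const laplacian_def)
  qed
  have "L2_inner h (\<lambda>x. 1) = 0"
    by (rule harmonic_poly_orthogonal[OF h one _ n d]) (use k in simp)
  then have "(\<integral>x. h x \<partial>sphere_measure) = 0" by (simp add: L2_inner_def)
  moreover have "(\<integral>y. ?w (norm y) * h (sgn y) \<partial>lborel) = (\<integral>y. ?w (norm (y :: real ^ 'n)) \<partial>lborel) * (\<integral>x. h x \<partial>sphere_measure)"
  proof (rule polar_integral(1)[of ?w "2 ^ k"])
    fix s :: real
    show "\<bar>?w s\<bar> \<le> 2 ^ k" using r by (auto simp: indicator_def abs_mult power_mono)
    show "2 < s \<Longrightarrow> ?w s = 0" using r by (auto simp: indicator_def)
    show "integrable sphere_measure h"
      by (intro integrable_continuous_sphere harmonic_poly_continuous_on[OF h])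
  qed (use k in auto)
  moreover have "indicator (cball 0 r) y * h y = ?w (norm y) * h (sgn y)" for y
    using hpoly_polar[OF hp, of y] by (auto simp: indicator_def)
  ultimately show ?thesis by simp
qed

lemma integrable_cball_continuous:
  fixes f :: "real ^ 'n \<Rightarrow> real"
  assumes "continuous_on UNIV f" shows "integrable lborel (\<lambda>y. indicator (cball a r) y * f y)"
  using borel_integrable_compact[of "cball a r" f] continuous_on_subset[OF assms] by simp

lemma integral_indicator_cball:
  "r \<ge> 0 \<Longrightarrow> (\<integral>y. indicator (cball (a :: real ^ 'n) r) y \<partial>lborel) = unit_ball_vol (real CARD('n)) * r ^ CARD('n)"
  using emeasure_cball[of r a] by (simp add: measure_def)

text \<open>After translating \<open>a\<close> to the origin, the harmonic components of positive
  degree integrate to \<open>0\<close> over the ball and vanish at its centre, so only the constant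
  component remains on both sides.\<close>

lemma harmonic_mean_value:
  fixes p :: "real ^ 'n \<Rightarrow> real"
  assumes p: "polyfun t p" and lap: "\<And>x. laplacian p x = 0"
    and n: "CARD('n) = Suc d" and d: "d \<ge> 1" and r: "0 \<le> r" "r \<le> 2"
  shows "(\<integral>y. indicator (cball a r) y * p y \<partial>lborel) = unit_ball_vol (real CARD('n)) * r ^ CARD('n) * p a"
proof -
  let ?q = "\<lambda>z. p (a + z)"
  have q: "polyfun t ?q" by (rule polyfun_translate[OF p])
  have "laplacian ?q z = 0" for z using laplacian_translate[OF p] lap by simp
  from harmonic_components[OF q this]
  obtain c where c: "\<And>k. harmonic_poly k (c k)" "\<And>z. p (a + z) = (\<Sum>k\<le>t. c k z)" by blast
  have hp: "hpoly k (c k)" for k using c(1) by (simp add: harmonic_poly_def)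
  have "(\<integral>y. indicator (cball a r) y * p y \<partial>lborel) = (\<integral>y. indicator (cball a r) y * p y \<partial>distr lborel borel ((+) a))"
    by (simp add: lborel_distr_plus)
  also have "\<dots> = (\<integral>z. indicator (cball a r) (a + z) * p (a + z) \<partial>lborel)"
  proof (rule integral_distr)
    have [measurable]: "p \<in> borel_measurable borel"
      by (intro borel_measurable_continuous_onI polyfun_continuous_on[OF p])
    show "(\<lambda>y. indicator (cball a r) y * p y) \<in> borel_measurable borel"
      by (intro borel_measurable_times borel_measurable_indicator) auto
  qed simp
  also have "\<dots> = (\<integral>z. (\<Sum>k\<le>t. indicator (cball 0 r) z * c k z) \<partial>lborel)"
    by (intro Bochner_Integration.integral_cong refl) (simp add: c(2) sum_distrib_left[symmetric] indicator_def dist_norm)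
  also have "\<dots> = (\<Sum>k\<le>t. \<integral>z. indicator (cball 0 r) z * c k z \<partial>lborel)"
    by (intro Bochner_Integration.integral_sum integrable_cball_continuous harmonic_poly_continuous_on[OF c(1)])
  also have "\<dots> = (\<Sum>k\<le>t. if k = 0 then (\<integral>z. indicator (cball 0 r) z * c 0 z \<partial>lborel) else 0)"
    using harmonic_poly_ball_integral[OF c(1) _ n d r(2)] by (intro sum.cong) auto
  also have "\<dots> = (\<integral>z. indicator (cball 0 r) z * c 0 z \<partial>lborel)" by simp
  also have "\<dots> = (\<integral>z. indicator (cball (0 :: real ^ 'n) r) z * c 0 0 \<partial>lborel)"
  proof (rule Bochner_Integration.integral_cong)
    have "c 0 z = c 0 0" for z using hpoly_homogeneous[OF hp[of 0], of 0 z] by simp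
    then show "indicator (cball 0 r) z * c 0 z = indicator (cball 0 r) z * c 0 0" for z by metis
  qed simp
  also have "\<dots> = unit_ball_vol (real CARD('n)) * r ^ CARD('n) * c 0 0"
    using integral_indicator_cball[OF r(1), of "0 :: real ^ 'n"] by simp
  also have "c 0 0 = p a"
  proof -
    have "c k 0 = 0" if "k \<noteq> 0" for k using hpoly_homogeneous[OF hp[of k], of 0 0] that by (simp add: power_0_left)
    then have "(\<Sum>k\<le>t. c k 0) = (\<Sum>k\<le>t. if k = 0 then c 0 0 else 0)" by (intro sum.cong) auto
    then show ?thesis using c(2)[of 0] by simp
  qed
  finally show ?thesis .
qed

text \<open>Integrating the square of \<open>p y - p a\<close> over the ball and applying the mean
  value property to the mixed term leaves the difference of the two sides, which is
  nonnegative.\<close>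

lemma harmonic_square_subharmonic:
  fixes p :: "real ^ 'n \<Rightarrow> real"
  assumes p: "polyfun t p" and lap: "\<And>x. laplacian p x = 0"
    and n: "CARD('n) = Suc d" and d: "d \<ge> 1" and r: "0 \<le> r" "r \<le> 2"
  shows "unit_ball_vol (real CARD('n)) * r ^ CARD('n) * (p a)\<^sup>2 \<le> (\<integral>y. indicator (cball a r) y * (p y)\<^sup>2 \<partial>lborel)"
proof -
  let ?V = "unit_ball_vol (real CARD('n)) * r ^ CARD('n)"
  have c: "continuous_on UNIV p" by (rule polyfun_continuous_on[OF p])
  have i1: "integrable lborel (\<lambda>y. indicator (cball a r) y * (p y)\<^sup>2)"
    by (intro integrable_cball_continuous continuous_intros c)
  have i2: "integrable lborel (\<lambda>y. indicator (cball a r) y * p y)"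
    by (intro integrable_cball_continuous c)
  have i3: "integrable lborel (indicator (cball a r) :: real ^ 'n \<Rightarrow> real)"
    using integrable_cball_continuous[of "\<lambda>_. 1" a r] by simp
  have "0 \<le> (\<integral>y. indicator (cball a r) y * (p y - p a)\<^sup>2 \<partial>lborel)"
    by (intro integral_nonneg_AE) (auto simp: indicator_def)
  also have "\<dots> = (\<integral>y. (indicator (cball a r) y * (p y)\<^sup>2 - (2 * p a) * (indicator (cball a r) y * p y)) + (p a)\<^sup>2 * indicator (cball a r) y \<partial>lborel)"
    by (intro Bochner_Integration.integral_cong refl) (simp add: power2_diff algebra_simps)
  also have "\<dots> = ((\<integral>y. indicator (cball a r) y * (p y)\<^sup>2 \<partial>lborel) - (2 * p a) * (\<integral>y. indicator (cball a r) y * p y \<partial>lborel))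
     + (p a)\<^sup>2 * (\<integral>y. indicator (cball a r) y \<partial>lborel)"
    using i1 i2 i3 by simp
  also have "\<dots> = (\<integral>y. indicator (cball a r) y * (p y)\<^sup>2 \<partial>lborel) - ?V * (p a)\<^sup>2"
    unfolding harmonic_mean_value[OF p lap n d r] integral_indicator_cball[OF r(1)]
    by (simp add: power2_eq_square)
  finally show ?thesis by simp
qed

section \<open>From a thin annulus to sums over points\<close>

lemma power_diff_le:
  fixes a b :: real
  assumes "0 \<le> b" "b \<le> a" shows "a ^ Suc k - b ^ Suc k \<le> real (Suc k) * (a - b) * a ^ k"
proof (induction k)
  case (Suc k)
  have "a ^ Suc (Suc k) - b ^ Suc (Suc k) = a * (a ^ Suc k - b ^ Suc k) + (a - b) * b ^ Suc k"
    by (simp add: algebra_simps)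
  also have "\<dots> \<le> a * (real (Suc k) * (a - b) * a ^ k) + (a - b) * a ^ Suc k"
    using assms Suc by (intro add_mono mult_left_mono power_mono) auto
  also have "\<dots> = real (Suc (Suc k)) * (a - b) * a ^ Suc k" by (simp add: algebra_simps)
  finally show ?case .
qed simp

text \<open>In polar coordinates the mixed products vanish by orthogonality. For degrees up to
  \<open>M\<close> the half-width \<open>1 / (2 * M)\<close> keeps \<open>norm y ^ (2 * l)\<close>
  below \<open>3\<close> on the annulus, so each diagonal term is at most \<open>3\<close> times the
  volume of the annulus times the spherical norm.\<close>

lemma annulus_integral:
  fixes h :: "nat \<Rightarrow> real ^ 'n \<Rightarrow> real"
  assumes h: "\<And>l. harmonic_poly l (h l)" and n: "CARD('n) = Suc d" and d: "d \<ge> 1" and M: "M \<ge> 1"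
  defines "r \<equiv> 1 / (2 * real M)"
  defines "A \<equiv> {y. 1 - r \<le> norm y \<and> norm y \<le> 1 + r}"
  shows "integrable lborel (\<lambda>y. indicator A y * (\<Sum>l\<le>M. h l y)\<^sup>2)"
    and "(\<integral>y. indicator A y * (\<Sum>l\<le>M. h l y)\<^sup>2 \<partial>lborel) \<le>
     3 * unit_ball_vol (real CARD('n)) * (real CARD('n) * 2 ^ CARD('n) * r) * (\<Sum>l\<le>M. L2_inner (h l) (h l))"
proof -
  have r: "0 < r" "r \<le> 1/2" using M by (auto simp: r_def field_simps)
  let ?w = "\<lambda>k s::real. indicator {1 - r..1 + r} s * s ^ k"
  have A: "A \<in> sets borel" unfolding A_def by measurable
  have wm: "?w k \<in> borel_measurable borel" for k by measurable
  have wb: "\<bar>?w k s\<bar> \<le> 2 ^ k" for k s using r by (auto simp: indicator_def abs_mult power_mono)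
  have w0: "?w k 0 = 0" for k using r by (auto simp: indicator_def)
  have w2: "s > 2 \<Longrightarrow> ?w k s = 0" for k s using r by (auto simp: indicator_def)
  have int: "integrable sphere_measure (\<lambda>x. h l x * h m x)" for l m
    by (rule L2_sphere_integrable[OF harmonic_poly_L2[OF h] harmonic_poly_L2[OF h]])
  note pol = polar_integral[OF wm wb w0 w2 int]
  have eq: "indicator A y * (h l y * h m y) = ?w (l + m) (norm y) * (h l (sgn y) * h m (sgn y))" for l m y
    using hpoly_polar[of l "h l" y] hpoly_polar[of m "h m" y] h[of l] h[of m]
    by (simp add: harmonic_poly_def indicator_def A_def power_add)
  have ilm: "integrable lborel (\<lambda>y. indicator A y * (h l y * h m y))" for l m
    unfolding eq by (rule pol(2))
  have sq: "indicator A y * (\<Sum>l\<le>M. h l y)\<^sup>2 = (\<Sum>l\<le>M. \<Sum>m\<le>M. indicator A y * (h l y * h m y))" for y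
  proof -
    have "(\<Sum>l\<le>M. h l y)\<^sup>2 = (\<Sum>l\<le>M. \<Sum>m\<le>M. h l y * h m y)"
      by (simp only: power2_eq_square sum_product)
    then show ?thesis by (simp only: sum_distrib_left)
  qed
  show "integrable lborel (\<lambda>y. indicator A y * (\<Sum>l\<le>M. h l y)\<^sup>2)"
    unfolding sq by (intro Bochner_Integration.integrable_sum ilm)
  have off: "(\<integral>y. indicator A y * (h l y * h m y) \<partial>lborel) = 0" if "l \<noteq> m" for l m
  proof -
    have "(\<integral>y. indicator A y * (h l y * h m y) \<partial>lborel) = (\<integral>y. ?w (l + m) (norm (y :: real ^ 'n)) \<partial>lborel) * L2_inner (h l) (h m)"
      unfolding eq L2_inner_def by (rule pol(1))
    then show ?thesis using harmonic_poly_orthogonal[OF h h that n d] by simp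
  qed
  have vol: "(\<integral>y. indicator A y \<partial>(lborel :: (real ^ 'n) measure)) \<le> unit_ball_vol (real CARD('n)) * (real CARD('n) * 2 ^ CARD('n) * r)"
  proof -
    \<comment> \<open>The difference of two closed balls misses the inner boundary of
      \<open>A\<close>; the sphere added for it has measure zero.\<close>
    have sub: "indicator A y \<le> (indicator (cball 0 (1 + r)) y - indicator (cball 0 (1 - r)) y + indicator (sphere 0 (1 - r)) y :: real)" for y :: "real ^ 'n"
      using r by (auto simp: indicator_def A_def)
    have s0: "(\<integral>y. indicator (sphere (0 :: real ^ 'n) (1 - r)) y \<partial>lborel) = (0 :: real)"
    proof -
      have "emeasure lborel (sphere (0 :: real ^ 'n) (1 - r)) = 0"
        using negligible_sphere[of "0 :: real ^ 'n" "1 - r"] by (simp add: negligible_iff_emeasure0)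
      then show ?thesis by (simp add: measure_def)
    qed
    have i: "integrable lborel (indicator (cball (0 :: real ^ 'n) s) :: _ \<Rightarrow> real)" for s
      using integrable_cball_continuous[of "\<lambda>_. 1 :: real" "0 :: real ^ 'n" s] by simp
    have isph: "integrable lborel (indicator (sphere (0 :: real ^ 'n) (1 - r)) :: _ \<Rightarrow> real)"
      using emeasure_bounded_finite[of "sphere (0 :: real ^ 'n) (1 - r)"] by (intro integrable_real_indicator) auto
    have iA: "integrable lborel (indicator A :: real ^ 'n \<Rightarrow> real)"
    proof (rule integrable_real_indicator)
      have "bounded A" by (rule boundedI[of _ "1 + r"]) (auto simp: A_def)
      then show "emeasure lborel A < \<infinity>" by (rule emeasure_bounded_finite)
    qed (use A in simp)
    have "(\<integral>y. indicator A y \<partial>(lborel :: (real ^ 'n) measure)) \<le>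
      (\<integral>y. (indicator (cball 0 (1 + r)) y - indicator (cball 0 (1 - r)) y + indicator (sphere 0 (1 - r)) y :: real) \<partial>(lborel :: (real ^ 'n) measure))"
      using i isph iA sub by (intro integral_mono) auto
    also have "\<dots> = unit_ball_vol (real CARD('n)) * ((1 + r) ^ CARD('n) - (1 - r) ^ CARD('n))"
      using i isph s0 integral_indicator_cball[of "1 + r" "0 :: real ^ 'n"] integral_indicator_cball[of "1 - r" "0 :: real ^ 'n"] r
      by (simp add: right_diff_distrib)
    also have "(1 + r) ^ CARD('n) - (1 - r) ^ CARD('n) \<le> real (CARD('n)) * (2 * r) * (1 + r) ^ d"
      using power_diff_le[of "1 - r" "1 + r" d] r by (simp add: n)
    also have "\<dots> \<le> real (CARD('n)) * (2 * r) * 2 ^ d"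
      using r by (intro mult_left_mono power_mono) auto
    also have "\<dots> = real CARD('n) * 2 ^ CARD('n) * r" by (simp add: n)
    finally show ?thesis by simp
  qed
  have diag: "(\<integral>y. indicator A y * (h l y * h l y) \<partial>lborel) \<le> 3 * (unit_ball_vol (real CARD('n)) * (real CARD('n) * 2 ^ CARD('n) * r)) * L2_inner (h l) (h l)"
    if l: "l \<le> M" for l
  proof -
    \<comment> \<open>Origin of the constant \<open>3\<close>: the power is at most
      \<open>exp r ^ (2 * M) = exp 1\<close> by the choice of \<open>r\<close>.\<close>
    have e3: "s ^ (l + l) \<le> 3" if s: "0 \<le> s" "s \<le> 1 + r" for s
    proof -
      have "s ^ (l + l) \<le> (1 + r) ^ (l + l)" using s by (intro power_mono) auto
      also have "\<dots> \<le> (1 + r) ^ (2 * M)" using l r by (intro power_increasing) auto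
      also have "\<dots> \<le> exp r ^ (2 * M)" using r exp_ge_add_one_self[of r] by (intro power_mono) auto
      also have "\<dots> = exp 1" using M by (simp add: exp_of_nat_mult[symmetric] r_def)
      also have "\<dots> \<le> 3" using exp_le by simp
      finally show ?thesis .
    qed
    have iw: "integrable lborel (\<lambda>y :: real ^ 'n. ?w (l + l) (norm y))"
      using polar_integral(2)[OF wm wb w0 w2, of "\<lambda>_. 1 :: real" "l + l"] by simp
    have iA: "integrable lborel (indicator A :: real ^ 'n \<Rightarrow> real)"
    proof (rule integrable_real_indicator)
      have "bounded A" by (rule boundedI[of _ "1 + r"]) (auto simp: A_def)
      then show "emeasure lborel A < \<infinity>" by (rule emeasure_bounded_finite)
    qed (use A in simp)
    have "(\<integral>y. ?w (l + l) (norm (y :: real ^ 'n)) \<partial>lborel) \<le> (\<integral>y. 3 * indicator A (y :: real ^ 'n) \<partial>lborel)"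
    proof (rule integral_mono[OF iw])
      show "integrable lborel (\<lambda>y. 3 * indicator A y :: real)" using iA by simp
      show "?w (l + l) (norm y) \<le> 3 * indicator A y" for y :: "real ^ 'n"
        using e3[of "norm y"] by (auto simp: indicator_def A_def)
    qed
    also have "\<dots> \<le> 3 * (unit_ball_vol (real CARD('n)) * (real CARD('n) * 2 ^ CARD('n) * r))" using vol by simp
    finally have "(\<integral>y. ?w (l + l) (norm (y :: real ^ 'n)) \<partial>lborel) * L2_inner (h l) (h l) \<le>
      3 * (unit_ball_vol (real CARD('n)) * (real CARD('n) * 2 ^ CARD('n) * r)) * L2_inner (h l) (h l)"
      by (rule mult_right_mono) (rule L2_inner_self_nonneg)
    moreover have "(\<integral>y. indicator A y * (h l y * h l y) \<partial>lborel) = (\<integral>y. ?w (l + l) (norm (y :: real ^ 'n)) \<partial>lborel) * L2_inner (h l) (h l)"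
      unfolding eq L2_inner_def by (rule pol(1))
    ultimately show ?thesis by simp
  qed
  have "(\<integral>y. indicator A y * (\<Sum>l\<le>M. h l y)\<^sup>2 \<partial>lborel) = (\<Sum>l\<le>M. \<Sum>m\<le>M. \<integral>y. indicator A y * (h l y * h m y) \<partial>lborel)"
    unfolding sq by (subst Bochner_Integration.integral_sum, intro Bochner_Integration.integrable_sum ilm,
        subst Bochner_Integration.integral_sum, intro ilm, rule refl)
  also have "\<dots> = (\<Sum>l\<le>M. \<integral>y. indicator A y * (h l y * h l y) \<partial>lborel)"
  proof (intro sum.cong refl)
    fix l assume "l \<in> {..M}"
    have "(\<Sum>m\<le>M. \<integral>y. indicator A y * (h l y * h m y) \<partial>lborel) = (\<Sum>m\<le>M. if m = l then \<integral>y. indicator A y * (h l y * h l y) \<partial>lborel else 0)"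
      using off by (intro sum.cong) auto
    then show "(\<Sum>m\<le>M. \<integral>y. indicator A y * (h l y * h m y) \<partial>lborel) = (\<integral>y. indicator A y * (h l y * h l y) \<partial>lborel)"
      using \<open>l \<in> {..M}\<close> by simp
  qed
  also have "\<dots> \<le> (\<Sum>l\<le>M. 3 * (unit_ball_vol (real CARD('n)) * (real CARD('n) * 2 ^ CARD('n) * r)) * L2_inner (h l) (h l))"
    by (intro sum_mono diag) simp
  also have "\<dots> = 3 * unit_ball_vol (real CARD('n)) * (real CARD('n) * 2 ^ CARD('n) * r) * (\<Sum>l\<le>M. L2_inner (h l) (h l))"
    by (simp add: sum_distrib_left mult.assoc)
  finally show "(\<integral>y. indicator A y * (\<Sum>l\<le>M. h l y)\<^sup>2 \<partial>lborel) \<le>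
     3 * unit_ball_vol (real CARD('n)) * (real CARD('n) * 2 ^ CARD('n) * r) * (\<Sum>l\<le>M. L2_inner (h l) (h l))" .
qed

text \<open>The factor \<open>3 * Suc d * 2 ^ Suc d\<close> comes from the annulus;
  \<open>2 ^ d\<close> comes from dividing the annulus width by the volume scale
  \<open>r ^ (d + 1)\<close> of the small balls with \<open>r = 1 / (2 * M)\<close>, which gives
  \<open>(2 * M) ^ d\<close>.\<close>

definition mz_const :: "nat \<Rightarrow> real" where
  "mz_const d = 3 * real (Suc d) * 2 ^ Suc d * 2 ^ d"

text \<open>A Marcinkiewicz--Zygmund inequality. If a point lies in several of the balls of radius
  \<open>1 / (2 * M)\<close>, all their centres are within \<open>1 / M\<close> of any one of them,
  so \<open>\<kappa>\<close> bounds the overlap although it is only assumed at the points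
  \<open>x i\<close>.\<close>

lemma point_sum_bound:
  fixes h :: "nat \<Rightarrow> real ^ 'n \<Rightarrow> real" and x :: "'i \<Rightarrow> real ^ 'n"
  assumes h: "\<And>l. harmonic_poly l (h l)" and n: "CARD('n) = Suc d" and d: "d \<ge> 1" and M: "M \<ge> 1"
    and I: "finite I" "I \<noteq> {}" and x: "\<And>i. i \<in> I \<Longrightarrow> norm (x i) = 1"
    and sep: "\<And>i. i \<in> I \<Longrightarrow> real (card {j \<in> I. dist (x j) (x i) \<le> 1 / real M}) \<le> \<kappa>"
  shows "(\<Sum>i\<in>I. (\<Sum>l\<le>M. h l (x i))\<^sup>2) \<le> mz_const d * \<kappa> * real M ^ d * (\<Sum>l\<le>M. L2_inner (h l) (h l))"
proof -
  define r where "r = 1 / (2 * real M)"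
  have r: "0 < r" "r \<le> 1/2" using M by (auto simp: r_def field_simps)
  define A where "A = {y :: real ^ 'n. 1 - r \<le> norm y \<and> norm y \<le> 1 + r}"
  define p where "p y = (\<Sum>l\<le>M. h l y)" for y
  define om where "om = unit_ball_vol (real CARD('n))"
  have om: "om > 0" by (simp add: om_def)
  have kap: "\<kappa> \<ge> 0" using I(2) sep by (meson all_not_in_conv of_nat_0_le_iff order_trans)
  have hp: "hpoly l (h l)" for l using h by (simp add: harmonic_poly_def)
  have pp: "polyfun M p" unfolding p_def[abs_def] by (intro polyfun_sum polyfun_hpoly[OF hp]) auto
  have "laplacian p y = (\<Sum>l\<le>M. laplacian (h l) y)" for y
    unfolding p_def[abs_def] by (rule laplacian_sum) (use hp in auto)
  then have lap: "laplacian p y = 0" for y using h by (simp add: harmonic_poly_def)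
  have cont: "continuous_on UNIV (\<lambda>y. (p y)\<^sup>2)" by (intro continuous_intros polyfun_continuous_on[OF pp])
  note ann = annulus_integral[OF h n d M, folded r_def, folded A_def p_def]
  have pw: "(\<Sum>i\<in>I. indicator (cball (x i) r) y * (p y)\<^sup>2) \<le> \<kappa> * (indicator A y * (p y)\<^sup>2)" for y
  proof (cases "\<exists>i\<in>I. y \<in> cball (x i) r")
    case True
    then obtain i where i: "i \<in> I" "dist (x i) y \<le> r" by auto
    have "\<bar>norm y - norm (x i)\<bar> \<le> r" using i(2) norm_triangle_ineq3[of y "x i"] by (simp add: dist_norm norm_minus_commute)
    then have yA: "y \<in> A" using x[OF i(1)] by (auto simp: A_def)
    have "(\<Sum>j\<in>I. indicator (cball (x j) r) y :: real) = real (card {j \<in> I. y \<in> cball (x j) r})"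
      using I(1) by (simp add: indicator_def sum.If_cases Int_def)
    also have "\<dots> \<le> real (card {j \<in> I. dist (x j) (x i) \<le> 1 / real M})"
    proof -
      have "dist (x j) (x i) \<le> 1 / real M" if "dist (x j) y \<le> r" for j
      proof -
        have "dist (x j) (x i) \<le> r + r" using that i(2) dist_triangle2[of "x j" "x i" y] by linarith
        then show ?thesis by (simp add: r_def)
      qed
      then show ?thesis using I(1) by (intro of_nat_mono card_mono) auto
    qed
    also have "\<dots> \<le> \<kappa>" by (rule sep[OF i(1)])
    finally show ?thesis using yA by (simp add: sum_distrib_right[symmetric] mult_right_mono)
  next
    case False
    then have "(\<Sum>i\<in>I. indicator (cball (x i) r) y * (p y)\<^sup>2) = 0" by (intro sum.neutral) (auto simp: indicator_def)
    then show ?thesis using kap by simp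
  qed
  have "om * r ^ CARD('n) * (\<Sum>i\<in>I. (p (x i))\<^sup>2) = (\<Sum>i\<in>I. om * r ^ CARD('n) * (p (x i))\<^sup>2)"
    by (rule sum_distrib_left)
  also have "\<dots> \<le> (\<Sum>i\<in>I. \<integral>y. indicator (cball (x i) r) y * (p y)\<^sup>2 \<partial>lborel)"
    unfolding om_def by (intro sum_mono harmonic_square_subharmonic[OF pp lap n d]) (use r in auto)
  also have "\<dots> = (\<integral>y. (\<Sum>i\<in>I. indicator (cball (x i) r) y * (p y)\<^sup>2) \<partial>lborel)"
    by (intro Bochner_Integration.integral_sum[symmetric] integrable_cball_continuous cont)
  also have "\<dots> \<le> (\<integral>y. \<kappa> * (indicator A y * (p y)\<^sup>2) \<partial>lborel)"
    by (intro integral_mono pw Bochner_Integration.integrable_sum integrable_cball_continuous cont integrable_mult_right ann(1))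
  also have "\<dots> \<le> \<kappa> * (3 * om * (real CARD('n) * 2 ^ CARD('n) * r) * (\<Sum>l\<le>M. L2_inner (h l) (h l)))"
    unfolding integral_mult_right_zero om_def by (rule mult_left_mono[OF ann(2) kap])
  also have "\<dots> = om * r ^ CARD('n) * (mz_const d * \<kappa> * real M ^ d * (\<Sum>l\<le>M. L2_inner (h l) (h l)))"
  proof -
    have "r ^ d * 2 ^ d * real M ^ d = (r * 2 * real M) ^ d" by (simp add: power_mult_distrib)
    also have "\<dots> = 1" using M by (simp add: r_def)
    finally have e: "r ^ d * (2 ^ d * real M ^ d) = 1" by (simp add: mult.assoc)
    have "om * r ^ CARD('n) * (mz_const d * \<kappa> * real M ^ d * (\<Sum>l\<le>M. L2_inner (h l) (h l)))
       = (r ^ d * (2 ^ d * real M ^ d)) * (\<kappa> * (3 * om * (real CARD('n) * 2 ^ CARD('n) * r) * (\<Sum>l\<le>M. L2_inner (h l) (h l))))"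
      unfolding n mz_const_def by (simp only: power_Suc mult_ac)
    then show ?thesis unfolding e mult_1_left by (rule sym)
  qed
  finally show ?thesis
    unfolding p_def using om r by (simp add: mult_le_cancel_left_pos)
qed

section \<open>Design points in a cap\<close>

fun chebyshev :: "nat \<Rightarrow> real \<Rightarrow> real" where
  "chebyshev 0 t = 1"
| "chebyshev (Suc 0) t = t"
| "chebyshev (Suc (Suc k)) t = 2 * t * chebyshev (Suc k) t - chebyshev k t"

lemma chebyshev_cos: "chebyshev k (cos \<theta>) = cos (real k * \<theta>)"
proof (induction k "cos \<theta>" rule: chebyshev.induct)
  case (3 k)
  have a: "real (Suc (Suc k)) * \<theta> = real (Suc k) * \<theta> + \<theta>" "real k * \<theta> = real (Suc k) * \<theta> - \<theta>"
    by (simp_all add: algebra_simps)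
  show ?case using 3 unfolding chebyshev.simps a cos_add cos_diff by simp
qed auto

lemma polyfun_chebyshev: "polyfun k (\<lambda>y. chebyshev k (y \<bullet> a))"
proof (induction k "0 :: real" rule: chebyshev.induct)
  case (3 k)
  have "polyfun (Suc k + 1) (\<lambda>y. (y \<bullet> a) * chebyshev (Suc k) (y \<bullet> a))"
    by (rule polyfun_mult_hpoly[OF 3(1) hpoly_inner]) simp
  from polyfun_plus[OF polyfun_cmult[OF this, of 2] polyfun_cmult[OF polyfun_mono[OF 3(2)], of _ "-1"], simplified]
  show ?case by (simp add: mult.assoc)
qed (auto intro: polyfun_const polyfun_hpoly hpoly_inner)

text \<open>The Dirichlet kernel written in \<open>t = cos \<theta>\<close>, so that inserting
  \<open>y \<bullet> a\<close> gives a polynomial of degree at most \<open>K\<close> concentrated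
  near \<open>a\<close>.\<close>

definition dirichlet :: "nat \<Rightarrow> real \<Rightarrow> real" where
  "dirichlet K t = 1 + 2 * (\<Sum>k=1..K. chebyshev k t)"

lemma polyfun_dirichlet: "polyfun K (\<lambda>y. dirichlet K (y \<bullet> a))"
  unfolding dirichlet_def
  by (intro polyfun_plus polyfun_const polyfun_cmult polyfun_sum polyfun_mono[OF polyfun_chebyshev]) auto

text \<open>The closed form is kept multiplied by \<open>sin (\<theta> / 2)\<close> so that it also
  holds where that factor vanishes; increasing \<open>K\<close> by one adds a difference of two
  sines.\<close>

lemma dirichlet_identity: "sin (\<theta> / 2) * dirichlet K (cos \<theta>) = sin ((real K + 1 / 2) * \<theta>)"
proof (induction K)
  case 0 show ?case by (simp add: dirichlet_def)
next
  case (Suc K)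
  have "sin ((real (Suc K) + 1 / 2) * \<theta>) = sin (real (Suc K) * \<theta> + \<theta> / 2)"
    and "sin ((real K + 1 / 2) * \<theta>) = sin (real (Suc K) * \<theta> - \<theta> / 2)"
    by (rule arg_cong[where f = sin], simp add: field_simps)+
  then have "sin ((real (Suc K) + 1 / 2) * \<theta>) = sin ((real K + 1 / 2) * \<theta>) + 2 * sin (\<theta> / 2) * cos (real (Suc K) * \<theta>)"
    by (simp only: sin_add sin_diff) simp
  moreover have "dirichlet (Suc K) (cos \<theta>) = dirichlet K (cos \<theta>) + 2 * cos (real (Suc K) * \<theta>)"
    by (simp add: dirichlet_def chebyshev_cos)
  ultimately show ?case using Suc by (simp only: distrib_left)
qed

lemma abs_sin_mult_le: "\<bar>sin (real k * \<phi>)\<bar> \<le> real k * \<bar>sin \<phi>\<bar>"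
proof (induction k)
  case (Suc k)
  have eq: "real (Suc k) * \<phi> = real k * \<phi> + \<phi>" by (simp add: algebra_simps)
  have "\<bar>sin (real (Suc k) * \<phi>)\<bar> = \<bar>sin (real k * \<phi>) * cos \<phi> + cos (real k * \<phi>) * sin \<phi>\<bar>"
    by (simp only: eq sin_add)
  also have "\<dots> \<le> \<bar>sin (real k * \<phi>)\<bar> * \<bar>cos \<phi>\<bar> + \<bar>cos (real k * \<phi>)\<bar> * \<bar>sin \<phi>\<bar>"
    by (rule order_trans[OF abs_triangle_ineq]) (simp add: abs_mult)
  also have "\<dots> \<le> \<bar>sin (real k * \<phi>)\<bar> * 1 + 1 * \<bar>sin \<phi>\<bar>"
    by (intro add_mono mult_mono) auto
  also have "\<dots> \<le> real (Suc k) * \<bar>sin \<phi>\<bar>" using Suc by (simp add: algebra_simps)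
  finally show ?case .
qed simp

text \<open>With \<open>\<theta>\<close> the angle between \<open>x\<close> and \<open>a\<close>,
  the distance is \<open>2 * \<bar>sin (\<theta> / 2)\<bar>\<close>. The trivial bound counts the
  summands, the decay is read off the closed form, and the lower bound holds because every
  \<open>cos (k * \<theta>)\<close> with \<open>k \<le> K\<close> is at least \<open>1/2\<close>
  when \<open>K * dist x a \<le> 1\<close>.\<close>

lemma dirichlet_bounds:
  fixes x a :: "real ^ 'n"
  assumes x: "norm x = 1" and a: "norm a = 1"
  shows "\<bar>dirichlet K (x \<bullet> a)\<bar> \<le> 2 * real K + 1"
    and "dist x a * \<bar>dirichlet K (x \<bullet> a)\<bar> \<le> 2"
    and "real K * dist x a \<le> 1 \<Longrightarrow> real K + 1 \<le> dirichlet K (x \<bullet> a)"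
proof -
  define \<theta> where "\<theta> = arccos (x \<bullet> a)"
  have "\<bar>x \<bullet> a\<bar> \<le> 1" using Cauchy_Schwarz_ineq2[of x a] x a by simp
  then have c: "x \<bullet> a = cos \<theta>" by (simp add: \<theta>_def cos_arccos_abs)
  have "(dist x a)\<^sup>2 = 2 - 2 * cos \<theta>"
    using x a by (simp add: dist_norm power2_norm_eq_inner inner_diff c[symmetric] norm_eq_1 inner_commute)
  also have "\<dots> = (2 * sin (\<theta> / 2))\<^sup>2"
    using cos_double_sin[of "\<theta> / 2"] by (simp add: power_mult_distrib)
  finally have "\<bar>dist x a\<bar> = \<bar>2 * sin (\<theta> / 2)\<bar>" unfolding power2_eq_iff by (metis abs_minus_cancel)
  then have dist: "dist x a = 2 * \<bar>sin (\<theta> / 2)\<bar>" by (simp add: abs_mult)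
  have cb: "\<bar>chebyshev k (x \<bullet> a)\<bar> \<le> 1" for k unfolding c chebyshev_cos by simp
  have "\<bar>dirichlet K (x \<bullet> a)\<bar> \<le> 1 + 2 * (\<Sum>k=1..K. \<bar>chebyshev k (x \<bullet> a)\<bar>)"
    unfolding dirichlet_def
    by (rule order_trans[OF abs_triangle_ineq]) (simp add: abs_mult sum_abs)
  also have "\<dots> \<le> 1 + 2 * (\<Sum>k=1..K. 1)" by (intro add_left_mono mult_left_mono sum_mono cb) auto
  finally show "\<bar>dirichlet K (x \<bullet> a)\<bar> \<le> 2 * real K + 1" by simp
  have "dist x a * \<bar>dirichlet K (x \<bullet> a)\<bar> = 2 * \<bar>sin (\<theta> / 2) * dirichlet K (cos \<theta>)\<bar>"
    by (simp add: dist c abs_mult)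
  also have "\<dots> \<le> 2" unfolding dirichlet_identity by simp
  finally show "dist x a * \<bar>dirichlet K (x \<bullet> a)\<bar> \<le> 2" .
  assume Kd: "real K * dist x a \<le> 1"
  have "1/2 \<le> chebyshev k (x \<bullet> a)" if k: "k \<le> K" for k
  proof -
    have "\<bar>sin (real k * (\<theta> / 2))\<bar> \<le> real k * \<bar>sin (\<theta> / 2)\<bar>" by (rule abs_sin_mult_le)
    also have "\<dots> \<le> real K * \<bar>sin (\<theta> / 2)\<bar>" using k by (intro mult_right_mono) auto
    also have "\<dots> \<le> 1/2" using Kd by (simp add: dist)
    finally have "\<bar>sin (real k * (\<theta> / 2))\<bar>\<^sup>2 \<le> (1/2)\<^sup>2" by (intro power_mono) auto
    then have s: "(sin (real k * (\<theta> / 2)))\<^sup>2 \<le> 1/4" by (simp add: power_divide)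
    have "cos (real k * \<theta>) = cos (2 * (real k * (\<theta> / 2)))" by simp
    also have "\<dots> = 1 - 2 * (sin (real k * (\<theta> / 2)))\<^sup>2" by (rule cos_double_sin)
    finally show ?thesis using s unfolding c chebyshev_cos by linarith
  qed
  then have "(\<Sum>k=1..K. 1/2) \<le> (\<Sum>k=1..K. chebyshev k (x \<bullet> a))" by (intro sum_mono) auto
  then show "real K + 1 \<le> dirichlet K (x \<bullet> a)" by (simp add: dirichlet_def)
qed

text \<open>Dyadic caps around \<open>a\<close>: at scale \<open>j\<close> the kernel is at most
  \<open>m * 2 / 2 ^ j\<close>, while the cap has measure of order \<open>(2 ^ j / m) ^ d\<close>.
  The exponent \<open>2 * q > d\<close> makes the resulting series in \<open>j\<close> geometric
  with ratio \<open>1/2\<close>, which accounts for the last factor \<open>2\<close> of the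
  constant.\<close>

lemma dirichlet_power_integral:
  fixes a :: "real ^ 'n"
  assumes a: "norm a = 1" and n: "CARD('n) = Suc d" and q: "2 * q \<ge> Suc d"
  shows "(\<integral>y. dirichlet K (y \<bullet> a) ^ (2 * q) \<partial>sphere_measure) \<le>
    2 ^ (2 * q + 2 * d + 3) * (2 * real K + 1) ^ (2 * q) / (2 * real K + 1) ^ d"
proof -
  define m where "m = 2 * real K + 1"
  have m: "m \<ge> 1" by (simp add: m_def)
  \<comment> \<open>Large enough that \<open>m \<le> 2 ^ J\<close>; the last cap then has radius at
    least \<open>2\<close> and is the whole sphere.\<close>
  define J where "J = 2 * K + 1"
  have mJ: "m \<le> 2 ^ J"
  proof -
    have "m = real J" by (simp add: m_def J_def)
    also have "\<dots> \<le> real (2 ^ J)" by (intro of_nat_mono less_imp_le less_exp)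
    finally show ?thesis by simp
  qed
  let ?C = "\<lambda>j. {x \<in> sphere 0 1. dist x a \<le> 2 * 2 ^ j / m}"
  have Csets: "?C j \<in> sets sphere_measure" for j
  proof -
    have "?C j = sphere 0 1 \<inter> cball a (2 * 2 ^ j / m)" by (auto simp: dist_commute)
    then have "closed (?C j)" by (simp add: closed_Int)
    then show ?thesis by (auto simp: sets_sphere_measure_iff borel_closed)
  qed
  have pw: "dirichlet K (y \<bullet> a) ^ (2 * q) \<le> (\<Sum>j\<le>J. m ^ (2 * q) * (2 / 2 ^ j) ^ (2 * q) * indicator (?C j) y)"
    if y: "y \<in> sphere 0 1" for y
  proof -
    have ny: "norm y = 1" using y by simp
    note b = dirichlet_bounds[OF ny a, of K, folded m_def]
    have ev: "dirichlet K (y \<bullet> a) ^ (2 * q) = \<bar>dirichlet K (y \<bullet> a)\<bar> ^ (2 * q)" by (simp add: power_even_abs)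
    have "dist y a \<le> 2" using norm_triangle_ineq4[of y a] ny a by (simp add: dist_norm)
    then have ex: "m * dist y a / 2 \<le> 2 ^ J" using mJ mult_mono[of m "2 ^ J" "dist y a" 2] m by simp
    \<comment> \<open>The smallest cap containing \<open>y\<close>. For \<open>j = 0\<close> the
      trivial bound is enough; otherwise minimality gives \<open>dist y a > 2 ^ j / m\<close>, and
      the decay of the kernel applies.\<close>
    define j where "j = (LEAST j. m * dist y a / 2 \<le> 2 ^ j)"
    have j: "m * dist y a / 2 \<le> 2 ^ j" unfolding j_def by (rule LeastI[of _ J]) (rule ex)
    have jJ: "j \<le> J" unfolding j_def by (rule Least_le) (rule ex)
    have inC: "y \<in> ?C j" using j y m by (simp add: field_simps)
    have "\<bar>dirichlet K (y \<bullet> a)\<bar> \<le> m * (2 / 2 ^ j)"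
    proof (cases "j = 0")
      case True then show ?thesis using b(1) m by simp
    next
      case False
      then have "\<not> (m * dist y a / 2 \<le> 2 ^ (j - 1))" unfolding j_def using not_less_Least[of "j - 1"] by (metis False diff_less j_def less_one not_gr_zero)
      moreover have "(2::real) ^ j = 2 * 2 ^ (j - 1)" using False by (cases j) auto
      ultimately have big: "2 ^ j < m * dist y a" by simp
      then have dpos: "dist y a > 0" using m by (metis less_eq_real_def mult_zero_right not_less_iff_gr_or_eq zero_le_dist zero_less_numeral zero_less_power)
      have "\<bar>dirichlet K (y \<bullet> a)\<bar> \<le> 2 / dist y a" using b(2) dpos by (simp add: field_simps)
      also have "\<dots> \<le> m * (2 / 2 ^ j)" using big dpos by (simp add: field_simps)
      finally show ?thesis .
    qed
    then have "dirichlet K (y \<bullet> a) ^ (2 * q) \<le> (m * (2 / 2 ^ j)) ^ (2 * q)"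
      unfolding ev by (intro power_mono) auto
    also have "\<dots> = m ^ (2 * q) * (2 / 2 ^ j) ^ (2 * q) * indicator (?C j) y"
      unfolding power_mult_distrib using inC by simp
    also have "\<dots> \<le> (\<Sum>j\<le>J. m ^ (2 * q) * (2 / 2 ^ j) ^ (2 * q) * indicator (?C j) y)"
      using jJ m by (intro member_le_sum) auto
    finally show ?thesis .
  qed
  have cont: "continuous_on (sphere 0 1) (\<lambda>y. dirichlet K (y \<bullet> a) ^ (2 * q))"
    by (intro continuous_intros polyfun_continuous_on[OF polyfun_dirichlet])
  have indi: "integrable sphere_measure (indicator (?C j) :: real ^ 'n \<Rightarrow> real)" for j
    using Csets by (intro integrable_real_indicator) (auto simp: sphere.emeasure_finite less_top[symmetric])
  have "(\<integral>y. dirichlet K (y \<bullet> a) ^ (2 * q) \<partial>sphere_measure) \<le>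
     (\<integral>y. (\<Sum>j\<le>J. m ^ (2 * q) * (2 / 2 ^ j) ^ (2 * q) * indicator (?C j) y) \<partial>sphere_measure)"
    by (intro integral_mono integrable_continuous_sphere[OF cont] Bochner_Integration.integrable_sum integrable_mult_right indi pw)
      (simp add: space_sphere_measure)
  also have "\<dots> = (\<Sum>j\<le>J. m ^ (2 * q) * (2 / 2 ^ j) ^ (2 * q) * measure sphere_measure (?C j))"
  proof -
    have 1: "(\<integral>y. c * indicator (?C j) y \<partial>sphere_measure) = c * measure sphere_measure (?C j)" for c :: real and j
      using sets.Int_space_eq2[OF Csets[of j]] by (simp only: integral_mult_right_zero Bochner_Integration.integral_indicator)
    show ?thesis
      by (subst Bochner_Integration.integral_sum) (intro integrable_mult_right indi, simp only: 1)
  qed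
  also have "\<dots> \<le> (\<Sum>j\<le>J. m ^ (2 * q) * (2 / 2 ^ j) ^ (2 * q) * (2 ^ (d + 2) * (2 * 2 ^ j / m) ^ d))"
    using m by (intro sum_mono mult_left_mono sphere_cap_bound[OF a _ n]) auto
  also have "\<dots> \<le> (\<Sum>j\<le>J. (2 ^ (2 * q + 2 * d + 2) * m ^ (2 * q) / m ^ d) * (1 / 2) ^ j)"
  proof (rule sum_mono)
    fix j
    have "((2 ^ j) ^ d :: real) * 2 ^ j = (2 ^ j) ^ Suc d" by simp
    also have "\<dots> \<le> (2 ^ j) ^ (2 * q)" using q by (intro power_increasing) auto
    finally have "((2 ^ j) ^ d :: real) / (2 ^ j) ^ (2 * q) \<le> 1 / 2 ^ j" by (simp add: field_simps)
    then have "(2 ^ (2 * q + 2 * d + 2) * m ^ (2 * q) / m ^ d) * ((2 ^ j) ^ d / (2 ^ j) ^ (2 * q)) \<le> (2 ^ (2 * q + 2 * d + 2) * m ^ (2 * q) / m ^ d) * (1 / 2 ^ j)"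
      using m by (intro mult_left_mono) auto
    moreover have "m ^ (2 * q) * (2 / 2 ^ j) ^ (2 * q) * (2 ^ (d + 2) * (2 * 2 ^ j / m) ^ d) =
       (2 ^ (2 * q + 2 * d + 2) * m ^ (2 * q) / m ^ d) * ((2 ^ j) ^ d / (2 ^ j) ^ (2 * q))"
    proof -
      have "(2::real) ^ (2 * q + 2 * d + 2) = 2 ^ (2 * q) * 2 ^ (d + 2) * 2 ^ d"
        by (simp flip: power_add)
      then show ?thesis by (simp add: power_mult_distrib power_divide mult_ac)
    qed
    ultimately show "m ^ (2 * q) * (2 / 2 ^ j) ^ (2 * q) * (2 ^ (d + 2) * (2 * 2 ^ j / m) ^ d) \<le>
       (2 ^ (2 * q + 2 * d + 2) * m ^ (2 * q) / m ^ d) * (1 / 2) ^ j"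
      by (simp add: power_one_over)
  qed
  also have "\<dots> = (2 ^ (2 * q + 2 * d + 2) * m ^ (2 * q) / m ^ d) * (\<Sum>j\<le>J. (1 / 2) ^ j)"
    by (simp only: sum_distrib_left)
  also have "\<dots> \<le> (2 ^ (2 * q + 2 * d + 2) * m ^ (2 * q) / m ^ d) * 2"
  proof (rule mult_left_mono)
    have "(\<Sum>j\<le>J. (1 / 2 :: real) ^ j) = 2 - (1 / 2) ^ J"
      by (induction J) (auto simp: field_simps)
    then show "(\<Sum>j\<le>J. (1 / 2 :: real) ^ j) \<le> 2" by simp
  qed (use m in simp)
  also have "\<dots> = 2 ^ (2 * q + 2 * d + 3) * m ^ (2 * q) / m ^ d" by (simp add: power_add numeral_3_eq_3)
  finally show ?thesis unfolding m_def .
qed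

lemma spherical_design_norm: "spherical_design t n x \<Longrightarrow> j \<in> {1..n} \<Longrightarrow> norm (x j) = 1"
  unfolding spherical_design_def by (metis image_subset_iff mem_sphere_0)

text \<open>With \<open>q = Suc d\<close>: \<open>2 ^ (2 * q + 2 * d + 3)\<close> is the constant of
  \<open>dirichlet_power_integral\<close>, another \<open>2 ^ (2 * q)\<close> stems from the lower
  bound \<open>m / 2\<close> for the kernel on the cap, and \<open>q ^ d\<close> from replacing
  \<open>m\<close> by \<open>L / q\<close>.\<close>

definition cap_const :: "nat \<Rightarrow> real" where
  "cap_const d = real (Suc d) ^ d * 2 ^ (4 * Suc d + 2 * d + 3)"

text \<open>The even power of the kernel is nonnegative, has degree at most
  \<open>2 * q * K \<le> 2 * L\<close> and is large on the cap. The design averages it exactly, so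
  few points can lie in the cap.\<close>

lemma design_cap_count:
  fixes x :: "nat \<Rightarrow> real ^ 'n"
  assumes des: "spherical_design t n x" and t: "t \<ge> 2 * L" and L: "L \<ge> 1"
    and n: "CARD('n) = Suc d" and a: "norm a = 1"
  shows "real (card {j \<in> {1..n}. dist (x j) a \<le> 1 / real L}) \<le> cap_const d * real n / real L ^ d"
proof -
  define q where "q = Suc d"
  \<comment> \<open>\<open>K = 0\<close> is allowed: then \<open>m = 1\<close>, and the estimate
    \<open>L < q * (K + 1) \<le> q * m\<close> used at the end still holds.\<close>
  define K where "K = L div q"
  define m where "m = 2 * real K + 1"
  let ?J = "\<lambda>y. dirichlet K (y \<bullet> a) ^ (2 * q)"
  let ?S = "{j \<in> {1..n}. dist (x j) a \<le> 1 / real L}"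
  note xs = spherical_design_norm[OF des]
  have n1: "n \<ge> 1"
    and ex: "\<And>p. p \<in> polynomials_upto t \<Longrightarrow> (1 / real n) * (\<Sum>i=1..n. p (x i)) = (\<integral>y. p y \<partial>sphere_measure)"
    using des by (auto simp: spherical_design_def)
  have KL: "K * q \<le> L" by (simp add: K_def)
  have "polyfun (2 * q * K) ?J" by (rule polyfun_power[OF polyfun_dirichlet])
  moreover have "2 * q * K \<le> t" using KL t by (simp add: mult.commute[of q] mult.assoc)
  ultimately have "?J \<in> polynomials_upto t" using polyfun_imp_polynomials_upto polyfun_mono by blast
  from ex[OF this] n1 have sumJ: "(\<Sum>i=1..n. ?J (x i)) = real n * (\<integral>y. ?J y \<partial>sphere_measure)"
    by (simp add: field_simps)
  have KL': "K \<le> L" unfolding K_def by (rule div_le_dividend)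
  have m1: "m \<ge> 1" by (simp add: m_def)
  have "real (card ?S) * (m / 2) ^ (2 * q) = (\<Sum>i\<in>?S. (m / 2) ^ (2 * q))" by simp
  also have "\<dots> \<le> (\<Sum>i\<in>?S. ?J (x i))"
  proof (rule sum_mono)
    fix i assume i: "i \<in> ?S"
    have "real K * dist (x i) a \<le> real L * (1 / real L)" using i KL' by (intro mult_mono) auto
    then have "real K * dist (x i) a \<le> 1" using L by simp
    from dirichlet_bounds(3)[OF xs a this] i have "real K + 1 \<le> dirichlet K (x i \<bullet> a)" by simp
    then show "(m / 2) ^ (2 * q) \<le> ?J (x i)" by (intro power_mono) (auto simp: m_def)
  qed
  also have "\<dots> \<le> (\<Sum>i=1..n. ?J (x i))" by (intro sum_mono2) (auto simp: zero_le_even_power)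
  also have "\<dots> \<le> real n * (2 ^ (2 * q + 2 * d + 3) * m ^ (2 * q) / m ^ d)"
    unfolding sumJ m_def by (intro mult_left_mono dirichlet_power_integral[OF a n]) (auto simp: q_def)
  finally have 1: "real (card ?S) * (m / 2) ^ (2 * q) \<le> real n * (2 ^ (2 * q + 2 * d + 3) * m ^ (2 * q) / m ^ d)" .
  have "real (card ?S) = (real (card ?S) * (m / 2) ^ (2 * q)) * (2 ^ (2 * q) / m ^ (2 * q))"
    using m1 by (simp add: power_divide)
  also have "\<dots> \<le> (real n * (2 ^ (2 * q + 2 * d + 3) * m ^ (2 * q) / m ^ d)) * (2 ^ (2 * q) / m ^ (2 * q))"
    using m1 by (intro mult_right_mono 1) auto
  also have "\<dots> = real n * 2 ^ (4 * q + 2 * d + 3) * (1 / m ^ d)"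
  proof -
    have "(2::real) ^ (4 * q + 2 * d + 3) = 2 ^ (2 * q) * 2 ^ (2 * q + 2 * d + 3)" by (simp flip: power_add)
    then show ?thesis using m1 by simp
  qed
  also have "\<dots> \<le> real n * 2 ^ (4 * q + 2 * d + 3) * (real q ^ d / real L ^ d)"
  proof (rule mult_left_mono)
    have "L < q * (K + 1)" unfolding K_def using dividend_less_times_div[of q L] by (simp add: q_def)
    then have "real L \<le> real (q * (K + 1))" by linarith
    also have "\<dots> \<le> real q * m" unfolding of_nat_mult by (intro mult_left_mono) (auto simp: m_def)
    finally have "real L ^ d \<le> (real q * m) ^ d" by (intro power_mono) auto
    then show "1 / m ^ d \<le> real q ^ d / real L ^ d"
      using m1 L by (simp add: power_mult_distrib field_simps)
  qed simp
  also have "\<dots> = cap_const d * real n / real L ^ d" by (simp add: cap_const_def q_def)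
  finally show ?thesis .
qed

definition design_const :: "nat \<Rightarrow> real" where
  "design_const d = mz_const d * cap_const d"

lemma design_const_pos: "design_const d > 0"
  by (simp add: design_const_def mz_const_def cap_const_def)

text \<open>For \<open>M \<ge> L\<close> the caps of radius \<open>1 / M\<close> lie in those of
  radius \<open>1 / L\<close>, whose point count the design controls. Counting at the coarser scale
  is what produces the factor \<open>(M / L) ^ d\<close>.\<close>

lemma design_point_sum:
  fixes x :: "nat \<Rightarrow> real ^ 'n" and h :: "nat \<Rightarrow> real ^ 'n \<Rightarrow> real"
  assumes des: "spherical_design t n x" and t: "t \<ge> 2 * L" and L: "L \<ge> 1" and M: "M \<ge> L"
    and n: "CARD('n) = Suc d" and d: "d \<ge> 1" and h: "\<And>l. harmonic_poly l (h l)"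
  shows "(\<Sum>i=1..n. (\<Sum>l\<le>M. h l (x i))\<^sup>2) \<le> design_const d * real n * (real M / real L) ^ d * (\<Sum>l\<le>M. L2_inner (h l) (h l))"
proof -
  note xs = spherical_design_norm[OF des]
  have n1: "{1..n} \<noteq> {}" using des by (auto simp: spherical_design_def)
  have "(\<Sum>i\<in>{1..n}. (\<Sum>l\<le>M. h l (x i))\<^sup>2) \<le> mz_const d * (cap_const d * real n / real L ^ d) * real M ^ d * (\<Sum>l\<le>M. L2_inner (h l) (h l))"
  proof (rule point_sum_bound[OF h n d])
    show "M \<ge> 1" using L M by simp
    fix i assume i: "i \<in> {1..n}"
    have "1 / real M \<le> 1 / real L" using M L by (simp add: frac_le)
    then have "{j \<in> {1..n}. dist (x j) (x i) \<le> 1 / real M} \<subseteq> {j \<in> {1..n}. dist (x j) (x i) \<le> 1 / real L}" by force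
    then have "real (card {j \<in> {1..n}. dist (x j) (x i) \<le> 1 / real M}) \<le> real (card {j \<in> {1..n}. dist (x j) (x i) \<le> 1 / real L})"
      by (intro of_nat_mono card_mono) auto
    also have "\<dots> \<le> cap_const d * real n / real L ^ d" by (rule design_cap_count[OF des t L n xs[OF i]])
    finally show "real (card {j \<in> {1..n}. dist (x j) (x i) \<le> 1 / real M}) \<le> cap_const d * real n / real L ^ d" .
  qed (use xs n1 in auto)
  then show ?thesis by (simp add: design_const_def power_divide field_simps)
qed

text \<open>The case of a single point, with \<open>\<kappa> = 1\<close>. Its factor
  \<open>M ^ d\<close> is too large for the rate; it serves the uniform convergence of the
  expansion.\<close>

lemma harmonic_sum_sup_bound:
  fixes h :: "nat \<Rightarrow> real ^ 'n \<Rightarrow> real"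
  assumes n: "CARD('n) = Suc d" and d: "d \<ge> 1" and M: "M \<ge> 1" and h: "\<And>l. harmonic_poly l (h l)" and x: "norm x = 1"
  shows "(\<Sum>l\<le>M. h l x)\<^sup>2 \<le> mz_const d * real M ^ d * (\<Sum>l\<le>M. L2_inner (h l) (h l))"
  using point_sum_bound[OF h n d M, of "{0::nat}" "\<lambda>_. x" 1] x by simp

section \<open>Dyadic decomposition in Sobolev balls\<close>

locale sobolev_function =
  fixes d :: nat and N :: "nat \<Rightarrow> nat" and Y :: "nat \<Rightarrow> nat \<Rightarrow> real ^ 'n \<Rightarrow> real"
    and s R :: real and f :: "real ^ 'n \<Rightarrow> real"
  assumes d: "d \<ge> 1" and card: "CARD('n) = Suc d" and s: "s > real d / 2"
    and basis: "harmonic_basis d N Y" and R: "R \<ge> 0" and f: "f \<in> sobolev_ball d N Y s R"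
begin

definition "coef l m = L2_inner f (Y l m)"
definition "energy l = (\<Sum>m=1..N l. (coef l m)\<^sup>2)"
text \<open>The functions \<open>Y l m\<close> are prescribed only on the sphere. A harmonic
  polynomial representative makes \<open>hcomp\<close> harmonic on the whole space, as the point sum
  bounds require.\<close>

definition "Ypoly l m = (SOME h. harmonic_poly l h \<and> (\<forall>x\<in>sphere 0 1. Y l m x = h x))"
definition "hcomp l x = (\<Sum>m=1..N l. coef l m * Ypoly l m x)"
definition "partial M x = (\<Sum>l\<le>M. hcomp l x)"

lemma Y_SH: "m \<in> {1..N l} \<Longrightarrow> Y l m \<in> spherical_harmonics d l"
  and Y_on: "m \<in> {1..N l} \<Longrightarrow> m' \<in> {1..N l} \<Longrightarrow> L2_inner (Y l m) (Y l m') = (if m = m' then 1 else 0)"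
  using basis by (simp_all add: harmonic_basis_def)

lemma Ypoly:
  assumes "m \<in> {1..N l}"
  shows "harmonic_poly l (Ypoly l m)" "\<And>x. x \<in> sphere 0 1 \<Longrightarrow> Y l m x = Ypoly l m x"
  using someI_ex[OF spherical_harmonics_eq_harmonic_poly[OF basis card d Y_SH[OF assms]]]
  unfolding Ypoly_def by auto

lemma Y_L2: "m \<in> {1..N l} \<Longrightarrow> Y l m \<in> L2_sphere"
  by (rule spherical_harmonics_L2[OF Y_SH])

lemma Y_orthonormal:
  assumes "m \<in> {1..N l}" "m' \<in> {1..N l'}"
  shows "L2_inner (Y l m) (Y l' m') = (if l = l' \<and> m = m' then 1 else 0)"
  using Y_on assms spherical_harmonics_orthogonal[OF Y_SH[OF assms(1)] Y_SH[OF assms(2)] _ d]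
  by (cases "l = l'") auto

lemma f_L2: "f \<in> L2_sphere"
  using f by (simp add: sobolev_ball_def)

lemma hcomp_harmonic: "harmonic_poly l (hcomp l)"
  unfolding hcomp_def[abs_def] by (intro harmonic_poly_sum harmonic_poly_cmult Ypoly(1))

lemma hcomp_L2: "hcomp l \<in> L2_sphere" by (rule harmonic_poly_L2[OF hcomp_harmonic])

lemma hcomp_sphere: "x \<in> sphere 0 1 \<Longrightarrow> hcomp l x = (\<Sum>m=1..N l. coef l m * Y l m x)"
  unfolding hcomp_def by (intro sum.cong refl) (simp only: Ypoly(2))

lemma hcomp_inner_Y:
  assumes "m \<in> {1..N l'}"
  shows "L2_inner (hcomp l) (Y l' m) = (if l = l' then coef l' m else 0)"
proof -
  have "L2_inner (hcomp l) (Y l' m) = L2_inner (\<lambda>x. \<Sum>m=1..N l. coef l m * Y l m x) (Y l' m)"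
    by (rule L2_inner_cong) (rule hcomp_sphere refl, assumption?)+
  also have "\<dots> = (\<Sum>k=1..N l. coef l k * L2_inner (Y l k) (Y l' m))"
    by (rule L2_inner_lincomb(1)[OF Y_L2 Y_L2[OF assms]])
  also have "\<dots> = (\<Sum>k=1..N l. if k = m then (if l = l' then coef l' m else 0) else 0)"
    using assms by (intro sum.cong) (auto simp: Y_orthonormal)
  finally show ?thesis using assms by auto
qed

lemma hcomp_energy: "L2_inner (hcomp l) (hcomp l) = energy l"
proof -
  have "L2_inner (hcomp l) (hcomp l) = L2_inner (hcomp l) (\<lambda>x. \<Sum>m=1..N l. coef l m * Y l m x)"
    by (rule L2_inner_cong) (rule hcomp_sphere refl, assumption?)+
  also have "\<dots> = (\<Sum>m=1..N l. coef l m * L2_inner (hcomp l) (Y l m))"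
    by (rule L2_inner_lincomb(2)[OF Y_L2 hcomp_L2])
  also have "\<dots> = energy l" unfolding energy_def by (intro sum.cong refl) (simp add: hcomp_inner_Y power2_eq_square)
  finally show ?thesis .
qed

lemma energy_nonneg: "energy l \<ge> 0"
  by (simp add: energy_def sum_nonneg)

lemma eigenvalue_ge: "(real l)\<^sup>2 \<le> 1 + harmonic_eigenvalue d l"
proof -
  have "real l * real l \<le> real l * (real l + real d - 1)" using d by (intro mult_left_mono) auto
  then show ?thesis by (simp add: harmonic_eigenvalue_def power2_eq_square)
qed

text \<open>The Sobolev weight is at least the square of \<open>L powr s\<close> on degrees from
  \<open>L\<close> on. The finite set \<open>A\<close> makes the estimate applicable both to single
  blocks and to unions of blocks without infinite sums.\<close>

lemma energy_tail:
  assumes A: "finite A" "\<And>l. l \<in> A \<Longrightarrow> l \<ge> L" and L: "L \<ge> 1"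
  shows "(\<Sum>l\<in>A. energy l) \<le> (real L powr (- s) * R)\<^sup>2"
proof -
  have s0: "s > 0" using s by (meson divide_nonneg_nonneg of_nat_0_le_iff le_less_trans zero_le_numeral)
  have "(\<Sum>l\<in>A. ennreal ((1 + harmonic_eigenvalue d l) powr s * energy l)) \<le> sobolev_norm_sq d N Y s f"
    unfolding sobolev_norm_sq_def energy_def coef_def by (rule sum_le_suminf[OF summableI A(1)]) auto
  also have "\<dots> \<le> ennreal (R\<^sup>2)" using f by (simp add: sobolev_ball_def)
  finally have "ennreal (\<Sum>l\<in>A. (1 + harmonic_eigenvalue d l) powr s * energy l) \<le> ennreal (R\<^sup>2)"
    by (subst sum_ennreal[symmetric]) (auto intro: mult_nonneg_nonneg energy_nonneg)
  then have 1: "(\<Sum>l\<in>A. (1 + harmonic_eigenvalue d l) powr s * energy l) \<le> R\<^sup>2" by (simp add: ennreal_le_iff)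
  have "(real L powr s)\<^sup>2 * (\<Sum>l\<in>A. energy l) \<le> (\<Sum>l\<in>A. (1 + harmonic_eigenvalue d l) powr s * energy l)"
    unfolding sum_distrib_left
  proof (intro sum_mono mult_right_mono energy_nonneg)
    fix l assume "l \<in> A"
    then have "(real L)\<^sup>2 \<le> (real l)\<^sup>2" using A(2) by (intro power_mono) auto
    then have "(real L)\<^sup>2 \<le> 1 + harmonic_eigenvalue d l" using eigenvalue_ge[of l] by linarith
    then have "((real L)\<^sup>2) powr s \<le> (1 + harmonic_eigenvalue d l) powr s" using s0 by (intro powr_mono2) auto
    moreover have "((real L)\<^sup>2) powr s = (real L powr s)\<^sup>2"
      using L by (simp add: power2_eq_square powr_mult)
    ultimately show "(real L powr s)\<^sup>2 \<le> (1 + harmonic_eigenvalue d l) powr s" by simp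
  qed
  with 1 have "(real L powr s)\<^sup>2 * (\<Sum>l\<in>A. energy l) \<le> R\<^sup>2" by linarith
  moreover have "real L powr s > 0" using L by simp
  ultimately show ?thesis by (simp add: powr_minus power_mult_distrib field_simps power_inverse)
qed

section \<open>Dyadic blocks\<close>

definition "block L k x = partial (2 ^ Suc k * L) x - partial (2 ^ k * L) x"

text \<open>Block \<open>k\<close> has L2 norm at most \<open>(2 ^ k * L) powr (- s) * R\<close>,
  and passing to the design points costs, up to a constant, a further
  \<open>2 powr (k * d / 2)\<close>. Consecutive bounds differ by the factor \<open>ratio\<close>,
  which is below \<open>1\<close> because \<open>s > d / 2\<close>.\<close>

definition "ratio = 2 powr (real d / 2 - s)"

lemma ratio: "0 < ratio" "ratio < 1"
  using s by (auto simp: ratio_def powr_less_one)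

lemma block_eq:
  "block L k x = (\<Sum>l\<le>2 ^ Suc k * L. if l > 2 ^ k * L then hcomp l x else 0)"
proof -
  have sub: "{..2 ^ k * L} \<subseteq> {..2 ^ Suc k * L}" by auto
  have "(\<Sum>l\<le>2 ^ Suc k * L. hcomp l x) = (\<Sum>l\<in>{..2 ^ Suc k * L} - {..2 ^ k * L}. hcomp l x) + (\<Sum>l\<le>2 ^ k * L. hcomp l x)"
    by (rule sum.subset_diff[OF sub]) simp
  moreover have "(\<Sum>l\<in>{..2 ^ Suc k * L} - {..2 ^ k * L}. hcomp l x) = (\<Sum>l\<le>2 ^ Suc k * L. if l > 2 ^ k * L then hcomp l x else 0)"
    by (intro sum.mono_neutral_cong_left) auto
  ultimately show ?thesis by (simp add: block_def partial_def)
qed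

text \<open>Low components are replaced by zero so that a block becomes a sum over all
  \<open>l\<close> up to its top degree, the form in which the point sum bounds are stated.\<close>

definition "high M l = (if l > M then hcomp l else (\<lambda>x. 0))"

lemma high_harmonic: "harmonic_poly l (high M l)"
  unfolding high_def by (cases "l > M") (auto intro: hcomp_harmonic harmonic_poly_zero)

lemma block_high: "block L k x = (\<Sum>l\<le>2 ^ Suc k * L. high (2 ^ k * L) l x)"
  unfolding block_eq high_def by (intro sum.cong) auto

lemma block_energy:
  assumes L: "L \<ge> 1"
  shows "(\<Sum>l\<le>2 ^ Suc k * L. L2_inner (high (2 ^ k * L) l) (high (2 ^ k * L) l))
    \<le> (real (2 ^ k * L) powr (- s) * R)\<^sup>2"
proof -
  have "(\<Sum>l\<le>2 ^ Suc k * L. L2_inner (high (2 ^ k * L) l) (high (2 ^ k * L) l))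
    = (\<Sum>l\<in>{2 ^ k * L<..2 ^ Suc k * L}. energy l)"
    by (intro sum.mono_neutral_cong_right) (auto simp: hcomp_energy high_def)
  also have "\<dots> \<le> (real (2 ^ k * L) powr (- s) * R)\<^sup>2"
    by (rule energy_tail) (use L in auto)
  finally show ?thesis .
qed

lemma block_powr:
  assumes L: "L \<ge> 1"
  shows "(real (2 ^ k * L) powr (- s) * R)\<^sup>2 * real (2 ^ k) ^ d = (ratio ^ k * (real L powr (- s) * R))\<^sup>2"
proof -
  have "(real (2 ^ k) powr (- s))\<^sup>2 * real (2 ^ k) ^ d = (ratio ^ k)\<^sup>2"
  proof -
    have r: "ratio ^ k = real (2 ^ k) powr (real d / 2 - s)"
    proof -
      have "ratio ^ k = 2 powr (real k * (real d / 2 - s))"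
        using powr_realpow[of ratio k] ratio by (simp add: ratio_def powr_powr mult.commute)
      also have "\<dots> = (2 powr real k) powr (real d / 2 - s)" by (simp only: powr_powr)
      finally show ?thesis by (simp add: powr_realpow)
    qed
    have "real (2 ^ k) ^ d = real (2 ^ k) powr (real d)" by (subst powr_realpow) auto
    also have "\<dots> = (real (2 ^ k) powr (real d / 2))\<^sup>2"
      unfolding power2_eq_square powr_add[symmetric] by simp
    finally have "(real (2 ^ k) powr (- s))\<^sup>2 * real (2 ^ k) ^ d = (real (2 ^ k) powr (- s) * real (2 ^ k) powr (real d / 2))\<^sup>2"
      by (simp only: power_mult_distrib)
    also have "real (2 ^ k) powr (- s) * real (2 ^ k) powr (real d / 2) = real (2 ^ k) powr (real d / 2 - s)"
      unfolding powr_add[symmetric] by simp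
    finally show ?thesis unfolding r .
  qed
  note 1 = this
  have "real (2 ^ k * L) powr (- s) = real (2 ^ k) powr (- s) * real L powr (- s)"
    by (simp add: powr_mult)
  then have "(real (2 ^ k * L) powr (- s) * R)\<^sup>2 * real (2 ^ k) ^ d =
    ((real (2 ^ k) powr (- s))\<^sup>2 * real (2 ^ k) ^ d) * (real L powr (- s) * R)\<^sup>2"
    by (simp only: power_mult_distrib mult_ac)
  then show ?thesis unfolding 1 by (simp only: power_mult_distrib)
qed

lemma block_bound:
  assumes L: "L \<ge> 1" and x: "norm x = 1"
  shows "\<bar>block L k x\<bar> \<le> sqrt (mz_const d * 2 ^ d * real L ^ d) * (real L powr (- s) * R) * ratio ^ k"
proof -
  have mz: "mz_const d \<ge> 0" by (simp add: mz_const_def)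
  let ?b = "sqrt (mz_const d * 2 ^ d * real L ^ d) * (real L powr (- s) * R) * ratio ^ k"
  have b0: "?b \<ge> 0" using ratio R mz by simp
  have "(block L k x)\<^sup>2 \<le> mz_const d * real (2 ^ Suc k * L) ^ d * (real (2 ^ k * L) powr (- s) * R)\<^sup>2"
    unfolding block_high
    by (rule order_trans[OF harmonic_sum_sup_bound[OF card d _ high_harmonic x] mult_left_mono[OF block_energy[OF L]]])
      (use L mz in auto)
  also have "\<dots> = (mz_const d * 2 ^ d * real L ^ d) * ((real (2 ^ k * L) powr (- s) * R)\<^sup>2 * real (2 ^ k) ^ d)"
    by (simp add: power_mult_distrib mult_ac)
  also have "\<dots> = ?b\<^sup>2"
    unfolding block_powr[OF L] using mz by (simp add: power_mult_distrib mult_ac)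
  finally have "\<bar>block L k x\<bar> \<le> \<bar>?b\<bar>" by (simp only: abs_le_square_iff)
  then show ?thesis using b0 by linarith
qed

lemma sum_block: "(\<Sum>k<K. block L k x) = partial (2 ^ K * L) x - partial L x"
  unfolding block_def by (subst sum_lessThan_telescope[of "\<lambda>k. partial (2 ^ k * L) x"]) simp

section \<open>The continuous representative as a uniform limit\<close>

lemma partial_continuous: "continuous_on S (partial M)"
  unfolding partial_def[abs_def] by (intro continuous_intros harmonic_poly_continuous_on[OF hcomp_harmonic])

lemma partial_L2: "partial M \<in> L2_sphere"
  by (rule continuous_L2_sphere[OF partial_continuous])

lemma partial_inner_Y:
  assumes "m \<in> {1..N l}"
  shows "L2_inner (partial M) (Y l m) = (if l \<le> M then coef l m else 0)"
proof -
  have "L2_inner (partial M) (Y l m) = (\<Sum>l'\<le>M. L2_inner (hcomp l') (Y l m))"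
    unfolding partial_def[abs_def] by (rule L2_inner_sum[OF hcomp_L2 Y_L2[OF assms]])
  also have "\<dots> = (\<Sum>l'\<le>M. if l' = l then coef l m else 0)"
    using assms by (intro sum.cong) (auto simp: hcomp_inner_Y)
  finally show ?thesis by simp
qed

text \<open>\<open>L\<close> only anchors the dyadic grid; for each \<open>L \<ge> 1\<close> the
  result turns out to agree with \<open>cont_rep f\<close> on the sphere.\<close>

definition "limit_fun L x = partial L x + (\<Sum>k. block L k x)"

lemma uniform_limit_partial:
  assumes L: "L \<ge> 1"
  shows "uniform_limit (sphere 0 1) (\<lambda>K. partial (2 ^ K * L)) (limit_fun L) sequentially"
proof -
  have "uniform_limit (sphere 0 1) (\<lambda>K x. \<Sum>k<K. block L k x) (\<lambda>x. \<Sum>k. block L k x) sequentially"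
  proof (rule Weierstrass_m_test)
    show "summable (\<lambda>k. sqrt (mz_const d * 2 ^ d * real L ^ d) * (real L powr (- s) * R) * ratio ^ k)"
      using ratio by (intro summable_mult summable_geometric) auto
    show "norm (block L k x) \<le> sqrt (mz_const d * 2 ^ d * real L ^ d) * (real L powr (- s) * R) * ratio ^ k"
      if "x \<in> sphere 0 1" for k x using block_bound[OF L, of x k] that by simp
  qed
  moreover have "uniform_limit (sphere 0 1) (\<lambda>K. partial L) (partial L) sequentially" by (rule uniform_limit_const)
  ultimately have "uniform_limit (sphere 0 1) (\<lambda>K x. partial L x + (\<Sum>k<K. block L k x)) (\<lambda>x. partial L x + (\<Sum>k. block L k x)) sequentially"
    by (intro uniform_limit_add)
  then
  show ?thesis unfolding limit_fun_def[abs_def] sum_block by simp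
qed

lemma limit_fun_continuous:
  assumes L: "L \<ge> 1" shows "continuous_on (sphere 0 1) (limit_fun L)"
  by (rule uniform_limit_theorem[OF _ uniform_limit_partial[OF L]])
    (auto intro: always_eventually partial_continuous)

lemma partial_limit:
  assumes "L \<ge> 1" "x \<in> sphere 0 1" shows "(\<lambda>K. partial (2 ^ K * L) x) \<longlonglongrightarrow> limit_fun L x"
  by (rule tendsto_uniform_limitI[OF uniform_limit_partial[OF assms(1)] assms(2)])

lemma partial_bounded:
  assumes L: "L \<ge> 1"
  shows "\<exists>B. \<forall>K. \<forall>x\<in>sphere 0 1. \<bar>partial (2 ^ K * L) x\<bar> \<le> B"
proof -
  let ?c = "sqrt (mz_const d * 2 ^ d * real L ^ d) * (real L powr (- s) * R)"
  have c: "?c \<ge> 0" using R by (simp add: mz_const_def)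
  have "bounded (partial L ` sphere 0 1)"
    by (intro compact_imp_bounded compact_continuous_image partial_continuous) simp
  then obtain B where B: "\<And>x. x \<in> sphere 0 1 \<Longrightarrow> \<bar>partial L x\<bar> \<le> B" unfolding bounded_iff by fastforce
  have "\<bar>partial (2 ^ K * L) x\<bar> \<le> B + ?c * (1 / (1 - ratio))" if x: "x \<in> sphere 0 1" for K x
  proof -
    have "\<bar>\<Sum>k<K. block L k x\<bar> \<le> (\<Sum>k<K. \<bar>block L k x\<bar>)" by (rule sum_abs)
    also have "\<dots> \<le> (\<Sum>k<K. ?c * ratio ^ k)" using block_bound[OF L] x by (intro sum_mono) auto
    also have "\<dots> = ?c * (\<Sum>k<K. ratio ^ k)" by (simp only: sum_distrib_left)
    also have "\<dots> \<le> ?c * (\<Sum>k. ratio ^ k)"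
      using ratio c by (intro mult_left_mono sum_le_suminf summable_geometric) auto
    also have "\<dots> = ?c * (1 / (1 - ratio))" using ratio by (simp add: suminf_geometric)
    finally show ?thesis using B[OF x] unfolding sum_block by linarith
  qed
  then show ?thesis by blast
qed

text \<open>Each coefficient of the partial sums is eventually that of \<open>f\<close>, so the
  uniform limit has the same coefficients. The difference is orthogonal to every harmonic, hence to
  every polynomial, and density of the polynomials applies.\<close>

lemma limit_fun_AE:
  assumes L: "L \<ge> 1" shows "AE x in sphere_measure. f x = limit_fun L x"
proof -
  have gL: "limit_fun L \<in> L2_sphere" by (rule continuous_L2_sphere[OF limit_fun_continuous[OF L]])
  obtain B where B: "\<And>K x. x \<in> sphere 0 1 \<Longrightarrow> \<bar>partial (2 ^ K * L) x\<bar> \<le> B" using partial_bounded[OF L] by blast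
  let ?g = "\<lambda>x. f x - limit_fun L x"
  have g2: "?g \<in> L2_sphere" by (rule L2_sphere_diff[OF f_L2 gL])
  have Y0: "L2_inner ?g (Y l m) = 0" if m: "m \<in> {1..N l}" for l m
  proof -
    have YL: "Y l m \<in> L2_sphere" by (rule Y_L2[OF m])
    have "(\<lambda>K. L2_inner (partial (2 ^ K * L)) (Y l m)) \<longlonglongrightarrow> L2_inner (limit_fun L) (Y l m)"
      unfolding L2_inner_def
    proof (rule integral_dominated_convergence[where w = "\<lambda>x. B * \<bar>Y l m x\<bar>"])
      show "(\<lambda>x. limit_fun L x * Y l m x) \<in> borel_measurable sphere_measure"
        by (intro borel_measurable_times L2_sphere_measurable gL YL)
      show "(\<lambda>x. partial (2 ^ K * L) x * Y l m x) \<in> borel_measurable sphere_measure" for K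
        by (intro borel_measurable_times L2_sphere_measurable partial_L2 YL)
      show "integrable sphere_measure (\<lambda>x. B * \<bar>Y l m x\<bar>)"
        by (intro integrable_mult_right integrable_abs L2_sphere_integrable1 YL)
      show "AE x in sphere_measure. (\<lambda>K. partial (2 ^ K * L) x * Y l m x) \<longlonglongrightarrow> limit_fun L x * Y l m x"
        by (intro AE_I2 tendsto_mult tendsto_const partial_limit[OF L]) (simp add: space_sphere_measure)
      show "AE x in sphere_measure. norm (partial (2 ^ K * L) x * Y l m x) \<le> B * \<bar>Y l m x\<bar>" for K
        using B by (intro AE_I2) (auto simp: space_sphere_measure abs_mult intro!: mult_right_mono)
    qed
    moreover have "(\<lambda>K. L2_inner (partial (2 ^ K * L)) (Y l m)) \<longlonglongrightarrow> coef l m"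
    proof (rule tendsto_eventually)
      have "l \<le> 2 ^ K * L" if "K \<ge> l" for K
      proof -
        have "l \<le> K" by fact
        also have "K \<le> 2 ^ K" using less_exp[of K] by simp
        also have "2 ^ K \<le> 2 ^ K * L" using L by simp
        finally show ?thesis .
      qed
      then show "\<forall>\<^sub>F K in sequentially. L2_inner (partial (2 ^ K * L)) (Y l m) = coef l m"
        using partial_inner_Y[OF m] by (auto simp: eventually_sequentially)
    qed
    ultimately have "L2_inner (limit_fun L) (Y l m) = coef l m" by (rule LIMSEQ_unique)
    then show ?thesis using L2_inner_diff[OF f_L2 gL YL] by (simp add: coef_def)
  qed
  have h0: "L2_inner ?g h = 0" if h: "harmonic_poly l h" for l h
  proof -
    obtain c where c: "\<And>x. x \<in> sphere 0 1 \<Longrightarrow> h x = (\<Sum>m=1..N l. c m * Y l m x)"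
      using basis harmonic_poly_in_spherical_harmonics[OF h card] unfolding harmonic_basis_def by metis
    have "L2_inner ?g h = L2_inner ?g (\<lambda>x. \<Sum>m=1..N l. c m * Y l m x)" by (rule L2_inner_cong) (use c in auto)
    also have "\<dots> = (\<Sum>m=1..N l. c m * L2_inner ?g (Y l m))" by (rule L2_inner_lincomb(2)[OF Y_L2 g2])
    finally show ?thesis using Y0 by simp
  qed
  have "L2_inner ?g p = 0" if "polyfun t p" for t p
  proof -
    obtain h where h: "\<And>l. harmonic_poly l (h l)" "\<And>x. x\<in>sphere 0 1 \<Longrightarrow> p x = (\<Sum>l\<le>t. h l x)"
      using polyfun_on_sphere[OF \<open>polyfun t p\<close>] by blast
    have "L2_inner ?g p = L2_inner ?g (\<lambda>x. \<Sum>l\<le>t. h l x)" by (rule L2_inner_cong) (use h in auto)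
    also have "\<dots> = (\<Sum>l\<le>t. L2_inner ?g (h l))" by (rule L2_inner_right(4)[OF harmonic_poly_L2[OF h(1)] g2])
    also have "\<dots> = 0" by (intro sum.neutral ballI h0[OF h(1)])
    finally show ?thesis .
  qed
  from AE_0_if_orthogonal_polyfun[OF g2 this] show ?thesis by simp
qed

text \<open>\<open>limit_fun\<close> supplies the existence that gives the choice in
  \<open>cont_rep\<close> its meaning; uniqueness of continuous representatives then identifies the
  two.\<close>

lemma cont_rep_eq_limit_fun:
  assumes L: "L \<ge> 1" and x: "x \<in> sphere 0 1" shows "cont_rep f x = limit_fun L x"
proof -
  have "\<exists>g. continuous_on (sphere 0 1) g \<and> (AE x in sphere_measure. f x = g x)"
    using limit_fun_continuous[OF L] limit_fun_AE[OF L] by blast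
  from someI_ex[OF this] have 1: "continuous_on (sphere 0 1) (cont_rep f)" "AE x in sphere_measure. f x = cont_rep f x"
    unfolding cont_rep_def by auto
  have "AE x in sphere_measure. cont_rep f x = limit_fun L x"
    using 1(2) limit_fun_AE[OF L] by eventually_elim simp
  from continuous_AE_eq_sphere[OF 1(1) limit_fun_continuous[OF L] this x] show ?thesis .
qed

text \<open>Finite differences of partial sums have energy bounded by \<open>energy_tail\<close>,
  and the bound passes to the uniform limit; this replaces Parseval's identity for the infinite
  expansion.\<close>

lemma residual_L2:
  assumes L: "L \<ge> 1"
  shows "L2_inner (\<lambda>x. f x - partial L x) (\<lambda>x. f x - partial L x) \<le> (real L powr (- s) * R)\<^sup>2"
proof -
  obtain B where B: "\<And>K x. x \<in> sphere 0 1 \<Longrightarrow> \<bar>partial (2 ^ K * L) x\<bar> \<le> B" using partial_bounded[OF L] by blast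
  let ?D = "\<lambda>K x. partial (2 ^ K * L) x - partial L x"
  have gL: "limit_fun L \<in> L2_sphere" by (rule continuous_L2_sphere[OF limit_fun_continuous[OF L]])
  have DL: "?D K \<in> L2_sphere" for K by (intro L2_sphere_diff partial_L2)
  have "(\<lambda>K. L2_inner (?D K) (?D K)) \<longlonglongrightarrow> L2_inner (\<lambda>x. limit_fun L x - partial L x) (\<lambda>x. limit_fun L x - partial L x)"
    unfolding L2_inner_def
  proof (rule integral_dominated_convergence[where w = "\<lambda>x. (2 * B) * (2 * B)"])
    show "(\<lambda>x. (limit_fun L x - partial L x) * (limit_fun L x - partial L x)) \<in> borel_measurable sphere_measure"
      by (intro borel_measurable_times borel_measurable_diff L2_sphere_measurable gL partial_L2)
    show "(\<lambda>x. ?D K x * ?D K x) \<in> borel_measurable sphere_measure" for K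
      by (intro borel_measurable_times L2_sphere_measurable DL)
    show "AE x in sphere_measure. (\<lambda>K. ?D K x * ?D K x) \<longlonglongrightarrow> (limit_fun L x - partial L x) * (limit_fun L x - partial L x)"
      by (intro AE_I2 tendsto_mult tendsto_diff tendsto_const partial_limit[OF L]) (simp_all add: space_sphere_measure)
    have "\<bar>?D K x * ?D K x\<bar> \<le> (2 * B) * (2 * B)" if "x \<in> sphere 0 1" for K x
    proof -
      have "\<bar>?D K x\<bar> \<le> 2 * B" using B[OF that, of K] B[OF that, of 0] by simp
      then show ?thesis unfolding abs_mult by (intro mult_mono) auto
    qed
    then show "AE x in sphere_measure. norm (?D K x * ?D K x) \<le> (2 * B) * (2 * B)" for K
      by (intro AE_I2) (simp only: space_sphere_measure real_norm_def)
  qed simp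
  moreover have "L2_inner (?D K) (?D K) \<le> (real L powr (- s) * R)\<^sup>2" for K
  proof -
    have sub: "{..L} \<subseteq> {..2 ^ K * L}" using L by auto
    let ?A = "{..2 ^ K * L} - {..L}"
    have Deq: "?D K = (\<lambda>x. \<Sum>l\<in>?A. hcomp l x)"
      unfolding partial_def by (subst sum.subset_diff[OF sub]) auto
    have "L2_inner (\<lambda>x. \<Sum>l\<in>?A. hcomp l x) (\<lambda>x. \<Sum>l\<in>?A. hcomp l x) = (\<Sum>l\<in>?A. L2_inner (hcomp l) (\<lambda>x. \<Sum>l\<in>?A. hcomp l x))"
      by (rule L2_inner_sum[OF hcomp_L2 L2_sphere_sum[OF hcomp_L2]])
    also have "\<dots> = (\<Sum>l\<in>?A. \<Sum>l'\<in>?A. L2_inner (hcomp l) (hcomp l'))"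
      by (intro sum.cong refl L2_inner_right(4) hcomp_L2)
    also have "\<dots> = (\<Sum>l\<in>?A. energy l)"
    proof (intro sum.cong refl)
      fix l assume l: "l \<in> ?A"
      have "(\<Sum>l'\<in>?A. L2_inner (hcomp l) (hcomp l')) = (\<Sum>l'\<in>?A. if l' = l then energy l else 0)"
        using harmonic_poly_orthogonal[OF hcomp_harmonic hcomp_harmonic _ card d] hcomp_energy
        by (intro sum.cong) auto
      then show "(\<Sum>l'\<in>?A. L2_inner (hcomp l) (hcomp l')) = energy l" using l by simp
    qed
    also have "\<dots> \<le> (real L powr (- s) * R)\<^sup>2" by (rule energy_tail) (use L in auto)
    finally show ?thesis unfolding Deq .
  qed
  ultimately have 1: "L2_inner (\<lambda>x. limit_fun L x - partial L x) (\<lambda>x. limit_fun L x - partial L x) \<le> (real L powr (- s) * R)\<^sup>2"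
    by (intro LIMSEQ_le_const2) auto
  have "L2_inner (\<lambda>x. f x - partial L x) (\<lambda>x. f x - partial L x) = L2_inner (\<lambda>x. limit_fun L x - partial L x) (\<lambda>x. limit_fun L x - partial L x)"
    unfolding L2_inner_def
  proof (rule integral_cong_AE)
    show "AE x in sphere_measure. (f x - partial L x) * (f x - partial L x) = (limit_fun L x - partial L x) * (limit_fun L x - partial L x)"
      using limit_fun_AE[OF L] by eventually_elim simp
  qed (intro borel_measurable_times borel_measurable_diff L2_sphere_measurable gL partial_L2 f_L2)+
  with 1 show ?thesis by simp
qed

lemma L2_set_sum_le: "L2_set (\<lambda>i. \<Sum>k<K. g k i) A \<le> (\<Sum>k<(K::nat). L2_set (g k) A)"
proof (induction K)
  case (Suc K)
  then show ?case using L2_set_triangle_ineq[of "\<lambda>i. \<Sum>k<K. g k i" "g K" A] by simp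
qed (simp add: L2_set_def)

text \<open>The triangle inequality in \<open>L2_set\<close> over the blocks. Block \<open>k\<close>
  contributes at most a constant times \<open>ratio ^ k\<close>: its decay beats the growth of the
  point sum bound, and the geometric series gives \<open>1 / (1 - ratio)\<close>.\<close>

lemma residual_points:
  fixes x :: "nat \<Rightarrow> real ^ 'n"
  assumes des: "spherical_design t n x" and t: "t \<ge> 2 * L" and L: "L \<ge> 1"
  shows "L2_set (\<lambda>i. cont_rep f (x i) - partial L (x i)) {1..n}
    \<le> sqrt (design_const d * 2 ^ d) / (1 - ratio) * sqrt (real n) * (real L powr (- s) * R)"
proof -
  let ?c = "sqrt (design_const d * 2 ^ d) * sqrt (real n) * (real L powr (- s) * R)"
  have c0: "?c \<ge> 0" using R design_const_pos[of d] by simp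
  have b: "L2_set (\<lambda>i. block L k (x i)) {1..n} \<le> ?c * ratio ^ k" for k
  proof -
    have LM: "2 ^ Suc k * L \<ge> L" by simp
    have "(\<Sum>i=1..n. (block L k (x i))\<^sup>2) \<le> design_const d * real n * (real (2 ^ Suc k * L) / real L) ^ d * (real (2 ^ k * L) powr (- s) * R)\<^sup>2"
      unfolding block_high
      by (rule order_trans[OF design_point_sum[OF des t L LM card d high_harmonic] mult_left_mono[OF block_energy[OF L]]])
        (use design_const_pos[of d] in auto)
    also have "\<dots> = (design_const d * 2 ^ d * real n) * ((real (2 ^ k * L) powr (- s) * R)\<^sup>2 * real (2 ^ k) ^ d)"
      using L by (simp add: power_mult_distrib mult_ac)
    also have "\<dots> = (design_const d * 2 ^ d * real n) * (ratio ^ k * (real L powr (- s) * R))\<^sup>2"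
      unfolding block_powr[OF L] ..
    finally have "L2_set (\<lambda>i. block L k (x i)) {1..n} \<le> sqrt ((design_const d * 2 ^ d * real n) * (ratio ^ k * (real L powr (- s) * R))\<^sup>2)"
      unfolding L2_set_def by (rule real_sqrt_le_mono)
    also have "\<dots> = ?c * ratio ^ k"
      using ratio R design_const_pos[of d] by (simp add: real_sqrt_mult mult_ac)
    finally show ?thesis .
  qed
  have "L2_set (\<lambda>i. partial (2 ^ K * L) (x i) - partial L (x i)) {1..n} \<le> ?c * (1 / (1 - ratio))" for K
  proof -
    have "L2_set (\<lambda>i. partial (2 ^ K * L) (x i) - partial L (x i)) {1..n} \<le> (\<Sum>k<K. L2_set (\<lambda>i. block L k (x i)) {1..n})"
      unfolding sum_block[symmetric] by (rule L2_set_sum_le)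
    also have "\<dots> \<le> (\<Sum>k<K. ?c * ratio ^ k)" by (intro sum_mono b)
    also have "\<dots> = ?c * (\<Sum>k<K. ratio ^ k)" by (simp only: sum_distrib_left)
    also have "\<dots> \<le> ?c * (\<Sum>k. ratio ^ k)"
      using ratio c0 by (intro mult_left_mono sum_le_suminf summable_geometric) auto
    also have "\<dots> = ?c * (1 / (1 - ratio))" using ratio by (simp add: suminf_geometric)
    finally show ?thesis .
  qed
  moreover have "(\<lambda>K. L2_set (\<lambda>i. partial (2 ^ K * L) (x i) - partial L (x i)) {1..n}) \<longlonglongrightarrow> L2_set (\<lambda>i. cont_rep f (x i) - partial L (x i)) {1..n}"
  proof -
    have "(\<lambda>K. partial (2 ^ K * L) (x i)) \<longlonglongrightarrow> cont_rep f (x i)" if i: "i \<in> {1..n}" for i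
    proof -
      have xi: "x i \<in> sphere 0 1" using spherical_design_norm[OF des i] by simp
      show ?thesis unfolding cont_rep_eq_limit_fun[OF L xi] by (rule partial_limit[OF L xi])
    qed
    then show ?thesis unfolding L2_set_def
      by (intro tendsto_real_sqrt tendsto_sum tendsto_power tendsto_diff tendsto_const)
  qed
  ultimately have "L2_set (\<lambda>i. cont_rep f (x i) - partial L (x i)) {1..n} \<le> ?c * (1 / (1 - ratio))"
    by (intro LIMSEQ_le_const2) auto
  then show ?thesis by (simp add: mult_ac)
qed

end

section \<open>Laws determined by linear functionals\<close>

text \<open>Finite combinations of coordinates, taken as functions on the path space. They stay
  measurable for the product sigma-algebra even when \<open>I\<close> is uncountable, and their
  characteristic functions determine the law.\<close>

definition lin_functionals :: "'i set \<Rightarrow> (('i \<Rightarrow> real) \<Rightarrow> real) set" where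
  "lin_functionals I = {X. \<exists>J a. finite J \<and> J \<subseteq> I \<and> X = (\<lambda>\<omega>. \<Sum>i\<in>J. a i * \<omega> i)}"

lemma lin_functionals_zero: "(\<lambda>\<omega>. 0) \<in> lin_functionals I"
  unfolding lin_functionals_def by (intro CollectI exI[of _ "{}"]) auto

lemma lin_functionals_coord: "i \<in> I \<Longrightarrow> (\<lambda>\<omega>. \<omega> i) \<in> lin_functionals I"
  unfolding lin_functionals_def by (intro CollectI exI[of _ "{i}"] exI[of _ "\<lambda>_. 1"]) auto

lemma lin_functionals_scale:
  assumes "X \<in> lin_functionals I" shows "(\<lambda>\<omega>. c * X \<omega>) \<in> lin_functionals I"
proof -
  obtain J a where "finite J" "J \<subseteq> I" "X = (\<lambda>\<omega>. \<Sum>i\<in>J. a i * \<omega> i)"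
    using assms unfolding lin_functionals_def by blast
  then show ?thesis unfolding lin_functionals_def
    by (intro CollectI exI[of _ J] exI[of _ "\<lambda>i. c * a i"]) (auto simp: sum_distrib_left mult.assoc)
qed

lemma lin_functionals_add:
  assumes "X \<in> lin_functionals I" "Y \<in> lin_functionals I"
  shows "(\<lambda>\<omega>. X \<omega> + Y \<omega>) \<in> lin_functionals I"
proof -
  obtain J a where J: "finite J" "J \<subseteq> I" "X = (\<lambda>\<omega>. \<Sum>i\<in>J. a i * \<omega> i)"
    using assms(1) unfolding lin_functionals_def by blast
  obtain K b where K: "finite K" "K \<subseteq> I" "Y = (\<lambda>\<omega>. \<Sum>i\<in>K. b i * \<omega> i)"
    using assms(2) unfolding lin_functionals_def by blast
  let ?c = "\<lambda>i. (if i \<in> J then a i else 0) + (if i \<in> K then b i else 0)"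
  have "X \<omega> + Y \<omega> = (\<Sum>i\<in>J \<union> K. ?c i * \<omega> i)" for \<omega>
  proof -
    have "(\<Sum>i\<in>J \<union> K. ?c i * \<omega> i) = (\<Sum>i\<in>J \<union> K. (if i \<in> J then a i else 0) * \<omega> i) + (\<Sum>i\<in>J \<union> K. (if i \<in> K then b i else 0) * \<omega> i)"
      by (simp add: distrib_right sum.distrib)
    also have "(\<Sum>i\<in>J \<union> K. (if i \<in> J then a i else 0) * \<omega> i) = X \<omega>"
      unfolding J(3) using J K by (intro sum.mono_neutral_cong_right) auto
    also have "(\<Sum>i\<in>J \<union> K. (if i \<in> K then b i else 0) * \<omega> i) = Y \<omega>"
      unfolding K(3) using J K by (intro sum.mono_neutral_cong_right) auto
    finally show ?thesis ..
  qed
  then show ?thesis using J K unfolding lin_functionals_def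
    by (intro CollectI exI[of _ "J \<union> K"] exI[of _ ?c]) auto
qed

lemma lin_functionals_sum:
  "(\<And>j. j \<in> A \<Longrightarrow> X j \<in> lin_functionals I) \<Longrightarrow> (\<lambda>\<omega>. \<Sum>j\<in>A. c j * X j \<omega>) \<in> lin_functionals I"
proof (induction A rule: infinite_finite_induct)
  case (insert x F)
  then have "(\<lambda>\<omega>. c x * X x \<omega> + (\<Sum>j\<in>F. c j * X j \<omega>)) \<in> lin_functionals I"
    by (intro lin_functionals_add[OF lin_functionals_scale]) auto
  with insert.hyps show ?case by simp
qed (auto intro: lin_functionals_zero)

lemma lin_functionals_diff:
  "X \<in> lin_functionals I \<Longrightarrow> Y \<in> lin_functionals I \<Longrightarrow> (\<lambda>\<omega>. X \<omega> - Y \<omega>) \<in> lin_functionals I"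
  using lin_functionals_add[OF _ lin_functionals_scale[of Y I "-1"]] by simp

lemma lin_functionals_affine:
  assumes "X \<in> lin_functionals I" shows "X (\<lambda>i\<in>I. m i + t * \<omega> i) = X m + t * X \<omega>"
proof -
  obtain J a where J: "finite J" "J \<subseteq> I" "X = (\<lambda>\<omega>. \<Sum>i\<in>J. a i * \<omega> i)"
    using assms unfolding lin_functionals_def by blast
  have "X (\<lambda>i\<in>I. m i + t * \<omega> i) = (\<Sum>i\<in>J. a i * m i + t * (a i * \<omega> i))"
    unfolding J(3) using J(2) by (intro sum.cong) (auto simp: algebra_simps)
  then show ?thesis by (simp add: J(3) sum.distrib sum_distrib_left)
qed

lemma lin_functionals_measurable:
  assumes "X \<in> lin_functionals I" shows "X \<in> borel_measurable (Pi\<^sub>M I (\<lambda>_. borel))"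
proof -
  obtain J a where J: "finite J" "J \<subseteq> I" "X = (\<lambda>\<omega>. \<Sum>i\<in>J. a i * \<omega> i)"
    using assms unfolding lin_functionals_def by blast
  show ?thesis unfolding J(3) using J(2)
    by (intro borel_measurable_sum borel_measurable_times measurable_const measurable_component_singleton) auto
qed

lemma iexp_measurable [measurable]: "iexp \<in> borel_measurable borel"
  by (intro borel_measurable_continuous_onI continuous_intros)

lemma iexp_add: "iexp (x + y) = iexp x * iexp y"
  by (simp add: distrib_left exp_add)

text \<open>The weight \<open>v\<close> turns the one-dimensional uniqueness theorem into a tool for joint laws.\<close>

lemma weighted_char_unique:
  fixes P Q :: "'a measure" and v Z :: "'a \<Rightarrow> real"
  assumes P: "prob_space P" and Q: "prob_space Q" and PQ: "sets P = sets Q"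
    and v[measurable]: "v \<in> borel_measurable P" and Z[measurable]: "Z \<in> borel_measurable P"
    and v0: "\<And>x. 0 \<le> v x" and vB: "\<And>x. v x \<le> B"
    and eq: "\<And>t. (CLINT x|P. v x * iexp (t * Z x)) = (CLINT x|Q. v x * iexp (t * Z x))"
    and A: "A \<in> sets borel"
  shows "(\<integral>x. v x * indicator A (Z x) \<partial>P) = (\<integral>x. v x * indicator A (Z x) \<partial>Q)"
proof -
  \<comment> \<open>Normalised by its mass \<open>m\<close>, the weight is a probability density;
    the law of \<open>Z\<close> under it has the weighted integral, divided by \<open>m\<close>, as
    characteristic function.\<close>
  have main: "measure (distr (density P (\<lambda>x. v x / m)) borel Z) A = (\<integral>x. v x * indicator A (Z x) \<partial>P) / m
     \<and> char (distr (density P (\<lambda>x. v x / m)) borel Z) t = (CLINT x|P. v x * iexp (t * Z x)) / m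
     \<and> real_distribution (distr (density P (\<lambda>x. v x / m)) borel Z)"
    if P: "prob_space P" and [measurable]: "v \<in> borel_measurable P" "Z \<in> borel_measurable P"
      and m: "m = (\<integral>x. v x \<partial>P)" "m > 0" and A: "A \<in> sets borel" for P m A t
  proof -
    interpret P: prob_space P by (rule P)
    have vi: "integrable P v" using v0 vB by (intro P.integrable_const_bound[of _ B]) (auto)
    let ?D = "density P (\<lambda>x. v x / m)"
    have "emeasure ?D (space ?D) = (\<integral>\<^sup>+x. ennreal (v x / m) \<partial>P)"
      by (subst emeasure_density) (auto intro!: nn_integral_cong)
    also have "\<dots> = ennreal (\<integral>x. v x / m \<partial>P)" using vi v0 m by (intro nn_integral_eq_integral) auto
    also have "\<dots> = 1" using m by simp
    finally have D: "prob_space ?D" by (rule prob_spaceI)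
    have rd: "real_distribution (distr ?D borel Z)"
      by (rule prob_space.real_distribution_distr[OF D]) simp
    interpret R: real_distribution "distr ?D borel Z" by (rule rd)
    have "measure (distr ?D borel Z) A = (\<integral>x. indicator A x \<partial>distr ?D borel Z)" using A by simp
    also have "\<dots> = (\<integral>x. indicator A (Z x) \<partial>?D)" using A by (subst integral_distr) auto
    also have "\<dots> = (\<integral>x. v x / m * indicator A (Z x) \<partial>P)"
      using A v0 m by (subst integral_real_density) auto
    also have "\<dots> = (\<integral>x. v x * indicator A (Z x) \<partial>P) / m" by simp
    finally have 1: "measure (distr ?D borel Z) A = (\<integral>x. v x * indicator A (Z x) \<partial>P) / m" .
    have "char (distr ?D borel Z) t = (CLINT x|?D. iexp (t * Z x))"
      unfolding char_def by (subst integral_distr) auto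
    also have "\<dots> = (CLINT x|P. (v x / m) *\<^sub>R iexp (t * Z x))"
      using v0 m by (subst integral_density) auto
    also have "\<dots> = (CLINT x|P. (v x * iexp (t * Z x)) / m)"
      by (intro Bochner_Integration.integral_cong refl) (simp add: scaleR_conv_of_real)
    also have "\<dots> = (CLINT x|P. v x * iexp (t * Z x)) / m" by simp
    finally show ?thesis using 1 rd by blast
  qed
  interpret P: prob_space P by (rule P)
  interpret Q: prob_space Q by (rule Q)
  have [measurable]: "v \<in> borel_measurable Q" "Z \<in> borel_measurable Q"
    using v Z unfolding measurable_cong_sets[OF PQ refl] by simp_all
  have vP: "integrable P v" using v0 vB by (intro P.integrable_const_bound[of _ B]) (auto)
  have vQ: "integrable Q v" using v0 vB by (intro Q.integrable_const_bound[of _ B]) (auto)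
  define m where "m = (\<integral>x. v x \<partial>P)"
  have m0: "m \<ge> 0" unfolding m_def using v0 by simp
  have "complex_of_real (\<integral>x. v x \<partial>P) = complex_of_real (\<integral>x. v x \<partial>Q)" using eq[of 0] by simp
  then have mQ: "m = (\<integral>x. v x \<partial>Q)" unfolding m_def using of_real_eq_iff by blast
  show ?thesis
  proof (cases "m = 0")
    case True
    have "AE x in P. v x = 0" using integral_nonneg_eq_0_iff_AE[OF vP] v0 True m_def by simp
    then have "AE x in P. v x * indicator A (Z x) = 0" by eventually_elim simp
    then have 1: "(\<integral>x. v x * indicator A (Z x) \<partial>P) = 0" by (rule integral_eq_zero_AE)
    have "AE x in Q. v x = 0" using integral_nonneg_eq_0_iff_AE[OF vQ] v0 True mQ by simp
    then have "AE x in Q. v x * indicator A (Z x) = 0" by eventually_elim simp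
    then have 2: "(\<integral>x. v x * indicator A (Z x) \<partial>Q) = 0" by (rule integral_eq_zero_AE)
    show ?thesis using 1 2 by simp
  next
    case False
    with m0 have mp: "m > 0" by simp
    note p = main[OF P v Z m_def mp A] and q = main[OF Q _ _ mQ mp A]
    have "distr (density P (\<lambda>x. v x / m)) borel Z = distr (density Q (\<lambda>x. v x / m)) borel Z"
      by (rule Levy_uniqueness) (use p q eq in auto)
    then show ?thesis using p q mp by simp
  qed
qed

text \<open>Cramer--Wold: coordinates are turned one by one from exponents into indicators.\<close>

lemma lin_functionals_determine:
  fixes P Q :: "('i \<Rightarrow> real) measure"
  assumes P: "prob_space P" and Q: "prob_space Q"
    and sP: "sets P = sets (Pi\<^sub>M I (\<lambda>_. borel))" and sQ: "sets Q = sets (Pi\<^sub>M I (\<lambda>_. borel))"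
    and eq: "\<And>X. X \<in> lin_functionals I \<Longrightarrow> (CLINT \<omega>|P. iexp (X \<omega>)) = (CLINT \<omega>|Q. iexp (X \<omega>))"
  shows "P = Q"
proof -
  interpret P: prob_space P by (rule P)
  interpret Q: prob_space Q by (rule Q)
  have PQ: "sets P = sets Q" using sP sQ by simp
  note mP = measurable_cong_sets[OF sP refl] and mQ = measurable_cong_sets[OF sQ refl]
  have linP: "X \<in> borel_measurable P" "X \<in> borel_measurable Q" if "X \<in> lin_functionals I" for X
    using lin_functionals_measurable[OF that] mP mQ by auto
  have ind: "(CLINT \<omega>|P. complex_of_real (\<Prod>j\<in>S. indicator (A j) (\<omega> j)) * iexp (X \<omega>)) = (CLINT \<omega>|Q. complex_of_real (\<Prod>j\<in>S. indicator (A j) (\<omega> j)) * iexp (X \<omega>))"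
    if "finite S" "S \<subseteq> I" "\<And>j. j \<in> S \<Longrightarrow> A j \<in> sets borel" "X \<in> lin_functionals I" for S X and A :: "'i \<Rightarrow> real set"
    using that
  proof (induction S arbitrary: X rule: finite_induct)
    case empty then show ?case using eq by simp
  next
    case (insert i S)
    define w where "w \<omega> = (\<Prod>j\<in>S. indicator (A j) (\<omega> j) :: real)" for \<omega> :: "'i \<Rightarrow> real"
    have wm: "w \<in> borel_measurable (Pi\<^sub>M I (\<lambda>_. borel))"
      unfolding w_def[abs_def] using insert.prems
      by (intro borel_measurable_prod measurable_compose[OF measurable_component_singleton borel_measurable_indicator]) auto
    have [measurable]: "w \<in> borel_measurable P" "w \<in> borel_measurable Q" using wm mP mQ by auto
    have w01: "0 \<le> w \<omega>" "w \<omega> \<le> 1" for \<omega>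
      unfolding w_def by (auto intro!: prod_nonneg prod_le_1 simp: indicator_def)
    have iI: "(\<lambda>\<omega>. \<omega> i) \<in> lin_functionals I" using insert.prems(1) by (intro lin_functionals_coord) auto
    note [measurable] = linP[OF iI]
    have IH: "(CLINT \<omega>|P. w \<omega> * iexp (Y \<omega>)) = (CLINT \<omega>|Q. w \<omega> * iexp (Y \<omega>))" if "Y \<in> lin_functionals I" for Y
      unfolding w_def using insert.IH[OF _ _ that] insert.prems by simp
    note [measurable] = linP[OF insert.prems(3)]
    \<comment> \<open>Weights have to be real and nonnegative, while
      \<open>iexp (X \<omega>)\<close> is complex. For \<open>norm c \<le> 1\<close> the weight
      \<open>w \<omega> * (1 + Re (c * iexp (X \<omega>)))\<close> is admissible;
      \<open>c = 0\<close> removes the constant part, and \<open>c = 1\<close> and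
      \<open>c = - \<i>\<close> recover real and imaginary part.\<close>
    have step: "(\<integral>\<omega>. v \<omega> * indicator (A i) (\<omega> i) \<partial>P) = (\<integral>\<omega>. v \<omega> * indicator (A i) (\<omega> i) \<partial>Q)"
      if veq: "\<And>\<omega>. v \<omega> = w \<omega> * (1 + Re (c * iexp (X \<omega>)))" and c: "norm c \<le> 1" for v c
    proof (rule weighted_char_unique[OF P Q PQ])
      have vabs: "\<bar>Re (c * iexp (X \<omega>))\<bar> \<le> 1" for \<omega>
        using order_trans[OF abs_Re_le_cmod, of "c * iexp (X \<omega>)" 1] c by (simp add: norm_mult)
      show "v \<in> borel_measurable P" unfolding veq[abs_def] by measurable
      show "(\<lambda>\<omega>. \<omega> i) \<in> borel_measurable P" by simp
      show "0 \<le> v \<omega>" for \<omega> unfolding veq using vabs[of \<omega>] w01(1)[of \<omega>] by (intro mult_nonneg_nonneg) auto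
      show "v \<omega> \<le> 2" for \<omega>
      proof -
        have "v \<omega> \<le> 1 * 2" unfolding veq using vabs[of \<omega>] w01[of \<omega>] by (intro mult_mono) auto
        then show ?thesis by simp
      qed
      show "A i \<in> sets borel" using insert.prems(2) by simp
      fix t
      let ?Y1 = "\<lambda>\<omega>. t * \<omega> i" and ?Y2 = "\<lambda>\<omega>. X \<omega> + t * \<omega> i" and ?Y3 = "\<lambda>\<omega>. - 1 * X \<omega> + t * \<omega> i"
      have Y: "?Y1 \<in> lin_functionals I" "?Y2 \<in> lin_functionals I" "?Y3 \<in> lin_functionals I"
        by (rule lin_functionals_scale[OF iI], rule lin_functionals_add[OF insert.prems(3) lin_functionals_scale[OF iI]],
            rule lin_functionals_add[OF lin_functionals_scale[OF insert.prems(3)] lin_functionals_scale[OF iI]])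
      \<comment> \<open>Writing the real part as half the sum of a number and its conjugate turns
        the weighted exponential into three exponentials of linear functionals, to which the
        induction hypothesis applies.\<close>
      have dec: "v \<omega> * iexp (t * \<omega> i) = w \<omega> * iexp (?Y1 \<omega>) + (c / 2) * (w \<omega> * iexp (?Y2 \<omega>)) + (cnj c / 2) * (w \<omega> * iexp (?Y3 \<omega>))" for \<omega>
      proof -
        have "complex_of_real (Re (c * iexp (X \<omega>))) = (c * iexp (X \<omega>) + cnj (c * iexp (X \<omega>))) / 2"
          by (simp only: complex_add_cnj) simp
        also have "cnj (c * iexp (X \<omega>)) = cnj c * iexp (- 1 * X \<omega>)" by (simp add: exp_cnj)
        finally have "complex_of_real (Re (c * iexp (X \<omega>))) = (c * iexp (X \<omega>) + cnj c * iexp (- 1 * X \<omega>)) / 2" .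
        note R = this
        have gen: "W * (1 + (c * a + c' * b) / 2) * e = W * e + (c / 2) * (W * (a * e)) + (c' / 2) * (W * (b * e))"
          for W a b e c c' :: complex by (simp add: field_simps)
        have V: "complex_of_real (v \<omega>) = complex_of_real (w \<omega>) * (1 + complex_of_real (Re (c * iexp (X \<omega>))))"
          by (simp only: veq of_real_mult of_real_add of_real_1)
        show ?thesis unfolding V R iexp_add by (rule gen)
      qed
      have int: "integrable P (\<lambda>\<omega>. complex_of_real (w \<omega>) * iexp (Y \<omega>))" "integrable Q (\<lambda>\<omega>. complex_of_real (w \<omega>) * iexp (Y \<omega>))"
        if "Y \<in> lin_functionals I" for Y
        using linP[OF that] w01 by (auto intro!: P.integrable_const_bound[of _ 1] Q.integrable_const_bound[of _ 1] simp: norm_mult)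
      show "(CLINT \<omega>|P. v \<omega> * iexp (t * \<omega> i)) = (CLINT \<omega>|Q. v \<omega> * iexp (t * \<omega> i))"
        unfolding dec using int[OF Y(1)] int[OF Y(2)] int[OF Y(3)] IH[OF Y(1)] IH[OF Y(2)] IH[OF Y(3)] by simp
    qed
    let ?u = "\<lambda>\<omega>. w \<omega> * indicator (A i) (\<omega> i)"
    have um: "?u \<in> borel_measurable P" "?u \<in> borel_measurable Q"
      using insert.prems(2)[of i] by measurable
    have ub: "norm (?u \<omega> * r) \<le> 1" if "\<bar>r\<bar> \<le> 1" for \<omega> r
      using that w01[of \<omega>] by (auto simp: indicator_def abs_mult mult_le_one)
    have split: "(\<integral>\<omega>. ?u \<omega> * Re (c * iexp (X \<omega>)) \<partial>P) = (\<integral>\<omega>. ?u \<omega> * Re (c * iexp (X \<omega>)) \<partial>Q)" if c: "norm c \<le> 1" for c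
    proof -
      have r1: "\<bar>Re (c * iexp (X \<omega>))\<bar> \<le> 1" for \<omega>
        using order_trans[OF abs_Re_le_cmod, of "c * iexp (X \<omega>)" 1] c by (simp add: norm_mult)
      have rm: "(\<lambda>\<omega>. Re (c * iexp (X \<omega>))) \<in> borel_measurable P" "(\<lambda>\<omega>. Re (c * iexp (X \<omega>))) \<in> borel_measurable Q" by measurable
      have i1: "integrable P ?u" "integrable Q ?u"
        using ub[of 1] um by (auto intro!: P.integrable_const_bound[of _ 1] Q.integrable_const_bound[of _ 1])
      have i2: "integrable P (\<lambda>\<omega>. ?u \<omega> * Re (c * iexp (X \<omega>)))"
        using ub[OF r1] by (intro P.integrable_const_bound[of _ 1] borel_measurable_times um rm) auto
      have i3: "integrable Q (\<lambda>\<omega>. ?u \<omega> * Re (c * iexp (X \<omega>)))"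
        using ub[OF r1] by (intro Q.integrable_const_bound[of _ 1] borel_measurable_times um rm) auto
      have e: "(w \<omega> * (1 + Re (c' * iexp (X \<omega>)))) * indicator (A i) (\<omega> i) = ?u \<omega> + ?u \<omega> * Re (c' * iexp (X \<omega>))" for c' \<omega>
        by (simp add: algebra_simps)
      have "(\<integral>\<omega>. ?u \<omega> \<partial>P) = (\<integral>\<omega>. ?u \<omega> \<partial>Q)" using step[of w 0] by simp
      moreover have "(\<integral>\<omega>. ?u \<omega> + ?u \<omega> * Re (c * iexp (X \<omega>)) \<partial>P) = (\<integral>\<omega>. ?u \<omega> + ?u \<omega> * Re (c * iexp (X \<omega>)) \<partial>Q)"
        using step[OF refl c] unfolding e .
      ultimately show ?thesis using i1 i2 i3 by simp
    qed
    have uc: "complex_of_real (\<Prod>j\<in>insert i S. indicator (A j) (\<omega> j)) * iexp (X \<omega>) =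
      complex_of_real (?u \<omega> * Re (1 * iexp (X \<omega>))) + \<i> * complex_of_real (?u \<omega> * Re (- \<i> * iexp (X \<omega>)))" for \<omega>
    proof -
      have "complex_of_real (\<Prod>j\<in>insert i S. indicator (A j) (\<omega> j)) = complex_of_real (?u \<omega>)"
        using insert.hyps by (simp add: w_def mult.commute)
      then show ?thesis by (simp add: complex_eq_iff)
    qed
    have intc: "integrable P (\<lambda>\<omega>. ?u \<omega> * Re (c * iexp (X \<omega>)))" "integrable Q (\<lambda>\<omega>. ?u \<omega> * Re (c * iexp (X \<omega>)))" if c: "norm c \<le> 1" for c
    proof -
      have r1: "\<bar>Re (c * iexp (X \<omega>))\<bar> \<le> 1" for \<omega>
        using order_trans[OF abs_Re_le_cmod, of "c * iexp (X \<omega>)" 1] c by (simp add: norm_mult)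
      have rm: "(\<lambda>\<omega>. Re (c * iexp (X \<omega>))) \<in> borel_measurable P" "(\<lambda>\<omega>. Re (c * iexp (X \<omega>))) \<in> borel_measurable Q" by measurable
      show "integrable P (\<lambda>\<omega>. ?u \<omega> * Re (c * iexp (X \<omega>)))"
        using ub[OF r1] by (intro P.integrable_const_bound[of _ 1] borel_measurable_times um rm) auto
      show "integrable Q (\<lambda>\<omega>. ?u \<omega> * Re (c * iexp (X \<omega>)))"
        using ub[OF r1] by (intro Q.integrable_const_bound[of _ 1] borel_measurable_times um rm) auto
    qed
    have n: "norm (1::complex) \<le> 1" "norm (- \<i>) \<le> 1" by simp_all
    have expand: "(CLINT \<omega>|M. complex_of_real (?u \<omega> * Re (1 * iexp (X \<omega>))) + \<i> * complex_of_real (?u \<omega> * Re (- \<i> * iexp (X \<omega>)))) =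
        complex_of_real (\<integral>\<omega>. ?u \<omega> * Re (1 * iexp (X \<omega>)) \<partial>M) + \<i> * complex_of_real (\<integral>\<omega>. ?u \<omega> * Re (- \<i> * iexp (X \<omega>)) \<partial>M)"
      if a: "integrable M (\<lambda>\<omega>. ?u \<omega> * Re (1 * iexp (X \<omega>)))" and b: "integrable M (\<lambda>\<omega>. ?u \<omega> * Re (- \<i> * iexp (X \<omega>)))" for M
    proof -
      have "(CLINT \<omega>|M. complex_of_real (?u \<omega> * Re (1 * iexp (X \<omega>))) + \<i> * complex_of_real (?u \<omega> * Re (- \<i> * iexp (X \<omega>)))) =
        (CLINT \<omega>|M. complex_of_real (?u \<omega> * Re (1 * iexp (X \<omega>)))) + (CLINT \<omega>|M. \<i> * complex_of_real (?u \<omega> * Re (- \<i> * iexp (X \<omega>))))"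
        by (intro Bochner_Integration.integral_add integrable_of_real a integrable_mult_right b)
      then show ?thesis by (simp only: integral_mult_right_zero integral_complex_of_real)
    qed
    show ?case
      unfolding uc expand[OF intc(1)[OF n(1)] intc(1)[OF n(2)]] expand[OF intc(2)[OF n(1)] intc(2)[OF n(2)]]
        split[OF n(1)] split[OF n(2)] ..
  qed
  show ?thesis
  proof (rule measure_eqI_PiM_infinite[OF sP sQ])
    show "finite_measure P" by unfold_locales
    fix A :: "'i \<Rightarrow> real set" and J assume J: "finite J" "J \<subseteq> I" "\<And>j. j \<in> J \<Longrightarrow> A j \<in> sets borel"
    have iprod: "complex_of_real (\<Prod>j\<in>J. indicator (A j) (\<omega> j)) = complex_of_real (indicator (prod_emb I (\<lambda>_. borel) J (Pi\<^sub>E J A)) \<omega>)"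
      if "\<omega> \<in> space (Pi\<^sub>M I (\<lambda>_. borel))" for \<omega>
    proof (cases "\<forall>j\<in>J. \<omega> j \<in> A j")
      case True
      then have "\<omega> \<in> prod_emb I (\<lambda>_. borel) J (Pi\<^sub>E J A)" using that by (auto simp: prod_emb_def space_PiM)
      then show ?thesis using True by simp
    next
      case False
      then have "\<omega> \<notin> prod_emb I (\<lambda>_. borel) J (Pi\<^sub>E J A)" by (auto simp: prod_emb_def)
      moreover obtain j where "j \<in> J" "\<omega> j \<notin> A j" using False by blast
      then have "(\<Prod>j\<in>J. indicator (A j) (\<omega> j) :: real) = 0"
        by (intro prod_zero[OF J(1)] bexI[of _ j]) auto
      ultimately show ?thesis by simp
    qed
    let ?E = "prod_emb I (\<lambda>_. borel) J (Pi\<^sub>E J A)"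
    have E: "?E \<in> sets (Pi\<^sub>M I (\<lambda>_. borel :: real measure))" using J by (intro sets_PiM_I) auto
    have "measure M ?E = Re (CLINT \<omega>|M. complex_of_real (\<Prod>j\<in>J. indicator (A j) (\<omega> j)) * iexp 0)"
      if sM: "sets M = sets (Pi\<^sub>M I (\<lambda>_. borel :: real measure))" for M
    proof -
      have "(CLINT \<omega>|M. complex_of_real (\<Prod>j\<in>J. indicator (A j) (\<omega> j)) * iexp 0) = (CLINT \<omega>|M. complex_of_real (indicator ?E \<omega>))"
        using sets_eq_imp_space_eq[OF sM] iprod by (intro Bochner_Integration.integral_cong refl) simp
      then show ?thesis using E sM sets.sets_into_space[OF E] sets_eq_imp_space_eq[OF sM] by (simp add: Int_absorb2)
    qed
    from this[OF sP] this[OF sQ] have "measure P ?E = measure Q ?E" using ind[OF J lin_functionals_zero] by simp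
    then show "emeasure P ?E = emeasure Q ?E" by (simp add: P.emeasure_eq_measure Q.emeasure_eq_measure)
  qed
qed

section \<open>Gaussian processes\<close>

text \<open>A centred Gaussian law in terms of characteristic functions: the variance is read off as
  a second moment, so degenerate directions are included and no density occurs. Product noise and
  white noise both have this form.\<close>

locale gaussian_measure = prob_space P for I :: "'i set" and P :: "('i \<Rightarrow> real) measure" +
  assumes sets_P: "sets P = sets (Pi\<^sub>M I (\<lambda>_. borel))"
    and square_integrable: "X \<in> lin_functionals I \<Longrightarrow> integrable P (\<lambda>\<omega>. (X \<omega>)\<^sup>2)"
    and char_fun: "X \<in> lin_functionals I \<Longrightarrow> (CLINT \<omega>|P. iexp (X \<omega>)) = complex_of_real (exp (- (\<integral>\<omega>. (X \<omega>)\<^sup>2 \<partial>P) / 2))"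
begin

definition cov :: "(('i \<Rightarrow> real) \<Rightarrow> real) \<Rightarrow> (('i \<Rightarrow> real) \<Rightarrow> real) \<Rightarrow> real" where
  "cov X Z = (\<integral>\<omega>. X \<omega> * Z \<omega> \<partial>P)"

lemma lin_measurable: "X \<in> lin_functionals I \<Longrightarrow> X \<in> borel_measurable P"
  unfolding measurable_cong_sets[OF sets_P refl] by (rule lin_functionals_measurable)

lemma prod_integrable:
  assumes "X \<in> lin_functionals I" "Z \<in> lin_functionals I"
  shows "integrable P (\<lambda>\<omega>. X \<omega> * Z \<omega>)"
proof (rule Bochner_Integration.integrable_bound)
  show "integrable P (\<lambda>\<omega>. (X \<omega>)\<^sup>2 + (Z \<omega>)\<^sup>2)"
    using assms square_integrable by simp
  show "(\<lambda>\<omega>. X \<omega> * Z \<omega>) \<in> borel_measurable P"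
    using assms lin_measurable by (intro borel_measurable_times) auto
  have "\<bar>a * b\<bar> \<le> a\<^sup>2 + b\<^sup>2" for a b :: real
  proof -
    have "2 * (\<bar>a\<bar> * \<bar>b\<bar>) \<le> \<bar>a\<bar>\<^sup>2 + \<bar>b\<bar>\<^sup>2" using sum_squares_bound[of "\<bar>a\<bar>" "\<bar>b\<bar>"] by (simp add: mult.assoc)
    moreover have "0 \<le> \<bar>a\<bar> * \<bar>b\<bar>" by simp
    ultimately have "\<bar>a\<bar> * \<bar>b\<bar> \<le> \<bar>a\<bar>\<^sup>2 + \<bar>b\<bar>\<^sup>2" by linarith
    then show ?thesis by (simp only: abs_mult power2_abs)
  qed
  then show "AE \<omega> in P. norm (X \<omega> * Z \<omega>) \<le> norm ((X \<omega>)\<^sup>2 + (Z \<omega>)\<^sup>2)" by simp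
qed

lemma cov_commute: "cov X Z = cov Z X" by (simp add: cov_def mult.commute)

lemma char_cov: "X \<in> lin_functionals I \<Longrightarrow> (CLINT \<omega>|P. iexp (X \<omega>)) = complex_of_real (exp (- cov X X / 2))"
  using char_fun[of X] by (simp add: cov_def power2_eq_square)

lemma cov_nonneg: "cov X X \<ge> 0"
  unfolding cov_def by (intro integral_nonneg_AE) auto

lemma cov_lincomb:
  assumes "\<And>j. j \<in> A \<Longrightarrow> X j \<in> lin_functionals I" "Z \<in> lin_functionals I"
  shows "cov (\<lambda>\<omega>. \<Sum>j\<in>A. c j * X j \<omega>) Z = (\<Sum>j\<in>A. c j * cov (X j) Z)"
proof -
  have "cov (\<lambda>\<omega>. \<Sum>j\<in>A. c j * X j \<omega>) Z = (\<integral>\<omega>. (\<Sum>j\<in>A. c j * (X j \<omega> * Z \<omega>)) \<partial>P)"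
    unfolding cov_def by (simp add: sum_distrib_right mult.assoc)
  also have "\<dots> = (\<Sum>j\<in>A. \<integral>\<omega>. c j * (X j \<omega> * Z \<omega>) \<partial>P)"
    using assms by (intro Bochner_Integration.integral_sum integrable_mult_right prod_integrable)
  finally show ?thesis by (simp add: cov_def)
qed

lemma cov_diff:
  assumes "X \<in> lin_functionals I" "Y \<in> lin_functionals I" "Z \<in> lin_functionals I"
  shows "cov (\<lambda>\<omega>. X \<omega> - Y \<omega>) Z = cov X Z - cov Y Z"
  unfolding cov_def using assms by (simp add: left_diff_distrib prod_integrable)

lemma cov_scale: "cov (\<lambda>\<omega>. c * X \<omega>) Z = c * cov X Z"
  unfolding cov_def by (simp add: mult.assoc)

end

lemma std_gaussian_facts:
  shows "prob_space std_gaussian" "measure std_gaussian UNIV = 1" "sets std_gaussian = sets borel" "space std_gaussian = UNIV"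
    "integrable std_gaussian (\<lambda>z. z)" "(\<integral>z. z \<partial>std_gaussian) = 0"
    "integrable std_gaussian (\<lambda>z. z\<^sup>2)" "(\<integral>z. z\<^sup>2 \<partial>std_gaussian) = 1"
    "(CLINT z|std_gaussian. iexp (t * z)) = complex_of_real (exp (- t\<^sup>2 / 2))"
proof -
  show p: "prob_space std_gaussian" unfolding std_gaussian_def by (intro prob_space_normal_density) simp
  show "measure std_gaussian UNIV = 1" using prob_space.prob_space[OF p] by (simp add: std_gaussian_def)
  show "sets std_gaussian = sets borel" "space std_gaussian = UNIV" by (simp_all add: std_gaussian_def)
  show "integrable std_gaussian (\<lambda>z. z)" using integrable_std_normal_distribution_moment[of 1] by (simp add: std_gaussian_def)
  show "(\<integral>z. z \<partial>std_gaussian) = 0" using integral_std_normal_distribution_moment_odd[of 1] by (simp add: std_gaussian_def)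
  show "integrable std_gaussian (\<lambda>z. z\<^sup>2)" using integrable_std_normal_distribution_moment[of 2] by (simp add: std_gaussian_def)
  show "(\<integral>z. z\<^sup>2 \<partial>std_gaussian) = 1" using std_normal_distribution_even_moments(1)[of 1] by (simp add: std_gaussian_def)
  show "(CLINT z|std_gaussian. iexp (t * z)) = complex_of_real (exp (- t\<^sup>2 / 2))"
    using fun_cong[OF char_std_normal_distribution, of t] by (simp add: char_def std_gaussian_def)
qed

text \<open>The defining property leaves the location \<open>b\<close> and the scale
  \<open>\<tau>\<close> of each combination unspecified. Comparing first moments with the zero mean
  function forces \<open>b = 0\<close>, and the second moment then identifies the variance.\<close>

lemma gaussian_process_measure:
  assumes "gaussian_process I (\<lambda>_. 0) k P"
  shows "gaussian_measure I P" and "i \<in> I \<Longrightarrow> j \<in> I \<Longrightarrow> (\<integral>\<omega>. \<omega> i * \<omega> j \<partial>P) = k i j"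
proof -
  have P: "prob_space P" and sP: "sets P = sets (Pi\<^sub>M I (\<lambda>_. borel))"
    and law: "\<And>J a. finite J \<Longrightarrow> J \<subseteq> I \<Longrightarrow> \<exists>b \<tau>. distr P borel (\<lambda>\<omega>. \<Sum>i\<in>J. a i * \<omega> i) = distr std_gaussian borel (\<lambda>z. b + \<tau> * z)"
    and mean: "\<And>i. i \<in> I \<Longrightarrow> (\<integral>\<omega>. \<omega> i \<partial>P) = 0"
    and cov: "\<And>i j. i \<in> I \<Longrightarrow> j \<in> I \<Longrightarrow> (\<integral>\<omega>. \<omega> i * \<omega> j \<partial>P) = k i j"
    using assms by (simp_all add: gaussian_process_def)
  interpret P: prob_space P by (rule P)
  interpret N: prob_space std_gaussian by (rule std_gaussian_facts(1))
  have Xm: "X \<in> borel_measurable P" if "X \<in> lin_functionals I" for X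
    unfolding measurable_cong_sets[OF sP refl] by (rule lin_functionals_measurable[OF that])
  have Nm: "(\<lambda>z. b + \<tau> * z) \<in> borel_measurable std_gaussian" for b \<tau> :: real
    unfolding measurable_cong_sets[OF std_gaussian_facts(3) refl] by measurable
  have main: "integrable P X \<and> (\<integral>\<omega>. X \<omega> \<partial>P) = b \<and> integrable P (\<lambda>\<omega>. (X \<omega>)\<^sup>2) \<and> (\<integral>\<omega>. (X \<omega>)\<^sup>2 \<partial>P) = b\<^sup>2 + \<tau>\<^sup>2
     \<and> (CLINT \<omega>|P. iexp (X \<omega>)) = iexp b * exp (- \<tau>\<^sup>2 / 2)"
    if X: "X \<in> lin_functionals I" and eq: "distr P borel X = distr std_gaussian borel (\<lambda>z. b + \<tau> * z)" for X b \<tau>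
  proof (intro conjI)
    note [measurable] = Xm[OF X] Nm
    have sq: "(b + \<tau> * z)\<^sup>2 = b\<^sup>2 + (2 * b * \<tau>) * z + \<tau>\<^sup>2 * z\<^sup>2" for z by (simp add: power2_sum power_mult_distrib)
    have "integrable (distr P borel X) (\<lambda>x. x)" unfolding eq
      by (subst integrable_distr_eq) (auto simp: std_gaussian_facts)
    then show "integrable P X" by (subst (asm) integrable_distr_eq) auto
    have "(\<integral>\<omega>. X \<omega> \<partial>P) = (\<integral>x. x \<partial>distr P borel X)" by (subst integral_distr) auto
    also have "\<dots> = b" unfolding eq by (subst integral_distr) (auto simp: std_gaussian_facts std_gaussian_facts)
    finally show "(\<integral>\<omega>. X \<omega> \<partial>P) = b" .
    have "integrable (distr P borel X) (\<lambda>x. x\<^sup>2)" unfolding eq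
      by (subst integrable_distr_eq) (auto simp: std_gaussian_facts sq)
    then show "integrable P (\<lambda>\<omega>. (X \<omega>)\<^sup>2)" by (subst (asm) integrable_distr_eq) auto
    have "(\<integral>\<omega>. (X \<omega>)\<^sup>2 \<partial>P) = (\<integral>x. x\<^sup>2 \<partial>distr P borel X)" by (subst integral_distr) auto
    also have "\<dots> = b\<^sup>2 + \<tau>\<^sup>2" unfolding eq
      by (subst integral_distr) (auto simp: std_gaussian_facts sq std_gaussian_facts)
    finally show "(\<integral>\<omega>. (X \<omega>)\<^sup>2 \<partial>P) = b\<^sup>2 + \<tau>\<^sup>2" .
    have "(CLINT \<omega>|P. iexp (X \<omega>)) = (CLINT x|distr P borel X. iexp x)" by (subst integral_distr) auto
    also have "\<dots> = (CLINT z|std_gaussian. iexp (b + \<tau> * z))" unfolding eq by (subst integral_distr) auto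
    also have "\<dots> = (CLINT z|std_gaussian. iexp b * iexp (\<tau> * z))" by (simp only: iexp_add)
    also have "\<dots> = iexp b * (CLINT z|std_gaussian. iexp (\<tau> * z))" by (rule integral_mult_right_zero)
    also have "\<dots> = iexp b * exp (- \<tau>\<^sup>2 / 2)" by (simp only: std_gaussian_facts(9))
    finally show "(CLINT \<omega>|P. iexp (X \<omega>)) = iexp b * exp (- \<tau>\<^sup>2 / 2)" .
  qed
  \<comment> \<open>The prescribed means alone do not yield integrability, because the integral of a
    nonintegrable function is \<open>0\<close> by convention; it is drawn from the law of a one-term
    combination.\<close>
  have coord: "integrable P (\<lambda>\<omega>. \<omega> i)" if "i \<in> I" for i
  proof -
    obtain b \<tau> where "distr P borel (\<lambda>\<omega>. \<Sum>j\<in>{i}. 1 * \<omega> j) = distr std_gaussian borel (\<lambda>z. b + \<tau> * z)"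
      using law[of "{i}" "\<lambda>_. 1"] \<open>i \<in> I\<close> by auto
    then show ?thesis using main[OF lin_functionals_coord[OF that]] by simp
  qed
  have lin: "integrable P (\<lambda>\<omega>. (X \<omega>)\<^sup>2) \<and> (CLINT \<omega>|P. iexp (X \<omega>)) = complex_of_real (exp (- (\<integral>\<omega>. (X \<omega>)\<^sup>2 \<partial>P) / 2))"
    if X: "X \<in> lin_functionals I" for X
  proof -
    obtain J a where J: "finite J" "J \<subseteq> I" "X = (\<lambda>\<omega>. \<Sum>i\<in>J. a i * \<omega> i)"
      using X unfolding lin_functionals_def by blast
    obtain b \<tau> where eq: "distr P borel X = distr std_gaussian borel (\<lambda>z. b + \<tau> * z)"
      using law[OF J(1,2), of a] unfolding J(3) by blast
    note m = main[OF X eq]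
    have "(\<integral>\<omega>. X \<omega> \<partial>P) = (\<Sum>i\<in>J. a i * (\<integral>\<omega>. \<omega> i \<partial>P))"
      unfolding J(3) using J coord by (subst Bochner_Integration.integral_sum) auto
    then have "b = 0" using m J(2) mean by (simp add: subset_eq)
    then show ?thesis using m by simp
  qed
  show "gaussian_measure I P"
    by (intro gaussian_measure.intro P gaussian_measure_axioms.intro sP) (use lin in blast)+
  show "i \<in> I \<Longrightarrow> j \<in> I \<Longrightarrow> (\<integral>\<omega>. \<omega> i * \<omega> j \<partial>P) = k i j" by (rule cov)
qed

lemma gaussian_measure_product:
  fixes n :: nat
  defines "P \<equiv> Pi\<^sub>M {1..n} (\<lambda>_. std_gaussian)"
  shows "gaussian_measure {1..n} P"
    and "i \<in> {1..n} \<Longrightarrow> j \<in> {1..n} \<Longrightarrow> (\<integral>\<omega>. \<omega> i * \<omega> j \<partial>P) = (if i = j then 1 else 0)"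
proof -
  interpret N: prob_space std_gaussian by (rule std_gaussian_facts(1))
  interpret F: product_prob_space "\<lambda>_ :: nat. std_gaussian" by unfold_locales
  have P: "prob_space P" unfolding P_def by (intro prob_space_PiM) unfold_locales
  interpret P: prob_space P by (rule P)
  have sP: "sets P = sets (Pi\<^sub>M {1..n} (\<lambda>_. borel))"
    unfolding P_def by (intro sets_PiM_cong refl std_gaussian_facts)
  note std = std_gaussian_facts
  have cij: "integrable P (\<lambda>\<omega>. \<omega> i * \<omega> j) \<and> (\<integral>\<omega>. \<omega> i * \<omega> j \<partial>P) = (if i = j then 1 else 0)"
    if ij: "i \<in> {1..n}" "j \<in> {1..n}" for i j
  proof -
    \<comment> \<open>Expresses the product of two coordinates as a product over all coordinates,
      with the factor \<open>z * z\<close> when \<open>i = j\<close>, so that independence applies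
      in both cases.\<close>
    let ?f = "\<lambda>k z. (if k = i then z else 1) * (if k = j then z else (1::real))"
    have int: "integrable std_gaussian (?f k)" for k
    proof -
      have "integrable std_gaussian (\<lambda>z. z * z)" using std(7) by (simp only: power2_eq_square)
      then show ?thesis using std(5) by (cases "k = i"; cases "k = j") simp_all
    qed
    have prod: "(\<Prod>k\<in>{1..n}. ?f k (\<omega> k)) = \<omega> i * \<omega> j" for \<omega> :: "nat \<Rightarrow> real"
      using ij by (simp add: prod.distrib prod.delta)
    have "integrable P (\<lambda>\<omega>. \<Prod>k\<in>{1..n}. ?f k (\<omega> k))"
      unfolding P_def by (intro F.product_integrable_prod int) simp
    then have 1: "integrable P (\<lambda>\<omega>. \<omega> i * \<omega> j)" unfolding prod .
    have "(\<integral>\<omega>. (\<Prod>k\<in>{1..n}. ?f k (\<omega> k)) \<partial>P) = (\<Prod>k\<in>{1..n}. \<integral>z. ?f k z \<partial>std_gaussian)"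
      unfolding P_def by (intro F.product_integral_prod int) simp
    also have "\<dots> = (if i = j then 1 else 0)"
    proof (cases "i = j")
      case True
      have "(\<integral>z. ?f k z \<partial>std_gaussian) = 1" for k
        using True std(8) by (cases "k = i") (simp_all add: power2_eq_square std_gaussian_facts)
      then show ?thesis using True by simp
    next
      case False
      have "(\<integral>z. ?f i z \<partial>std_gaussian) = 0" using False std(6) by simp
      then have "(\<Prod>k\<in>{1..n}. \<integral>z. ?f k z \<partial>std_gaussian) = 0"
        by (intro prod_zero bexI[of _ i] ij(1)) simp_all
      then show ?thesis using False by simp
    qed
    finally show ?thesis using 1 unfolding prod by blast
  qed
  show c: "i \<in> {1..n} \<Longrightarrow> j \<in> {1..n} \<Longrightarrow> (\<integral>\<omega>. \<omega> i * \<omega> j \<partial>P) = (if i = j then 1 else 0)" for i j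
    using cij by blast
  have lin: "integrable P (\<lambda>\<omega>. (X \<omega>)\<^sup>2) \<and> (CLINT \<omega>|P. iexp (X \<omega>)) = complex_of_real (exp (- (\<integral>\<omega>. (X \<omega>)\<^sup>2 \<partial>P) / 2))"
    if X: "X \<in> lin_functionals {1..n}" for X
  proof -
    obtain J a0 where J: "finite J" "J \<subseteq> {1..n}" "X = (\<lambda>\<omega>. \<Sum>i\<in>J. a0 i * \<omega> i)"
      using X unfolding lin_functionals_def by blast
    define a where "a i = (if i \<in> J then a0 i else 0)" for i
    have Xeq: "X \<omega> = (\<Sum>i=1..n. a i * \<omega> i)" for \<omega>
      unfolding J(3) using J by (intro sum.mono_neutral_cong_left) (auto simp: a_def)
    have sq: "(X \<omega>)\<^sup>2 = (\<Sum>i=1..n. \<Sum>j=1..n. (a i * a j) * (\<omega> i * \<omega> j))" for \<omega>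
      unfolding Xeq power2_eq_square sum_product by (intro sum.cong refl) simp
    have 1: "integrable P (\<lambda>\<omega>. (X \<omega>)\<^sup>2)" unfolding sq
      using cij by (intro Bochner_Integration.integrable_sum integrable_mult_right) auto
    have "(\<integral>\<omega>. (X \<omega>)\<^sup>2 \<partial>P) = (\<Sum>i=1..n. \<Sum>j=1..n. (a i * a j) * (\<integral>\<omega>. \<omega> i * \<omega> j \<partial>P))"
      unfolding sq using cij by (subst Bochner_Integration.integral_sum, force intro!: Bochner_Integration.integrable_sum integrable_mult_right)
        (intro sum.cong refl, subst Bochner_Integration.integral_sum, auto)
    also have "\<dots> = (\<Sum>i=1..n. \<Sum>j=1..n. if j = i then (a i)\<^sup>2 else 0)"
      using c by (intro sum.cong refl) (auto simp: power2_eq_square)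
    also have "\<dots> = (\<Sum>i=1..n. (a i)\<^sup>2)" by simp
    finally have var: "(\<integral>\<omega>. (X \<omega>)\<^sup>2 \<partial>P) = (\<Sum>i=1..n. (a i)\<^sup>2)" .
    have ie: "iexp (X \<omega>) = (\<Prod>i=1..n. iexp (a i * \<omega> i))" for \<omega>
      unfolding Xeq by (simp add: sum_distrib_left exp_sum)
    have im: "integrable std_gaussian (\<lambda>z. iexp (a i * z))" for i
    proof (intro N.integrable_const_bound[of _ 1])
      show "(\<lambda>z. iexp (a i * z)) \<in> borel_measurable std_gaussian"
        unfolding measurable_cong_sets[OF std(3) refl] by measurable
    qed simp
    have "(CLINT \<omega>|P. iexp (X \<omega>)) = (\<Prod>i=1..n. CLINT z|std_gaussian. iexp (a i * z))"
      unfolding ie P_def by (intro F.product_integral_prod im) simp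
    also have "\<dots> = (\<Prod>i=1..n. complex_of_real (exp (- (a i)\<^sup>2 / 2)))" by (simp only: std(9))
    also have "\<dots> = complex_of_real (\<Prod>i=1..n. exp (- (a i)\<^sup>2 / 2))" by simp
    also have "(\<Prod>i=1..n. exp (- (a i)\<^sup>2 / 2)) = exp (- (\<Sum>i=1..n. (a i)\<^sup>2) / 2)"
      by (simp add: exp_sum[symmetric] sum_negf sum_divide_distrib)
    finally show ?thesis using 1 var by simp
  qed
  show "gaussian_measure {1..n} P"
    by (intro gaussian_measure.intro P gaussian_measure_axioms.intro sP) (use lin in blast)+
qed

section \<open>Total variation of a shifted Gaussian on the line\<close>

lemma std_normal_density_le_1: "std_normal_density x \<le> 1"
proof -
  have "1 \<le> sqrt (2 * pi)" using pi_gt3 by simp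
  then have "1 / sqrt (2 * pi) * exp (- x\<^sup>2 / 2) \<le> 1 * 1" by (intro mult_mono) auto
  then show ?thesis by (simp add: std_normal_density_def)
qed

text \<open>As in the Neyman--Pearson lemma, the difference is largest when \<open>B\<close> is the
  half-line on which the shifted density dominates, which starts at \<open>v / 2\<close>. There it
  is the mass of an interval of length \<open>v\<close>, at most \<open>v\<close> because the
  density is at most \<open>1\<close>.\<close>

lemma gaussian_shift_half:
  assumes v: "v \<ge> 0" and B: "B \<in> sets borel"
  shows "measure std_gaussian {z. z + v \<in> B} - measure std_gaussian B \<le> v"
proof -
  let ?p = std_normal_density
  have pi: "integrable lborel ?p" by simp
  have pv: "integrable lborel (\<lambda>z. ?p (z - v))"
    using lborel_integrable_real_affine[OF pi, of 1 "- v"] by simp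
  have ind: "integrable lborel (\<lambda>z. indicator A z * g z)" if "integrable lborel g" "A \<in> sets borel" for A :: "real set" and g :: "real \<Rightarrow> real"
    using integrable_real_mult_indicator[of A lborel g] that by (simp add: mult.commute)
  have M: "measure std_gaussian A = (\<integral>z. indicator A z * ?p z \<partial>lborel)" if "A \<in> sets borel" for A
  proof -
    have "measure std_gaussian A = (\<integral>z. indicator A z \<partial>std_gaussian)" using that by (simp add: std_gaussian_def)
    also have "\<dots> = (\<integral>z. ?p z * indicator A z \<partial>lborel)"
      unfolding std_gaussian_def using that by (subst integral_real_density) auto
    finally show ?thesis by (simp add: mult.commute)
  qed
  have Mv: "measure std_gaussian {z. z + v \<in> A} = (\<integral>z. indicator A z * ?p (z - v) \<partial>lborel)" if A: "A \<in> sets borel" for A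
  proof -
    have s: "{z. z + v \<in> A} \<in> sets borel"
    proof -
      have "(\<lambda>z. z + v) -` A \<inter> space borel \<in> sets borel" by (rule measurable_sets[OF _ A]) simp
      then show ?thesis by (simp add: vimage_def)
    qed
    have "measure std_gaussian {z. z + v \<in> A} = (\<integral>z. indicator A (v + 1 * z) * ?p (v + 1 * z - v) \<partial>lborel)"
      unfolding M[OF s] by (intro Bochner_Integration.integral_cong) (auto simp: indicator_def add.commute)
    also have "\<dots> = (\<integral>z. indicator A z * ?p (z - v) \<partial>lborel)"
      using lborel_integral_real_affine[of 1 "\<lambda>z. indicator A z * ?p (z - v)" v] by simp
    finally show ?thesis .
  qed
  let ?H = "{v / 2..}"
  have H: "?H \<in> sets borel" by simp
  have cmp: "?p (z - v) \<ge> ?p z \<longleftrightarrow> z \<in> ?H \<or> v = 0" for z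
  proof -
    have "?p (z - v) \<ge> ?p z \<longleftrightarrow> (z - v)\<^sup>2 \<le> z\<^sup>2" using pi_gt_zero by (simp add: std_normal_density_def divide_le_cancel not_less)
    also have "\<dots> \<longleftrightarrow> v * v \<le> 2 * (z * v)" by (simp add: power2_diff) (simp add: power2_eq_square mult.assoc)
    also have "\<dots> \<longleftrightarrow> z \<in> ?H \<or> v = 0" using v by (cases "v = 0") auto
    finally show ?thesis .
  qed
  have "measure std_gaussian {z. z + v \<in> B} - measure std_gaussian B = (\<integral>z. indicator B z * ?p (z - v) - indicator B z * ?p z \<partial>lborel)"
    unfolding M[OF B] Mv[OF B] using ind[OF pv B] ind[OF pi B] by simp
  also have "\<dots> \<le> (\<integral>z. indicator ?H z * ?p (z - v) - indicator ?H z * ?p z \<partial>lborel)"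
  proof (rule integral_mono)
    show "integrable lborel (\<lambda>z. indicator B z * ?p (z - v) - indicator B z * ?p z)"
      using ind[OF pv B] ind[OF pi B] by simp
    show "integrable lborel (\<lambda>z. indicator ?H z * ?p (z - v) - indicator ?H z * ?p z)"
      using ind[OF pv H] ind[OF pi H] by simp
    show "indicator B z * ?p (z - v) - indicator B z * ?p z \<le> indicator ?H z * ?p (z - v) - indicator ?H z * ?p z" for z
      using cmp[of z] by (cases "z \<in> ?H"; cases "v = 0"; cases "z \<in> B") auto
  qed
  also have "\<dots> = measure std_gaussian {z. z + v \<in> ?H} - measure std_gaussian ?H"
    unfolding M[OF H] Mv[OF H] using ind[OF pv H] ind[OF pi H] by simp
  also have "{z. z + v \<in> ?H} = {- v / 2..}" by auto
  also have "measure std_gaussian {- v / 2..} - measure std_gaussian ?H = (\<integral>z. indicator {- v / 2..<v / 2} z * ?p z \<partial>lborel)"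
  proof -
    have e: "indicator {- v / 2..} z * ?p z - indicator ?H z * ?p z = indicator {- v / 2..<v / 2} z * ?p z" for z
      using v by (auto simp: indicator_def)
    have h': "{- v / 2..} \<in> sets borel" by simp
    have "(\<integral>z. indicator {- v / 2..} z * ?p z - indicator ?H z * ?p z \<partial>lborel) =
      (\<integral>z. indicator {- v / 2..} z * ?p z \<partial>lborel) - (\<integral>z. indicator ?H z * ?p z \<partial>lborel)"
      by (rule Bochner_Integration.integral_diff[OF ind[OF pi h'] ind[OF pi H]])
    then show ?thesis unfolding M[OF H] M[OF h'] e by (rule sym)
  qed
  also have "\<dots> \<le> (\<integral>z. indicator {- v / 2..<v / 2} z \<partial>lborel)"
  proof (rule integral_mono)
    show "integrable lborel (\<lambda>z. indicator {- v / 2..<v / 2} z * ?p z)" by (intro ind pi) simp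
    show "integrable lborel (indicator {- v / 2..<v / 2} :: real \<Rightarrow> real)"
      using v by (intro integrable_real_indicator) auto
    show "indicator {- v / 2..<v / 2} z * ?p z \<le> indicator {- v / 2..<v / 2} z" for z
      using std_normal_density_le_1[of z] by (auto simp: indicator_def)
  qed
  also have "\<dots> = v" using v by simp
  finally show ?thesis .
qed

text \<open>The one-sided estimate applied to \<open>B\<close> and to its complement.\<close>

lemma gaussian_shift:
  assumes v: "v \<ge> 0" and B: "B \<in> sets borel"
  shows "\<bar>measure std_gaussian {z. z + v \<in> B} - measure std_gaussian B\<bar> \<le> v"
proof -
  interpret N: prob_space std_gaussian by (rule std_gaussian_facts(1))
  have cB: "- B \<in> sets borel" using B by simp
  have s: "{z. z + v \<in> B} \<in> sets borel"
  proof -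
    have "(\<lambda>z. z + v) -` B \<inter> space borel \<in> sets borel" by (rule measurable_sets[OF _ B]) simp
    then show ?thesis by (simp add: vimage_def)
  qed
  have 1: "measure std_gaussian (- B) = 1 - measure std_gaussian B"
    using N.prob_compl[of B] B by (simp add: std_gaussian_facts Compl_eq_Diff_UNIV)
  have "{z. z + v \<in> - B} = UNIV - {z. z + v \<in> B}" by auto
  then have 2: "measure std_gaussian {z. z + v \<in> - B} = 1 - measure std_gaussian {z. z + v \<in> B}"
    using N.prob_compl[of "{z. z + v \<in> B}"] s by (simp add: std_gaussian_facts)
  show ?thesis using gaussian_shift_half[OF v B] gaussian_shift_half[OF v cB] 1 2 by linarith
qed

section \<open>Exchanging Gaussian components\<close>

text \<open>The common form of both experiments: a mean plus scaled centred noise.\<close>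

definition gshift :: "('i \<Rightarrow> real) measure \<Rightarrow> 'i set \<Rightarrow> ('i \<Rightarrow> real) \<Rightarrow> real \<Rightarrow> ('i \<Rightarrow> real) measure" where
  "gshift P I m \<tau> = distr P (Pi\<^sub>M I (\<lambda>_. borel)) (\<lambda>\<omega>. \<lambda>i\<in>I. m i + \<tau> * \<omega> i)"

lemma affine_measurable:
  "(\<lambda>\<omega>. \<lambda>i\<in>I. m i + \<tau> * \<omega> i :: real) \<in> Pi\<^sub>M I (\<lambda>_. borel) \<rightarrow>\<^sub>M Pi\<^sub>M I (\<lambda>_. borel)"
  by (intro measurable_restrict borel_measurable_add borel_measurable_times borel_measurable_const measurable_component_singleton)

text \<open>A kernel that draws auxiliary randomness from \<open>P2\<close> and applies
  \<open>\<Phi>\<close> produces the image of the product measure; this turns questions about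
  kernels into questions about laws.\<close>

lemma bind_distr_pair:
  assumes P1: "prob_space P1" and P2: "prob_space P2"
    and m: "(\<lambda>(x, y). \<Phi> x y) \<in> P1 \<Otimes>\<^sub>M P2 \<rightarrow>\<^sub>M N"
  shows "P1 \<bind> (\<lambda>x. distr P2 N (\<Phi> x)) = distr (P1 \<Otimes>\<^sub>M P2) N (\<lambda>(x, y). \<Phi> x y)"
proof -
  interpret P1: prob_space P1 by (rule P1)
  interpret P2: prob_space P2 by (rule P2)
  have P2': "P2 \<in> space (prob_algebra P2)" using P2 by (simp add: space_prob_algebra)
  have P1': "P1 \<in> space (prob_algebra P1)" using P1 by (simp add: space_prob_algebra)
  have k: "(\<lambda>x. distr P2 N (\<Phi> x)) \<in> P1 \<rightarrow>\<^sub>M prob_algebra N"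
    by (rule measurable_distr_prob_space2[OF measurable_const[OF P2'] m])
  have sb: "sets (P1 \<bind> (\<lambda>x. distr P2 N (\<Phi> x))) = sets N"
    by (rule sets_bind) (auto simp: P1.not_empty)
  show ?thesis
  proof (rule measure_eqI)
    show "sets (P1 \<bind> (\<lambda>x. distr P2 N (\<Phi> x))) = sets (distr (P1 \<Otimes>\<^sub>M P2) N (\<lambda>(x, y). \<Phi> x y))"
      using sb by simp
    fix B assume "B \<in> sets (P1 \<bind> (\<lambda>x. distr P2 N (\<Phi> x)))"
    then have B: "B \<in> sets N" using sb by simp
    have pre: "(\<lambda>(x, y). \<Phi> x y) -` B \<inter> space (P1 \<Otimes>\<^sub>M P2) \<in> sets (P1 \<Otimes>\<^sub>M P2)"
      by (rule measurable_sets[OF m B])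
    have "emeasure (P1 \<bind> (\<lambda>x. distr P2 N (\<Phi> x))) B = (\<integral>\<^sup>+x. emeasure (distr P2 N (\<Phi> x)) B \<partial>P1)"
      by (rule emeasure_bind_prob_algebra[OF P1' k B])
    also have "\<dots> = (\<integral>\<^sup>+x. emeasure P2 (Pair x -` ((\<lambda>(x, y). \<Phi> x y) -` B \<inter> space (P1 \<Otimes>\<^sub>M P2))) \<partial>P1)"
    proof (rule nn_integral_cong)
      fix x assume x: "x \<in> space P1"
      have "\<Phi> x \<in> P2 \<rightarrow>\<^sub>M N" using measurable_compose[OF measurable_Pair1'[OF x] m] by simp
      then have "emeasure (distr P2 N (\<Phi> x)) B = emeasure P2 (\<Phi> x -` B \<inter> space P2)"
        using B by (rule emeasure_distr)
      also have "\<Phi> x -` B \<inter> space P2 = Pair x -` ((\<lambda>(x, y). \<Phi> x y) -` B \<inter> space (P1 \<Otimes>\<^sub>M P2))"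
        using x by (auto simp: space_pair_measure)
      finally show "emeasure (distr P2 N (\<Phi> x)) B = emeasure P2 (Pair x -` ((\<lambda>(x, y). \<Phi> x y) -` B \<inter> space (P1 \<Otimes>\<^sub>M P2)))" .
    qed
    also have "\<dots> = emeasure (P1 \<Otimes>\<^sub>M P2) ((\<lambda>(x, y). \<Phi> x y) -` B \<inter> space (P1 \<Otimes>\<^sub>M P2))"
      by (rule P2.emeasure_pair_measure_alt[OF pre, symmetric])
    also have "\<dots> = emeasure (distr (P1 \<Otimes>\<^sub>M P2) N (\<lambda>(x, y). \<Phi> x y)) B"
      by (rule emeasure_distr[OF m B, symmetric])
    finally show "emeasure (P1 \<bind> (\<lambda>x. distr P2 N (\<Phi> x))) B = emeasure (distr (P1 \<Otimes>\<^sub>M P2) N (\<lambda>(x, y). \<Phi> x y)) B" .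
  qed
qed

text \<open>The components of the second process along \<open>l2\<close> are exchanged for those of the first
  process along \<open>l1\<close>.\<close>

locale gaussian_transport =
  G1: gaussian_measure I1 P1 + G2: gaussian_measure I2 P2
  for I1 :: "'i set" and P1 and I2 :: "'j set" and P2 +
  fixes A :: "'k set" and l1 :: "'k \<Rightarrow> ('i \<Rightarrow> real) \<Rightarrow> real" and l2 :: "'k \<Rightarrow> ('j \<Rightarrow> real) \<Rightarrow> real"
  assumes A: "finite A"
    and l1: "j \<in> A \<Longrightarrow> l1 j \<in> lin_functionals I1" and l2: "j \<in> A \<Longrightarrow> l2 j \<in> lin_functionals I2"
    and orth1: "i \<in> A \<Longrightarrow> j \<in> A \<Longrightarrow> G1.cov (l1 i) (l1 j) = (if i = j then 1 else 0)"
    and orth2: "i \<in> A \<Longrightarrow> j \<in> A \<Longrightarrow> G2.cov (l2 i) (l2 j) = (if i = j then 1 else 0)"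
begin

definition coeff :: "'k \<Rightarrow> 'j \<Rightarrow> real" where
  "coeff j g = G2.cov (l2 j) (\<lambda>\<omega>. \<omega> g)"

definition transport :: "('i \<Rightarrow> real) \<Rightarrow> ('j \<Rightarrow> real) \<Rightarrow> 'j \<Rightarrow> real" where
  "transport \<omega>1 \<omega>2 = (\<lambda>g\<in>I2. (\<Sum>j\<in>A. coeff j g * l1 j \<omega>1) + (\<omega>2 g - (\<Sum>j\<in>A. coeff j g * l2 j \<omega>2)))"

lemma l1_measurable: "j \<in> A \<Longrightarrow> l1 j \<in> borel_measurable (Pi\<^sub>M I1 (\<lambda>_. borel))"
  by (rule lin_functionals_measurable[OF l1])

lemma l2_measurable: "j \<in> A \<Longrightarrow> l2 j \<in> borel_measurable (Pi\<^sub>M I2 (\<lambda>_. borel))"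
  by (rule lin_functionals_measurable[OF l2])

text \<open>The factors \<open>a\<close> and \<open>b\<close> are left free so that one statement
  serves \<open>transport\<close>, where both are \<open>1\<close>, and the rescaling in
  \<open>kernel\<close>.\<close>

lemma transport_measurable0:
  "(\<lambda>(\<omega>1, \<omega>2). \<lambda>g\<in>I2. (\<Sum>j\<in>A. coeff j g * (a * l1 j \<omega>1)) + b * (\<omega>2 g - (\<Sum>j\<in>A. coeff j g * l2 j \<omega>2)))
    \<in> Pi\<^sub>M I1 (\<lambda>_. borel) \<Otimes>\<^sub>M Pi\<^sub>M I2 (\<lambda>_. borel) \<rightarrow>\<^sub>M Pi\<^sub>M I2 (\<lambda>_. borel)"
  unfolding case_prod_beta
  by (intro measurable_restrict borel_measurable_add borel_measurable_sum borel_measurable_times borel_measurable_diff borel_measurable_const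
      measurable_compose[OF measurable_fst l1_measurable] measurable_compose[OF measurable_snd l2_measurable]
      measurable_compose[OF measurable_snd measurable_component_singleton])

lemma pair_sets: "sets (P1 \<Otimes>\<^sub>M P2) = sets (Pi\<^sub>M I1 (\<lambda>_. borel) \<Otimes>\<^sub>M Pi\<^sub>M I2 (\<lambda>_. borel))"
  by (rule sets_pair_measure_cong[OF G1.sets_P G2.sets_P])

lemma transport_measurable: "(\<lambda>(\<omega>1, \<omega>2). transport \<omega>1 \<omega>2) \<in> P1 \<Otimes>\<^sub>M P2 \<rightarrow>\<^sub>M Pi\<^sub>M I2 (\<lambda>_. borel)"
  using transport_measurable0[of 1 1] unfolding measurable_cong_sets[OF pair_sets refl] transport_def by simp

text \<open>On transported noise a functional \<open>X\<close> becomes \<open>U\<close> on the first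
  process plus \<open>X - W\<close> on the second, which are independent. Removing the projection
  \<open>W\<close> lowers the variance by the sum of the \<open>(t j)\<^sup>2\<close>, and
  \<open>U\<close> contributes the same sum, so the characteristic function of \<open>X\<close> is
  unchanged.\<close>

lemma transport_law: "distr (P1 \<Otimes>\<^sub>M P2) (Pi\<^sub>M I2 (\<lambda>_. borel)) (\<lambda>(\<omega>1, \<omega>2). transport \<omega>1 \<omega>2) = P2"
proof -
  interpret pair: pair_prob_space P1 P2 by unfold_locales
  let ?D = "distr (P1 \<Otimes>\<^sub>M P2) (Pi\<^sub>M I2 (\<lambda>_. borel)) (\<lambda>(\<omega>1, \<omega>2). transport \<omega>1 \<omega>2)"
  show ?thesis
  proof (rule lin_functionals_determine)
    show "prob_space ?D" by (rule pair.prob_space_distr[OF transport_measurable])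
    show "prob_space P2" by unfold_locales
    show "sets ?D = sets (Pi\<^sub>M I2 (\<lambda>_. borel))" by simp
    show "sets P2 = sets (Pi\<^sub>M I2 (\<lambda>_. borel))" by (rule G2.sets_P)
    fix X assume X: "X \<in> lin_functionals I2"
    then obtain J a where J: "finite J" "J \<subseteq> I2" "X = (\<lambda>\<omega>. \<Sum>g\<in>J. a g * \<omega> g)"
      unfolding lin_functionals_def by blast
    \<comment> \<open>\<open>t j\<close> is the covariance of \<open>X\<close> with
      \<open>l2 j\<close>; thus \<open>W\<close> is the orthogonal projection of \<open>X\<close>
      onto the exchanged directions and \<open>U\<close> its counterpart in the first
      process.\<close>
    define t where "t j = (\<Sum>g\<in>J. a g * coeff j g)" for j
    define U where "U \<omega> = (\<Sum>j\<in>A. t j * l1 j \<omega>)" for \<omega>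
    define W where "W \<omega> = (\<Sum>j\<in>A. t j * l2 j \<omega>)" for \<omega>
    have U: "U \<in> lin_functionals I1" unfolding U_def[abs_def] by (rule lin_functionals_sum[OF l1])
    have W: "W \<in> lin_functionals I2" unfolding W_def[abs_def] by (rule lin_functionals_sum[OF l2])
    have V: "(\<lambda>\<omega>. X \<omega> - W \<omega>) \<in> lin_functionals I2" by (rule lin_functionals_diff[OF X W])
    have tX: "G2.cov X (l2 j) = t j" if "j \<in> A" for j
      unfolding J(3) t_def coeff_def using J(2) l2[OF that]
      by (subst G2.cov_lincomb) (auto intro: lin_functionals_coord simp: G2.cov_commute)
    have Xt: "X (transport \<omega>1 \<omega>2) = U \<omega>1 + (X \<omega>2 - W \<omega>2)" for \<omega>1 \<omega>2
    proof -
      have sw: "(\<Sum>g\<in>J. a g * (\<Sum>j\<in>A. coeff j g * y j)) = (\<Sum>j\<in>A. t j * y j)" for y :: "'k \<Rightarrow> real"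
        unfolding t_def sum_distrib_left sum_distrib_right by (subst sum.swap) (simp add: mult.assoc)
      have "X (transport \<omega>1 \<omega>2) = (\<Sum>g\<in>J. a g * (\<Sum>j\<in>A. coeff j g * l1 j \<omega>1) + (a g * \<omega>2 g - a g * (\<Sum>j\<in>A. coeff j g * l2 j \<omega>2)))"
        unfolding J(3) transport_def using J(2) by (intro sum.cong) (auto simp: distrib_left right_diff_distrib)
      also have "\<dots> = U \<omega>1 + (X \<omega>2 - W \<omega>2)"
        by (simp only: sum.distrib sum_subtractf sw) (simp add: U_def W_def J(3))
      finally show ?thesis .
    qed
    have covU: "G1.cov U U = (\<Sum>j\<in>A. (t j)\<^sup>2)"
    proof -
      have tU: "G1.cov (l1 i) U = t i" if i: "i \<in> A" for i
      proof -
        have "G1.cov U (l1 i) = (\<Sum>j\<in>A. t j * G1.cov (l1 j) (l1 i))"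
          unfolding U_def[abs_def] by (rule G1.cov_lincomb[OF l1 l1[OF i]])
        also have "\<dots> = (\<Sum>j\<in>A. if j = i then t i else 0)" using i by (intro sum.cong) (auto simp: orth1)
        finally have "G1.cov U (l1 i) = t i" using A i by simp
        then show ?thesis by (subst G1.cov_commute)
      qed
      have "G1.cov U U = (\<Sum>j\<in>A. t j * G1.cov (l1 j) U)"
        by (subst (1) U_def[abs_def]) (rule G1.cov_lincomb[OF l1 U])
      also have "\<dots> = (\<Sum>j\<in>A. (t j)\<^sup>2)" by (intro sum.cong refl) (simp only: tU power2_eq_square)
      finally show ?thesis .
    qed
    have covW: "G2.cov W W = (\<Sum>j\<in>A. (t j)\<^sup>2)"
    proof -
      have tU: "G2.cov (l2 i) W = t i" if i: "i \<in> A" for i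
      proof -
        have "G2.cov W (l2 i) = (\<Sum>j\<in>A. t j * G2.cov (l2 j) (l2 i))"
          unfolding W_def[abs_def] by (rule G2.cov_lincomb[OF l2 l2[OF i]])
        also have "\<dots> = (\<Sum>j\<in>A. if j = i then t i else 0)" using i by (intro sum.cong) (auto simp: orth2)
        finally have "G2.cov W (l2 i) = t i" using A i by simp
        then show ?thesis by (subst G2.cov_commute)
      qed
      have "G2.cov W W = (\<Sum>j\<in>A. t j * G2.cov (l2 j) W)"
        by (subst (1) W_def[abs_def]) (rule G2.cov_lincomb[OF l2 W])
      also have "\<dots> = (\<Sum>j\<in>A. (t j)\<^sup>2)" by (intro sum.cong refl) (simp only: tU power2_eq_square)
      finally show ?thesis .
    qed
    have covXW: "G2.cov W X = (\<Sum>j\<in>A. (t j)\<^sup>2)"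
    proof -
      have "G2.cov W X = (\<Sum>j\<in>A. t j * G2.cov (l2 j) X)"
        unfolding W_def[abs_def] by (rule G2.cov_lincomb[OF l2 X])
      also have "\<dots> = (\<Sum>j\<in>A. (t j)\<^sup>2)"
        by (intro sum.cong refl) (simp only: G2.cov_commute[of "l2 _" X] tX power2_eq_square)
      finally show ?thesis .
    qed
    have covV: "G2.cov (\<lambda>\<omega>. X \<omega> - W \<omega>) (\<lambda>\<omega>. X \<omega> - W \<omega>) = G2.cov X X - (\<Sum>j\<in>A. (t j)\<^sup>2)"
    proof -
      have "G2.cov (\<lambda>\<omega>. X \<omega> - W \<omega>) (\<lambda>\<omega>. X \<omega> - W \<omega>) = G2.cov X (\<lambda>\<omega>. X \<omega> - W \<omega>) - G2.cov W (\<lambda>\<omega>. X \<omega> - W \<omega>)"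
        by (rule G2.cov_diff[OF X W V])
      moreover have "G2.cov X (\<lambda>\<omega>. X \<omega> - W \<omega>) = G2.cov X X - G2.cov W X"
        by (subst G2.cov_commute) (rule G2.cov_diff[OF X W X])
      moreover have "G2.cov W (\<lambda>\<omega>. X \<omega> - W \<omega>) = G2.cov X W - G2.cov W W"
        by (subst G2.cov_commute) (rule G2.cov_diff[OF X W W])
      ultimately show ?thesis using covW covXW by (simp add: G2.cov_commute[of X W])
    qed
    have m1: "(\<lambda>\<omega>. iexp (U \<omega>)) \<in> borel_measurable P1" and m2: "(\<lambda>\<omega>. iexp (X \<omega> - W \<omega>)) \<in> borel_measurable P2"
      using measurable_compose[OF G1.lin_measurable[OF U] iexp_measurable] measurable_compose[OF G2.lin_measurable[OF V] iexp_measurable] by auto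
    have int: "integrable (P1 \<Otimes>\<^sub>M P2) (\<lambda>z. iexp (U (fst z)) * iexp (X (snd z) - W (snd z)))"
      by (intro pair.integrable_const_bound[of _ 1] borel_measurable_times measurable_compose[OF measurable_fst m1] measurable_compose[OF measurable_snd m2])
        (simp add: norm_mult)
    have "(CLINT \<omega>|?D. iexp (X \<omega>)) = (CLINT z|P1 \<Otimes>\<^sub>M P2. iexp (X (transport (fst z) (snd z))))"
      by (subst integral_distr[OF transport_measurable measurable_compose[OF lin_functionals_measurable[OF X] iexp_measurable]])
        (simp add: case_prod_beta)
    also have "\<dots> = (CLINT z|P1 \<Otimes>\<^sub>M P2. iexp (U (fst z)) * iexp (X (snd z) - W (snd z)))"
      by (simp only: Xt iexp_add)
    also have "\<dots> = (CLINT x|P1. CLINT y|P2. iexp (U x) * iexp (X y - W y))"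
      using pair.integral_fst'[OF int] by simp
    also have "\<dots> = (CLINT x|P1. iexp (U x) * (CLINT y|P2. iexp (X y - W y)))"
      by (simp only: integral_mult_right_zero)
    also have "\<dots> = (CLINT x|P1. iexp (U x)) * (CLINT y|P2. iexp (X y - W y))"
      by (simp only: integral_mult_left_zero)
    also have "\<dots> = complex_of_real (exp (- G1.cov U U / 2) * exp (- G2.cov (\<lambda>\<omega>. X \<omega> - W \<omega>) (\<lambda>\<omega>. X \<omega> - W \<omega>) / 2))"
      by (simp only: G1.char_cov[OF U] G2.char_cov[OF V] of_real_mult)
    also have "\<dots> = complex_of_real (exp (- G2.cov X X / 2))"
      unfolding covU covV exp_add[symmetric] by (simp add: field_simps)
    also have "\<dots> = (CLINT \<omega>|P2. iexp (X \<omega>))" by (rule G2.char_cov[OF X, symmetric])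
    finally show "(CLINT \<omega>|?D. iexp (X \<omega>)) = (CLINT \<omega>|P2. iexp (X \<omega>))" .
  qed
qed

text \<open>Needed for the design: it bounds the coefficients of the point residual along the
  discretised harmonics by its Euclidean norm.\<close>

lemma bessel:
  assumes X: "X \<in> lin_functionals I2"
  shows "(\<Sum>j\<in>A. (G2.cov X (l2 j))\<^sup>2) \<le> G2.cov X X"
proof -
  let ?W = "\<lambda>\<omega>. \<Sum>j\<in>A. G2.cov X (l2 j) * l2 j \<omega>"
  have W: "?W \<in> lin_functionals I2" by (rule lin_functionals_sum[OF l2])
  have V: "(\<lambda>\<omega>. X \<omega> - ?W \<omega>) \<in> lin_functionals I2" by (rule lin_functionals_diff[OF X W])
  have l2W: "G2.cov (l2 i) ?W = G2.cov X (l2 i)" if i: "i \<in> A" for i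
  proof -
    have "G2.cov ?W (l2 i) = (\<Sum>j\<in>A. G2.cov X (l2 j) * G2.cov (l2 j) (l2 i))"
      by (rule G2.cov_lincomb[OF l2 l2[OF i]])
    also have "\<dots> = (\<Sum>j\<in>A. if j = i then G2.cov X (l2 i) else 0)" using i by (intro sum.cong) (auto simp: orth2)
    finally have "G2.cov ?W (l2 i) = G2.cov X (l2 i)" using A i by simp
    then show ?thesis by (subst G2.cov_commute)
  qed
  have WZ: "G2.cov ?W Z = (\<Sum>j\<in>A. G2.cov X (l2 j) * G2.cov (l2 j) Z)" if "Z \<in> lin_functionals I2" for Z
    by (rule G2.cov_lincomb[OF l2 that])
  have "G2.cov ?W X = (\<Sum>j\<in>A. (G2.cov X (l2 j))\<^sup>2)"
    unfolding WZ[OF X] by (intro sum.cong refl) (simp only: G2.cov_commute[of "l2 _" X] power2_eq_square)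
  moreover have "G2.cov ?W ?W = (\<Sum>j\<in>A. (G2.cov X (l2 j))\<^sup>2)"
    unfolding WZ[OF W] by (intro sum.cong refl) (simp only: l2W power2_eq_square)
  moreover have "G2.cov (\<lambda>\<omega>. X \<omega> - ?W \<omega>) (\<lambda>\<omega>. X \<omega> - ?W \<omega>) = G2.cov X (\<lambda>\<omega>. X \<omega> - ?W \<omega>) - G2.cov ?W (\<lambda>\<omega>. X \<omega> - ?W \<omega>)"
    by (rule G2.cov_diff[OF X W V])
  moreover have "G2.cov X (\<lambda>\<omega>. X \<omega> - ?W \<omega>) = G2.cov X X - G2.cov ?W X"
    by (subst G2.cov_commute) (rule G2.cov_diff[OF X W X])
  moreover have "G2.cov ?W (\<lambda>\<omega>. X \<omega> - ?W \<omega>) = G2.cov X ?W - G2.cov ?W ?W"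
    by (subst G2.cov_commute) (rule G2.cov_diff[OF X W W])
  moreover have "G2.cov X ?W = G2.cov ?W X" by (rule G2.cov_commute)
  ultimately show ?thesis using G2.cov_nonneg[of "\<lambda>\<omega>. X \<omega> - ?W \<omega>"] by linarith
qed

lemma gshift_transport:
  "gshift P2 I2 m \<tau> = distr (P1 \<Otimes>\<^sub>M P2) (Pi\<^sub>M I2 (\<lambda>_. borel)) (\<lambda>(\<omega>1, \<omega>2). \<lambda>g\<in>I2. m g + \<tau> * transport \<omega>1 \<omega>2 g)"
proof -
  have "gshift P2 I2 m \<tau> = distr (distr (P1 \<Otimes>\<^sub>M P2) (Pi\<^sub>M I2 (\<lambda>_. borel)) (\<lambda>(\<omega>1, \<omega>2). transport \<omega>1 \<omega>2))
      (Pi\<^sub>M I2 (\<lambda>_. borel)) (\<lambda>\<omega>. \<lambda>i\<in>I2. m i + \<tau> * \<omega> i)"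
    unfolding gshift_def transport_law ..
  also have "\<dots> = distr (P1 \<Otimes>\<^sub>M P2) (Pi\<^sub>M I2 (\<lambda>_. borel)) ((\<lambda>\<omega>. \<lambda>i\<in>I2. m i + \<tau> * \<omega> i) \<circ> (\<lambda>(\<omega>1, \<omega>2). transport \<omega>1 \<omega>2))"
    by (rule distr_distr[OF affine_measurable transport_measurable])
  finally show ?thesis by (simp add: comp_def split_beta')
qed

text \<open>The components of the observation \<open>z\<close> along \<open>l1\<close>, rescaled
  from noise level \<open>\<tau>1\<close> to \<open>\<tau>2\<close>, become the components along
  \<open>l2\<close>; all other directions receive fresh noise of level \<open>\<tau>2\<close>. The
  mean is unknown to the kernel, so only its part along \<open>l1\<close> is carried over.\<close>

definition kernel :: "real \<Rightarrow> real \<Rightarrow> ('i \<Rightarrow> real) \<Rightarrow> ('j \<Rightarrow> real) measure" where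
  "kernel \<tau>1 \<tau>2 z = distr P2 (Pi\<^sub>M I2 (\<lambda>_. borel))
     (\<lambda>\<omega>. \<lambda>g\<in>I2. (\<Sum>j\<in>A. coeff j g * (\<tau>2 / \<tau>1 * l1 j z)) + \<tau>2 * (\<omega> g - (\<Sum>j\<in>A. coeff j g * l2 j \<omega>)))"

lemma kernel_measurable: "kernel \<tau>1 \<tau>2 \<in> Pi\<^sub>M I1 (\<lambda>_. borel) \<rightarrow>\<^sub>M prob_algebra (Pi\<^sub>M I2 (\<lambda>_. borel))"
  unfolding kernel_def
proof (rule measurable_distr_prob_space2[OF measurable_const transport_measurable0])
  show "P2 \<in> space (prob_algebra (Pi\<^sub>M I2 (\<lambda>_. borel)))"
    using G2.sets_P G2.prob_space_axioms by (simp add: space_prob_algebra)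
qed

text \<open>By linearity \<open>l1 j\<close> splits the observation into mean and noise. After
  rescaling, the noise part is \<open>\<tau>2\<close> times the transported noise, whose law is
  \<open>P2\<close>; what remains is the mean in the conclusion.\<close>

lemma kernel_bind:
  assumes \<tau>1: "\<tau>1 \<noteq> 0"
  shows "gshift P1 I1 m \<tau>1 \<bind> kernel \<tau>1 \<tau>2 = gshift P2 I2 (\<lambda>g. \<Sum>j\<in>A. coeff j g * (\<tau>2 / \<tau>1 * l1 j m)) \<tau>2"
proof -
  let ?aff = "\<lambda>\<omega>. \<lambda>i\<in>I1. m i + \<tau>1 * \<omega> i"
  let ?m2 = "\<lambda>g. \<Sum>j\<in>A. coeff j g * (\<tau>2 / \<tau>1 * l1 j m)"
  let ?\<Phi> = "\<lambda>\<omega>1 \<omega>2. \<lambda>g\<in>I2. ?m2 g + \<tau>2 * transport \<omega>1 \<omega>2 g"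
  have aff: "?aff \<in> P1 \<rightarrow>\<^sub>M Pi\<^sub>M I1 (\<lambda>_. borel)"
    unfolding measurable_cong_sets[OF G1.sets_P refl] by (rule affine_measurable)
  have eq: "(\<lambda>\<omega>2. \<lambda>g\<in>I2. (\<Sum>j\<in>A. coeff j g * (\<tau>2 / \<tau>1 * l1 j (?aff \<omega>1))) + \<tau>2 * (\<omega>2 g - (\<Sum>j\<in>A. coeff j g * l2 j \<omega>2))) = ?\<Phi> \<omega>1" for \<omega>1
  proof (intro ext)
    fix \<omega>2 g
    have "(\<Sum>j\<in>A. coeff j g * (\<tau>2 / \<tau>1 * l1 j (?aff \<omega>1))) = (\<Sum>j\<in>A. coeff j g * (\<tau>2 / \<tau>1 * l1 j m) + \<tau>2 * (coeff j g * l1 j \<omega>1))"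
      using \<tau>1 by (intro sum.cong refl) (simp add: lin_functionals_affine[OF l1] field_simps)
    then show "(\<lambda>g\<in>I2. (\<Sum>j\<in>A. coeff j g * (\<tau>2 / \<tau>1 * l1 j (?aff \<omega>1))) + \<tau>2 * (\<omega>2 g - (\<Sum>j\<in>A. coeff j g * l2 j \<omega>2))) g = ?\<Phi> \<omega>1 \<omega>2 g"
      by (simp add: transport_def sum.distrib sum_distrib_left distrib_left)
  qed
  have ks: "kernel \<tau>1 \<tau>2 \<in> Pi\<^sub>M I1 (\<lambda>_. borel) \<rightarrow>\<^sub>M subprob_algebra (Pi\<^sub>M I2 (\<lambda>_. borel))"
    by (rule measurable_prob_algebraD[OF kernel_measurable])
  have "gshift P1 I1 m \<tau>1 \<bind> kernel \<tau>1 \<tau>2 = P1 \<bind> (\<lambda>\<omega>1. kernel \<tau>1 \<tau>2 (?aff \<omega>1))"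
    unfolding gshift_def by (rule bind_distr[OF aff ks G1.not_empty])
  also have "\<dots> = P1 \<bind> (\<lambda>\<omega>1. distr P2 (Pi\<^sub>M I2 (\<lambda>_. borel)) (?\<Phi> \<omega>1))"
    unfolding kernel_def eq ..
  also have "\<dots> = distr (P1 \<Otimes>\<^sub>M P2) (Pi\<^sub>M I2 (\<lambda>_. borel)) (\<lambda>(\<omega>1, \<omega>2). ?\<Phi> \<omega>1 \<omega>2)"
  proof (rule bind_distr_pair[OF G1.prob_space_axioms G2.prob_space_axioms])
    show "(\<lambda>(\<omega>1, \<omega>2). ?\<Phi> \<omega>1 \<omega>2) \<in> P1 \<Otimes>\<^sub>M P2 \<rightarrow>\<^sub>M Pi\<^sub>M I2 (\<lambda>_. borel)"
      using measurable_compose[OF transport_measurable affine_measurable[of ?m2 \<tau>2]] by (simp add: split_beta')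
  qed
  also have "\<dots> = gshift P2 I2 ?m2 \<tau>2" by (rule gshift_transport[symmetric])
  finally show ?thesis .
qed

end

text \<open>The noise is split into a standard Gaussian coordinate along the normalised functional
  \<open>e\<close> and an independent remainder. The two means differ by a shift of that coordinate
  alone, so for each fixed remainder the one-dimensional bound applies. If \<open>l\<close> has
  variance \<open>0\<close>, the means coincide.\<close>

lemma (in gaussian_measure) total_variation_gshift:
  assumes l: "l \<in> lin_functionals I" and m: "\<And>g. g \<in> I \<Longrightarrow> m g - m' g = \<tau> * cov l (\<lambda>\<omega>. \<omega> g)"
  shows "total_variation (gshift P I m \<tau>) (gshift P I m' \<tau>) \<le> ennreal (sqrt (cov l l))"
proof (cases "cov l l = 0")
  case True
  have "AE \<omega> in P. l \<omega> * l \<omega> = 0"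
    using True integral_nonneg_eq_0_iff_AE[OF prod_integrable[OF l l]] by (simp add: cov_def)
  then have l0: "AE \<omega> in P. l \<omega> = 0" by simp
  have "cov l X = 0" for X
  proof -
    have "AE \<omega> in P. l \<omega> * X \<omega> = 0" using l0 by eventually_elim simp
    then show ?thesis unfolding cov_def by (rule integral_eq_zero_AE)
  qed
  then have "m g = m' g" if "g \<in> I" for g using m[OF that] by simp
  then have "(\<lambda>\<omega>. \<lambda>i\<in>I. m i + \<tau> * \<omega> i) = (\<lambda>\<omega>. \<lambda>i\<in>I. m' i + \<tau> * \<omega> i)"
    by (intro ext) (simp add: restrict_def)
  then have "gshift P I m \<tau> = gshift P I m' \<tau>" by (simp only: gshift_def)
  then show ?thesis unfolding total_variation_def by (intro SUP_least) simp
next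
  case False
  with cov_nonneg[of l] have pos: "cov l l > 0" by simp
  define v where "v = sqrt (cov l l)"
  have v: "v > 0" "v * v = cov l l" using pos by (auto simp: v_def)
  define e where "e \<omega> = inverse v * l \<omega>" for \<omega>
  have e: "e \<in> lin_functionals I" unfolding e_def[abs_def] by (rule lin_functionals_scale[OF l])
  have "cov e e = inverse v * (inverse v * cov l l)"
    unfolding e_def[abs_def] by (simp only: cov_scale cov_commute[of l "\<lambda>\<omega>. inverse v * l \<omega>"])
  also have "\<dots> = inverse v * (inverse v * (v * v))" by (simp only: v(2))
  also have "\<dots> = (inverse v * v) * (inverse v * v)" by (simp only: mult_ac)
  also have "inverse v * v = 1" using less_imp_neq[OF v(1)] by (intro left_inverse) simp
  finally have ee: "cov e e = 1" by (simp only: mult_1_right)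
  \<comment> \<open>The process is transported to itself along the single direction
    \<open>e\<close>: drawing that component from an independent copy makes it independent of the
    remainder.\<close>
  interpret T: gaussian_transport I P I P "{()}" "\<lambda>_. e" "\<lambda>_. e"
    by unfold_locales (auto simp: e ee)
  let ?c = "\<lambda>g. cov e (\<lambda>\<omega>. \<omega> g)"
  let ?S = "Pi\<^sub>M I (\<lambda>_. borel :: real measure)"
  \<comment> \<open>The shifted path as a function of the value \<open>z\<close> along
    \<open>e\<close> and of the remainder of \<open>b\<close>; changing the mean from
    \<open>m'\<close> to \<open>m\<close> replaces \<open>z\<close> by \<open>z + v\<close>.\<close>
  define \<Theta> where "\<Theta> z b = (\<lambda>g\<in>I. m' g + \<tau> * (?c g * z + (b g - ?c g * e b)))" for z b
  have mg: "m g = m' g + \<tau> * (v * ?c g)" if "g \<in> I" for g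
    using m[OF that] v unfolding e_def[abs_def] cov_scale by (simp add: field_simps)
  have shift1: "gshift P I m \<tau> = distr (P \<Otimes>\<^sub>M P) ?S (\<lambda>(a, b). \<Theta> (e a + v) b)"
    unfolding T.gshift_transport
    by (intro distr_cong refl) (auto simp: \<Theta>_def T.transport_def T.coeff_def mg algebra_simps fun_eq_iff)
  have shift2: "gshift P I m' \<tau> = distr (P \<Otimes>\<^sub>M P) ?S (\<lambda>(a, b). \<Theta> (e a) b)"
    unfolding T.gshift_transport
    by (intro distr_cong refl) (auto simp: \<Theta>_def T.transport_def T.coeff_def fun_eq_iff)
  have em: "e \<in> borel_measurable ?S" by (rule lin_functionals_measurable[OF e])
  have eP: "e \<in> borel_measurable P" by (rule lin_measurable[OF e])
  have \<Theta>m: "(\<lambda>(z, b). \<Theta> z b) \<in> borel \<Otimes>\<^sub>M ?S \<rightarrow>\<^sub>M ?S"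
    unfolding \<Theta>_def case_prod_beta
    by (intro measurable_restrict borel_measurable_add borel_measurable_times borel_measurable_diff borel_measurable_const measurable_fst
        measurable_compose[OF measurable_snd em] measurable_compose[OF measurable_snd measurable_component_singleton])
  have \<Theta>m': "(\<lambda>(z, b). \<Theta> z b) \<in> borel \<Otimes>\<^sub>M P \<rightarrow>\<^sub>M ?S"
    using \<Theta>m unfolding measurable_cong_sets[OF sets_pair_measure_cong[OF refl sets_P] refl] .
  have shm: "(\<lambda>(a, b). \<Theta> (e a + r) b) \<in> P \<Otimes>\<^sub>M P \<rightarrow>\<^sub>M ?S" for r
  proof -
    have "(\<lambda>z. (e (fst z) + r, snd z)) \<in> P \<Otimes>\<^sub>M P \<rightarrow>\<^sub>M borel \<Otimes>\<^sub>M P"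
      by (intro measurable_Pair borel_measurable_add measurable_compose[OF measurable_fst eP] borel_measurable_const measurable_snd)
    from measurable_compose[OF this \<Theta>m'] show ?thesis by (simp add: split_beta')
  qed
  have law: "distr P borel e = std_gaussian"
  proof (rule Levy_uniqueness)
    show "real_distribution (distr P borel e)" by (rule real_distribution_distr[OF eP])
    show "real_distribution std_gaussian" unfolding std_gaussian_def by (rule real_dist_normal_dist)
    show "char (distr P borel e) = char std_gaussian"
    proof
      fix t
      have te: "(\<lambda>\<omega>. t * e \<omega>) \<in> lin_functionals I" by (rule lin_functionals_scale[OF e])
      have "cov (\<lambda>\<omega>. t * e \<omega>) (\<lambda>\<omega>. t * e \<omega>) = t * (t * cov e e)"
        by (simp only: cov_scale cov_commute[of e "\<lambda>\<omega>. t * e \<omega>"])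
      then have "cov (\<lambda>\<omega>. t * e \<omega>) (\<lambda>\<omega>. t * e \<omega>) = t\<^sup>2" by (simp add: ee power2_eq_square)
      then have "(CLINT \<omega>|P. iexp (t * e \<omega>)) = complex_of_real (exp (- t\<^sup>2 / 2))" using char_cov[OF te] by simp
      then show "char (distr P borel e) t = char std_gaussian t"
        unfolding char_def using eP std_gaussian_facts(9)[of t] by (subst integral_distr) auto
    qed
  qed
  interpret pair: pair_sigma_finite P P by unfold_locales
  interpret N: prob_space std_gaussian by (rule std_gaussian_facts(1))
  have sec: "emeasure (distr (P \<Otimes>\<^sub>M P) ?S (\<lambda>(a, b). \<Theta> (e a + r) b)) B = (\<integral>\<^sup>+b. ennreal (measure std_gaussian {z. z + r \<in> {z. \<Theta> z b \<in> B}}) \<partial>P)"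
    and secm: "(\<lambda>b. ennreal (measure std_gaussian {z. z + r \<in> {z. \<Theta> z b \<in> B}})) \<in> borel_measurable P"
    if B: "B \<in> sets ?S" for r B
  proof -
    let ?Q = "(\<lambda>(a, b). \<Theta> (e a + r) b) -` B \<inter> space (P \<Otimes>\<^sub>M P)"
    have Q: "?Q \<in> sets (P \<Otimes>\<^sub>M P)" by (rule measurable_sets[OF shm B])
    have pt: "emeasure P ((\<lambda>a. (a, b)) -` ?Q) = ennreal (measure std_gaussian {z. z + r \<in> {z. \<Theta> z b \<in> B}})" if b: "b \<in> space P" for b
    proof -
      have "(\<lambda>z. \<Theta> (z + r) b) \<in> borel \<rightarrow>\<^sub>M ?S"
      proof -
        have "(\<lambda>z. (z + r, b)) \<in> borel \<rightarrow>\<^sub>M borel \<Otimes>\<^sub>M P" using b by measurable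
        from measurable_compose[OF this \<Theta>m'] show ?thesis by simp
      qed
      from measurable_sets[OF this B] have Z: "{z. \<Theta> (z + r) b \<in> B} \<in> sets borel" by (simp add: vimage_def)
      have "(\<lambda>a. (a, b)) -` ?Q = e -` {z. \<Theta> (z + r) b \<in> B} \<inter> space P" using b by (auto simp: space_pair_measure)
      then have "emeasure P ((\<lambda>a. (a, b)) -` ?Q) = emeasure (distr P borel e) {z. \<Theta> (z + r) b \<in> B}"
        using emeasure_distr[OF eP Z] by simp
      then show ?thesis unfolding law by (simp add: N.emeasure_eq_measure)
    qed
    have "emeasure (distr (P \<Otimes>\<^sub>M P) ?S (\<lambda>(a, b). \<Theta> (e a + r) b)) B = emeasure (P \<Otimes>\<^sub>M P) ?Q"
      by (rule emeasure_distr[OF shm B])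
    also have "\<dots> = (\<integral>\<^sup>+b. emeasure P ((\<lambda>a. (a, b)) -` ?Q) \<partial>P)" by (rule pair.emeasure_pair_measure_alt2[OF Q])
    also have "\<dots> = (\<integral>\<^sup>+b. ennreal (measure std_gaussian {z. z + r \<in> {z. \<Theta> z b \<in> B}}) \<partial>P)"
      by (rule nn_integral_cong) (rule pt)
    finally show "emeasure (distr (P \<Otimes>\<^sub>M P) ?S (\<lambda>(a, b). \<Theta> (e a + r) b)) B = (\<integral>\<^sup>+b. ennreal (measure std_gaussian {z. z + r \<in> {z. \<Theta> z b \<in> B}}) \<partial>P)" .
    have "(\<lambda>b. emeasure P ((\<lambda>a. (a, b)) -` ?Q)) \<in> borel_measurable P" by (rule pair.measurable_emeasure_Pair2[OF Q])
    then show "(\<lambda>b. ennreal (measure std_gaussian {z. z + r \<in> {z. \<Theta> z b \<in> B}})) \<in> borel_measurable P"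
      by (rule measurable_cong[THEN iffD1, rotated]) (rule pt)
  qed
  have Zb: "{z. \<Theta> z b \<in> B} \<in> sets borel" if "b \<in> space P" "B \<in> sets ?S" for b B
  proof -
    have "(\<lambda>z. \<Theta> z b) \<in> borel \<rightarrow>\<^sub>M ?S" using measurable_compose[OF measurable_Pair2'[OF that(1)] \<Theta>m'] by simp
    from measurable_sets[OF this that(2)] show ?thesis by (simp add: vimage_def)
  qed
  have comp: "emeasure (distr (P \<Otimes>\<^sub>M P) ?S (\<lambda>(a, b). \<Theta> (e a + r) b)) B \<le> emeasure (distr (P \<Otimes>\<^sub>M P) ?S (\<lambda>(a, b). \<Theta> (e a + r') b)) B + ennreal v"
    if B: "B \<in> sets ?S" and r: "r = 0 \<and> r' = v \<or> r = v \<and> r' = 0" for r r' B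
  proof -
    have "(\<integral>\<^sup>+b. ennreal (measure std_gaussian {z. z + r \<in> {z. \<Theta> z b \<in> B}}) \<partial>P) \<le>
      (\<integral>\<^sup>+b. ennreal (measure std_gaussian {z. z + r' \<in> {z. \<Theta> z b \<in> B}}) + ennreal v \<partial>P)"
    proof (rule nn_integral_mono)
      fix b assume b: "b \<in> space P"
      have "measure std_gaussian {z. z + r \<in> {z. \<Theta> z b \<in> B}} \<le> measure std_gaussian {z. z + r' \<in> {z. \<Theta> z b \<in> B}} + v"
        using gaussian_shift[OF less_imp_le[OF v(1)] Zb[OF b B]] r by auto
      then show "ennreal (measure std_gaussian {z. z + r \<in> {z. \<Theta> z b \<in> B}}) \<le> ennreal (measure std_gaussian {z. z + r' \<in> {z. \<Theta> z b \<in> B}}) + ennreal v"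
        using v by (simp flip: ennreal_plus)
    qed
    also have "\<dots> = (\<integral>\<^sup>+b. ennreal (measure std_gaussian {z. z + r' \<in> {z. \<Theta> z b \<in> B}}) \<partial>P) + (\<integral>\<^sup>+b. ennreal v \<partial>P)"
      by (rule nn_integral_add[OF secm[OF B]]) simp
    also have "(\<integral>\<^sup>+b. ennreal v \<partial>P) = ennreal v" by (simp add: emeasure_space_1)
    finally show ?thesis unfolding sec[OF B] .
  qed
  have shift2': "gshift P I m' \<tau> = distr (P \<Otimes>\<^sub>M P) ?S (\<lambda>(a, b). \<Theta> (e a + 0) b)" unfolding shift2 by simp
  interpret pp: pair_prob_space P P by unfold_locales
  interpret D1: prob_space "gshift P I m \<tau>" unfolding shift1 by (rule pp.prob_space_distr[OF shm])
  interpret D2: prob_space "gshift P I m' \<tau>" unfolding shift2' by (rule pp.prob_space_distr[OF shm])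
  show ?thesis unfolding total_variation_def v_def[symmetric]
  proof (rule SUP_least)
    fix B assume "B \<in> sets (gshift P I m \<tau>)"
    then have B: "B \<in> sets ?S" by (simp add: gshift_def)
    have "ennreal (measure (gshift P I m \<tau>) B) \<le> ennreal (measure (gshift P I m' \<tau>) B) + ennreal v"
      using comp[OF B, of v 0] unfolding shift1[symmetric] shift2'[symmetric] by (simp add: D1.emeasure_eq_measure D2.emeasure_eq_measure)
    then have 1: "measure (gshift P I m \<tau>) B \<le> measure (gshift P I m' \<tau>) B + v" using v by (simp flip: ennreal_plus)
    have "ennreal (measure (gshift P I m' \<tau>) B) \<le> ennreal (measure (gshift P I m \<tau>) B) + ennreal v"
      using comp[OF B, of 0 v] unfolding shift1[symmetric] shift2'[symmetric] by (simp add: D1.emeasure_eq_measure D2.emeasure_eq_measure)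
    then have 2: "measure (gshift P I m' \<tau>) B \<le> measure (gshift P I m \<tau>) B + v" using v by (simp flip: ennreal_plus)
    show "ennreal \<bar>measure (gshift P I m \<tau>) B - measure (gshift P I m' \<tau>) B\<bar> \<le> ennreal v"
      using 1 2 by (intro ennreal_leI) linarith
  qed
qed

text \<open>Exhibits \<open>kernel\<close> as a candidate in the infimum. The functional
  \<open>l\<close> represents the error of the produced mean in the Cameron--Martin sense, and its
  standard deviation bounds the total variation.\<close>

lemma (in gaussian_transport) deficiency_le:
  assumes \<tau>: "\<tau>1 \<noteq> 0"
    and E: "sample_space E = Pi\<^sub>M I1 (\<lambda>_. borel)" "\<And>f. f \<in> \<Theta> \<Longrightarrow> law E f = gshift P1 I1 (m1 f) \<tau>1"
    and E': "sample_space E' = Pi\<^sub>M I2 (\<lambda>_. borel)" "\<And>f. f \<in> \<Theta> \<Longrightarrow> law E' f = gshift P2 I2 (m2 f) \<tau>2"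
    and l: "\<And>f. f \<in> \<Theta> \<Longrightarrow> \<exists>l\<in>lin_functionals I2. sqrt (G2.cov l l) \<le> b \<and>
      (\<forall>g\<in>I2. (\<Sum>j\<in>A. coeff j g * (\<tau>2 / \<tau>1 * l1 j (m1 f))) - m2 f g = \<tau>2 * G2.cov l (\<lambda>\<omega>. \<omega> g))"
  shows "deficiency \<Theta> E E' \<le> ennreal b"
  unfolding deficiency_def
proof (rule INF_lower2)
  show "kernel \<tau>1 \<tau>2 \<in> sample_space E \<rightarrow>\<^sub>M prob_algebra (sample_space E')"
    unfolding E E' by (rule kernel_measurable)
  show "(SUP f\<in>\<Theta>. total_variation (law E f \<bind> kernel \<tau>1 \<tau>2) (law E' f)) \<le> ennreal b"
  proof (rule SUP_least)
    fix f assume f: "f \<in> \<Theta>"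
    obtain l where l: "l \<in> lin_functionals I2" "sqrt (G2.cov l l) \<le> b"
      "\<And>g. g \<in> I2 \<Longrightarrow> (\<Sum>j\<in>A. coeff j g * (\<tau>2 / \<tau>1 * l1 j (m1 f))) - m2 f g = \<tau>2 * G2.cov l (\<lambda>\<omega>. \<omega> g)"
      using l[OF f] by blast
    have "total_variation (law E f \<bind> kernel \<tau>1 \<tau>2) (law E' f) \<le> ennreal (sqrt (G2.cov l l))"
      unfolding E(2)[OF f] E'(2)[OF f] kernel_bind[OF \<tau>] by (rule G2.total_variation_gshift[OF l(1,3)])
    also have "\<dots> \<le> ennreal b" using l(2) by (rule ennreal_leI)
    finally show "total_variation (law E f \<bind> kernel \<tau>1 \<tau>2) (law E' f) \<le> ennreal b" .
  qed
qed

section \<open>Comparison of the experiments\<close>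

locale design_regression =
  fixes d :: nat and N :: "nat \<Rightarrow> nat" and Y :: "nat \<Rightarrow> nat \<Rightarrow> real ^ 'n \<Rightarrow> real"
    and s R :: real and W :: "((real ^ 'n \<Rightarrow> real) \<Rightarrow> real) measure" and \<sigma> :: real and n L t :: nat and x :: "nat \<Rightarrow> real ^ 'n"
  assumes d: "d \<ge> 1" and card: "CARD('n) = Suc d" and s: "s > real d / 2"
    and basis: "harmonic_basis d N Y" and noise: "white_noise W" and R: "R \<ge> 0" and \<sigma>: "\<sigma> > 0"
    and L: "L \<ge> 1" and t: "t \<ge> 2 * L" and des: "spherical_design t n x"
begin

definition "J = Sigma {..L} (\<lambda>l. {1..N l})"
definition "YJ j = Y (fst j) (snd j)"

lemma sobolev: "f \<in> sobolev_ball d N Y s R \<Longrightarrow> sobolev_function d N Y s R f"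
  by unfold_locales (use d card s basis R in auto)

text \<open>The zero function lies in every ball; interpreting \<open>sobolev_function\<close> at it
  makes the facts about the basis available without fixing a regression function.\<close>

lemma zero_ball: "(\<lambda>x. 0) \<in> sobolev_ball d N Y s R"
  by (simp add: sobolev_ball_def L2_sphere_zero sobolev_norm_sq_def)

sublocale Z: sobolev_function d N Y s R "\<lambda>x. 0"
  by (rule sobolev[OF zero_ball])

lemma finite_J: "finite J" by (auto simp: J_def)

lemma n_pos: "n \<ge> 1" using des by (simp add: spherical_design_def)

lemma YJ_L2: "j \<in> J \<Longrightarrow> YJ j \<in> L2_sphere"
  by (auto simp: J_def YJ_def intro: Z.Y_L2)

lemma YJ_orthonormal: "i \<in> J \<Longrightarrow> j \<in> J \<Longrightarrow> L2_inner (YJ i) (YJ j) = (if i = j then 1 else 0)"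
  by (auto simp: J_def YJ_def Z.Y_orthonormal prod_eq_iff)

lemma YJ_poly: "j \<in> J \<Longrightarrow> \<exists>p. polyfun L p \<and> (\<forall>y\<in>sphere 0 1. YJ j y = p y)"
  using Z.Ypoly polyfun_harmonic_eq by (fastforce simp: J_def YJ_def)

lemma point_sphere: "i \<in> {1..n} \<Longrightarrow> x i \<in> sphere 0 1"
  using spherical_design_norm[OF des] by simp

text \<open>The source of the strength \<open>2 * L\<close>: a product of two polynomials of degree
  at most \<open>L\<close> is integrated exactly. Polynomial representatives are passed separately
  because the functions are constrained only on the sphere.\<close>

lemma quadrature:
  assumes p: "polyfun L p" and q: "polyfun L q"
    and f: "\<And>y. y \<in> sphere 0 1 \<Longrightarrow> f y = p y" and g: "\<And>y. y \<in> sphere 0 1 \<Longrightarrow> g y = q y"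
  shows "(\<Sum>i=1..n. f (x i) * g (x i)) = real n * L2_inner f g"
proof -
  have pq: "(\<lambda>y. p y * q y) \<in> polynomials_upto t"
  proof (rule polyfun_imp_polynomials_upto)
    have "L + L \<le> t" using t by simp
    then show "polyfun t (\<lambda>y. p y * q y)" by (rule polyfun_mono[OF polyfun_mult[OF p q]])
  qed
  have "\<forall>p\<in>polynomials_upto t. (1 / real n) * (\<Sum>i=1..n. p (x i)) = (\<integral>y. p y \<partial>sphere_measure)"
    using des unfolding spherical_design_def by blast
  note bspec[OF this pq]
  also have "(\<integral>y. p y * q y \<partial>sphere_measure) = L2_inner p q" by (simp only: L2_inner_def)
  also have "\<dots> = L2_inner f g" by (rule L2_inner_cong) (simp_all only: f g)
  finally have "(\<Sum>i=1..n. p (x i) * q (x i)) = real n * L2_inner f g" using n_pos by (simp add: field_simps)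
  moreover have "(\<Sum>i=1..n. f (x i) * g (x i)) = (\<Sum>i=1..n. p (x i) * q (x i))"
    by (rule sum.cong) (simp_all only: f[OF point_sphere] g[OF point_sphere])
  ultimately show ?thesis by (simp only:)
qed

definition "FN = Pi\<^sub>M {1..n} (\<lambda>_. std_gaussian)"

sublocale F: gaussian_measure "{1..n}" FN
  unfolding FN_def by (rule gaussian_measure_product)

sublocale G: gaussian_measure L2_sphere W
  using noise unfolding white_noise_def by (rule gaussian_process_measure)

lemma F_lin: "(\<lambda>\<omega>. \<Sum>i=1..n. a i * \<omega> i) \<in> lin_functionals {1..n}"
  by (rule lin_functionals_sum[OF lin_functionals_coord])

lemma F_cov_coord: "k \<in> {1..n} \<Longrightarrow> F.cov (\<lambda>\<omega>. \<Sum>i=1..n. a i * \<omega> i) (\<lambda>\<omega>. \<omega> k) = a k"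
proof -
  assume k: "k \<in> {1..n}"
  have "F.cov (\<lambda>\<omega>. \<Sum>i=1..n. a i * \<omega> i) (\<lambda>\<omega>. \<omega> k) = (\<Sum>i=1..n. a i * F.cov (\<lambda>\<omega>. \<omega> i) (\<lambda>\<omega>. \<omega> k))"
    by (rule F.cov_lincomb[OF lin_functionals_coord lin_functionals_coord[OF k]])
  also have "\<dots> = (\<Sum>i=1..n. if i = k then a k else 0)"
  proof (rule sum.cong[OF refl])
    fix i assume i: "i \<in> {1..n}"
    have "F.cov (\<lambda>\<omega>. \<omega> i) (\<lambda>\<omega>. \<omega> k) = (if i = k then 1 else 0)"
      unfolding F.cov_def unfolding FN_def by (rule gaussian_measure_product(2)[OF i k])
    then show "a i * F.cov (\<lambda>\<omega>. \<omega> i) (\<lambda>\<omega>. \<omega> k) = (if i = k then a k else 0)" by auto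
  qed
  finally show ?thesis using k by simp
qed

lemma F_cov: "F.cov (\<lambda>\<omega>. \<Sum>i=1..n. a i * \<omega> i) (\<lambda>\<omega>. \<Sum>i=1..n. b i * \<omega> i) = (\<Sum>i=1..n. a i * b i)"
proof -
  have "F.cov (\<lambda>\<omega>. \<Sum>i=1..n. b i * \<omega> i) (\<lambda>\<omega>. \<Sum>i=1..n. a i * \<omega> i) = (\<Sum>i=1..n. b i * F.cov (\<lambda>\<omega>. \<omega> i) (\<lambda>\<omega>. \<Sum>i=1..n. a i * \<omega> i))"
    by (rule F.cov_lincomb[OF lin_functionals_coord F_lin])
  also have "\<dots> = (\<Sum>i=1..n. a i * b i)"
  proof (rule sum.cong[OF refl])
    fix i assume i: "i \<in> {1..n}"
    have "F.cov (\<lambda>\<omega>. \<omega> i) (\<lambda>\<omega>. \<Sum>i=1..n. a i * \<omega> i) = a i"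
      by (subst F.cov_commute) (rule F_cov_coord[OF i])
    then show "b i * F.cov (\<lambda>\<omega>. \<omega> i) (\<lambda>\<omega>. \<Sum>i=1..n. a i * \<omega> i) = a i * b i"
      by (simp only: mult.commute[of "b i"])
  qed
  finally show ?thesis by (subst F.cov_commute)
qed

lemma G_cov: "f \<in> L2_sphere \<Longrightarrow> g \<in> L2_sphere \<Longrightarrow> G.cov (\<lambda>\<omega>. \<omega> f) (\<lambda>\<omega>. \<omega> g) = L2_inner f g"
  using noise unfolding white_noise_def G.cov_def by (rule gaussian_process_measure(2))

definition "lF j \<omega> = (\<Sum>i=1..n. (YJ j (x i) / sqrt (real n)) * \<omega> i)"
definition "lG j (\<omega> :: (real ^ 'n \<Rightarrow> real) \<Rightarrow> real) = \<omega> (YJ j)"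

lemma lF: "lF j \<in> lin_functionals {1..n}"
  unfolding lF_def[abs_def] by (rule F_lin)

lemma lG: "j \<in> J \<Longrightarrow> lG j \<in> lin_functionals L2_sphere"
  unfolding lG_def[abs_def] by (rule lin_functionals_coord[OF YJ_L2])

lemma lF_orth:
  assumes "i \<in> J" "j \<in> J" shows "F.cov (lF i) (lF j) = (if i = j then 1 else 0)"
proof -
  obtain p where p: "polyfun L p" "\<And>y. y\<in>sphere 0 1 \<Longrightarrow> YJ i y = p y" using YJ_poly[OF assms(1)] by blast
  obtain q where q: "polyfun L q" "\<And>y. y\<in>sphere 0 1 \<Longrightarrow> YJ j y = q y" using YJ_poly[OF assms(2)] by blast
  have "F.cov (lF i) (lF j) = (\<Sum>k=1..n. (YJ i (x k) / sqrt (real n)) * (YJ j (x k) / sqrt (real n)))"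
    unfolding lF_def[abs_def] by (rule F_cov)
  also have "\<dots> = (\<Sum>k=1..n. YJ i (x k) * YJ j (x k)) / real n"
    unfolding sum_divide_distrib by (intro sum.cong refl) (simp add: field_simps)
  also have "\<dots> = L2_inner (YJ i) (YJ j)"
    by (subst quadrature[OF p(1) q(1) p(2) q(2)]) (use n_pos in auto)
  finally show ?thesis using YJ_orthonormal[OF assms] by simp
qed

lemma lG_orth: "i \<in> J \<Longrightarrow> j \<in> J \<Longrightarrow> G.cov (lG i) (lG j) = (if i = j then 1 else 0)"
  unfolding lG_def[abs_def] by (simp add: G_cov YJ_L2 YJ_orthonormal)

sublocale FG: gaussian_transport "{1..n}" FN L2_sphere W J lF lG
  by (unfold_locales; (rule finite_J | erule lF_orth lG_orth lG | rule lF | assumption)+)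

sublocale GF: gaussian_transport L2_sphere W "{1..n}" FN J lG lF
  by (unfold_locales; (rule finite_J | erule lF_orth lG_orth lG | rule lF | assumption)+)

section \<open>Errors of the projection and of hyperinterpolation\<close>

definition "point_const = sqrt (design_const d * 2 ^ d) / (1 - 2 powr (real d / 2 - s))"
definition "rate = real L powr (- s) * R"

lemma point_const_nonneg: "point_const \<ge> 0"
  using Z.ratio(2) design_const_pos[of d] by (simp add: point_const_def Z.ratio_def)

lemma rate_nonneg: "rate \<ge> 0" using R by (simp add: rate_def)

definition "theta f j = L2_inner f (YJ j)"
definition "proj f y = (\<Sum>j\<in>J. theta f j * YJ j y)"

lemma proj_partial:
  assumes f: "f \<in> sobolev_ball d N Y s R" and y: "y \<in> sphere 0 1"
  shows "proj f y = sobolev_function.partial N Y f L y"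
proof -
  interpret S: sobolev_function d N Y s R f by (rule sobolev[OF f])
  show ?thesis unfolding proj_def J_def S.partial_def S.hcomp_sphere[OF y]
    by (subst sum.Sigma) (auto simp: theta_def S.coef_def YJ_def case_prod_beta)
qed

lemma proj_L2: "proj f \<in> L2_sphere"
  unfolding proj_def[abs_def] by (rule L2_sphere_lincomb[OF YJ_L2])

lemma residual_points:
  assumes f: "f \<in> sobolev_ball d N Y s R"
  shows "L2_set (\<lambda>i. cont_rep f (x i) - proj f (x i)) {1..n} \<le> point_const * sqrt (real n) * rate"
proof -
  interpret S: sobolev_function d N Y s R f by (rule sobolev[OF f])
  have "L2_set (\<lambda>i. cont_rep f (x i) - proj f (x i)) {1..n} = L2_set (\<lambda>i. cont_rep f (x i) - S.partial L (x i)) {1..n}"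
    by (rule L2_set_cong) (simp_all only: proj_partial[OF f point_sphere])
  then show ?thesis using S.residual_points[OF des t L] by (simp add: point_const_def rate_def S.ratio_def)
qed

lemma residual_L2:
  assumes f: "f \<in> sobolev_ball d N Y s R"
  shows "L2_inner (\<lambda>y. proj f y - f y) (\<lambda>y. proj f y - f y) \<le> rate\<^sup>2"
proof -
  interpret S: sobolev_function d N Y s R f by (rule sobolev[OF f])
  have "L2_inner (\<lambda>y. proj f y - f y) (\<lambda>y. proj f y - f y) = (\<integral>y. (f y - S.partial L y) * (f y - S.partial L y) \<partial>sphere_measure)"
    unfolding L2_inner_def
    by (intro Bochner_Integration.integral_cong refl) (simp add: space_sphere_measure proj_partial[OF f] algebra_simps)
  then show ?thesis using S.residual_L2[OF L] by (simp add: L2_inner_def rate_def)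
qed

text \<open>The Fourier projection of degree \<open>L\<close> with its coefficients computed by the
  equal-weight rule of the design; it is the mean that the kernel from regression to white noise
  produces.\<close>

definition "hyperinterp f y = (\<Sum>j\<in>J. ((\<Sum>i=1..n. YJ j (x i) * cont_rep f (x i)) / real n) * YJ j y)"

lemma hyperinterp_L2: "hyperinterp f \<in> L2_sphere"
  unfolding hyperinterp_def[abs_def] by (rule L2_sphere_lincomb[OF YJ_L2])

text \<open>The rule is exact on \<open>proj f\<close> against each basis function, so the
  difference is the hyperinterpolant of the point residual \<open>r\<close> alone.\<close>

lemma hyperinterp_proj:
  assumes f: "f \<in> sobolev_ball d N Y s R"
  shows "L2_inner (\<lambda>y. hyperinterp f y - proj f y) (\<lambda>y. hyperinterp f y - proj f y) \<le> (point_const * rate)\<^sup>2"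
proof -
  define r where "r i = cont_rep f (x i) - proj f (x i)" for i
  define c where "c j = (\<Sum>i=1..n. YJ j (x i) * r i) / real n" for j
  have c: "(\<Sum>i=1..n. YJ j (x i) * cont_rep f (x i)) / real n - theta f j = c j" if j: "j \<in> J" for j
  proof -
    obtain p where p: "polyfun L p" "\<And>y. y\<in>sphere 0 1 \<Longrightarrow> YJ j y = p y" using YJ_poly[OF j] by blast
    have "\<exists>q. polyfun L q \<and> (\<forall>y\<in>sphere 0 1. proj f y = q y)"
    proof -
      obtain P where P: "\<And>j. j \<in> J \<Longrightarrow> polyfun L (P j) \<and> (\<forall>y\<in>sphere 0 1. YJ j y = P j y)" using YJ_poly by metis
      have "polyfun L (\<lambda>y. \<Sum>j\<in>J. theta f j * P j y)" by (intro polyfun_sum polyfun_cmult) (use P in blast)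
      moreover have "proj f y = (\<Sum>j\<in>J. theta f j * P j y)" if "y \<in> sphere 0 1" for y
        unfolding proj_def using P that by (intro sum.cong refl) simp
      ultimately show ?thesis by blast
    qed
    then obtain q where q: "polyfun L q" "\<And>y. y\<in>sphere 0 1 \<Longrightarrow> proj f y = q y" by blast
    have "L2_inner (YJ j) (proj f) = (\<Sum>k\<in>J. theta f k * L2_inner (YJ j) (YJ k))"
      unfolding proj_def[abs_def] by (rule L2_inner_lincomb(2)[OF YJ_L2 YJ_L2[OF j]])
    also have "\<dots> = (\<Sum>k\<in>J. if k = j then theta f j else 0)"
      using j by (intro sum.cong) (auto simp: YJ_orthonormal)
    also have "\<dots> = theta f j" using j finite_J by simp
    finally have "(\<Sum>i=1..n. YJ j (x i) * proj f (x i)) = real n * theta f j"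
      using quadrature[OF p(1) q(1) p(2) q(2)] by simp
    then have "theta f j = (\<Sum>i=1..n. YJ j (x i) * proj f (x i)) / real n" using n_pos by simp
    then show ?thesis unfolding c_def r_def by (simp add: right_diff_distrib sum_subtractf diff_divide_distrib)
  qed
  have eq: "hyperinterp f y - proj f y = (\<Sum>j\<in>J. c j * YJ j y)" for y
    unfolding hyperinterp_def proj_def sum_subtractf[symmetric] left_diff_distrib[symmetric]
    by (intro sum.cong refl) (simp only: c)
  have sumL: "(\<lambda>y. \<Sum>j\<in>J. c j * YJ j y) \<in> L2_sphere" by (rule L2_sphere_lincomb[OF YJ_L2])
  have ip: "L2_inner (YJ j) (\<lambda>y. \<Sum>j\<in>J. c j * YJ j y) = c j" if j: "j \<in> J" for j
  proof -
    have "L2_inner (YJ j) (\<lambda>y. \<Sum>j\<in>J. c j * YJ j y) = (\<Sum>k\<in>J. c k * L2_inner (YJ j) (YJ k))"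
      by (rule L2_inner_lincomb(2)[OF YJ_L2 YJ_L2[OF j]])
    also have "\<dots> = (\<Sum>k\<in>J. if k = j then c j else 0)"
      using j by (intro sum.cong) (auto simp: YJ_orthonormal)
    finally show ?thesis using j finite_J by simp
  qed
  have "L2_inner (\<lambda>y. hyperinterp f y - proj f y) (\<lambda>y. hyperinterp f y - proj f y) = (\<Sum>j\<in>J. c j * L2_inner (YJ j) (\<lambda>y. \<Sum>j\<in>J. c j * YJ j y))"
    unfolding eq by (rule L2_inner_lincomb(1)[OF YJ_L2 sumL])
  also have "\<dots> = (\<Sum>j\<in>J. (c j)\<^sup>2)" by (intro sum.cong refl) (simp only: ip power2_eq_square)
  \<comment> \<open>Each \<open>c j\<close> is, up to \<open>1 / sqrt n\<close>, the covariance of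
    the noise functional with coefficients \<open>r\<close> and the discretised harmonic
    \<open>lF j\<close>, which brings the sum within reach of \<open>bessel\<close>.\<close>
  also have "\<dots> = (\<Sum>j\<in>J. (F.cov (\<lambda>\<omega>. \<Sum>i=1..n. r i * \<omega> i) (lF j))\<^sup>2) / real n"
  proof -
    have "(c j)\<^sup>2 = (F.cov (\<lambda>\<omega>. \<Sum>i=1..n. r i * \<omega> i) (lF j))\<^sup>2 / real n" for j
    proof -
      have "F.cov (\<lambda>\<omega>. \<Sum>i=1..n. r i * \<omega> i) (lF j) = (\<Sum>i=1..n. r i * (YJ j (x i) / sqrt (real n)))"
        unfolding lF_def[abs_def] by (rule F_cov)
      also have "\<dots> = (\<Sum>i=1..n. YJ j (x i) * r i) / sqrt (real n)"
        unfolding sum_divide_distrib by (intro sum.cong refl) simp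
      finally show ?thesis unfolding c_def using n_pos by (simp add: power_divide power2_eq_square)
    qed
    then show ?thesis by (simp add: sum_divide_distrib)
  qed
  also have "\<dots> \<le> F.cov (\<lambda>\<omega>. \<Sum>i=1..n. r i * \<omega> i) (\<lambda>\<omega>. \<Sum>i=1..n. r i * \<omega> i) / real n"
    by (intro divide_right_mono GF.bessel F_lin) simp
  also have "\<dots> = (L2_set r {1..n})\<^sup>2 / real n"
    unfolding F_cov L2_set_def by (simp add: power2_eq_square sum_nonneg)
  also have "\<dots> \<le> (point_const * sqrt (real n) * rate)\<^sup>2 / real n"
    using residual_points[OF f] by (intro divide_right_mono power_mono) (auto simp: r_def[abs_def] L2_set_nonneg)
  also have "\<dots> = (point_const * rate)\<^sup>2" using n_pos by (simp add: power_mult_distrib)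
  finally show ?thesis .
qed

text \<open>Comes from splitting the error at \<open>proj f\<close> and bounding the square of a sum
  by twice the sum of the squares.\<close>

definition "rate_const = sqrt (2 * (point_const\<^sup>2 + 1))"

lemma hyperinterp_residual:
  assumes f: "f \<in> sobolev_ball d N Y s R"
  shows "sqrt (L2_inner (\<lambda>y. hyperinterp f y - f y) (\<lambda>y. hyperinterp f y - f y)) \<le> rate_const * rate"
proof -
  let ?a = "\<lambda>y. hyperinterp f y - proj f y" and ?b = "\<lambda>y. proj f y - f y"
  have fL: "f \<in> L2_sphere" using f by (simp add: sobolev_ball_def)
  have aL: "?a \<in> L2_sphere" by (rule L2_sphere_diff[OF hyperinterp_L2 proj_L2])
  have bL: "?b \<in> L2_sphere" by (rule L2_sphere_diff[OF proj_L2 fL])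
  have hL: "(\<lambda>y. hyperinterp f y - f y) \<in> L2_sphere" by (rule L2_sphere_diff[OF hyperinterp_L2 fL])
  have "L2_inner (\<lambda>y. hyperinterp f y - f y) (\<lambda>y. hyperinterp f y - f y) \<le> (\<integral>y. 2 * (?a y * ?a y) + 2 * (?b y * ?b y) \<partial>sphere_measure)"
    unfolding L2_inner_def
  proof (rule integral_mono)
    show "integrable sphere_measure (\<lambda>y. (hyperinterp f y - f y) * (hyperinterp f y - f y))" by (rule L2_sphere_integrable[OF hL hL])
    show "integrable sphere_measure (\<lambda>y. 2 * (?a y * ?a y) + 2 * (?b y * ?b y))"
      by (intro Bochner_Integration.integrable_add integrable_mult_right L2_sphere_integrable aL bL)
    fix y
    have "(u + w) * (u + w) \<le> 2 * (u * u) + 2 * (w * w)" for u w :: real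
      using sum_squares_bound[of u w] by (simp add: algebra_simps power2_eq_square)
    from this[of "?a y" "?b y"] show "(hyperinterp f y - f y) * (hyperinterp f y - f y) \<le> 2 * (?a y * ?a y) + 2 * (?b y * ?b y)" by simp
  qed
  also have "\<dots> = 2 * L2_inner ?a ?a + 2 * L2_inner ?b ?b"
    unfolding L2_inner_def using L2_sphere_integrable[OF aL aL] L2_sphere_integrable[OF bL bL] by simp
  also have "\<dots> \<le> 2 * (point_const * rate)\<^sup>2 + 2 * rate\<^sup>2"
    using hyperinterp_proj[OF f] residual_L2[OF f] by linarith
  also have "\<dots> = (rate_const * rate)\<^sup>2"
    by (simp add: rate_const_def power_mult_distrib algebra_simps)
  finally have "sqrt (L2_inner (\<lambda>y. hyperinterp f y - f y) (\<lambda>y. hyperinterp f y - f y)) \<le> sqrt ((rate_const * rate)\<^sup>2)"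
    by (rule real_sqrt_le_mono)
  then show ?thesis using rate_nonneg by (simp add: rate_const_def)
qed

lemma point_const_le: "point_const \<le> rate_const"
proof -
  have "point_const = sqrt (point_const\<^sup>2)" using point_const_nonneg by simp
  also have "\<dots> \<le> rate_const" unfolding rate_const_def by (intro real_sqrt_le_mono) simp
  finally show ?thesis .
qed

section \<open>The two deficiencies and the Le Cam distance\<close>

definition "bound = sqrt (real n) / \<sigma> * (rate_const * rate)"

lemma regression_law:
  "law (regression_experiment n \<sigma> x) f = gshift FN {1..n} (\<lambda>i. cont_rep f (x i)) \<sigma>"
  by (simp add: regression_experiment_def gshift_def FN_def)

lemma white_noise_law:
  "law (white_noise_experiment W n \<sigma>) f = gshift W L2_sphere (L2_inner f) (\<sigma> / sqrt (real n))"
  by (simp add: white_noise_experiment_def gshift_def)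

text \<open>The kernel produces the mean \<open>g \<mapsto> L2_inner (hyperinterp f) g\<close>, so
  only the L2 error of hyperinterpolation has to be represented by a functional of the white
  noise.\<close>

lemma deficiency_FG:
  "deficiency (sobolev_ball d N Y s R) (regression_experiment n \<sigma> x) (white_noise_experiment W n \<sigma>) \<le> ennreal bound"
proof (rule FG.deficiency_le[where ?m1.0 = "\<lambda>f i. cont_rep f (x i)" and ?m2.0 = L2_inner and ?\<tau>1.0 = \<sigma> and ?\<tau>2.0 = "\<sigma> / sqrt (real n)"])
  show "\<sigma> \<noteq> 0" using \<sigma> by simp
  show "sample_space (regression_experiment n \<sigma> x) = Pi\<^sub>M {1..n} (\<lambda>_. borel)" by (simp add: regression_experiment_def)
  show "sample_space (white_noise_experiment W n \<sigma>) = Pi\<^sub>M L2_sphere (\<lambda>_. borel)" by (simp add: white_noise_experiment_def)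
  show "law (regression_experiment n \<sigma> x) f = gshift FN {1..n} (\<lambda>i. cont_rep f (x i)) \<sigma>" for f by (rule regression_law)
  show "law (white_noise_experiment W n \<sigma>) f = gshift W L2_sphere (L2_inner f) (\<sigma> / sqrt (real n))" for f by (rule white_noise_law)
  fix f assume f: "f \<in> sobolev_ball d N Y s R"
  have fL: "f \<in> L2_sphere" using f by (simp add: sobolev_ball_def)
  let ?e = "\<lambda>y. hyperinterp f y - f y" and ?k = "sqrt (real n) / \<sigma>"
  have eL: "?e \<in> L2_sphere" by (rule L2_sphere_diff[OF hyperinterp_L2 fL])
  have k: "?k > 0" using n_pos \<sigma> by simp
  \<comment> \<open>White noise at the error function represents pairing with that error; the factor
    \<open>sqrt n / \<sigma>\<close> compensates the noise level
    \<open>\<sigma> / sqrt n\<close>.\<close>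
  let ?l = "\<lambda>\<omega>. ?k * \<omega> ?e"
  have covl: "G.cov ?l (\<lambda>\<omega>. \<omega> g) = ?k * L2_inner ?e g" if "g \<in> L2_sphere" for g
    by (simp only: G.cov_scale[of ?k "\<lambda>\<omega>. \<omega> ?e"] G_cov[OF eL that])
  have "G.cov ?l ?l = ?k * (?k * L2_inner ?e ?e)"
    by (simp only: G.cov_scale[of ?k "\<lambda>\<omega>. \<omega> ?e"] G.cov_commute[of "\<lambda>\<omega>. \<omega> ?e" ?l] G_cov[OF eL eL])
  then have "sqrt (G.cov ?l ?l) = sqrt (?k\<^sup>2 * L2_inner ?e ?e)" by (simp only: power2_eq_square mult.assoc)
  also have "\<dots> = ?k * sqrt (L2_inner ?e ?e)" using k by (simp only: real_sqrt_mult real_sqrt_abs abs_of_pos)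
  also have "\<dots> \<le> bound" unfolding bound_def using k by (intro mult_left_mono hyperinterp_residual[OF f]) simp
  finally have b: "sqrt (G.cov ?l ?l) \<le> bound" .
  have "(\<Sum>j\<in>J. FG.coeff j g * (\<sigma> / sqrt (real n) / \<sigma> * lF j (\<lambda>i. cont_rep f (x i)))) - L2_inner f g = \<sigma> / sqrt (real n) * G.cov ?l (\<lambda>\<omega>. \<omega> g)"
    if g: "g \<in> L2_sphere" for g
  proof -
    have "(\<Sum>j\<in>J. FG.coeff j g * (\<sigma> / sqrt (real n) / \<sigma> * lF j (\<lambda>i. cont_rep f (x i)))) = L2_inner (hyperinterp f) g"
    proof -
      have "L2_inner (hyperinterp f) g = (\<Sum>j\<in>J. ((\<Sum>i=1..n. YJ j (x i) * cont_rep f (x i)) / real n) * L2_inner (YJ j) g)"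
        unfolding hyperinterp_def[abs_def] by (rule L2_inner_lincomb(1)[OF YJ_L2 g])
      also have "\<dots> = (\<Sum>j\<in>J. FG.coeff j g * (\<sigma> / sqrt (real n) / \<sigma> * lF j (\<lambda>i. cont_rep f (x i))))"
      proof (intro sum.cong refl)
        fix j assume j: "j \<in> J"
        have c: "FG.coeff j g = L2_inner (YJ j) g"
          unfolding FG.coeff_def unfolding lG_def[abs_def] by (rule G_cov[OF YJ_L2[OF j] g])
        have "lF j (\<lambda>i. cont_rep f (x i)) = (\<Sum>i=1..n. YJ j (x i) * cont_rep f (x i)) / sqrt (real n)"
          unfolding lF_def sum_divide_distrib by (intro sum.cong refl) simp
        then have "\<sigma> / sqrt (real n) / \<sigma> * lF j (\<lambda>i. cont_rep f (x i)) = (\<Sum>i=1..n. YJ j (x i) * cont_rep f (x i)) / real n"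
          using \<sigma> by (simp add: field_simps)
        then show "((\<Sum>i=1..n. YJ j (x i) * cont_rep f (x i)) / real n) * L2_inner (YJ j) g = FG.coeff j g * (\<sigma> / sqrt (real n) / \<sigma> * lF j (\<lambda>i. cont_rep f (x i)))"
          unfolding c by simp
      qed
      finally show ?thesis ..
    qed
    moreover have "\<sigma> / sqrt (real n) * (?k * L2_inner ?e g) = L2_inner ?e g" using \<sigma> n_pos by simp
    ultimately show ?thesis unfolding covl[OF g] using L2_inner_diff[OF hyperinterp_L2 fL g, of f] by simp
  qed
  moreover have "?l \<in> lin_functionals L2_sphere" by (rule lin_functionals_scale[OF lin_functionals_coord[OF eL]])
  ultimately show "\<exists>l\<in>lin_functionals L2_sphere. sqrt (G.cov l l) \<le> bound \<and>
    (\<forall>g\<in>L2_sphere. (\<Sum>j\<in>J. FG.coeff j g * (\<sigma> / sqrt (real n) / \<sigma> * lF j (\<lambda>i. cont_rep f (x i)))) - L2_inner f g = \<sigma> / sqrt (real n) * G.cov l (\<lambda>\<omega>. \<omega> g))"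
    using b by blast
qed

text \<open>The kernel produces the values of \<open>proj f\<close> at the design points; these
  differ from the regression means by the point residual.\<close>

lemma deficiency_GF:
  "deficiency (sobolev_ball d N Y s R) (white_noise_experiment W n \<sigma>) (regression_experiment n \<sigma> x) \<le> ennreal bound"
proof (rule GF.deficiency_le[where ?m2.0 = "\<lambda>f i. cont_rep f (x i)" and ?m1.0 = L2_inner and ?\<tau>2.0 = \<sigma> and ?\<tau>1.0 = "\<sigma> / sqrt (real n)"])
  show "\<sigma> / sqrt (real n) \<noteq> 0" using \<sigma> n_pos by simp
  show "sample_space (regression_experiment n \<sigma> x) = Pi\<^sub>M {1..n} (\<lambda>_. borel)" by (simp add: regression_experiment_def)
  show "sample_space (white_noise_experiment W n \<sigma>) = Pi\<^sub>M L2_sphere (\<lambda>_. borel)" by (simp add: white_noise_experiment_def)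
  show "law (regression_experiment n \<sigma> x) f = gshift FN {1..n} (\<lambda>i. cont_rep f (x i)) \<sigma>" for f by (rule regression_law)
  show "law (white_noise_experiment W n \<sigma>) f = gshift W L2_sphere (L2_inner f) (\<sigma> / sqrt (real n))" for f by (rule white_noise_law)
  fix f assume f: "f \<in> sobolev_ball d N Y s R"
  let ?r = "\<lambda>i. cont_rep f (x i) - proj f (x i)"
  \<comment> \<open>The sign is that of the produced mean minus the target mean,
    \<open>proj f\<close> minus \<open>cont_rep f\<close>; the noise level \<open>\<sigma>\<close>
    is divided out.\<close>
  let ?a = "\<lambda>i. - ?r i / \<sigma>"
  let ?l = "\<lambda>\<omega>. \<Sum>i=1..n. ?a i * \<omega> i"
  have "F.cov ?l ?l = (\<Sum>i=1..n. (?r i)\<^sup>2) / \<sigma>\<^sup>2"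
    unfolding F_cov sum_divide_distrib by (intro sum.cong refl) (simp only: power2_eq_square[symmetric] power_divide power2_minus)
  then have "sqrt (F.cov ?l ?l) = L2_set ?r {1..n} / \<sigma>"
    using \<sigma> by (simp add: L2_set_def real_sqrt_divide)
  also have "\<dots> \<le> (point_const * sqrt (real n) * rate) / \<sigma>"
    using \<sigma> by (intro divide_right_mono residual_points[OF f]) simp
  also have "\<dots> \<le> (rate_const * sqrt (real n) * rate) / \<sigma>"
    using \<sigma> rate_nonneg by (intro divide_right_mono mult_right_mono point_const_le) auto
  also have "\<dots> = bound" by (simp add: bound_def)
  finally have b: "sqrt (F.cov ?l ?l) \<le> bound" .
  have "(\<Sum>j\<in>J. GF.coeff j i * (\<sigma> / (\<sigma> / sqrt (real n)) * lG j (L2_inner f))) - cont_rep f (x i) = \<sigma> * F.cov ?l (\<lambda>\<omega>. \<omega> i)"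
    if i: "i \<in> {1..n}" for i
  proof -
    have "(\<Sum>j\<in>J. GF.coeff j i * (\<sigma> / (\<sigma> / sqrt (real n)) * lG j (L2_inner f))) = proj f (x i)"
      unfolding proj_def
    proof (intro sum.cong refl)
      fix j assume j: "j \<in> J"
      have "GF.coeff j i = YJ j (x i) / sqrt (real n)"
        unfolding GF.coeff_def unfolding lF_def[abs_def] by (rule F_cov_coord[OF i])
      then show "GF.coeff j i * (\<sigma> / (\<sigma> / sqrt (real n)) * lG j (L2_inner f)) = theta f j * YJ j (x i)"
        using \<sigma> n_pos by (simp add: lG_def theta_def)
    qed
    moreover have "F.cov ?l (\<lambda>\<omega>. \<omega> i) = ?a i" by (rule F_cov_coord[OF i])
    ultimately show ?thesis using \<sigma> by simp
  qed
  then show "\<exists>l\<in>lin_functionals {1..n}. sqrt (F.cov l l) \<le> bound \<and>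
    (\<forall>i\<in>{1..n}. (\<Sum>j\<in>J. GF.coeff j i * (\<sigma> / (\<sigma> / sqrt (real n)) * lG j (L2_inner f))) - cont_rep f (x i) = \<sigma> * F.cov l (\<lambda>\<omega>. \<omega> i))"
    using b F_lin[of ?a] by blast
qed

lemma le_cam_bound:
  "le_cam_distance (sobolev_ball d N Y s R) (regression_experiment n \<sigma> x) (white_noise_experiment W n \<sigma>)
    \<le> ennreal (rate_const * inverse \<sigma> * real n powr (1/2) * real L powr (- s) * R)"
proof -
  have "bound = rate_const * inverse \<sigma> * real n powr (1/2) * real L powr (- s) * R"
    unfolding bound_def rate_def powr_half_sqrt[OF of_nat_0_le_iff] divide_inverse[of _ \<sigma>] by (simp only: mult_ac)
  then show ?thesis unfolding le_cam_distance_def using max.boundedI[OF deficiency_FG deficiency_GF] by (simp only:)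
qed

end

text \<open>The value of \<open>rate_const\<close> as a closed expression in \<open>d\<close> and
  \<open>s\<close>, so that the constant can be chosen before basis, noise, radius and design are
  quantified.\<close>

definition le_cam_const :: "nat \<Rightarrow> real \<Rightarrow> real" where
  "le_cam_const d s = sqrt (2 * ((sqrt (design_const d * 2 ^ d) / (1 - 2 powr (real d / 2 - s)))\<^sup>2 + 1))"

lemma le_cam_const_pos: "le_cam_const d s > 0"
  unfolding le_cam_const_def by (intro real_sqrt_gt_zero mult_pos_pos add_nonneg_pos) auto

lemma le_cam_distance_design:
  fixes Y :: "nat \<Rightarrow> nat \<Rightarrow> real ^ 'n \<Rightarrow> real"
  assumes "d \<ge> 1" "CARD('n) = d + 1" "s > real d / 2" "harmonic_basis d N Y" "white_noise W" "R \<ge> 0" "\<sigma> > 0"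
    "L \<ge> 1" "t \<ge> 2 * L" "spherical_design t n x"
  shows "le_cam_distance (sobolev_ball d N Y s R) (regression_experiment n \<sigma> x) (white_noise_experiment W n \<sigma>)
    \<le> ennreal (le_cam_const d s * inverse \<sigma> * real n powr (1/2) * real L powr (- s) * R)"
proof -
  interpret design_regression d N Y s R W \<sigma> n L t x
    by unfold_locales (use assms in auto)
  show ?thesis using le_cam_bound by (simp add: le_cam_const_def rate_const_def point_const_def)
qed

text \<open>The exponent \<open>e\<close> is negative because \<open>s > d / 2\<close>, so powers of
  \<open>n\<close> reverse the size bounds: the upper bound with \<open>c2\<close> yields the second
  estimate and the lower bound with \<open>c1\<close> the third.\<close>

lemma design_size_rates:
  fixes c1 c2 s :: real
  assumes c: "0 < c1" "c1 \<le> c2" and d: "d \<ge> 1" and s: "s > real d / 2" and L: "L \<ge> 1"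
    and n: "c1 * real L ^ d \<le> real n" "real n \<le> c2 * real L ^ d"
  defines "e \<equiv> - s / real d + 1/2"
  shows "real n powr (1/2) * real L powr (- s) \<le> sqrt c2 * real L powr (- s + real d / 2)"
    and "real L powr (- s + real d / 2) \<le> inverse (c2 powr e) * real n powr e"
    and "real n powr e \<le> c1 powr e * real L powr (- s + real d / 2)"
proof -
  have L0: "real L > 0" and d0: "real d > 0" using L d by auto
  have Ld: "real L ^ d > 0" using L0 by simp
  have n0: "real n > 0" using n(1) c Ld by (meson less_le_trans mult_pos_pos)
  have e: "e \<le> 0" using s d0 by (simp add: e_def field_simps)
  have Lp: "(real L ^ d) powr r = real L powr (real d * r)" for r
    using L0 by (simp add: powr_realpow[symmetric] powr_powr)
  have de: "real d * e = - s + real d / 2" using d0 by (simp add: e_def field_simps)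
  have "real n powr (1/2) \<le> (c2 * real L ^ d) powr (1/2)" using n(2) by (intro powr_mono2) auto
  also have "\<dots> = sqrt c2 * real L powr (real d / 2)"
    using c Ld by (simp add: powr_mult Lp powr_half_sqrt)
  finally have "real n powr (1/2) * real L powr (- s) \<le> (sqrt c2 * real L powr (real d / 2)) * real L powr (- s)"
    by (intro mult_right_mono) auto
  also have "\<dots> = sqrt c2 * (real L powr (real d / 2) * real L powr (- s))" by simp
  also have "real L powr (real d / 2) * real L powr (- s) = real L powr (- s + real d / 2)"
    by (simp add: powr_add[symmetric] add.commute)
  finally show "real n powr (1/2) * real L powr (- s) \<le> sqrt c2 * real L powr (- s + real d / 2)" .
  have "(c2 * real L ^ d) powr e \<le> real n powr e" using n(2) n0 e by (intro powr_mono2') auto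
  then have "c2 powr e * real L powr (- s + real d / 2) \<le> real n powr e"
    using c Ld by (simp add: powr_mult Lp de)
  then show "real L powr (- s + real d / 2) \<le> inverse (c2 powr e) * real n powr e"
    using c by (simp add: field_simps)
  have "real n powr e \<le> (c1 * real L ^ d) powr e" using n(1) c Ld e by (intro powr_mono2') auto
  then show "real n powr e \<le> c1 powr e * real L powr (- s + real d / 2)"
    using c Ld by (simp add: powr_mult Lp de)
qed

theorem theorem3p7:
  fixes d :: nat and s :: real
  assumes "d \<ge> 1" and "CARD('n::finite) = d + 1" and "s > real d / 2"
  shows
    "(\<exists>C>0. \<forall>N (Y :: nat \<Rightarrow> nat \<Rightarrow> real ^ 'n \<Rightarrow> real) W R \<sigma> n L t (x :: nat \<Rightarrow> real ^ 'n).
        harmonic_basis d N Y \<longrightarrow> white_noise W \<longrightarrow> R \<ge> 0 \<longrightarrow> \<sigma> > 0 \<longrightarrow>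
        n \<ge> 1 \<longrightarrow> L \<ge> 1 \<longrightarrow> t \<ge> 2 * L \<longrightarrow> spherical_design t n x \<longrightarrow>
        le_cam_distance (sobolev_ball d N Y s R)
            (regression_experiment n \<sigma> x) (white_noise_experiment W n \<sigma>)
          \<le> ennreal (C * inverse \<sigma> * real n powr (1/2) * real L powr (- s) * R))
   \<and>
     (\<forall>c1 c2 :: real. 0 < c1 \<longrightarrow> c1 \<le> c2 \<longrightarrow>
       (\<exists>C>0. \<exists>A>0. \<exists>B>0.
         \<forall>N (Y :: nat \<Rightarrow> nat \<Rightarrow> real ^ 'n \<Rightarrow> real) W R \<sigma> n L (x :: nat \<Rightarrow> real ^ 'n).
          harmonic_basis d N Y \<longrightarrow> white_noise W \<longrightarrow> R \<ge> 0 \<longrightarrow> \<sigma> > 0 \<longrightarrow>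
          n \<ge> 1 \<longrightarrow> L \<ge> 1 \<longrightarrow> spherical_design (2 * L) n x \<longrightarrow>
          c1 * real L ^ d \<le> real n \<longrightarrow> real n \<le> c2 * real L ^ d \<longrightarrow>
          le_cam_distance (sobolev_ball d N Y s R)
              (regression_experiment n \<sigma> x) (white_noise_experiment W n \<sigma>)
            \<le> ennreal (C * (inverse \<sigma> * real L powr (- s + real d / 2) * R)) \<and>
          inverse \<sigma> * real L powr (- s + real d / 2) * R
            \<le> A * (inverse \<sigma> * real n powr (- s / real d + 1/2) * R) \<and>
          inverse \<sigma> * real n powr (- s / real d + 1/2) * R
            \<le> B * (inverse \<sigma> * real L powr (- s + real d / 2) * R)))
   \<and>
     (\<forall>(c1::real) c2 N (Y :: nat \<Rightarrow> nat \<Rightarrow> real ^ 'n \<Rightarrow> real) W R \<sigma>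
        (n :: nat \<Rightarrow> nat) (L :: nat \<Rightarrow> nat) (x :: nat \<Rightarrow> nat \<Rightarrow> real ^ 'n).
        0 < c1 \<longrightarrow> c1 \<le> c2 \<longrightarrow>
        harmonic_basis d N Y \<longrightarrow> white_noise W \<longrightarrow> R \<ge> 0 \<longrightarrow> \<sigma> > 0 \<longrightarrow>
        (\<forall>k. L k \<ge> 1 \<and> n k \<ge> 1 \<and> spherical_design (2 * L k) (n k) (x k) \<and>
             c1 * real (L k) ^ d \<le> real (n k) \<and> real (n k) \<le> c2 * real (L k) ^ d) \<longrightarrow>
        filterlim n at_top sequentially \<longrightarrow>
        (\<lambda>k. le_cam_distance (sobolev_ball d N Y s R)
               (regression_experiment (n k) \<sigma> (x k)) (white_noise_experiment W (n k) \<sigma>))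
          \<longlonglongrightarrow> 0)"
proof (intro conjI allI impI)
  let ?C = "le_cam_const d s"
  show "\<exists>C>0. \<forall>N (Y :: nat \<Rightarrow> nat \<Rightarrow> real ^ 'n \<Rightarrow> real) W R \<sigma> n L t (x :: nat \<Rightarrow> real ^ 'n).
        harmonic_basis d N Y \<longrightarrow> white_noise W \<longrightarrow> R \<ge> 0 \<longrightarrow> \<sigma> > 0 \<longrightarrow>
        n \<ge> 1 \<longrightarrow> L \<ge> 1 \<longrightarrow> t \<ge> 2 * L \<longrightarrow> spherical_design t n x \<longrightarrow>
        le_cam_distance (sobolev_ball d N Y s R)
            (regression_experiment n \<sigma> x) (white_noise_experiment W n \<sigma>)
          \<le> ennreal (C * inverse \<sigma> * real n powr (1/2) * real L powr (- s) * R)"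
    using le_cam_distance_design[OF assms] le_cam_const_pos by (intro exI[of _ ?C]) blast
next
  let ?C = "le_cam_const d s" and ?e = "- s / real d + 1/2"
  fix c1 c2 :: real assume c: "0 < c1" "c1 \<le> c2"
  show "\<exists>C>0. \<exists>A>0. \<exists>B>0.
         \<forall>N (Y :: nat \<Rightarrow> nat \<Rightarrow> real ^ 'n \<Rightarrow> real) W R \<sigma> n L (x :: nat \<Rightarrow> real ^ 'n).
          harmonic_basis d N Y \<longrightarrow> white_noise W \<longrightarrow> R \<ge> 0 \<longrightarrow> \<sigma> > 0 \<longrightarrow>
          n \<ge> 1 \<longrightarrow> L \<ge> 1 \<longrightarrow> spherical_design (2 * L) n x \<longrightarrow>
          c1 * real L ^ d \<le> real n \<longrightarrow> real n \<le> c2 * real L ^ d \<longrightarrow>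
          le_cam_distance (sobolev_ball d N Y s R)
              (regression_experiment n \<sigma> x) (white_noise_experiment W n \<sigma>)
            \<le> ennreal (C * (inverse \<sigma> * real L powr (- s + real d / 2) * R)) \<and>
          inverse \<sigma> * real L powr (- s + real d / 2) * R
            \<le> A * (inverse \<sigma> * real n powr (- s / real d + 1/2) * R) \<and>
          inverse \<sigma> * real n powr (- s / real d + 1/2) * R
            \<le> B * (inverse \<sigma> * real L powr (- s + real d / 2) * R)"
  proof (rule exI[of _ "?C * sqrt c2"], intro conjI, use c le_cam_const_pos in simp,
      rule exI[of _ "inverse (c2 powr ?e)"], intro conjI, use c in simp,
      rule exI[of _ "c1 powr ?e"], intro conjI, use c in simp, intro allI impI)
    fix N and Y :: "nat \<Rightarrow> nat \<Rightarrow> real ^ 'n \<Rightarrow> real" and W :: "((real ^ 'n \<Rightarrow> real) \<Rightarrow> real) measure" and R \<sigma> n L and x :: "nat \<Rightarrow> real ^ 'n"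
    assume a: "harmonic_basis d N Y" "white_noise W" "(0::real) \<le> R" "(0::real) < \<sigma>" "1 \<le> n" "1 \<le> L"
      "spherical_design (2 * L) n x" and n: "c1 * real L ^ d \<le> real n" "real n \<le> c2 * real L ^ d"
    note r = design_size_rates[OF c assms(1,3) a(6) n]
    have "?C * inverse \<sigma> * real n powr (1/2) * real L powr (- s) * R = (?C * inverse \<sigma> * R) * (real n powr (1/2) * real L powr (- s))"
      by (simp only: mult_ac)
    also have "\<dots> \<le> (?C * inverse \<sigma> * R) * (sqrt c2 * real L powr (- s + real d / 2))"
      using a le_cam_const_pos[of d s] by (intro mult_left_mono r(1)) auto
    also have "\<dots> = ?C * sqrt c2 * (inverse \<sigma> * real L powr (- s + real d / 2) * R)"
      by (simp only: mult_ac)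
    finally have le: "?C * inverse \<sigma> * real n powr (1/2) * real L powr (- s) * R \<le> ?C * sqrt c2 * (inverse \<sigma> * real L powr (- s + real d / 2) * R)" .
    have 1: "le_cam_distance (sobolev_ball d N Y s R) (regression_experiment n \<sigma> x) (white_noise_experiment W n \<sigma>)
      \<le> ennreal (?C * sqrt c2 * (inverse \<sigma> * real L powr (- s + real d / 2) * R))"
      by (rule order_trans[OF le_cam_distance_design[OF assms a(1-4,6) order_refl a(7)] ennreal_leI[OF le]])
    have k: "inverse \<sigma> * R \<ge> 0" using a by simp
    have 2: "inverse \<sigma> * real L powr (- s + real d / 2) * R \<le> inverse (c2 powr ?e) * (inverse \<sigma> * real n powr ?e * R)"
      using mult_left_mono[OF r(2) k] by (simp only: mult_ac)
    have 3: "inverse \<sigma> * real n powr ?e * R \<le> c1 powr ?e * (inverse \<sigma> * real L powr (- s + real d / 2) * R)"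
      using mult_left_mono[OF r(3) k] by (simp only: mult_ac)
    show "le_cam_distance (sobolev_ball d N Y s R) (regression_experiment n \<sigma> x) (white_noise_experiment W n \<sigma>)
      \<le> ennreal (?C * sqrt c2 * (inverse \<sigma> * real L powr (- s + real d / 2) * R)) \<and>
      inverse \<sigma> * real L powr (- s + real d / 2) * R \<le> inverse (c2 powr ?e) * (inverse \<sigma> * real n powr ?e * R) \<and>
      inverse \<sigma> * real n powr ?e * R \<le> c1 powr ?e * (inverse \<sigma> * real L powr (- s + real d / 2) * R)"
      using 1 2 3 by blast
  qed
next
  let ?C = "le_cam_const d s"
  fix c1 c2 :: real and N and Y :: "nat \<Rightarrow> nat \<Rightarrow> real ^ 'n \<Rightarrow> real" and W :: "((real ^ 'n \<Rightarrow> real) \<Rightarrow> real) measure" and R \<sigma>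
    and n L :: "nat \<Rightarrow> nat" and x :: "nat \<Rightarrow> nat \<Rightarrow> real ^ 'n"
  assume c: "0 < c1" "c1 \<le> c2" and a: "harmonic_basis d N Y" "white_noise W" "(0::real) \<le> R" "(0::real) < \<sigma>"
    and k: "\<forall>k. L k \<ge> 1 \<and> n k \<ge> 1 \<and> spherical_design (2 * L k) (n k) (x k) \<and>
             c1 * real (L k) ^ d \<le> real (n k) \<and> real (n k) \<le> c2 * real (L k) ^ d"
    and n: "filterlim n at_top sequentially"
  let ?e = "- s / real d + 1/2"
  \<comment> \<open>The constant of an estimate in \<open>n k\<close> alone, obtained by eliminating
    \<open>L k\<close> with the upper size bound; convergence then needs nothing but the growth of
    \<open>n k\<close>.\<close>
  define D where "D = ?C * sqrt c2 * inverse (c2 powr ?e) * inverse \<sigma> * R"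
  have e: "?e < 0" using assms(1,3) by (simp add: field_simps)
  have bound: "le_cam_distance (sobolev_ball d N Y s R) (regression_experiment (n k) \<sigma> (x k)) (white_noise_experiment W (n k) \<sigma>)
     \<le> ennreal (D * real (n k) powr ?e)" for k
  proof -
    have kk: "L k \<ge> 1" "spherical_design (2 * L k) (n k) (x k)" "c1 * real (L k) ^ d \<le> real (n k)" "real (n k) \<le> c2 * real (L k) ^ d"
      using \<open>\<forall>k. _\<close> by blast+
    note r = design_size_rates[OF c assms(1,3) kk(1,3,4)]
    have "real (n k) powr (1/2) * real (L k) powr (- s) \<le> sqrt c2 * real (L k) powr (- s + real d / 2)" by (rule r(1))
    also have "\<dots> \<le> sqrt c2 * (inverse (c2 powr ?e) * real (n k) powr ?e)"
      using c by (intro mult_left_mono r(2)) auto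
    finally have "(?C * inverse \<sigma> * R) * (real (n k) powr (1/2) * real (L k) powr (- s)) \<le> (?C * inverse \<sigma> * R) * (sqrt c2 * (inverse (c2 powr ?e) * real (n k) powr ?e))"
      using a le_cam_const_pos[of d s] by (intro mult_left_mono) auto
    then have "?C * inverse \<sigma> * real (n k) powr (1/2) * real (L k) powr (- s) * R \<le> D * real (n k) powr ?e"
      unfolding D_def by (simp only: mult_ac)
    from order_trans[OF le_cam_distance_design[OF assms a kk(1) order_refl kk(2)] ennreal_leI[OF this]]
    show ?thesis .
  qed
  have nr: "filterlim (\<lambda>k. real (n k)) at_top sequentially"
    by (rule filterlim_compose[OF filterlim_real_sequentially n])
  have "(\<lambda>k. D * real (n k) powr ?e) \<longlonglongrightarrow> D * 0"
    by (intro tendsto_mult tendsto_const tendsto_neg_powr[OF e nr])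
  then have "(\<lambda>k. ennreal (D * real (n k) powr ?e)) \<longlonglongrightarrow> ennreal 0"
    by (intro tendsto_ennrealI) simp
  then have lim: "(\<lambda>k. ennreal (D * real (n k) powr ?e)) \<longlonglongrightarrow> 0" by simp
  show "(\<lambda>k. le_cam_distance (sobolev_ball d N Y s R)
               (regression_experiment (n k) \<sigma> (x k)) (white_noise_experiment W (n k) \<sigma>)) \<longlonglongrightarrow> 0"
    by (rule tendsto_sandwich[OF _ _ tendsto_const lim]) (use bound in \<open>auto intro: always_eventually\<close>)
qed

end
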